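(* Let $A:=R[[T]]\{T^{-1}\}$, let $B$ be a finite $A$-algebra of degree $p$, flat over $R$, and let $G$ be a cyclic group of order $p$ of automorphisms of $B$. Assume that $A$ is identified with $B^G$, and that $\bar B:=B\otimes_Rk$ is a field which is a purely inseparable extension of degree $p$ of $\bar A=k((t))$. Then $B$ is a complete discrete valuation ring with uniformizer $\pi$ and residue field of the form $k((z))$; if $Z$ lifts $z$ in $B$, then $B=R[[Z]]\{Z^{-1}\}$. Let $\delta$ be the valuation of the different of $B$ over $A$. (A) If $\delta=v_K(p)$, then $\mathrm{Spec}\,B\to\mathrm{Spec}\,A$ is an fppf torsor under $\mu_p$, and thus there is a unit $u$ in $A$ such that $B=A[y]/(y^p-u)$. Moreover, $u$ is unique up to multiplication by the $p$-th power of a unit of $A$. In particular, the differential form $\omega:=\frac{d\bar u}{\bar u}$ is uniquely determined. Moreover, the residue $h$ of $\omega$ belongs to $\mathbb F_p$. Let $\phi$ be the unique isomorphism of $G$ onto $\mathbb Z/p\mathbb Z$ such that $\sigma y=\zeta^{\phi(\sigma)}y$ for $\sigma\in G$. There are two cases: (A.a) If the residue $h$ of $\omega$ is nonzero, then $y=Z^h$, where $Z$ is a parameter of $B$, and, for $\sigma\in G$, $\sigma Z=\zeta^{\frac1h\phi(\sigma)}Z$. (A.b) If the residue $h$ of $\omega$ is zero, then the integer $m:=1+\mathrm{ord}_t\,\omega$ is positive and prime to $p$. Moreover (for a suitable choice of $u$), there is a parameter $Z$ of $B$ such that $y=1+Z^m$ and, for $\sigma\in G$, $$\sigma Z=\zeta^{\frac1m\phi(\sigma)}Z\bigl(1+\zeta^{-\phi(\sigma)}(\zeta^{\phi(\sigma)}-1)Z^{-m}\bigr)^{\frac1m}.$$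 (B) If $0<\delta<v_K(p)$, then $\mathrm{Spec}\,B\to\mathrm{Spec}\,A$ is an fppf torsor under $\mathcal H_n$, where $n$ is the integer given by $v_K(p)=\delta+n(p-1)$. Thus there is $u$ in $A$ such that $B=A[w]/\bigl(\frac{(\pi^nw+1)^p-1}{\pi^{pn}}-u\bigr)$, with $\bar u\notin k((t^p))$. Moreover, $\bar u$ is unique up to addition of a $p$-th power. In particular, the differential form $\omega:=d\bar u$ is uniquely determined. The integer $m:=1+\mathrm{ord}_t(\omega)$ is prime to $p$. Let $\phi$ be the unique isomorphism of $G$ onto $\mathbb Z/p\mathbb Z$ such that $\sigma(\pi^nw+1)=\zeta^{\phi(\sigma)}(\pi^nw+1)$ for $\sigma\in G$. Then $w=Z^m$, where $Z$ is a parameter of $B$, and, for $\sigma\in G$, $$\sigma Z=\zeta^{\frac1m\phi(\sigma)}Z\bigl(1+\pi^{-n}(\zeta^{\phi(\sigma)}-1)\zeta^{-\phi(\sigma)}Z^{-m}\bigr)^{\frac1m}.$$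
   Context: $R$ is a complete discrete valuation ring with fraction field $K$ of characteristic $0$ and algebraically closed residue field $k$ of characteristic $p>0$; $\pi$ is a fixed uniformizer, $v_K$ the valuation with $v_K(\pi)=1$. $K$ contains a primitive $p$-th root of unity $\zeta$; $\lambda=\zeta-1$, $v_K(\lambda)=v_K(p)/(p-1)$. $R[[T]]\{T^{-1}\}$ is the ring of Laurent series $\sum_{\nu\in\mathbb Z}a_\nu T^\nu$ with $a_\nu\in R$ and $a_\nu\to0$ as $\nu\to-\infty$; it is a complete discrete valuation ring with uniformizer $\pi$ and residue field $k((t))$, $t=T\bmod\pi$. A parameter of a ring $B$ of this type is $Z\in B$ with $B=R[[Z]]\{Z^{-1}\}$. Bars denote reduction modulo $\pi$. The valuation of the different is measured by the valuation for which $\pi$ has valuation $1$. For $n>0$, $\mathcal G^{(n)}=\mathrm{Spec}\,R[x,\frac1{\pi^nx+1}]$ is the $R$-group scheme with law $x\cdot x'=x+x'+\pi^nxx'$ (so that $x\mapsto\pi^nx+1$ is a homomorphism to $\mathbb G_m$). For $0<n\le v_K(\lambda)$, $\psi_n:\mathcal G^{(n)}\to\mathcal G^{(pn)}$, $x\mapsto\frac{(\pi^nx+1)^p-1}{\pi^{pn}}$, is an isogeny of degree $p$, and $\mathcal H_n:=\ker\psi_n$, a finite flat group scheme of degree $p$ with generic fibre isomorphic to $\mu_p$. Expressions $(1+x)^{1/m}$ with $m$ prime to $p$ are given by the binomial series; in exponents of $\zeta$, $\frac1m$ and $\frac1h$ denote inverses modulo $p$. *)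

theory Defs
  imports
    "HOL-Computational_Algebra.Computational_Algebra"
    "HOL-Number_Theory.Modular_Inverse"
    "HOL-Library.Poly_Mapping"
    "HOL-Algebra.Elementary_Groups"
begin

unbundle fps_syntax

section \<open>Complete discrete valuation rings\<close>

definition (in comm_ring_1) cdvr_uniformizer :: "'a \<Rightarrow> bool" where
  "cdvr_uniformizer \<pi> \<longleftrightarrow>
     (\<forall>x y. x * y = 0 \<longrightarrow> x = 0 \<or> y = 0) \<and>
     \<pi> \<noteq> 0 \<and> \<not> \<pi> dvd 1 \<and>
     (\<forall>x. x \<noteq> 0 \<longrightarrow> (\<exists>u n. u dvd 1 \<and> x = u * \<pi> ^ n)) \<and>
     (\<forall>s. (\<forall>n. \<pi> ^ n dvd s (Suc n) - s n) \<longrightarrow> (\<exists>l. \<forall>n. \<pi> ^ n dvd l - s n))"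

class complete_dvr = idom +
  assumes ex_cdvr_uniformizer: "\<exists>\<pi>. cdvr_uniformizer \<pi>"

text \<open>The valuation normalised by \<open>val \<pi> \<pi> = 1\<close>; only meaningful for nonzero \<open>x\<close>.\<close>

definition val :: "'a::comm_ring_1 \<Rightarrow> 'a \<Rightarrow> nat" where
  "val \<pi> x = (GREATEST n. \<pi> ^ n dvd x)"

text \<open>The exact quotient in a domain, i.e. the quotient in the fraction field when it
  happens to lie in the ring.\<close>

definition exact_div :: "'a::comm_ring_1 \<Rightarrow> 'a \<Rightarrow> 'a" where
  "exact_div a b = (THE c. b * c = a)"

definition ring_homo :: "('a::comm_ring_1 \<Rightarrow> 'b::comm_ring_1) \<Rightarrow> bool" where
  "ring_homo f \<longleftrightarrow> f 1 = 1 \<and> (\<forall>x y. f (x + y) = f x + f y) \<and> (\<forall>x y. f (x * y) = f x * f y)"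

text \<open>\<open>\<rho>\<close> exhibits its codomain as the quotient of its domain by the principal ideal \<open>(\<pi>)\<close>.\<close>

definition reduction_map :: "'a::comm_ring_1 \<Rightarrow> ('a \<Rightarrow> 'c::comm_ring_1) \<Rightarrow> bool" where
  "reduction_map \<pi> \<rho> \<longleftrightarrow> ring_homo \<rho> \<and> surj \<rho> \<and> (\<forall>x. \<rho> x = 0 \<longleftrightarrow> \<pi> dvd x)"

text \<open>Unconditional summation for the \<open>\<pi>\<close>-adic topology.\<close>

definition has_adic_sum :: "'a::comm_ring_1 \<Rightarrow> ('i \<Rightarrow> 'a) \<Rightarrow> 'a \<Rightarrow> bool" where
  "has_adic_sum \<pi> f s \<longleftrightarrow>
     (\<forall>N. \<exists>F. finite F \<and> (\<forall>F'. finite F' \<longrightarrow> F \<subseteq> F' \<longrightarrow> \<pi> ^ N dvd s - sum f F'))"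

definition adic_sum :: "'a::comm_ring_1 \<Rightarrow> ('i \<Rightarrow> 'a) \<Rightarrow> 'a" where
  "adic_sum \<pi> f = (THE s. has_adic_sum \<pi> f s)"

section \<open>The ring \<open>R[[T]]{T\<inverse>}\<close>\<close>

text \<open>Neither the convergence condition nor the sums below depend on the choice of the
  uniformizer.\<close>

definition unif :: "'r::complete_dvr" where
  "unif = (SOME \<pi>. cdvr_uniformizer \<pi>)"

definition null_at_minus_inf :: "(int \<Rightarrow> 'r::complete_dvr) \<Rightarrow> bool" where
  "null_at_minus_inf f \<longleftrightarrow> (\<forall>N. \<exists>a. \<forall>i<a. unif ^ N dvd f i)"

definition cauchy_prod ::
  "(int \<Rightarrow> 'r::complete_dvr) \<Rightarrow> (int \<Rightarrow> 'r) \<Rightarrow> int \<Rightarrow> 'r" where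
  "cauchy_prod f g n = adic_sum unif (\<lambda>i. f i * g (n - i))"

lemma unif: "cdvr_uniformizer (unif :: 'r::complete_dvr)"
  unfolding unif_def by (rule someI_ex) (rule ex_cdvr_uniformizer)

lemma unif_separated:
  assumes "\<And>N. (unif :: 'r::complete_dvr) ^ N dvd x"
  shows "x = 0"
proof (rule ccontr)
  assume "x \<noteq> 0"
  then obtain u n where u: "u dvd 1" and x: "x = u * unif ^ n"
    using unif unfolding cdvr_uniformizer_def by metis
  have nz: "(unif::'r) \<noteq> 0" and nu: "\<not> (unif::'r) dvd 1"
    using unif unfolding cdvr_uniformizer_def by auto
  have "unif ^ Suc n dvd u * unif ^ n" using assms[of "Suc n"] x by simp
  then have "unif * unif ^ n dvd u * unif ^ n" by simp
  then have "unif dvd u" using nz by (simp only: dvd_mult_cancel_right) simp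
  then show False using u nu dvd_trans by blast
qed

lemma dvd_diff_trans:
  fixes d :: "'a::comm_ring_1"
  assumes "d dvd x - y" "d dvd y - z" shows "d dvd x - z"
  using dvd_add[OF assms] by simp

lemma dvd_diff_sym:
  fixes d :: "'a::comm_ring_1"
  assumes "d dvd x - y" shows "d dvd y - x"
  using assms by (metis dvd_minus_iff minus_diff_eq)

lemma has_adic_sum_unique:
  assumes "has_adic_sum (unif::'r::complete_dvr) f s" "has_adic_sum unif f t"
  shows "s = t"
proof -
  have "unif ^ N dvd s - t" for N
  proof -
    obtain F where F: "finite F" "\<And>F'. finite F' \<Longrightarrow> F \<subseteq> F' \<Longrightarrow> unif ^ N dvd s - sum f F'"
      using assms(1) unfolding has_adic_sum_def by blast
    obtain G where G: "finite G" "\<And>F'. finite F' \<Longrightarrow> G \<subseteq> F' \<Longrightarrow> unif ^ N dvd t - sum f F'"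
      using assms(2) unfolding has_adic_sum_def by blast
    show ?thesis
      using F(2)[of "F \<union> G"] G(2)[of "F \<union> G"] F(1) G(1)
      by (auto intro: dvd_diff_trans dvd_diff_sym)
  qed
  then show ?thesis using unif_separated[of "s - t"] by simp
qed

lemma adic_sum_eqI: "has_adic_sum (unif::'r::complete_dvr) f s \<Longrightarrow> adic_sum unif f = s"
  unfolding adic_sum_def by (rule the_equality) (auto intro: has_adic_sum_unique)

text \<open>Modulo \<open>\<pi>^N\<close> the elements of \<open>R[[T]]{T\<inverse>}\<close> are ordinary Laurent series; this
  reduces the ring axioms to those of \<open>'r fls\<close>.\<close>

definition trunc :: "int \<Rightarrow> (int \<Rightarrow> 'r::comm_ring_1) \<Rightarrow> 'r fls" where
  "trunc a f = Abs_fls (\<lambda>i. if i < a then 0 else f i)"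

lemma trunc_nth [simp]: "trunc a f $$ i = (if i < a then 0 else f i)"
  unfolding trunc_def by (rule nth_Abs_fls_lower_bound[of a]) auto

definition vanish :: "nat \<Rightarrow> int \<Rightarrow> (int \<Rightarrow> 'r::complete_dvr) \<Rightarrow> bool" where
  "vanish N a f \<longleftrightarrow> (\<forall>i<a. unif ^ N dvd f i)"

lemma null_iff: "null_at_minus_inf f \<longleftrightarrow> (\<forall>N. \<exists>a. vanish N a f)"
  by (simp add: null_at_minus_inf_def vanish_def)

lemma fls_times_nth_bounds:
  fixes f g :: "'r::comm_ring_1 fls"
  assumes "\<And>i. i < a \<Longrightarrow> f $$ i = 0" "\<And>i. i < b \<Longrightarrow> g $$ i = 0"
  shows "(f * g) $$ n = (\<Sum>i=a..n-b. f $$ i * g $$ (n - i))"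
proof (cases "f = 0 \<or> g = 0")
  case False
  have "a \<le> fls_subdegree f" "b \<le> fls_subdegree g"
    using False assms nth_fls_subdegree_nonzero not_le by metis+
  then show ?thesis
    unfolding fls_times_nth(2)
    by (intro sum.mono_neutral_left) (auto simp: not_le)
qed auto

lemma trunc_prod_cong:
  assumes "vanish N a f" "vanish N b g" "finite F" "{a..n-b} \<subseteq> F"
  shows "unif ^ N dvd (trunc a f * trunc b g) $$ n - (\<Sum>i\<in>F. f i * g (n - i))"
proof -
  have "(trunc a f * trunc b g) $$ n = (\<Sum>i=a..n-b. trunc a f $$ i * trunc b g $$ (n - i))"
    by (rule fls_times_nth_bounds) auto
  also have "\<dots> = (\<Sum>i=a..n-b. f i * g (n - i))" by (rule sum.cong) auto
  finally have 1: "(trunc a f * trunc b g) $$ n = (\<Sum>i=a..n-b. f i * g (n - i))" .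
  have 2: "(\<Sum>i\<in>F. f i * g (n - i)) =
      (\<Sum>i\<in>F-{a..n-b}. f i * g (n - i)) + (\<Sum>i=a..n-b. f i * g (n - i))"
    using assms by (intro sum.subset_diff) auto
  have "unif ^ N dvd (\<Sum>i\<in>F-{a..n-b}. f i * g (n - i))"
  proof (rule dvd_sum)
    fix i assume "i \<in> F - {a..n-b}"
    then have "i < a \<or> n - i < b" by auto
    then show "unif ^ N dvd f i * g (n - i)"
      using assms(1,2) unfolding vanish_def by auto
  qed
  then show ?thesis using 1 2 by simp
qed

lemma has_cauchy_prod:
  assumes "null_at_minus_inf f" "null_at_minus_inf (g :: int \<Rightarrow> 'r::complete_dvr)"
  shows "has_adic_sum unif (\<lambda>i. f i * g (n - i)) (cauchy_prod f g n)"
proof -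
  obtain a where a: "\<And>N. vanish N (a N) f" using assms(1) unfolding null_iff by metis
  obtain b where b: "\<And>N. vanish N (b N) g" using assms(2) unfolding null_iff by metis
  define s where "s = (\<lambda>N. (trunc (a N) f * trunc (b N) g) $$ n)"
  have "unif ^ N dvd s (Suc N) - s N" for N
  proof -
    let ?F = "{a N..n - b N} \<union> {a (Suc N)..n - b (Suc N)}"
    have "unif ^ N dvd s N - (\<Sum>i\<in>?F. f i * g (n - i))"
      unfolding s_def by (rule trunc_prod_cong[OF a b]) auto
    moreover have "unif ^ Suc N dvd s (Suc N) - (\<Sum>i\<in>?F. f i * g (n - i))"
      unfolding s_def by (rule trunc_prod_cong[OF a b]) auto
    then have "unif ^ N dvd s (Suc N) - (\<Sum>i\<in>?F. f i * g (n - i))"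
      using power_le_dvd le_Suc_eq by blast
    ultimately show ?thesis by (blast intro: dvd_diff_trans dvd_diff_sym)
  qed
  then obtain l where l: "\<And>N. unif ^ N dvd l - s N"
    using unif[where ?'r = 'r] unfolding cdvr_uniformizer_def by metis
  have "has_adic_sum unif (\<lambda>i. f i * g (n - i)) l"
    unfolding has_adic_sum_def
  proof (intro allI exI conjI impI)
    fix N F' assume "finite F'" "{a N..n - b N} \<subseteq> F'"
    then have "unif ^ N dvd s N - (\<Sum>i\<in>F'. f i * g (n - i))"
      unfolding s_def by (rule trunc_prod_cong[OF a b])
    with l show "unif ^ N dvd l - (\<Sum>i\<in>F'. f i * g (n - i))" by (blast intro: dvd_diff_trans)
  qed simp
  then show ?thesis unfolding cauchy_prod_def using adic_sum_eqI by metis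
qed

lemma cauchy_prod_cong:
  assumes "null_at_minus_inf f" "null_at_minus_inf g" "vanish N a f" "vanish N b g"
  shows "unif ^ N dvd cauchy_prod f g n - (trunc a f * trunc b g) $$ n"
proof -
  obtain F where F: "finite F" "\<And>F'. finite F' \<Longrightarrow> F \<subseteq> F' \<Longrightarrow>
      unif ^ N dvd cauchy_prod f g n - (\<Sum>i\<in>F'. f i * g (n - i))"
    using has_cauchy_prod[OF assms(1,2)] unfolding has_adic_sum_def by metis
  have "unif ^ N dvd (trunc a f * trunc b g) $$ n - (\<Sum>i\<in>F \<union> {a..n-b}. f i * g (n - i))"
    using F by (intro trunc_prod_cong assms) auto
  moreover have "unif ^ N dvd cauchy_prod f g n - (\<Sum>i\<in>F \<union> {a..n-b}. f i * g (n - i))"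
    using F by auto
  ultimately show ?thesis by (blast intro: dvd_diff_trans dvd_diff_sym)
qed

lemma vanish_cauchy_prod:
  assumes "null_at_minus_inf f" "null_at_minus_inf g" "vanish N a f" "vanish N b g"
  shows "vanish N (a + b) (cauchy_prod f g)"
  unfolding vanish_def
proof (intro allI impI)
  fix n assume n: "n < a + b"
  have "(trunc a f * trunc b g) $$ n = (\<Sum>i=a..n-b. trunc a f $$ i * trunc b g $$ (n - i))"
    by (rule fls_times_nth_bounds) auto
  also have "\<dots> = 0" using n by simp
  finally show "unif ^ N dvd cauchy_prod f g n"
    using cauchy_prod_cong[OF assms, of n] by simp
qed

lemma null_cauchy_prod:
  assumes "null_at_minus_inf f" "null_at_minus_inf g"
  shows "null_at_minus_inf (cauchy_prod f g)"
  using assms vanish_cauchy_prod[OF assms] unfolding null_iff by metis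

lemma fls_cong_mult_right:
  fixes F G H :: "'r::comm_ring_1 fls"
  assumes "\<And>n. d dvd F $$ n - G $$ n"
  shows "d dvd (F * H) $$ n - (G * H) $$ n"
proof -
  have "(F * H) $$ n - (G * H) $$ n = ((F - G) * H) $$ n"
    by (simp add: left_diff_distrib)
  also have "d dvd \<dots>"
    unfolding fls_times_nth(2) by (intro dvd_sum dvd_mult2) (simp add: assms)
  finally show ?thesis .
qed

lemma cauchy_prod_assoc_cong:
  assumes "null_at_minus_inf f" "null_at_minus_inf g" "null_at_minus_inf h"
    and "vanish N a f" "vanish N b g" "vanish N c h"
  shows "unif ^ N dvd cauchy_prod (cauchy_prod f g) h n - (trunc a f * trunc b g * trunc c h) $$ n"
proof -
  have 1: "unif ^ N dvd cauchy_prod (cauchy_prod f g) h n -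
      (trunc (a + b) (cauchy_prod f g) * trunc c h) $$ n"
    using assms by (intro cauchy_prod_cong null_cauchy_prod vanish_cauchy_prod)
  have "unif ^ N dvd trunc (a + b) (cauchy_prod f g) $$ n - (trunc a f * trunc b g) $$ n" for n
  proof (cases "n < a + b")
    case True
    have "(trunc a f * trunc b g) $$ n = (\<Sum>i=a..n-b. trunc a f $$ i * trunc b g $$ (n - i))"
      by (rule fls_times_nth_bounds) auto
    then show ?thesis using True by simp
  next
    case False
    then show ?thesis using cauchy_prod_cong[OF assms(1,2,4,5), of n] by simp
  qed
  then have "unif ^ N dvd (trunc (a + b) (cauchy_prod f g) * trunc c h) $$ n -
      (trunc a f * trunc b g * trunc c h) $$ n"
    by (rule fls_cong_mult_right)
  with 1 show ?thesis by (rule dvd_diff_trans)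
qed

lemma cauchy_prod_commute:
  assumes "null_at_minus_inf f" "null_at_minus_inf (g :: int \<Rightarrow> 'r::complete_dvr)"
  shows "cauchy_prod f g = cauchy_prod g f"
proof
  fix n
  have "unif ^ N dvd cauchy_prod f g n - cauchy_prod g f n" for N
  proof -
    obtain a b where ab: "vanish N a f" "vanish N b g" using assms unfolding null_iff by metis
    show ?thesis
      using cauchy_prod_cong[OF assms ab, of n]
        cauchy_prod_cong[OF assms(2,1) ab(2,1), of n]
      by (metis dvd_diff_trans dvd_diff_sym mult.commute)
  qed
  then show "cauchy_prod f g n = cauchy_prod g f n"
    using unif_separated[of "cauchy_prod f g n - cauchy_prod g f n"] by simp
qed

lemma cauchy_prod_assoc:
  assumes "null_at_minus_inf f" "null_at_minus_inf g"
    "null_at_minus_inf (h :: int \<Rightarrow> 'r::complete_dvr)"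
  shows "cauchy_prod (cauchy_prod f g) h = cauchy_prod f (cauchy_prod g h)"
proof
  fix n
  let ?l = "cauchy_prod (cauchy_prod f g) h n" and ?r = "cauchy_prod (cauchy_prod g h) f n"
  have "unif ^ N dvd ?l - ?r" for N
  proof -
    obtain a b c where abc: "vanish N a f" "vanish N b g" "vanish N c h"
      using assms unfolding null_iff by metis
    have "trunc a f * trunc b g * trunc c h = trunc b g * trunc c h * trunc a f"
      by (simp add: mult_ac)
    then show ?thesis
      using cauchy_prod_assoc_cong[OF assms abc, of n]
        cauchy_prod_assoc_cong[OF assms(2,3,1) abc(2,3,1), of n]
      by (metis dvd_diff_trans dvd_diff_sym)
  qed
  then have "?l = ?r" using unif_separated[of "?l - ?r"] by simp
  then show "?l = cauchy_prod f (cauchy_prod g h) n"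
    using cauchy_prod_commute[OF assms(1) null_cauchy_prod[OF assms(2,3)]] by simp
qed

lemma null_add:
  assumes "null_at_minus_inf f" "null_at_minus_inf g"
  shows "null_at_minus_inf (\<lambda>i. f i + g i)"
  unfolding null_iff
proof
  fix N
  obtain a b where "vanish N a f" "vanish N b g" using assms unfolding null_iff by metis
  then have "vanish N (min a b) (\<lambda>i. f i + g i)" by (auto simp: vanish_def)
  then show "\<exists>a. vanish N a (\<lambda>i. f i + g i)" ..
qed

lemma null_uminus: "null_at_minus_inf f \<Longrightarrow> null_at_minus_inf (\<lambda>i. - f i)"
  by (simp add: null_at_minus_inf_def)

lemma null_single: "null_at_minus_inf (\<lambda>i. if i = k then c else 0)"
  unfolding null_at_minus_inf_def by (intro allI exI[of _ k]) auto

lemma cauchy_prod_distrib: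
  assumes "null_at_minus_inf f" "null_at_minus_inf g"
    "null_at_minus_inf (h :: int \<Rightarrow> 'r::complete_dvr)"
  shows "cauchy_prod (\<lambda>i. f i + g i) h n = cauchy_prod f h n + cauchy_prod g h n"
proof -
  let ?l = "cauchy_prod (\<lambda>i. f i + g i) h n" and ?r = "cauchy_prod f h n + cauchy_prod g h n"
  have "unif ^ N dvd ?l - ?r" for N
  proof -
    obtain a b c where "vanish N a f" "vanish N b g" and c: "vanish N c h"
      using assms unfolding null_iff by metis
    then have ab: "vanish N (min a b) f" "vanish N (min a b) g"
      "vanish N (min a b) (\<lambda>i. f i + g i)" by (auto simp: vanish_def)
    have eq: "trunc (min a b) (\<lambda>i. f i + g i) = trunc (min a b) f + trunc (min a b) g"
      by (rule fls_eqI) simp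
    have 1: "unif ^ N dvd ?l - (trunc (min a b) (\<lambda>i. f i + g i) * trunc c h) $$ n"
      by (intro cauchy_prod_cong null_add assms ab c)
    have 2: "unif ^ N dvd cauchy_prod f h n - (trunc (min a b) f * trunc c h) $$ n"
      by (intro cauchy_prod_cong assms ab c)
    have 3: "unif ^ N dvd cauchy_prod g h n - (trunc (min a b) g * trunc c h) $$ n"
      by (intro cauchy_prod_cong assms ab c)
    have "unif ^ N dvd ?r - (trunc (min a b) (\<lambda>i. f i + g i) * trunc c h) $$ n"
      using dvd_add[OF 2 3] unfolding eq by (simp add: algebra_simps)
    with 1 show ?thesis by (blast intro: dvd_diff_trans dvd_diff_sym)
  qed
  then show ?thesis using unif_separated[of "?l - ?r"] by simp
qed

lemma cauchy_prod_one:
  assumes "null_at_minus_inf (f :: int \<Rightarrow> 'r::complete_dvr)"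
  shows "cauchy_prod (\<lambda>i. if i = 0 then 1 else 0) f n = f n"
  unfolding cauchy_prod_def
proof (rule adic_sum_eqI, unfold has_adic_sum_def, intro allI exI conjI impI)
  fix N and F' :: "int set"
  assume F': "finite F'" "{0} \<subseteq> F'"
  have "(\<Sum>i\<in>F'. (if i = 0 then 1 else 0) * f (n - i)) = (\<Sum>i\<in>{0}. (if i = 0 then 1 else 0) * f (n - i))"
    using F' by (intro sum.mono_neutral_right) auto
  then show "unif ^ N dvd f n - (\<Sum>i\<in>F'. (if i = 0 then 1 else 0) * f (n - i))" by simp
qed simp

typedef (overloaded) ('r::complete_dvr) bilaurent = "{f :: int \<Rightarrow> 'r. null_at_minus_inf f}"
  morphisms bl_nth Abs_bilaurent
  using null_single[of 0 0] by blast

setup_lifting type_definition_bilaurent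

instantiation bilaurent :: (complete_dvr) comm_ring_1
begin

lift_definition zero_bilaurent :: "'a bilaurent" is "\<lambda>_. 0"
  using null_single[of 0 0] by simp

lift_definition one_bilaurent :: "'a bilaurent" is "\<lambda>i. if i = 0 then 1 else 0"
  by (rule null_single)

lift_definition plus_bilaurent :: "'a bilaurent \<Rightarrow> 'a bilaurent \<Rightarrow> 'a bilaurent"
  is "\<lambda>f g i. f i + g i" by (rule null_add)

lift_definition uminus_bilaurent :: "'a bilaurent \<Rightarrow> 'a bilaurent"
  is "\<lambda>f i. - f i" by (rule null_uminus)

lift_definition minus_bilaurent :: "'a bilaurent \<Rightarrow> 'a bilaurent \<Rightarrow> 'a bilaurent"
  is "\<lambda>f g i. f i - g i"
  using null_add null_uminus by fastforce

lift_definition times_bilaurent :: "'a bilaurent \<Rightarrow> 'a bilaurent \<Rightarrow> 'a bilaurent"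
  is cauchy_prod by (rule null_cauchy_prod)

instance
proof
  fix a b c :: "'a bilaurent"
  show "a * b * c = a * (b * c)" by transfer (rule cauchy_prod_assoc)
  show "a * b = b * a" by transfer (rule cauchy_prod_commute)
  show "1 * a = a" by transfer (rule ext, rule cauchy_prod_one)
  show "(a + b) * c = a * c + b * c" by transfer (rule ext, rule cauchy_prod_distrib)
  show "(0::'a bilaurent) \<noteq> 1" by transfer (metis zero_neq_one)
qed (transfer, simp add: algebra_simps)+

end

lift_definition bl_const :: "'r::complete_dvr \<Rightarrow> 'r bilaurent" is "\<lambda>c i. if i = 0 then c else 0"
  by (rule null_single)

lift_definition bl_T :: "'r::complete_dvr bilaurent" is "\<lambda>i. if i = 1 then 1 else 0"
  by (rule null_single)

text \<open>Reduction \<open>R[[T]]{T\<inverse>} \<rightarrow> k((t))\<close> induced by a reduction \<open>R \<rightarrow> k\<close>.\<close>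

definition bl_reduce :: "('r::complete_dvr \<Rightarrow> 'k::field) \<Rightarrow> 'r bilaurent \<Rightarrow> 'k fls" where
  "bl_reduce red f = Abs_fls (\<lambda>i. red (bl_nth f i))"

text \<open>\<open>B = R[[Z]]{Z\<inverse>}\<close>, for an \<open>R\<close>-algebra \<open>B\<close> with structure map \<open>s\<close>.\<close>

definition is_parameter ::
  "('r::complete_dvr \<Rightarrow> 'b::comm_ring_1) \<Rightarrow> 'b \<Rightarrow> bool" where
  "is_parameter s Z \<longleftrightarrow>
     (\<exists>\<theta> :: 'r bilaurent \<Rightarrow> 'b. ring_homo \<theta> \<and> bij \<theta> \<and> (\<forall>c. \<theta> (bl_const c) = s c) \<and> \<theta> bl_T = Z)"

section \<open>Algebras given by a structure map\<close>

definition alg_scale :: "('a::comm_ring_1 \<Rightarrow> 'b::comm_ring_1) \<Rightarrow> 'a \<Rightarrow> 'b \<Rightarrow> 'b" where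
  "alg_scale s a b = s a * b"

definition finite_algebra :: "('a::comm_ring_1 \<Rightarrow> 'b::comm_ring_1) \<Rightarrow> bool" where
  "finite_algebra s \<longleftrightarrow> (\<exists>S. finite S \<and> module.span (alg_scale s) S = UNIV)"

text \<open>For a domain \<open>A\<close>, \<open>B\<close> has degree \<open>d\<close> if \<open>B \<otimes> Frac A\<close> has dimension \<open>d\<close>, i.e. if \<open>d\<close> is
  the largest cardinality of an \<open>A\<close>-linearly independent subset of \<open>B\<close>.\<close>

definition algebra_degree :: "('a::comm_ring_1 \<Rightarrow> 'b::comm_ring_1) \<Rightarrow> nat \<Rightarrow> bool" where
  "algebra_degree s d \<longleftrightarrow>
     (\<exists>S. finite S \<and> card S = d \<and> \<not> module.dependent (alg_scale s) S) \<and>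
     (\<forall>S. finite S \<longrightarrow> \<not> module.dependent (alg_scale s) S \<longrightarrow> card S \<le> d)"

text \<open>Flatness in its equational form: every linear relation is a consequence of relations
  between the coefficients (equivalently \<open>I \<otimes> B \<rightarrow> B\<close> is injective for every ideal \<open>I\<close>).\<close>

definition flat_algebra :: "('a::comm_ring_1 \<Rightarrow> 'b::comm_ring_1) \<Rightarrow> bool" where
  "flat_algebra s \<longleftrightarrow>
     (\<forall>(n::nat) r b. (\<Sum>i<n. s (r i) * b i) = 0 \<longrightarrow>
        (\<exists>(m::nat) a c. (\<forall>i<n. b i = (\<Sum>j<m. s (a i j) * c j)) \<and>
                        (\<forall>j<m. (\<Sum>i<n. r i * a i j) = 0)))"

text \<open>The second clause says that \<open>I B = B\<close> implies \<open>I = A\<close> for every ideal \<open>I\<close> of \<open>A\<close>; it is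
  enough to consider finitely generated ideals.\<close>

definition faithfully_flat :: "('a::comm_ring_1 \<Rightarrow> 'b::comm_ring_1) \<Rightarrow> bool" where
  "faithfully_flat s \<longleftrightarrow> flat_algebra s \<and>
     (\<forall>(n::nat) a b. (\<Sum>i<n. s (a i) * b i) = 1 \<longrightarrow> (\<exists>c. (\<Sum>i<n. c i * a i) = 1))"

text \<open>\<open>B\<close> is finitely presented as a module over \<open>A\<close>. For finite algebras this is the same as
  being finitely presented as an algebra.\<close>

definition finitely_presented :: "('a::comm_ring_1 \<Rightarrow> 'b::comm_ring_1) \<Rightarrow> bool" where
  "finitely_presented s \<longleftrightarrow>
     (\<exists>(n::nat) e. (\<forall>b. \<exists>c. b = (\<Sum>i<n. s (c i) * e i)) \<and>
        (\<exists>(m::nat) r. (\<forall>j<m. (\<Sum>i<n. s (r j i) * e i) = 0) \<and>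
           (\<forall>c. (\<Sum>i<n. s (c i) * e i) = 0 \<longrightarrow>
              (\<exists>d. \<forall>i<n. c i = (\<Sum>j<m. d j * r j i)))))"

text \<open>\<open>B = A[y]/(F(y))\<close>.\<close>

definition presents :: "('a::comm_ring_1 \<Rightarrow> 'b::comm_ring_1) \<Rightarrow> 'a poly \<Rightarrow> 'b \<Rightarrow> bool" where
  "presents s F y \<longleftrightarrow>
     (\<forall>b. \<exists>P. b = poly (map_poly s P) y) \<and>
     (\<forall>P. poly (map_poly s P) y = 0 \<longleftrightarrow> F dvd P)"

text \<open>Trace of multiplication by \<open>b\<close>, for \<open>B\<close> finite free over \<open>A\<close>.\<close>

definition alg_trace :: "('a::comm_ring_1 \<Rightarrow> 'b::comm_ring_1) \<Rightarrow> 'b \<Rightarrow> 'a" where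
  "alg_trace s b = (THE t. \<exists>S. finite S \<and> \<not> module.dependent (alg_scale s) S \<and>
     module.span (alg_scale s) S = UNIV \<and>
     t = (\<Sum>e\<in>S. module.representation (alg_scale s) S (b * e) e))"

text \<open>The different is the inverse of the fractional ideal
  \<open>{x \<in> Frac B. Tr(xB) \<subseteq> A}\<close>. An element of \<open>Frac B\<close> is written \<open>c/a\<close> with \<open>c \<in> B\<close> and
  \<open>a \<in> A - {0}\<close>; it lies in that fractional ideal iff \<open>a\<close> divides \<open>Tr(cB)\<close>. Since \<open>1\<close> does,
  the inverse is contained in \<open>B\<close>.\<close>

definition different :: "('a::comm_ring_1 \<Rightarrow> 'b::comm_ring_1) \<Rightarrow> 'b set" where
  "different s = {b. \<forall>c a. a \<noteq> 0 \<longrightarrow> (\<forall>b'. a dvd alg_trace s (c * b')) \<longrightarrow> s a dvd b * c}"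

definition ideal_val :: "'b::comm_ring_1 \<Rightarrow> 'b set \<Rightarrow> nat" where
  "ideal_val \<pi> I = (THE d. I = {x. \<pi> ^ d dvd x})"

text \<open>\<open>L\<close> is purely inseparable of degree \<open>p\<close> over \<open>F\<close>, in characteristic \<open>p\<close>.\<close>

definition purely_insep_of_degree_p :: "nat \<Rightarrow> ('f::field \<Rightarrow> 'l::field) \<Rightarrow> bool" where
  "purely_insep_of_degree_p p j \<longleftrightarrow>
     ring_homo j \<and> vector_space.dim (alg_scale j) UNIV = p \<and> (\<forall>x. \<exists>n. x ^ (p ^ n) \<in> range j)"

section \<open>Torsors under finite closed subgroup schemes of \<open>\<G>\<^sub>m\<close> and \<open>\<G>\<^sup>(\<^sup>n\<^sup>)\<close>\<close>

text \<open>The group scheme \<open>Spec R[x]/(f)\<close>, with multiplication \<open>x \<mapsto> law(x\<^sub>1, x\<^sub>2)\<close> (the outer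
  variable is \<open>x\<^sub>2\<close>) and unit section \<open>x \<mapsto> unit\<close>.\<close>

record (overloaded) ('r::zero) line_group =
  equation :: "'r poly"
  law :: "'r poly poly"
  neutral :: 'r

definition mu_scheme :: "nat \<Rightarrow> 'r::comm_ring_1 line_group" where
  "mu_scheme p = \<lparr> equation = monom 1 p - 1, law = [:0, [:0, 1:]:], neutral = 1 \<rparr>"

text \<open>\<open>((\<pi>\<^sup>n x + 1)\<^sup>p - 1) / \<pi>\<^sup>p\<^sup>n\<close>\<close>

definition psi :: "'r::comm_ring_1 \<Rightarrow> nat \<Rightarrow> nat \<Rightarrow> 'r poly" where
  "psi \<pi> p n = exact_div ([:1, \<pi> ^ n:] ^ p - 1) [:\<pi> ^ (p * n):]"

text \<open>\<open>\<H>\<^sub>n = ker \<psi>\<^sub>n\<close>. There is no need to invert \<open>\<pi>\<^sup>n x + 1\<close>: its \<open>p\<close>-th power is \<open>1\<close> modulo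
  \<open>\<psi>\<^sub>n(x)\<close>.\<close>

definition H_scheme :: "'r::comm_ring_1 \<Rightarrow> nat \<Rightarrow> nat \<Rightarrow> 'r line_group" where
  "H_scheme \<pi> p n =
     \<lparr> equation = psi \<pi> p n, law = [:[:0, 1:], [:1, \<pi> ^ n:]:], neutral = 0 \<rparr>"

text \<open>The kernel of \<open>\<int>[B \<times> B] \<rightarrow> B \<otimes>\<^sub>A B\<close>.\<close>

inductive_set tensor_relations ::
  "('a::comm_ring_1 \<Rightarrow> 'b::comm_ring_1) \<Rightarrow> (('b \<times> 'b) \<Rightarrow>\<^sub>0 int) set" for s where
  "Poly_Mapping.single (b + b', c) 1 - Poly_Mapping.single (b, c) 1 - Poly_Mapping.single (b', c) 1
     \<in> tensor_relations s"
| "Poly_Mapping.single (b, c + c') 1 - Poly_Mapping.single (b, c) 1 - Poly_Mapping.single (b, c') 1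
     \<in> tensor_relations s"
| "Poly_Mapping.single (s a * b, c) 1 - Poly_Mapping.single (b, s a * c) 1 \<in> tensor_relations s"
| "0 \<in> tensor_relations s"
| "t \<in> tensor_relations s \<Longrightarrow> t' \<in> tensor_relations s \<Longrightarrow> t - t' \<in> tensor_relations s"

text \<open>An action over \<open>A\<close> of \<open>Spec R[x]/(f)\<close> on \<open>Spec B\<close>, given as a coaction
  \<open>B \<rightarrow> B \<otimes>\<^sub>R R[x]/(f) = B[x]/(f)\<close> with values represented by polynomials. The structure maps are
  \<open>\<iota> : A \<rightarrow> B\<close> and \<open>s : R \<rightarrow> B\<close>.\<close>

definition coaction ::
  "('a::comm_ring_1 \<Rightarrow> 'b::comm_ring_1) \<Rightarrow> ('r::comm_ring_1 \<Rightarrow> 'b) \<Rightarrow> 'r line_group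
    \<Rightarrow> ('b \<Rightarrow> 'b poly) \<Rightarrow> bool" where
  "coaction \<iota> s H \<rho> \<longleftrightarrow>
    (let f = map_poly s (equation H);
         m = map_poly (map_poly s) (law H);
         \<comment> \<open>the ideal \<open>(f(x\<^sub>1), f(x\<^sub>2))\<close> of \<open>B[x\<^sub>1][x\<^sub>2]\<close>\<close>
         I2 = {[:f:] * U + map_poly (\<lambda>c. [:c:]) f * V | U V. True}
     in (\<forall>b b'. f dvd \<rho> (b + b') - (\<rho> b + \<rho> b')) \<and>
        (\<forall>b b'. f dvd \<rho> (b * b') - \<rho> b * \<rho> b') \<and>
        (\<forall>a. f dvd \<rho> (\<iota> a) - [:\<iota> a:]) \<and>
        (\<forall>b. poly (\<rho> b) (s (neutral H)) = b) \<and>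
        (\<forall>b. map_poly \<rho> (\<rho> b) - poly (map_poly (\<lambda>c. [:[:c:]:]) (\<rho> b)) m \<in> I2))"

text \<open>\<open>B \<otimes>\<^sub>A B \<rightarrow> B[x]/(f)\<close>, \<open>b \<otimes> b' \<mapsto> b \<rho>(b')\<close>, evaluated on a representative in
  \<open>\<int>[B \<times> B]\<close>.\<close>

definition torsor_map :: "('b::comm_ring_1 \<Rightarrow> 'b poly) \<Rightarrow> (('b \<times> 'b) \<Rightarrow>\<^sub>0 int) \<Rightarrow> 'b poly" where
  "torsor_map \<rho> t =
     (\<Sum>(b, b')\<in>Poly_Mapping.keys t. of_int (Poly_Mapping.lookup t (b, b')) * smult b (\<rho> b'))"

definition fppf_torsor ::
  "('a::comm_ring_1 \<Rightarrow> 'b::comm_ring_1) \<Rightarrow> ('r::comm_ring_1 \<Rightarrow> 'b) \<Rightarrow> 'r line_group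
    \<Rightarrow> ('b \<Rightarrow> 'b poly) \<Rightarrow> bool" where
  "fppf_torsor \<iota> s H \<rho> \<longleftrightarrow>
     faithfully_flat \<iota> \<and> finitely_presented \<iota> \<and> coaction \<iota> s H \<rho> \<and>
     (\<forall>P. \<exists>t. map_poly s (equation H) dvd P - torsor_map \<rho> t) \<and>
     (\<forall>t. map_poly s (equation H) dvd torsor_map \<rho> t \<longleftrightarrow> t \<in> tensor_relations \<iota>)"

text \<open>\<open>B = A[y]/(y\<^sup>p - u)\<close>, where the presentation is the one attached to the torsor structure
  \<open>\<rho>\<close>: \<open>\<mu>\<^sub>p\<close> acts on \<open>y\<close> by multiplication. (Without this, \<open>u\<close> could be replaced by \<open>u\<^sup>j\<close> with
  \<open>j\<close> prime to \<open>p\<close>.)\<close>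

definition mu_presentation ::
  "nat \<Rightarrow> ('a::comm_ring_1 \<Rightarrow> 'b::comm_ring_1) \<Rightarrow> ('b \<Rightarrow> 'b poly) \<Rightarrow> 'a \<Rightarrow> 'b \<Rightarrow> bool" where
  "mu_presentation p \<iota> \<rho> u y \<longleftrightarrow>
     u dvd 1 \<and> presents \<iota> (monom 1 p - [:u:]) y \<and> (monom 1 p - 1) dvd \<rho> y - [:0, y:]"

text \<open>\<open>B = A[w]/(\<psi>\<^sub>n(w) - u)\<close>, where \<open>\<H>\<^sub>n\<close> acts on \<open>w\<close> by the group law of \<open>\<G>\<^sup>(\<^sup>n\<^sup>)\<close>, i.e.
  \<open>w \<mapsto> w + x + \<pi>\<^sup>n w x\<close>.\<close>

definition H_presentation ::
  "'r::comm_ring_1 \<Rightarrow> nat \<Rightarrow> nat \<Rightarrow> ('r \<Rightarrow> 'a::comm_ring_1) \<Rightarrow> ('a \<Rightarrow> 'b::comm_ring_1)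
    \<Rightarrow> ('b \<Rightarrow> 'b poly) \<Rightarrow> 'a \<Rightarrow> 'b \<Rightarrow> bool" where
  "H_presentation \<pi> p n c \<iota> \<rho> u w \<longleftrightarrow>
     presents \<iota> (map_poly c (psi \<pi> p n) - [:u:]) w \<and>
     map_poly (\<iota> \<circ> c) (psi \<pi> p n) dvd \<rho> w - [:w, 1 + \<iota> (c (\<pi> ^ n)) * w:]"

section \<open>Automorphisms and the explicit formulas\<close>

definition ring_auto :: "('b::comm_ring_1 \<Rightarrow> 'b) \<Rightarrow> bool" where
  "ring_auto \<sigma> \<longleftrightarrow> ring_homo \<sigma> \<and> bij \<sigma>"

definition comp_group :: "('b \<Rightarrow> 'b) set \<Rightarrow> ('b \<Rightarrow> 'b) monoid" where
  "comp_group G = \<lparr> carrier = G, monoid.mult = (\<circ>), one = id \<rparr>"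

text \<open>\<open>\<zeta>\<^sup>e\<close> for \<open>e\<close> in \<open>\<int>/p\<int>\<close>, where \<open>\<zeta>\<^sup>p = 1\<close>.\<close>

definition root_pow :: "'a::comm_ring_1 \<Rightarrow> nat \<Rightarrow> int \<Rightarrow> 'a" where
  "root_pow \<zeta> p e = \<zeta> ^ nat (e mod int p)"

text \<open>Integer powers of a unit.\<close>

definition unit_powi :: "'b::comm_ring_1 \<Rightarrow> int \<Rightarrow> 'b" where
  "unit_powi z e = (if 0 \<le> e then z ^ nat e else exact_div 1 z ^ nat (- e))"

text \<open>The isomorphism \<open>\<phi>\<close> of \<open>G\<close> onto \<open>\<int>/p\<int>\<close> with \<open>\<sigma> y = \<zeta>\<^bsup>\<phi>(\<sigma>)\<^esup> y\<close>.\<close>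

definition is_kummer_iso ::
  "nat \<Rightarrow> 'b::comm_ring_1 \<Rightarrow> ('b \<Rightarrow> 'b) set \<Rightarrow> 'b \<Rightarrow> (('b \<Rightarrow> 'b) \<Rightarrow> int) \<Rightarrow> bool" where
  "is_kummer_iso p \<zeta> G y \<phi> \<longleftrightarrow>
     \<phi> \<in> extensional G \<and> \<phi> \<in> iso (comp_group G) (integer_mod_group p) \<and>
     (\<forall>\<sigma>\<in>G. \<sigma> y = root_pow \<zeta> p (\<phi> \<sigma>) * y)"

text \<open>The element of a domain of characteristic \<open>0\<close> given by a rational number (whose
  denominator is invertible).\<close>

definition of_rat_elem :: "rat \<Rightarrow> 'a::comm_ring_1" where
  "of_rat_elem q = exact_div (of_int (fst (quotient_of q))) (of_int (snd (quotient_of q)))"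

text \<open>\<open>(1 + x)\<^sup>1\<^sup>/\<^sup>m\<close>, for \<open>m\<close> prime to the residue characteristic and \<open>\<pi>\<close> dividing \<open>x\<close>.\<close>

definition binom_root :: "'b::comm_ring_1 \<Rightarrow> int \<Rightarrow> 'b \<Rightarrow> 'b" where
  "binom_root \<pi> m x = adic_sum \<pi> (\<lambda>i::nat. of_rat_elem ((1 / of_int m) gchoose i) * x ^ i)"

end

theory Submission imports Defs begin

text \<open>
  A generator \<open>\<sigma>\<close> of \<open>G\<close> with \<open>\<sigma> y = \<zeta> y\<close> for some unit \<open>y\<close> is provided by Lagrange resolvents.
  Multiplying \<open>y\<close> by units of \<open>A\<close> one reaches \<open>y = 1 + \<pi>\<^sup>n W\<close>, where the residue class of \<open>W\<close>
  generates the residue field extension and \<open>n < v(\<zeta> - 1)\<close>: as long as the class of \<open>W\<close> lies in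
  \<open>k((t))\<close>, \<open>n\<close> can be increased, and \<open>n = v(\<zeta> - 1)\<close> is impossible, because \<open>\<sigma>\<close> acts trivially on
  the residue field of \<open>B\<close> but would move the class of \<open>W\<close>. Then \<open>B = A[W]\<close>, and the traces of
  the powers of \<open>y\<close> give \<open>v(p) = \<delta> + n (p - 1)\<close>.

  Both \<open>\<mu>\<^sub>p\<close> and \<open>\<H>\<^sub>n\<close> have \<open>p\<close> sections over \<open>R\<close>. As \<open>B\<close> is a domain, a coaction is determined by
  its values at these sections, so that an action is a homomorphism from \<open>\<int>/p\<int>\<close> to \<open>G\<close>; the torsor
  condition says that it is an isomorphism.

  Changing \<open>u\<close> in its class removes from the reduction of \<open>u\<close> the exponents divisible by \<open>p\<close>, so
  that its order \<open>m\<close> becomes prime to \<open>p\<close>. The reduction of \<open>y\<close>, \<open>y - 1\<close> or \<open>w\<close> is an \<open>m\<close>-th power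
  of a uniformizer, and this root lifts by Hensel's lemma to a parameter \<open>Z\<close>; the formulas for \<open>\<sigma> Z\<close>
  are the \<open>m\<close>-th roots of those for \<open>\<sigma> y\<close>, pinned down by \<open>\<sigma>\<close> acting trivially on the residue field.
\<close>

section \<open>Complete discrete valuation rings\<close>

text \<open>Neither integrality of B nor continuity of a homomorphism is given; both are extracted.
  An element W whose class generates the residue extension yields, by torsion-freeness and Nakayama,
  an A-basis 1, W, ..., W^(p-1) of B, and B inherits completeness from A coordinatewise. Ring
  homomorphisms between fields of Laurent series over k are controlled through orders alone, because
  a series of order 0 has n-th roots for every n prime to p. The action on the residue field is
  trivial because p-th powers of residues come from A and Frobenius is injective. The formula for
  \<delta> comes from p being the product of the 1 - \<zeta>^i with 0 < i < p: if \<zeta>^i = 1 +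
  \<pi>^n x_i, these p - 1 factors contribute \<pi>^(n(p-1)), and the product of the -x_i generates
  the different. The same x_i are the sections of \<open>\<H>\<^sub>n\<close>.\<close>

lemma dvd_prod_diff:
  fixes f g :: "'i \<Rightarrow> 'a::comm_ring_1"
  assumes "finite S" "\<And>i. i \<in> S \<Longrightarrow> d dvd f i - g i"
  shows "d dvd prod f S - prod g S"
  using assms
proof (induction S rule: finite_induct)
  case (insert i S)
  have "f i * prod f S - g i * prod g S = (f i - g i) * prod f S + g i * (prod f S - prod g S)"
    by (simp add: algebra_simps)
  then show ?case
    using insert by (simp add: dvd_add dvd_mult dvd_mult2)
qed simp

lemma dvd_power_diff:
  fixes x y :: "'a::comm_ring_1"
  assumes "d dvd x - y"
  shows "d dvd x ^ n - y ^ n"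
  using dvd_prod_diff[of "{..<n}" d "\<lambda>_. x" "\<lambda>_. y"] assms by simp

lemma dvd_mult_diff:
  fixes x y :: "'a::comm_ring_1"
  assumes "d dvd x - y" "d dvd x' - y'"
  shows "d dvd x * x' - y * y'"
proof -
  have "x * x' - y * y' = (x - y) * x' + y * (x' - y')" by (simp add: algebra_simps)
  then show ?thesis using assms by (simp add: dvd_add dvd_mult dvd_mult2)
qed

lemma dvd_add_diff:
  fixes x y :: "'a::comm_ring_1"
  assumes "d dvd x - y" "d dvd x' - y'"
  shows "d dvd (x + x') - (y + y')"
  using dvd_add[OF assms] by (simp add: algebra_simps)

lemma dvd_sum_diff:
  fixes f g :: "'i \<Rightarrow> 'a::comm_ring_1"
  assumes "\<And>i. i \<in> S \<Longrightarrow> d dvd f i - g i"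
  shows "d dvd sum f S - sum g S"
  unfolding sum_subtractf[symmetric] by (rule dvd_sum) (rule assms)

text \<open>The type is only \<open>comm_ring_1\<close>: B becomes a domain by a proof, not by its
  type class, so cancellation, units and valuations are developed from the uniformizer.\<close>

locale cdvr =
  fixes \<pi> :: "'a::comm_ring_1"
  assumes uniformizer: "cdvr_uniformizer \<pi>"
begin

lemma mult_eq_0: "x * y = 0 \<longleftrightarrow> x = (0::'a) \<or> y = 0"
  using uniformizer unfolding cdvr_uniformizer_def by auto

lemma pi_nz: "\<pi> \<noteq> 0" and pi_nonunit: "\<not> \<pi> dvd 1"
  using uniformizer unfolding cdvr_uniformizer_def by auto

lemma unit_times_power: "x \<noteq> 0 \<Longrightarrow> \<exists>u n. u dvd 1 \<and> x = u * \<pi> ^ n"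
  using uniformizer unfolding cdvr_uniformizer_def by auto

lemma limit:
  assumes "\<And>n. \<pi> ^ n dvd s (Suc n) - s n"
  shows "\<exists>l. \<forall>n. \<pi> ^ n dvd l - s n"
  using uniformizer assms unfolding cdvr_uniformizer_def by blast

lemma power_eq_0: "x ^ n = 0 \<longleftrightarrow> x = (0::'a) \<and> n > 0"
  by (induction n) (auto simp: mult_eq_0)

lemma pi_power_nz: "\<pi> ^ n \<noteq> 0"
  using pi_nz power_eq_0 by blast

lemma mult_cancel: "c \<noteq> 0 \<Longrightarrow> c * x = c * y \<longleftrightarrow> x = (y::'a)"
  using mult_eq_0[of c "x - y"] by (auto simp: algebra_simps)

lemma mult_cancel_right: "c \<noteq> 0 \<Longrightarrow> x * c = y * c \<longleftrightarrow> x = (y::'a)"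
  using mult_cancel[of c x y] by (simp add: mult.commute)

lemma dvd_cancel: "c \<noteq> 0 \<Longrightarrow> c * x dvd c * y \<longleftrightarrow> x dvd (y::'a)"
  using mult_cancel by (auto simp: dvd_def mult.assoc)

lemma unit_nz: "u dvd 1 \<Longrightarrow> u \<noteq> (0::'a)"
  using pi_nonunit pi_nz by auto

lemma unit_cancel: "u dvd 1 \<Longrightarrow> x dvd u * y \<longleftrightarrow> x dvd (y::'a)"
proof
  assume u: "u dvd 1" and d: "x dvd u * y"
  then obtain u' where "u * u' = 1" by (metis dvdE)
  then have "y = u' * (u * y)" by (metis mult.assoc mult.commute mult_1)
  then show "x dvd y" using d by (metis dvd_mult)
qed simp

lemma power_dvd_power: "\<pi> ^ n dvd \<pi> ^ m \<longleftrightarrow> n \<le> m"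
proof
  assume d: "\<pi> ^ n dvd \<pi> ^ m"
  show "n \<le> m"
  proof (rule ccontr)
    assume "\<not> n \<le> m"
    then obtain k where k: "n = m + Suc k" using less_imp_Suc_add not_le by fastforce
    have "\<pi> ^ m * \<pi> ^ Suc k dvd \<pi> ^ m * 1" using d by (simp add: k power_add mult_ac)
    then have "\<pi> ^ Suc k dvd 1" using dvd_cancel[OF pi_power_nz] by blast
    then have "\<pi> dvd 1" by (metis dvd_trans dvd_triv_left power_Suc)
    then show False using pi_nonunit by simp
  qed
qed (simp add: le_imp_power_dvd)

lemma dvd_unit_power: "u dvd 1 \<Longrightarrow> \<pi> ^ n dvd u * \<pi> ^ m \<longleftrightarrow> n \<le> m"
  using unit_cancel power_dvd_power by simp

lemma separated: "(\<And>N. \<pi> ^ N dvd x) \<Longrightarrow> x = 0"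
proof (rule ccontr)
  assume d: "\<And>N. \<pi> ^ N dvd x" and "x \<noteq> 0"
  then obtain u k where u: "u dvd 1" "x = u * \<pi> ^ k" using unit_times_power by blast
  show False using d[of "Suc k"] u dvd_unit_power[of u "Suc k" k] by simp
qed

lemma eqI: "(\<And>N. \<pi> ^ N dvd x - y) \<Longrightarrow> x = y"
  using separated[of "x - y"] by simp

lemma unit_iff: "x dvd 1 \<longleftrightarrow> \<not> \<pi> dvd x"
proof
  show "x dvd 1 \<Longrightarrow> \<not> \<pi> dvd x" using pi_nonunit dvd_trans by blast
  assume n: "\<not> \<pi> dvd x"
  then have "x \<noteq> 0" by auto
  then obtain u k where u: "u dvd 1" "x = u * \<pi> ^ k" using unit_times_power by blast
  then have "k = 0" using n by (cases k) auto
  then show "x dvd 1" using u by simp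
qed

lemma pi_dvd_mult: "\<pi> dvd x * y \<longleftrightarrow> \<pi> dvd x \<or> \<pi> dvd y"
  using unit_iff[of x] unit_cancel[of x \<pi> y] by auto

lemma pi_dvd_power: "\<pi> dvd x ^ n \<longleftrightarrow> \<pi> dvd x \<and> n > 0"
  by (induction n) (auto simp: pi_dvd_mult pi_nonunit)

lemma unit_mult: "x dvd 1 \<Longrightarrow> y dvd 1 \<Longrightarrow> x * y dvd (1::'a)"
  using unit_iff pi_dvd_mult by blast

lemma unit_power: "x dvd 1 \<Longrightarrow> x ^ n dvd (1::'a)"
  using unit_iff pi_dvd_power by blast

lemma dvd_power_iff_le_val: 
  assumes "x \<noteq> 0" shows "\<pi> ^ n dvd x \<longleftrightarrow> n \<le> val \<pi> x"
proof -
  obtain u k where u: "u dvd 1" "x = u * \<pi> ^ k" using unit_times_power assms by blast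
  have "val \<pi> x = k"
    unfolding val_def u(2) using dvd_unit_power[OF u(1)]
    by (intro Greatest_equality) auto
  then show ?thesis using u dvd_unit_power by simp
qed

lemma val_eqI: "u dvd 1 \<Longrightarrow> val \<pi> (u * \<pi> ^ k) = k"
  unfolding val_def using dvd_unit_power by (intro Greatest_equality) auto

lemma val_decomp:
  assumes "x \<noteq> 0" shows "\<exists>u. u dvd 1 \<and> x = u * \<pi> ^ val \<pi> x"
  using unit_times_power[OF assms] val_eqI by metis

lemma val_mult:
  assumes "x \<noteq> 0" "y \<noteq> 0" shows "val \<pi> (x * y) = val \<pi> x + val \<pi> y"
proof -
  obtain u v where u: "u dvd 1" "x = u * \<pi> ^ val \<pi> x" and v: "v dvd 1" "y = v * \<pi> ^ val \<pi> y"
    using val_decomp assms by meson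
  have "x * y = (u * v) * \<pi> ^ (val \<pi> x + val \<pi> y)"
    by (subst u(2), subst v(2)) (simp add: power_add mult_ac)
  then show ?thesis using val_eqI unit_mult u v by metis
qed

lemma val_power: "val \<pi> (\<pi> ^ k) = k"
  using val_eqI[of 1 k] by simp

lemma exact_div: 
  assumes "b \<noteq> (0::'a)" "b * c = a" shows "exact_div a b = c"
  unfolding exact_div_def
proof (rule the_equality)
  fix c' assume "b * c' = a"
  then show "c' = c" using assms mult_cancel[of b c' c] by simp
qed (rule assms)

text \<open>The cofactor \<open>1 + \<eta> + \<dots> + \<eta>\<^bsup>m-1\<^esup>\<close> of \<open>\<eta> - 1\<close> in \<open>\<eta>\<^sup>m - 1\<close> is congruent to \<open>m\<close>, hence a unit.\<close>

lemma power_eq_one_imp: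
  assumes "\<eta> ^ m = 1" "\<pi> dvd \<eta> - 1" "\<not> \<pi> dvd of_nat m"
  shows "\<eta> = 1"
proof -
  have "\<eta> ^ m - 1 = (\<eta> - 1) * (\<Sum>i<m. \<eta> ^ i)" by (simp add: power_diff_1_eq)
  then have "\<eta> = 1 \<or> (\<Sum>i<m. \<eta> ^ i) = 0" using assms(1) mult_eq_0 by auto
  moreover have "\<pi> dvd (\<Sum>i<m. \<eta> ^ i) - of_nat m"
    using dvd_sum_diff[of "{..<m}" \<pi> "\<lambda>i. \<eta> ^ i" "\<lambda>_. 1"] dvd_power_diff[OF assms(2)] by simp
  ultimately show ?thesis using assms(3) by (auto simp: dvd_minus_iff)
qed

text \<open>Uniqueness in Hensel's lemma for m-th roots: y/x is an m-th root of unity congruent to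
  1.\<close>

lemma power_eq_imp_eq:
  assumes "x ^ m = y ^ m" "\<pi> dvd x - y" "x dvd 1" "\<not> \<pi> dvd of_nat m"
  shows "x = y"
proof -
  obtain x' where x': "x * x' = 1" using assms(3) by (metis dvdE)
  have "(y * x') ^ m = 1"
    using assms(1) x' by (metis power_mult_distrib power_one)
  moreover have "y * x' - 1 = - ((x - y) * x')" using x' by (simp add: algebra_simps)
  then have "\<pi> dvd y * x' - 1" using assms(2) by simp
  ultimately have "y * x' = 1" using power_eq_one_imp assms(4) by blast
  then show ?thesis using x' by (metis mult.assoc mult.commute mult_1)
qed

subsection \<open>Adic sums\<close>

text \<open>Stronger than convergence to 0: modulo \<pi>^N the sum is exactly that of the first N
  terms. Power series in an element divisible by \<pi> have this form.\<close>

definition null_seq :: "(nat \<Rightarrow> 'a) \<Rightarrow> bool" where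
  "null_seq f \<longleftrightarrow> (\<forall>i. \<pi> ^ i dvd f i)"

lemma has_adic_sum_unique:
  assumes "has_adic_sum \<pi> f s" "has_adic_sum \<pi> f t"
  shows "s = t"
proof (rule eqI)
  fix N
  obtain F where F: "finite F" "\<And>F'. finite F' \<Longrightarrow> F \<subseteq> F' \<Longrightarrow> \<pi> ^ N dvd s - sum f F'"
    using assms(1) unfolding has_adic_sum_def by blast
  obtain G where G: "finite G" "\<And>F'. finite F' \<Longrightarrow> G \<subseteq> F' \<Longrightarrow> \<pi> ^ N dvd t - sum f F'"
    using assms(2) unfolding has_adic_sum_def by blast
  show "\<pi> ^ N dvd s - t"
    using F(2)[of "F \<union> G"] G(2)[of "F \<union> G"] F(1) G(1)
    by (auto intro: dvd_diff_trans dvd_diff_sym)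
qed

lemma null_seq_partial_cong:
  fixes N :: nat
  assumes "null_seq f" "finite F" "{..<N} \<subseteq> F"
  shows "\<pi> ^ N dvd sum f F - sum f {..<N}"
proof -
  have "sum f F = sum f (F - {..<N}) + sum f {..<N}"
    using assms by (intro sum.subset_diff) auto
  moreover have "\<pi> ^ N dvd sum f (F - {..<N})"
    using assms(1) unfolding null_seq_def by (intro dvd_sum) (auto simp: not_less intro: power_le_dvd)
  ultimately show ?thesis by simp
qed

lemma has_adic_sumI:
  assumes "null_seq f" "\<And>N. \<pi> ^ N dvd S - sum f {..<N::nat}"
  shows "has_adic_sum \<pi> f S"
  unfolding has_adic_sum_def
proof (intro allI exI conjI impI)
  fix N :: nat and F' assume "finite F'" "{..<N} \<subseteq> F'"
  then show "\<pi> ^ N dvd S - sum f F'"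
    using null_seq_partial_cong[OF assms(1)] assms(2)[of N] by (blast intro: dvd_diff_trans dvd_diff_sym)
qed simp

lemma adic_sum_eqI:
  assumes "null_seq f" "\<And>N. \<pi> ^ N dvd S - sum f {..<N::nat}"
  shows "adic_sum \<pi> f = S"
  unfolding adic_sum_def using has_adic_sumI[OF assms] has_adic_sum_unique by blast

lemma adic_sum_cong:
  assumes "null_seq f"
  shows "\<pi> ^ N dvd adic_sum \<pi> f - sum f {..<N}"
proof -
  have "\<exists>l. \<forall>n. \<pi> ^ n dvd l - sum f {..<n}"
    using assms by (intro limit) (simp add: null_seq_def)
  then obtain S where S: "\<And>N. \<pi> ^ N dvd S - sum f {..<N}" by blast
  then show ?thesis using adic_sum_eqI[OF assms S] by simp
qed

lemma null_seq_power: "\<pi> dvd x \<Longrightarrow> null_seq (\<lambda>i. c i * x ^ i)"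
  unfolding null_seq_def by (simp add: dvd_mult dvd_power_same)

lemma null_seq_add: "null_seq f \<Longrightarrow> null_seq g \<Longrightarrow> null_seq (\<lambda>i. f i + g i)"
  by (simp add: null_seq_def)

lemma adic_sum_add:
  assumes "null_seq f" "null_seq g"
  shows "adic_sum \<pi> (\<lambda>i. f i + g i) = adic_sum \<pi> f + adic_sum \<pi> g"
proof (rule adic_sum_eqI[OF null_seq_add[OF assms]])
  fix N show "\<pi> ^ N dvd adic_sum \<pi> f + adic_sum \<pi> g - (\<Sum>i<N. f i + g i)"
    using dvd_add_diff[OF adic_sum_cong[OF assms(1)] adic_sum_cong[OF assms(2)]]
    by (simp add: sum.distrib)
qed

lemma null_seq_cauchy:
  assumes "null_seq f" "null_seq g"
  shows "null_seq (\<lambda>n. \<Sum>i\<le>n. f i * g (n - i))"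
  unfolding null_seq_def
proof (intro allI dvd_sum)
  fix n i :: nat assume "i \<in> {..n}"
  then have "\<pi> ^ n = \<pi> ^ i * \<pi> ^ (n - i)" by (simp flip: power_add)
  then show "\<pi> ^ n dvd f i * g (n - i)"
    using assms unfolding null_seq_def by (simp add: mult_dvd_mono)
qed

text \<open>The Cauchy product up to N covers the triangle i + j < N of the square of pairs; on the
  rest of the square \<pi>^(i+j), hence \<pi>^N, divides the term.\<close>

lemma adic_sum_mult:
  assumes "null_seq f" "null_seq g"
  shows "adic_sum \<pi> (\<lambda>n. \<Sum>i\<le>n. f i * g (n - i)) = adic_sum \<pi> f * adic_sum \<pi> g"
proof (rule adic_sum_eqI[OF null_seq_cauchy[OF assms]])
  fix N
  have 1: "\<pi> ^ N dvd adic_sum \<pi> f * adic_sum \<pi> g - sum f {..<N} * sum g {..<N}"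
    by (intro dvd_mult_diff adic_sum_cong assms)
  have "(\<Sum>n<N. \<Sum>i\<le>n. f i * g (n - i)) = (\<Sum>(i,j)\<in>{(i,j). i + j < N}. f i * g j)"
    by (rule sum.triangle_reindex[symmetric])
  moreover have "sum f {..<N} * sum g {..<N} = (\<Sum>(i,j)\<in>{..<N}\<times>{..<N}. f i * g j)"
    by (simp add: sum_product sum.cartesian_product)
  moreover have "\<dots> = (\<Sum>(i,j)\<in>{..<N}\<times>{..<N} - {(i,j). i + j < N}. f i * g j)
      + (\<Sum>(i,j)\<in>{(i,j). i + j < N}. f i * g j)"
    by (intro sum.subset_diff) auto
  moreover have "\<pi> ^ N dvd (\<Sum>(i,j)\<in>{..<N}\<times>{..<N} - {(i,j). i + j < N}. f i * g j)"
  proof (rule dvd_sum, clarsimp simp: not_less)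
    fix i j assume "N \<le> i + j"
    moreover have "\<pi> ^ (i + j) dvd f i * g j"
      using assms unfolding null_seq_def power_add by (simp add: mult_dvd_mono)
    ultimately show "\<pi> ^ N dvd f i * g j" using power_le_dvd by blast
  qed
  ultimately have "\<pi> ^ N dvd sum f {..<N} * sum g {..<N} - (\<Sum>n<N. \<Sum>i\<le>n. f i * g (n - i))"
    by simp
  with 1 show "\<pi> ^ N dvd adic_sum \<pi> f * adic_sum \<pi> g - (\<Sum>n<N. \<Sum>i\<le>n. f i * g (n - i))"
    by (rule dvd_diff_trans)
qed

lemma adic_sum_finite:
  assumes "\<And>i. i \<ge> n \<Longrightarrow> f i = 0" "null_seq f"
  shows "adic_sum \<pi> f = sum f {..<n}"
proof (rule adic_sum_eqI[OF assms(2)])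
  fix N

  have *: "sum f {..<max n N} = sum f {..<n}"
    using assms(1) by (intro sum.mono_neutral_right) auto
  show "\<pi> ^ N dvd sum f {..<n} - sum f {..<N}"
    using null_seq_partial_cong[OF assms(2), of "{..<max n N}" N] * by auto
qed

end

subsection \<open>Recognising complete discrete valuation rings\<close>

text \<open>Geometric series invert 1 - \<pi> x, so everything outside (\<pi>) is a unit because the
  quotient is a field. Separatedness then writes each nonzero element as a unit times a power of
  \<pi>, and integrality follows from \<pi> being a nonzerodivisor. Used for bilateral series, for
  k[[t]] and for B.\<close>

lemma cdvr_uniformizerI:
  fixes \<pi> :: "'a::comm_ring_1" and \<rho> :: "'a \<Rightarrow> 'c::field"
  assumes red: "reduction_map \<pi> \<rho>"
    and nzd: "\<And>x. \<pi> * x = 0 \<Longrightarrow> x = 0"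
    and sep: "\<And>x. (\<And>N. \<pi> ^ N dvd x) \<Longrightarrow> x = 0"
    and lim: "\<And>s. (\<And>n. \<pi> ^ n dvd s (Suc n) - s n) \<Longrightarrow> \<exists>l. \<forall>n. \<pi> ^ n dvd l - s n"
  shows "cdvr_uniformizer \<pi>"
proof -
  have hom: "\<rho> 1 = 1" "\<rho> (x * y) = \<rho> x * \<rho> y" "\<rho> x = 0 \<longleftrightarrow> \<pi> dvd x" for x y
    using red unfolding reduction_map_def ring_homo_def by auto
  have nzd': "x = 0" if "\<pi> ^ n * x = 0" for n x
    using that by (induction n) (auto dest: nzd simp: mult.assoc)
  have pi_unit: "1 - \<pi> * x dvd 1" for x
  proof -
    have "\<exists>l. \<forall>n. \<pi> ^ n dvd l - (\<Sum>i<n. (\<pi> * x) ^ i)"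
      by (rule lim) (simp add: power_mult_distrib)
    then obtain l where l: "\<And>n. \<pi> ^ n dvd l - (\<Sum>i<n. (\<pi> * x) ^ i)" by blast
    have "(1 - \<pi> * x) * l - 1 = 0"
    proof (rule sep)
      fix N
      have "(1 - \<pi> * x) * l - 1 = (1 - \<pi> * x) * (l - (\<Sum>i<N. (\<pi> * x) ^ i)) - \<pi> ^ N * x ^ N"
        using one_diff_power_eq[of "\<pi> * x" N] by (simp add: algebra_simps power_mult_distrib)
      then show "\<pi> ^ N dvd (1 - \<pi> * x) * l - 1" using l[of N] by simp
    qed
    then show ?thesis by (metis dvdI eq_iff_diff_eq_0)
  qed
  have unit: "x dvd 1" if x: "\<not> \<pi> dvd x" for x
  proof -
    obtain y where "\<rho> y = inverse (\<rho> x)"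
      using red unfolding reduction_map_def by (metis surj_def)
    moreover have "\<rho> x \<noteq> 0" using hom x by simp
    ultimately have "\<rho> (x * y) = \<rho> 1" using hom by simp
    then have "\<rho> (1 - x * y) = 0"
      using red unfolding reduction_map_def ring_homo_def
      by (metis add.commute add_diff_cancel_left' diff_add_cancel add_cancel_right_left)
    then obtain z where "1 - x * y = \<pi> * z" using hom by (metis dvdE)
    then have "x * y = 1 - \<pi> * z" by (simp add: algebra_simps)
    then have "x dvd 1 - \<pi> * z" by (metis dvdI)
    then show ?thesis using pi_unit dvd_trans by blast
  qed
  have decomp: "\<exists>u n. u dvd 1 \<and> x = u * \<pi> ^ n" if x: "x \<noteq> 0" for x
  proof -
    obtain N where "\<not> \<pi> ^ N dvd x" using sep x by blast
    then have "\<exists>n. \<pi> ^ n dvd x \<and> \<not> \<pi> ^ Suc n dvd x"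
      by (induction N) auto
    then obtain n u where u: "x = \<pi> ^ n * u" "\<not> \<pi> ^ Suc n dvd x" by (auto simp: dvd_def)
    have "\<not> \<pi> dvd u" using u by (auto simp: dvd_def mult_ac)
    then show ?thesis using unit u(1) by (metis mult.commute)
  qed
  have nonunit: "\<not> \<pi> dvd 1" using hom by (metis zero_neq_one)
  have dom: "x = 0 \<or> y = 0" if xy: "x * y = 0" for x y :: 'a
  proof (rule ccontr)
    assume "\<not> (x = 0 \<or> y = 0)"
    then obtain u m v n where u: "u dvd 1" "x = u * \<pi> ^ m" "v dvd 1" "y = v * \<pi> ^ n"
      using decomp by meson
    then obtain u' v' where "u * u' = 1" "v * v' = 1" by (metis dvdE)
    then have "\<pi> ^ (m + n) * 1 = (x * y) * (u' * v')"
      using u by (simp add: power_add) (metis mult.assoc mult.commute mult.right_neutral)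
    then have "(1::'a) = 0" using xy nzd' by (metis mult_zero_left)
    then show False by simp
  qed
  have "\<pi> \<noteq> 0" using nzd[of 1] by (metis mult_zero_left zero_neq_one)
  then show ?thesis
    unfolding cdvr_uniformizer_def using dom nonunit decomp lim by blast
qed

section \<open>Binomial roots\<close>

text \<open>The localisation of the integers at p: the rationals that make sense in every ring in
  which the integers prime to p are units.\<close>

definition p_integral :: "nat \<Rightarrow> rat \<Rightarrow> bool" where
  "p_integral p q \<longleftrightarrow> (\<exists>a b. coprime b (int p) \<and> q = of_int a / of_int b)"

lemma coprime_prime_nz: "prime p \<Longrightarrow> coprime b (int p) \<Longrightarrow> b \<noteq> 0"
  by (auto simp: prime_nat_iff)

lemma p_integral_of_int: "p_integral p (of_int a)"
  unfolding p_integral_def by (intro exI[of _ a] exI[of _ 1]) simp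

lemma p_integral_add:
  assumes "prime p" "p_integral p x" "p_integral p y"
  shows "p_integral p (x + y)"
proof -
  obtain a b c d where *: "coprime b (int p)" "x = of_int a / of_int b"
    "coprime d (int p)" "y = of_int c / of_int d"
    using assms unfolding p_integral_def by blast
  have "b \<noteq> 0" "d \<noteq> 0" using * coprime_prime_nz assms(1) by blast+
  then have "x + y = of_int (a * d + c * b) / of_int (b * d)"
    using * by (simp add: field_simps)
  moreover have "coprime (b * d) (int p)" using * by simp
  ultimately show ?thesis unfolding p_integral_def by blast
qed

lemma p_integral_mult:
  assumes "p_integral p x" "p_integral p y"
  shows "p_integral p (x * y)"
proof -
  obtain a b c d where *: "coprime b (int p)" "x = of_int a / of_int b"
    "coprime d (int p)" "y = of_int c / of_int d"
    using assms unfolding p_integral_def by blast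
  then have "x * y = of_int (a * c) / of_int (b * d)" by simp
  moreover have "coprime (b * d) (int p)" using * by simp
  ultimately show ?thesis unfolding p_integral_def by blast
qed

text \<open>Let a = r/m and let p^e be the power of p in k!. Choose a natural number A with m A
  congruent to r modulo p^e. Then m^k a(a-1)...(a-k+1) is congruent modulo p^e to m^k
  A(A-1)...(A-k+1), a multiple of k!, so p^e cancels from the denominator.\<close>

lemma p_integral_gbinomial:
  assumes p: "prime p" and a: "p_integral p a"
  shows "p_integral p (a gchoose k)"
proof -
  obtain r m where m: "coprime m (int p)" "a = of_int r / of_int m"
    using a unfolding p_integral_def by blast
  have m0: "m \<noteq> 0" using m p coprime_prime_nz by blast
  have pi: "prime (int p)" using p by simp
  obtain c e where c: "(fact k :: int) = int p ^ e * c" "\<not> int p dvd c"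
    using multiplicity_decompose'[of "fact k :: int" "int p"] pi
    by (metis fact_nonzero not_prime_unit)
  have cop: "coprime c (int p)" using prime_imp_coprime[OF pi c(2)] by (simp add: coprime_commute)
  have "coprime m (int p ^ e)" using m(1) by simp
  then obtain A0 where "[m * A0 = 1] (mod int p ^ e)" using cong_solve_coprime_int by blast
  then have "[m * A0 * r = 1 * r] (mod int p ^ e)" by (rule cong_mult) simp
  then have "[m * (A0 * r mod int p ^ e) = r] (mod int p ^ e)"
    by (simp add: cong_def mod_mult_right_eq mult.assoc)
  moreover define A where "A = nat (A0 * r mod int p ^ e)"
  moreover have "int A = A0 * r mod int p ^ e" using p by (simp add: A_def prime_gt_0_nat)
  ultimately have A: "int p ^ e dvd r - m * int A"
    by (metis cong_iff_dvd_diff cong_sym)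
  define P where "P = (\<Prod>i<k. r - int i * m)"
  define Q where "Q = (\<Prod>i<k. m * (int A - int i))"
  have "int p ^ e dvd P - Q"
    unfolding P_def Q_def by (rule dvd_prod_diff) (use A in \<open>auto simp: algebra_simps\<close>)
  moreover have "int p ^ e dvd Q"
  proof -
    have "of_int (\<Prod>i<k. int A - int i) = (of_nat A gchoose k) * (fact k :: rat)"
      by (simp add: gbinomial_prod_rev atLeast0LessThan)
    also have "\<dots> = of_int (int (A choose k) * fact k)" by (simp add: binomial_gbinomial)
    finally have "(\<Prod>i<k. int A - int i) = int (A choose k) * fact k" by (simp only: of_int_eq_iff)
    moreover have "int p ^ e dvd fact k" unfolding c(1) by simp
    ultimately show ?thesis unfolding Q_def prod.distrib by (simp add: dvd_mult)
  qed
  ultimately have "int p ^ e dvd (P - Q) + Q" by (rule dvd_add)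
  then have "int p ^ e dvd P" by simp
  then obtain P' where P': "P = int p ^ e * P'" by (metis dvdE)
  have "of_int P = (\<Prod>i<k. of_int m * (a - of_nat i))"
    using m0 by (simp add: P_def m(2) algebra_simps)
  also have "\<dots> = of_int m ^ k * (a gchoose k) * fact k"
    by (simp add: prod.distrib gbinomial_prod_rev atLeast0LessThan)
  also have "fact k = (of_int (fact k) :: rat)" by simp
  finally have "(of_int P :: rat) = of_int m ^ k * (a gchoose k) * (of_nat p ^ e * of_int c)"
    unfolding c(1) by simp
  moreover have "c \<noteq> 0" using c(2) by auto
  ultimately have "a gchoose k = of_int P' / of_int (m ^ k * c)"
    using m0 p by (simp add: P' field_simps prime_gt_0_nat)
  moreover have "coprime (m ^ k * c) (int p)" using m(1) cop by simp
  ultimately show ?thesis unfolding p_integral_def by blast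
qed

section \<open>Inverses and integer powers of units\<close>

context cdvr
begin

definition recip :: "'a \<Rightarrow> 'a" where "recip x = exact_div 1 x"

lemma recip: "x dvd 1 \<Longrightarrow> x * recip x = 1"
proof -
  assume x: "x dvd 1"
  then obtain y where y: "x * y = 1" by (metis dvdE)
  have "recip x = y" unfolding recip_def by (rule exact_div[OF unit_nz[OF x] y])
  then show ?thesis using y by simp
qed

lemma recip': "x dvd 1 \<Longrightarrow> recip x * x = 1"
  using recip by (simp add: mult.commute)

lemma recip_unique: "x * y = 1 \<Longrightarrow> recip x = y"
proof -
  assume xy: "x * y = 1"
  then have "x \<noteq> 0" by auto
  then show ?thesis unfolding recip_def using exact_div xy by blast
qed

lemma recip_unit: "x dvd 1 \<Longrightarrow> recip x dvd 1"
  using recip' by (metis dvdI)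

lemma recip_mult: "x dvd 1 \<Longrightarrow> y dvd 1 \<Longrightarrow> recip (x * y) = recip x * recip y"
  by (rule recip_unique) (metis recip mult.assoc mult.commute mult_1)

lemma unit_powi_nonneg: "0 \<le> m \<Longrightarrow> unit_powi z m = z ^ nat m"
  and unit_powi_neg: "m < 0 \<Longrightarrow> unit_powi z m = recip z ^ nat (- m)"
  by (auto simp: unit_powi_def recip_def)

lemma unit_powi_unit: "z dvd 1 \<Longrightarrow> unit_powi z m dvd (1::'a)"
  using unit_power[of z] unit_power[OF recip_unit, of z] by (simp add: unit_powi_def flip: recip_def)

lemma unit_powi_mult:
  "x dvd 1 \<Longrightarrow> y dvd (1::'a) \<Longrightarrow> unit_powi (x * y) m = unit_powi x m * unit_powi y m"
  using recip_mult[of x y] by (simp add: unit_powi_def power_mult_distrib flip: recip_def)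

lemma recip_recip: "x dvd 1 \<Longrightarrow> recip (recip x) = x"
  by (rule recip_unique) (rule recip')

lemma recip_power: "x dvd 1 \<Longrightarrow> recip (x ^ n) = recip x ^ n"
  by (rule recip_unique) (metis recip power_mult_distrib power_one)

lemma unit_powi_minus: 
  assumes "z dvd 1" shows "unit_powi z (- m) = recip (unit_powi z m)"
proof -
  consider "m = 0" | "m > 0" | "m < 0" by linarith
  then show ?thesis
  proof cases
    case 1 then show ?thesis by (simp add: unit_powi_nonneg recip_unique)
  qed (use assms in \<open>simp_all add: unit_powi_nonneg unit_powi_neg recip_power recip_recip recip_unit\<close>)
qed

lemma unit_powi_eq_imp_eq:
  assumes "unit_powi x m = unit_powi y m" "\<pi> dvd x - y" "x dvd 1" "y dvd 1"
    "\<not> \<pi> dvd of_nat (nat \<bar>m\<bar>)"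
  shows "x = y"
proof (cases "0 \<le> m")
  case True
  then show ?thesis using power_eq_imp_eq[of x "nat \<bar>m\<bar>" y] assms by (simp add: unit_powi_nonneg)
next
  case False
  then have "recip x ^ nat \<bar>m\<bar> = recip y ^ nat \<bar>m\<bar>" using assms by (simp add: unit_powi_neg)
  then have "recip (recip x ^ nat \<bar>m\<bar>) = recip (recip y ^ nat \<bar>m\<bar>)" by simp
  then have "x ^ nat \<bar>m\<bar> = y ^ nat \<bar>m\<bar>" using assms by (simp add: recip_power recip_recip recip_unit)
  then show ?thesis using power_eq_imp_eq assms by blast
qed

end

section \<open>p-integral rationals in the ring and the binomial series\<close>

locale cdvr_p = cdvr \<pi> for \<pi> :: "'a::comm_ring_1" +
  fixes p :: nat
  assumes prime_p: "prime p" and pi_dvd_p: "\<pi> dvd of_nat p"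
begin

text \<open>A Bezout relation between p and b would put 1 into the ideal (\<pi>).\<close>

lemma pi_dvd_of_int: "\<pi> dvd of_int b \<longleftrightarrow> int p dvd b"
proof
  assume d: "\<pi> dvd of_int b"
  show "int p dvd b"
  proof (rule ccontr)
    assume "\<not> int p dvd b"
    then have "coprime (int p) b" using prime_p by (simp add: prime_imp_coprime)
    then have "gcd (int p) b = 1" by simp
    then obtain u v where "u * int p + v * b = 1" using bezout_int by metis
    then have "(of_int u * of_nat p + of_int v * of_int b :: 'a) = 1"
      by (metis of_int_add of_int_mult of_int_of_nat_eq of_int_1)
    then show False using d pi_dvd_p pi_nonunit by (metis dvd_add dvd_mult)
  qed
next
  assume "int p dvd b"
  then show "\<pi> dvd of_int b" using pi_dvd_p by (auto elim!: dvdE)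
qed

lemma pi_dvd_of_nat: "\<pi> dvd of_nat b \<longleftrightarrow> p dvd b"
  using pi_dvd_of_int[of "int b"] by simp

lemma of_int_unit: "coprime b (int p) \<Longrightarrow> (of_int b :: 'a) dvd 1"
  unfolding unit_iff pi_dvd_of_int using prime_p
  by (metis coprime_absorb_right not_prime_unit prime_nat_int_transfer)

text \<open>The definition goes through the reduced fraction; any other fraction with denominator
  prime to p gives the same value, since the reduced denominator divides that denominator.\<close>

lemma of_rat_elem_eqI:
  assumes "q = of_int a / of_int b" "coprime b (int p)" "of_int b * c = (of_int a :: 'a)"
  shows "of_rat_elem q = c"
proof -
  obtain a' b' where q: "quotient_of q = (a', b')" by fastforce
  have b0: "b \<noteq> 0" "b' > 0" using assms(2) coprime_prime_nz prime_p quotient_of_denom_pos[OF q] by auto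
  have "of_int a' / of_int b' = (of_int a / of_int b :: rat)"
    using quotient_of_div[OF q] assms(1) by simp
  then have "of_int (a' * b) = (of_int (a * b') :: rat)" using b0 by (simp add: field_simps)
  then have ab: "a' * b = a * b'" by (simp only: of_int_eq_iff)
  have "coprime a' b'" using quotient_of_coprime[OF q] .
  then have "b' dvd b" using ab by (metis coprime_commute coprime_dvd_mult_right_iff dvd_triv_right)
  then have cb': "coprime b' (int p)" using coprime_divisors[OF _ dvd_refl assms(2)] by simp
  have "of_int b * (of_int b' * c) = of_int b * (of_int a' :: 'a)"
    using assms(3) ab by (metis mult.assoc mult.commute of_int_mult)
  then have "of_int b' * c = of_int a'" using mult_cancel of_int_unit[OF assms(2)] unit_nz by blast
  then show ?thesis
    unfolding of_rat_elem_def q using exact_div[OF unit_nz[OF of_int_unit[OF cb']], of c "of_int a'"] by simp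
qed

lemma of_rat_elem_ex:
  assumes "p_integral p q"
  obtains a b where "coprime b (int p)" "q = of_int a / of_int b"
    "of_int b * of_rat_elem q = (of_int a :: 'a)"
proof -
  obtain a b where ab: "coprime b (int p)" "q = of_int a / of_int b"
    using assms unfolding p_integral_def by blast
  have "of_int b * (recip (of_int b) * of_int a) = (of_int a :: 'a)"
    using recip[OF of_int_unit[OF ab(1)]] by (metis mult.assoc mult_1)
  then show ?thesis using that ab of_rat_elem_eqI[OF ab(2,1)] by metis
qed

lemma of_rat_elem_add:
  assumes "p_integral p x" "p_integral p y"
  shows "of_rat_elem (x + y) = (of_rat_elem x + of_rat_elem y :: 'a)"
proof -
  obtain a b where 1: "coprime b (int p)" "x = of_int a / of_int b"
    "of_int b * of_rat_elem x = (of_int a :: 'a)" using of_rat_elem_ex assms by blast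
  obtain c d where 2: "coprime d (int p)" "y = of_int c / of_int d"
    "of_int d * of_rat_elem y = (of_int c :: 'a)" using of_rat_elem_ex assms by blast
  have "b \<noteq> 0" "d \<noteq> 0" using 1 2 coprime_prime_nz prime_p by blast+
  then have "x + y = of_int (a * d + c * b) / of_int (b * d)" using 1 2 by (simp add: field_simps)
  moreover have "of_int (b * d) * (of_rat_elem x + of_rat_elem y) =
      (of_int b * of_rat_elem x) * of_int d + (of_int d * of_rat_elem y) * (of_int b :: 'a)"
    by (simp add: algebra_simps)
  then have "of_int (b * d) * (of_rat_elem x + of_rat_elem y) = (of_int (a * d + c * b) :: 'a)"
    unfolding 1(3) 2(3) by simp
  ultimately show ?thesis by (intro of_rat_elem_eqI[of _ "a * d + c * b" "b * d"]) (use 1(1) 2(1) in auto)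
qed

lemma of_rat_elem_mult:
  assumes "p_integral p x" "p_integral p y"
  shows "of_rat_elem (x * y) = (of_rat_elem x * of_rat_elem y :: 'a)"
proof -
  obtain a b where 1: "coprime b (int p)" "x = of_int a / of_int b"
    "of_int b * of_rat_elem x = (of_int a :: 'a)" using of_rat_elem_ex assms by blast
  obtain c d where 2: "coprime d (int p)" "y = of_int c / of_int d"
    "of_int d * of_rat_elem y = (of_int c :: 'a)" using of_rat_elem_ex assms by blast
  have "x * y = of_int (a * c) / of_int (b * d)" using 1(2) 2(2) by simp
  moreover have "of_int (b * d) * (of_rat_elem x * of_rat_elem y) =
      (of_int b * of_rat_elem x) * (of_int d * (of_rat_elem y :: 'a))"
    by (simp add: algebra_simps)
  then have "of_int (b * d) * (of_rat_elem x * of_rat_elem y) = (of_int (a * c) :: 'a)"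
    unfolding 1(3) 2(3) by simp
  ultimately show ?thesis by (intro of_rat_elem_eqI[of _ "a * c" "b * d"]) (use 1(1) 2(1) in auto)
qed

lemma of_rat_elem_of_int: "of_rat_elem (of_int a) = (of_int a :: 'a)"
  by (rule of_rat_elem_eqI[of _ a 1]) auto

lemma of_rat_elem_sum:
  assumes "\<And>i. i \<in> S \<Longrightarrow> p_integral p (f i)"
  shows "p_integral p (sum f S) \<and> of_rat_elem (sum f S) = (\<Sum>i\<in>S. of_rat_elem (f i) :: 'a)"
  using assms
proof (induction S rule: infinite_finite_induct)
  case (insert i S)
  then show ?case using p_integral_add prime_p of_rat_elem_add by simp
qed (use p_integral_of_int[of p 0] of_rat_elem_of_int[of 0] in simp_all)

definition binom_series :: "rat \<Rightarrow> 'a \<Rightarrow> 'a" where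
  "binom_series a x = adic_sum \<pi> (\<lambda>i. of_rat_elem (a gchoose i) * x ^ i)"

text \<open>Vandermonde's identity says that the Cauchy product of the two series is the series for
  a + b; p-integrality lets it be carried from the rationals into the ring.\<close>

lemma binom_series_add:
  assumes x: "\<pi> dvd x" and a: "p_integral p a" and b: "p_integral p b"
  shows "binom_series (a + b) x = binom_series a x * binom_series b x"
proof -
  have "(\<Sum>i\<le>n. (of_rat_elem (a gchoose i) * x ^ i) * (of_rat_elem (b gchoose (n - i)) * x ^ (n - i)))
      = of_rat_elem ((a + b) gchoose n) * x ^ n" for n
  proof -
    have "of_rat_elem ((a + b) gchoose n) =
        (\<Sum>i\<le>n. of_rat_elem ((a gchoose i) * (b gchoose (n - i))) :: 'a)"
      unfolding gbinomial_Vandermonde[symmetric] atMost_atLeast0[symmetric]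
      by (rule conjunct2[OF of_rat_elem_sum]) (simp add: p_integral_gbinomial p_integral_mult prime_p a b)
    also have "\<dots> = (\<Sum>i\<le>n. of_rat_elem (a gchoose i) * of_rat_elem (b gchoose (n - i)))"
      by (simp add: of_rat_elem_mult p_integral_gbinomial prime_p a b)
    finally have eq: "of_rat_elem ((a + b) gchoose n) =
       (\<Sum>i\<le>n. of_rat_elem (a gchoose i) * of_rat_elem (b gchoose (n - i)) :: 'a)" .
    show ?thesis unfolding eq sum_distrib_right
    proof (rule sum.cong[OF refl])
      fix i assume "i \<in> {..n}"
      then have "x ^ n = x ^ i * x ^ (n - i)" by (simp flip: power_add)
      then show "(of_rat_elem (a gchoose i) * x ^ i) * (of_rat_elem (b gchoose (n - i)) * x ^ (n - i)) =
          of_rat_elem (a gchoose i) * of_rat_elem (b gchoose (n - i)) * x ^ n"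
        by (simp add: mult_ac)
    qed
  qed
  then show ?thesis
    unfolding binom_series_def adic_sum_mult[OF null_seq_power[OF x] null_seq_power[OF x], symmetric]
    by (intro arg_cong[of _ _ "adic_sum \<pi>"] ext) simp
qed

lemma binom_series_0: "\<pi> dvd x \<Longrightarrow> binom_series 0 x = 1"
  unfolding binom_series_def using null_seq_power
  by (subst adic_sum_finite[of 1]) (auto simp: gbinomial_0 of_rat_elem_of_int[of 0, simplified]
      of_rat_elem_of_int[of 1, simplified] gr0_conv_Suc Suc_le_eq)

lemma binom_series_1: "\<pi> dvd x \<Longrightarrow> binom_series 1 x = 1 + x"
proof -
  have "(1::rat) gchoose i = of_nat (1 choose i)" for i
    by (metis binomial_gbinomial of_nat_1)
  then have "(1::rat) gchoose 0 = 1" "(1::rat) gchoose 1 = 1" "i \<ge> 2 \<Longrightarrow> (1::rat) gchoose i = 0" for i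
    by (simp_all add: binomial_eq_0)
  then show "\<pi> dvd x \<Longrightarrow> binom_series 1 x = 1 + x"
    unfolding binom_series_def using null_seq_power
    by (subst adic_sum_finite[of 2]) (auto simp: of_rat_elem_of_int[of 0, simplified]
      of_rat_elem_of_int[of 1, simplified] numeral_2_eq_2 gbinomial_1)
qed

lemma binom_series_mult:
  assumes "\<pi> dvd x" "p_integral p a"
  shows "binom_series (of_nat n * a) x = binom_series a x ^ n"
proof (induction n)
  case (Suc n)
  have "p_integral p (of_nat n * a)"
    using p_integral_mult[OF p_integral_of_int[of p "int n"] assms(2)] by simp
  then have "binom_series (a + of_nat n * a) x = binom_series a x * binom_series (of_nat n * a) x"
    using assms binom_series_add by blast
  then show ?case using Suc by (simp add: algebra_simps)
qed (simp add: assms binom_series_0)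

lemma binom_root_cong: 
  assumes "\<pi> dvd x"
  shows "\<pi> dvd binom_root \<pi> m x - 1"
  using adic_sum_cong[OF null_seq_power[OF assms], of 1 "\<lambda>i. of_rat_elem ((1 / of_int m) gchoose i)"]
  unfolding binom_root_def by (simp add: of_rat_elem_of_int[of 1, simplified])

lemma unit_of_cong_1: "\<pi> dvd x - 1 \<Longrightarrow> x dvd 1"
proof -
  assume *: "\<pi> dvd x - 1"
  have "\<not> \<pi> dvd x" using dvd_diff[of \<pi> x "x - 1"] * pi_nonunit by auto
  then show ?thesis using unit_iff by blast
qed

text \<open>For m > 0 the exponents 1/m add up to 1. For m < 0 they add up to -1 after -m factors,
  and that power is the inverse of 1 + x.\<close>

lemma unit_powi_binom_root:
  assumes x: "\<pi> dvd x" and m: "coprime m (int p)"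
  shows "unit_powi (binom_root \<pi> m x) m = 1 + x"
proof -
  have m0: "m \<noteq> 0" using coprime_prime_nz[OF prime_p m] .
  have int: "p_integral p (1 / of_int m)"
    unfolding p_integral_def using m by (intro exI[of _ 1] exI[of _ m]) simp
  define S where "S = binom_root \<pi> m x"
  have S: "S = binom_series (1 / of_int m) x" by (simp add: S_def binom_root_def binom_series_def)
  have SN: "S ^ n = binom_series (of_nat n / of_int m) x" for n
    unfolding S using binom_series_mult[OF x int, of n] by simp
  show ?thesis
  proof (cases "m > 0")
    case True
    then have "S ^ nat m = binom_series 1 x" unfolding SN by simp
    then show ?thesis using True binom_series_1[OF x] by (simp add: unit_powi_nonneg S_def)
  next
    case False
    then have "S ^ nat (- m) = binom_series (- 1) x" unfolding SN using m0 by simp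
    moreover have "binom_series (- 1 + 1) x = binom_series (- 1) x * binom_series 1 x"
      by (rule binom_series_add[OF x]) (use p_integral_of_int[of p "- 1"] p_integral_of_int[of p 1] in simp_all)
    ultimately have "S ^ nat (- m) * (1 + x) = 1" using x by (simp add: binom_series_1 binom_series_0)
    moreover have "S dvd 1" using binom_root_cong[OF x] unit_of_cong_1 S_def by blast
    ultimately have "recip S ^ nat (- m) = 1 + x"
      using recip_unique recip_power by metis
    then show ?thesis using False m0 by (simp add: unit_powi_neg S_def)
  qed
qed

text \<open>Hensel's lemma for m-th roots: y is Z0^m (1 + x) with \<pi> dividing x, and the binomial
  root of 1 + x corrects Z0.\<close>

lemma unit_powi_root_exists:
  assumes y: "y dvd 1" and Z0: "Z0 dvd 1" and m: "coprime m (int p)"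
    and cong: "\<pi> dvd y - unit_powi Z0 m"
  shows "\<exists>Z. Z dvd 1 \<and> unit_powi Z m = y \<and> \<pi> dvd Z - Z0"
proof -
  define v where "v = recip (unit_powi Z0 m)"
  have v: "unit_powi Z0 m * v = 1" unfolding v_def by (intro recip unit_powi_unit Z0)
  define x where "x = v * (y - unit_powi Z0 m)"
  have x: "\<pi> dvd x" using cong by (simp add: x_def)
  have "unit_powi Z0 m * (1 + x) = unit_powi Z0 m + (unit_powi Z0 m * v) * (y - unit_powi Z0 m)"
    by (simp add: x_def algebra_simps)
  then have y: "y = unit_powi Z0 m * (1 + x)" unfolding v by simp
  define b where "b = binom_root \<pi> m x"
  have b: "\<pi> dvd b - 1" "b dvd 1" using binom_root_cong[OF x] unit_of_cong_1 b_def by blast+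
  have "unit_powi (Z0 * b) m = y"
    using unit_powi_mult[OF Z0 b(2)] unit_powi_binom_root[OF x m] y by (simp add: b_def)
  moreover have "Z0 * b - Z0 = Z0 * (b - 1)" by (simp add: algebra_simps)
  then have "\<pi> dvd Z0 * b - Z0" using b by simp
  ultimately show ?thesis using unit_mult[OF Z0 b(2)] by blast
qed

lemma unit_powi_inject:
  assumes "unit_powi x m = unit_powi y m" "\<pi> dvd x - y" "x dvd 1" "y dvd 1" "coprime m (int p)"
  shows "x = y"
proof (rule unit_powi_eq_imp_eq[OF assms(1-4)])
  have "\<not> int p dvd m" using assms(5) prime_p
    by (metis coprime_absorb_right not_prime_unit prime_nat_int_transfer)
  then show "\<not> \<pi> dvd of_nat (nat \<bar>m\<bar>)" unfolding pi_dvd_of_nat by (simp add: int_dvd_int_iff[symmetric])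
qed

end

section \<open>The ring of bilateral series\<close>

lemma bl_eqI: "(\<And>i. bl_nth f i = bl_nth g i) \<Longrightarrow> f = g"
  using bl_nth_inject by blast

lemma bl_nth_null: "null_at_minus_inf (bl_nth f)"
  using bl_nth[of f] by simp

lemmas bl_nth_simps [simp] = zero_bilaurent.rep_eq plus_bilaurent.rep_eq minus_bilaurent.rep_eq
  uminus_bilaurent.rep_eq bl_const.rep_eq bl_T.rep_eq one_bilaurent.rep_eq

lemma cauchy_prod_single:
  assumes "null_at_minus_inf (f :: int \<Rightarrow> 'r::complete_dvr)"
  shows "cauchy_prod (\<lambda>i. if i = k then c else 0) f n = c * f (n - k)"
  unfolding cauchy_prod_def
proof (rule adic_sum_eqI, unfold has_adic_sum_def, intro allI exI conjI impI)
  fix N and F' :: "int set"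
  assume F': "finite F'" "{k} \<subseteq> F'"
  have "(\<Sum>i\<in>F'. (if i = k then c else 0) * f (n - i)) = (\<Sum>i\<in>{k}. (if i = k then c else 0) * f (n - i))"
    using F' by (intro sum.mono_neutral_right) auto
  then show "unif ^ N dvd c * f (n - k) - (\<Sum>i\<in>F'. (if i = k then c else 0) * f (n - i))" by simp
qed simp

lemma bl_nth_const_mult: "bl_nth (bl_const c * f) n = c * bl_nth f n"
  unfolding times_bilaurent.rep_eq bl_const.rep_eq
  using cauchy_prod_single[OF bl_nth_null, of 0 c f n] by simp

lemma bl_const_hom:
  "bl_const 1 = 1" "bl_const 0 = 0"
  "bl_const (a + b) = bl_const a + bl_const b"
  "bl_const (a - b) = bl_const a - bl_const b"
  "bl_const (- a) = - bl_const a"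
  "bl_const (a * b) = bl_const a * bl_const b"
  by (rule bl_eqI; simp add: bl_nth_const_mult)+

lemma bl_const_power: "bl_const (a ^ n) = bl_const a ^ n"
  by (induction n) (simp_all add: bl_const_hom)

lemma bl_const_homo: "ring_homo bl_const"
  by (simp add: ring_homo_def bl_const_hom)

subsection \<open>Reduction and completeness\<close>

locale residue_dvr =
  fixes \<pi> :: "'r::complete_dvr" and red :: "'r \<Rightarrow> 'k::field"
  assumes unif_pi: "cdvr_uniformizer \<pi>" and red: "reduction_map \<pi> red"
begin

sublocale R: cdvr \<pi> by standard (rule unif_pi)

text \<open>The series ring is built with an arbitrarily chosen uniformizer. A nonunit is divisible
  by either uniformizer, so each divides the other.\<close>

lemma unif_dvd_iff: "unif ^ N dvd x \<longleftrightarrow> \<pi> ^ N dvd x"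
proof -
  interpret U: cdvr "unif :: 'r" by standard (rule unif)
  have "unif dvd \<pi>" using U.unit_iff R.pi_nonunit by (metis R.unit_iff dvd_refl)
  moreover have "\<pi> dvd unif" using R.unit_iff U.pi_nonunit by (metis U.unit_iff dvd_refl)
  ultimately show ?thesis by (meson dvd_power_same dvd_trans)
qed

lemma red_hom [simp]: "red 1 = 1" "red (x + y) = red x + red y" "red (x * y) = red x * red y"
  and red_eq_0_iff: "red x = 0 \<longleftrightarrow> \<pi> dvd x" and red_surj: "surj red"
  using red unfolding reduction_map_def ring_homo_def by auto

lemma red_0 [simp]: "red 0 = 0"
  by (simp add: red_eq_0_iff)

lemma red_minus [simp]: "red (- x) = - red x"
  using red_hom(2)[of x "- x"] by (simp add: eq_neg_iff_add_eq_0 add.commute)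

lemma red_diff [simp]: "red (x - y) = red x - red y"
  using red_hom(2)[of x "- y"] by simp

lemma red_sum [simp]: "red (sum f S) = (\<Sum>i\<in>S. red (f i))"
  by (induction S rule: infinite_finite_induct) auto

lemma red_eq_iff: "red x = red y \<longleftrightarrow> \<pi> dvd x - y"
  using red_eq_0_iff[of "x - y"] by simp

lemma red_power [simp]: "red (x ^ n) = red x ^ n"
  by (induction n) auto

lemma vanish_iff: "vanish N a f \<longleftrightarrow> (\<forall>i<a. \<pi> ^ N dvd f i)"
  by (simp add: vanish_def unif_dvd_iff)

lemma bl_vanish: "\<exists>a. vanish N a (bl_nth f)"
  using bl_nth_null[of f] unfolding null_iff by blast

lemma bl_nth_mult_cong:
  assumes "vanish N a (bl_nth f)" "vanish N b (bl_nth g)"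
  shows "\<pi> ^ N dvd bl_nth (f * g) n - (trunc a (bl_nth f) * trunc b (bl_nth g)) $$ n"
  using cauchy_prod_cong[OF bl_nth_null bl_nth_null assms]
  by (simp add: times_bilaurent.rep_eq unif_dvd_iff)

lemma bl_dvd_iff: "bl_const \<pi> ^ N dvd f \<longleftrightarrow> (\<forall>i. \<pi> ^ N dvd bl_nth f i)"
proof
  assume "bl_const \<pi> ^ N dvd f"
  then obtain g where "f = bl_const (\<pi> ^ N) * g" unfolding bl_const_power[symmetric] by (metis dvdE)
  then show "\<forall>i. \<pi> ^ N dvd bl_nth f i" by (simp add: bl_nth_const_mult)
next
  assume "\<forall>i. \<pi> ^ N dvd bl_nth f i"
  then have "\<forall>i. \<exists>c. bl_nth f i = \<pi> ^ N * c" by (simp add: dvd_def)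
  then obtain g where g: "\<And>i. bl_nth f i = \<pi> ^ N * g i" by metis
  have "null_at_minus_inf g"
    unfolding null_iff
  proof
    fix M
    \<comment> \<open>Dividing by \<pi>^N costs N in the decay, so the bound for the quotient modulo
      \<pi>^M is taken from f modulo \<pi>^(N+M).\<close>
    obtain a where "vanish (N + M) a (bl_nth f)" using bl_vanish by blast
    then have "vanish M a g"
      by (simp add: vanish_iff g power_add R.pi_nz)
    then show "\<exists>a. vanish M a g" ..
  qed
  then have "f = bl_const (\<pi> ^ N) * Abs_bilaurent g"
    by (intro bl_eqI) (simp add: bl_nth_const_mult Abs_bilaurent_inverse g)
  then show "bl_const \<pi> ^ N dvd f" unfolding bl_const_power by simp
qed

lemma bl_nth_reduce [simp]: "bl_reduce red f $$ i = red (bl_nth f i)"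
proof -
  obtain a where "vanish 1 a (bl_nth f)" using bl_vanish by blast
  then have "red (bl_nth f i) = 0" if "i < a" for i
    using that by (simp add: vanish_iff red_eq_0_iff)
  then show ?thesis
    unfolding bl_reduce_def by (intro nth_Abs_fls_lower_bound[of a]) auto
qed

lemma bl_reduce_add: "bl_reduce red (f + g) = bl_reduce red f + bl_reduce red g"
  by (rule fls_eqI) simp

lemma bl_reduce_mult: "bl_reduce red (f * g) = bl_reduce red f * bl_reduce red g"
proof (rule fls_eqI)
  fix n
  obtain a b where ab: "vanish 1 a (bl_nth f)" "vanish 1 b (bl_nth g)" using bl_vanish by metis
  then have 0: "red (bl_nth f i) = 0" if "i < a" for i
    using that by (simp add: vanish_iff red_eq_0_iff)
  have 1: "red (bl_nth g i) = 0" if "i < b" for i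
    using that ab by (simp add: vanish_iff red_eq_0_iff)
  have "red (bl_nth (f * g) n) = red ((trunc a (bl_nth f) * trunc b (bl_nth g)) $$ n)"
    using bl_nth_mult_cong[OF ab] red_eq_iff by simp
  also have "(trunc a (bl_nth f) * trunc b (bl_nth g)) $$ n =
      (\<Sum>i=a..n-b. trunc a (bl_nth f) $$ i * trunc b (bl_nth g) $$ (n - i))"
    by (rule fls_times_nth_bounds) auto
  also have "red \<dots> = (\<Sum>i=a..n-b. bl_reduce red f $$ i * bl_reduce red g $$ (n - i))"
    unfolding red_sum by (rule sum.cong) auto
  also have "\<dots> = (bl_reduce red f * bl_reduce red g) $$ n"
    by (rule fls_times_nth_bounds[symmetric]) (simp_all add: 0 1)
  finally show "bl_reduce red (f * g) $$ n = (bl_reduce red f * bl_reduce red g) $$ n" by simp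
qed

lemma bl_reduce_const: "bl_reduce red (bl_const c) = fls_const (red c)"
  by (rule fls_eqI) simp

lemma bl_reduce_T: "bl_reduce red bl_T = fls_X"
  by (rule fls_eqI) simp

lemma bl_reduce_1: "bl_reduce red 1 = 1"
  by (rule fls_eqI) simp

lemma bl_reduce_eq_0_iff: "bl_reduce red f = 0 \<longleftrightarrow> bl_const \<pi> dvd f"
  using bl_dvd_iff[of 1 f] by (auto simp: fls_eq_iff red_eq_0_iff)

text \<open>Coefficients are lifted with 0 going to 0, so that vanishing below a is exact and not
  merely modulo \<pi>. This later produces a genuine power series without constant term.\<close>

lemma bl_lift_exists: 
  assumes "\<And>i. i < a \<Longrightarrow> g $$ i = 0"
  shows "\<exists>f. bl_reduce red f = g \<and> (\<forall>i<a. bl_nth f i = 0)"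
proof -
  have "\<exists>x. red x = c \<and> (c = 0 \<longrightarrow> x = 0)" for c
    using red_surj red_0 by (metis surj_def)
  then obtain l where l: "\<And>c. red (l c) = c" "l 0 = 0" by metis
  have "null_at_minus_inf (\<lambda>i. l (g $$ i))"
    unfolding null_at_minus_inf_def using assms l by (intro allI exI[of _ a]) auto
  then have "bl_nth (Abs_bilaurent (\<lambda>i. l (g $$ i))) = (\<lambda>i. l (g $$ i))"
    by (simp add: Abs_bilaurent_inverse)
  then show ?thesis
    using assms l by (intro exI[of _ "Abs_bilaurent (\<lambda>i. l (g $$ i))"]) (auto intro: fls_eqI)
qed

lemma bl_reduction_map: "reduction_map (bl_const \<pi>) (bl_reduce red)"
  unfolding reduction_map_def ring_homo_def surj_def
  using bl_reduce_1 bl_reduce_add bl_reduce_mult bl_reduce_eq_0_iff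
    bl_lift_exists[OF fls_eq0_below_subdegree] by metis

lemma bl_cdvr_uniformizer: "cdvr_uniformizer (bl_const \<pi>)"
proof (rule cdvr_uniformizerI[OF bl_reduction_map])
  fix x :: "'r bilaurent" assume "bl_const \<pi> * x = 0"
  then have "\<pi> * bl_nth x i = 0" for i
    by (metis bl_nth_const_mult zero_bilaurent.rep_eq)
  then show "x = 0" using R.mult_eq_0 R.pi_nz by (intro bl_eqI) auto
next
  fix x :: "'r bilaurent" assume "\<And>N. bl_const \<pi> ^ N dvd x"
  then show "x = 0" using R.separated by (intro bl_eqI) (simp add: bl_dvd_iff)
next
  fix s :: "nat \<Rightarrow> 'r bilaurent" assume "\<And>n. bl_const \<pi> ^ n dvd s (Suc n) - s n"
  then have s: "\<pi> ^ n dvd bl_nth (s (Suc n)) i - bl_nth (s n) i" for n i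
    using bl_dvd_iff by simp
  have "\<exists>l. \<forall>n. \<pi> ^ n dvd l - bl_nth (s n) i" for i using s by (intro R.limit)
  then obtain l where l: "\<And>i n. \<pi> ^ n dvd l i - bl_nth (s n) i" by metis
  \<comment> \<open>The coefficientwise limit agrees with s N modulo \<pi>^N, hence decays modulo
    \<pi>^N where s N does.\<close>
  have "null_at_minus_inf l"
    unfolding null_iff
  proof
    fix N
    obtain a where "vanish N a (bl_nth (s N))" using bl_vanish by blast
    then have "\<pi> ^ N dvd l i" if "i < a" for i
      using dvd_add[OF l[of N i], of "bl_nth (s N) i"] that by (simp add: vanish_iff)
    then have "vanish N a l" unfolding vanish_iff by blast
    then show "\<exists>a. vanish N a l" ..
  qed
  then have "bl_nth (Abs_bilaurent l) = l" by (simp add: Abs_bilaurent_inverse)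
  then show "\<exists>l. \<forall>n. bl_const \<pi> ^ n dvd l - s n"
    using l by (intro exI[of _ "Abs_bilaurent l"]) (simp add: bl_dvd_iff)
qed

sublocale A: cdvr "bl_const \<pi>" by standard (rule bl_cdvr_uniformizer)

end

subsection \<open>Power series as bilateral series\<close>

lift_definition bl_of_fps :: "'r::complete_dvr fps \<Rightarrow> 'r bilaurent"
  is "\<lambda>f i. if i < 0 then 0 else f $ nat i"
  unfolding null_at_minus_inf_def by (intro allI exI[of _ 0]) auto

context residue_dvr
begin

lemma bl_of_fps_mult: "bl_of_fps (f * g) = bl_of_fps f * (bl_of_fps g :: 'r bilaurent)"
proof (rule bl_eqI, rule R.eqI)
  fix n N
  have v: "vanish N 0 (bl_nth (bl_of_fps f))" for f :: "'r fps"
    by (simp add: vanish_iff bl_of_fps.rep_eq)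
  have t: "trunc 0 (bl_nth (bl_of_fps f)) = fps_to_fls f" for f :: "'r fps"
    by (rule fls_eqI) (simp add: bl_of_fps.rep_eq)
  have "bl_nth (bl_of_fps (f * g)) n = (fps_to_fls f * fps_to_fls g) $$ n"
    by (simp add: bl_of_fps.rep_eq flip: fls_times_fps_to_fls)
  then show "\<pi> ^ N dvd bl_nth (bl_of_fps (f * g)) n - bl_nth (bl_of_fps f * bl_of_fps g) n"
    using bl_nth_mult_cong[OF v v, of f g n] unfolding t by (simp add: dvd_diff_sym)
qed

lemma bl_of_fps_homo: "ring_homo (bl_of_fps :: 'r fps \<Rightarrow> _)"
  unfolding ring_homo_def
  by (auto simp: bl_of_fps_mult bl_of_fps.rep_eq intro!: bl_eqI)

lemma bl_of_fps_const: "bl_of_fps (fps_const c) = bl_const (c::'r)"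
  by (rule bl_eqI) (simp add: bl_of_fps.rep_eq)

lemma bl_of_fps_X: "bl_of_fps fps_X = (bl_T :: 'r bilaurent)"
  by (rule bl_eqI) (auto simp: bl_of_fps.rep_eq)

end

section \<open>Homomorphisms out of the ring of bilateral series\<close>

lemma ring_homoD:
  assumes "ring_homo f"
  shows "f 1 = 1" "f 0 = 0" "f (x + y) = f x + f y" "f (x * y) = f x * f y" "f (- x) = - f x"
    "f (x - y) = f x - f y" "f (x ^ n) = f x ^ n" "f (of_nat n) = of_nat n" "f (of_int i) = of_int i"
    "f (sum g S) = (\<Sum>i\<in>S. f (g i))" "f (prod g S) = (\<Prod>i\<in>S. f (g i))"
proof -
  show h: "f 1 = 1" "f (x + y) = f x + f y" "f (x * y) = f x * f y" for x y
    using assms unfolding ring_homo_def by auto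
  show f0: "f 0 = 0" using h(2)[of 0 0] by simp
  show fm: "f (- x) = - f x" for x using h(2)[of x "- x"] f0 by (simp add: eq_neg_iff_add_eq_0 add.commute)
  show "f (x - y) = f x - f y" using h(2)[of x "- y"] fm by simp
  show "f (x ^ n) = f x ^ n" by (induction n) (auto simp: h)
  show n: "f (of_nat n) = of_nat n" for n by (induction n) (auto simp: h f0)
  show "f (of_int i) = of_int i" by (cases i) (simp_all add: n fm h f0 del: of_nat_Suc)
  show "f (sum g S) = (\<Sum>i\<in>S. f (g i))" by (induction S rule: infinite_finite_induct) (auto simp: h f0)
  show "f (prod g S) = (\<Prod>i\<in>S. f (g i))" by (induction S rule: infinite_finite_induct) (auto simp: h)
qed

lemma ring_homo_dvd: "ring_homo f \<Longrightarrow> x dvd y \<Longrightarrow> f x dvd f y"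
  by (auto simp: dvd_def ring_homoD(4))

lemma ring_homo_comp: "ring_homo f \<Longrightarrow> ring_homo g \<Longrightarrow> ring_homo (f \<circ> g)"
  by (simp add: ring_homo_def)

lemma ring_homo_inv:
  assumes "ring_homo f" "bij f" shows "ring_homo (Hilbert_Choice.inv f)"
proof -
  have "inj f" "surj f" using assms(2) by (simp_all add: bij_def)
  then show ?thesis
    unfolding ring_homo_def using ring_homoD[OF assms(1)]
    by (intro conjI allI inv_f_eq[OF \<open>inj f\<close>]) (simp_all add: surj_f_inv_f)
qed

locale residue_dvr_alg = residue_dvr \<pi> red + B: cdvr b\<pi>
  for \<pi> :: "'r::complete_dvr" and red :: "'r \<Rightarrow> 'k::field" and b\<pi> :: "'b::comm_ring_1"
begin

text \<open>Modulo \<open>\<pi>\<^sup>N\<close> a bilateral series is a power series divided by a power of \<open>T\<close>.\<close>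

definition shift_fps :: "nat \<Rightarrow> 'r bilaurent \<Rightarrow> 'r fps" where
  "shift_fps a f = Abs_fps (\<lambda>n. bl_nth f (int n - int a))"

text \<open>A homomorphism from R[[X]] is automatically \<pi>-adically continuous: the difference of
  the arguments is \<pi>^N times a power series. Nothing is said about the X-adic topology.\<close>

lemma fps_hom_cong:
  assumes \<phi>: "ring_homo \<phi>" "\<phi> (fps_const \<pi>) = b\<pi>"
    and "\<And>n. \<pi> ^ N dvd (f - g) $ n"
  shows "b\<pi> ^ N dvd \<phi> f - \<phi> g"
proof -
  have "\<forall>n. \<exists>c. (f - g) $ n = \<pi> ^ N * c" using assms(3) by (simp add: dvd_def)
  then obtain h where "\<And>n. (f - g) $ n = \<pi> ^ N * h n" by metis
  then have "f - g = fps_const \<pi> ^ N * Abs_fps h"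
    by (intro fps_ext) (simp add: fps_const_power)
  then have "\<phi> f - \<phi> g = b\<pi> ^ N * \<phi> (Abs_fps h)"
    using ring_homoD[OF \<phi>(1)] \<phi>(2) by metis
  then show ?thesis by simp
qed

text \<open>Once X goes to a unit, the image of the a-fold shift of f times the inverse of that unit
  to the power a is the value of f modulo \<pi>^N, for every a with \<pi>^N dividing all
  coefficients below -a. These values are compatible and have a limit in B.\<close>

theorem extend_fps_hom:
  fixes \<phi> :: "'r fps \<Rightarrow> 'b"
  assumes \<phi>: "ring_homo \<phi>" "\<phi> (fps_const \<pi>) = b\<pi>" and Z: "\<phi> fps_X dvd 1"
  shows "\<exists>\<theta>. ring_homo \<theta> \<and> (\<forall>F. \<theta> (bl_of_fps F) = \<phi> F)"
proof -
  note hom = ring_homoD[OF \<phi>(1)]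
  define Z where "Z = B.recip (\<phi> fps_X)"
  have Z1: "\<phi> fps_X * Z = 1" unfolding Z_def using B.recip[OF Z] .
  define E where "E = (\<lambda>a f. \<phi> (shift_fps a f) * Z ^ a)"
  \<comment> \<open>Passing from a to a + 1 only brings in the coefficient at -(a+1), which \<pi>^N
    divides.\<close>
  have step: "b\<pi> ^ N dvd E (Suc a) f - E a f" if "vanish N (- int a) (bl_nth f)" for N a f
  proof -
    have "shift_fps (Suc a) f = fps_const (bl_nth f (- int (Suc a))) + fps_X * shift_fps a f"
      by (intro fps_ext) (auto simp: shift_fps_def of_nat_diff diff_diff_eq)
    then have "E (Suc a) f = \<phi> (fps_const (bl_nth f (- int (Suc a)))) * Z ^ Suc a
        + (\<phi> fps_X * Z) * E a f"
      unfolding E_def by (simp add: hom algebra_simps)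
    then have "E (Suc a) f - E a f = \<phi> (fps_const (bl_nth f (- int (Suc a)))) * Z ^ Suc a"
      unfolding Z1 by simp
    moreover have "b\<pi> ^ N dvd \<phi> (fps_const (bl_nth f (- int (Suc a)))) - \<phi> 0"
      using that by (intro fps_hom_cong \<phi>) (auto simp: vanish_iff)
    ultimately show ?thesis by (simp add: hom)
  qed
  have steps: "b\<pi> ^ N dvd E (a + k) f - E a f" if "vanish N (- int a) (bl_nth f)" for N a k f
  proof (induction k)
    case (Suc k)
    have "vanish N (- int (a + k)) (bl_nth f)" using that by (auto simp: vanish_iff)
    from dvd_diff_trans[OF step[OF this] Suc] show ?case by simp
  qed simp
  have E_cong: "b\<pi> ^ N dvd E a f - E b f"
    if "vanish N (- int a) (bl_nth f)" "vanish N (- int b) (bl_nth f)" for N a b f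
    using steps[OF that(1), of "b - a"] steps[OF that(2), of "a - b"]
    by (cases "a \<le> b") (auto intro: dvd_diff_sym)
  have vex: "\<exists>a. vanish N (- int a) (bl_nth f)" for N and f :: "'r bilaurent"
  proof -
    obtain a where "vanish N a (bl_nth f)" using bl_vanish by blast
    then have "vanish N (- int (nat (- a))) (bl_nth f)" by (auto simp: vanish_iff)
    then show ?thesis ..
  qed
  have "\<exists>l. \<forall>N a. vanish N (- int a) (bl_nth f) \<longrightarrow> b\<pi> ^ N dvd l - E a f" for f
  proof -
    have "\<forall>N. \<exists>a. vanish N (- int a) (bl_nth f)" using vex by blast
    from choice[OF this] obtain a where a: "\<And>N. vanish N (- int (a N)) (bl_nth f)" by blast
    have "b\<pi> ^ N dvd E (a (Suc N)) f - E (a N) f" for N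
      using a[of "Suc N"] a[of N] by (intro E_cong) (auto simp: vanish_iff intro: dvd_mult_right)
    then obtain l where l: "\<And>N. b\<pi> ^ N dvd l - E (a N) f"
      using B.limit[of "\<lambda>N. E (a N) f"] by blast
    have "b\<pi> ^ N dvd l - E c f" if "vanish N (- int c) (bl_nth f)" for N c
      using dvd_diff_trans[OF l E_cong[OF a that]] .
    then show ?thesis by blast
  qed
  then obtain \<theta> where \<theta>: "\<And>f N a. vanish N (- int a) (bl_nth f) \<Longrightarrow> b\<pi> ^ N dvd \<theta> f - E a f"
    by metis
  have fps: "\<theta> (bl_of_fps F) = \<phi> F" for F
  proof (rule B.eqI)
    fix N
    have "shift_fps 0 (bl_of_fps F) = F" by (intro fps_ext) (simp add: shift_fps_def bl_of_fps.rep_eq)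
    then show "b\<pi> ^ N dvd \<theta> (bl_of_fps F) - \<phi> F"
      using \<theta>[of N 0 "bl_of_fps F"] by (simp add: E_def vanish_iff bl_of_fps.rep_eq)
  qed
  have add: "\<theta> (f + g) = \<theta> f + \<theta> g" for f g
  proof (rule B.eqI)
    fix N
    obtain a b where ab: "vanish N (- int a) (bl_nth f)" "vanish N (- int b) (bl_nth g)"
      using vex by metis
    define c where "c = max a b"
    have c: "vanish N (- int c) (bl_nth f)" "vanish N (- int c) (bl_nth g)"
      using ab by (auto simp: c_def vanish_iff)
    then have "vanish N (- int c) (bl_nth (f + g))" by (simp add: vanish_iff)
    note 1 = \<theta>[OF this]
    have "shift_fps c (f + g) = shift_fps c f + shift_fps c g"
      by (intro fps_ext) (simp add: shift_fps_def)
    then have "E c (f + g) = E c f + E c g" by (simp add: E_def hom algebra_simps)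
    then show "b\<pi> ^ N dvd \<theta> (f + g) - (\<theta> f + \<theta> g)"
      using 1 dvd_add_diff[OF \<theta>[OF c(1)] \<theta>[OF c(2)]] by (metis dvd_diff_sym dvd_diff_trans)
  qed
  have mult: "\<theta> (f * g) = \<theta> f * \<theta> g" for f g
  proof (rule B.eqI)
    fix N
    obtain a b where ab: "vanish N (- int a) (bl_nth f)" "vanish N (- int b) (bl_nth g)"
      using vex by metis
    have "vanish N (- int a + - int b) (bl_nth (f * g))"
      unfolding times_bilaurent.rep_eq by (intro vanish_cauchy_prod bl_nth_null ab)
    then have 1: "b\<pi> ^ N dvd \<theta> (f * g) - E (a + b) (f * g)" by (intro \<theta>) simp
    have "\<pi> ^ N dvd (shift_fps (a + b) (f * g) - shift_fps a f * shift_fps b g) $ n" for n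
    proof -
      have eq: "(shift_fps a f * shift_fps b g) $ n =
          (trunc (- int a) (bl_nth f) * trunc (- int b) (bl_nth g)) $$ (int n - int (a + b))"
      proof -
        have t: "trunc (- int a) (bl_nth f) = fls_shift (int a) (fps_to_fls (shift_fps a f))" for a f
          by (rule fls_eqI) (auto simp: shift_fps_def)
        have "trunc (- int a) (bl_nth f) * trunc (- int b) (bl_nth g) =
            fls_shift (int a + int b) (fps_to_fls (shift_fps a f * shift_fps b g))"
          unfolding t by (simp add: fls_times_both_shifted_simp fls_times_fps_to_fls)
        then show ?thesis by simp
      qed
      show ?thesis
        using bl_nth_mult_cong[OF ab, of "int n - int (a + b)"]
        unfolding fps_sub_nth eq by (simp add: shift_fps_def)
    qed
    then have "b\<pi> ^ N dvd \<phi> (shift_fps (a + b) (f * g)) - \<phi> (shift_fps a f * shift_fps b g)"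
      by (intro fps_hom_cong \<phi>)
    from dvd_mult_diff[OF this, of "Z ^ (a + b)" "Z ^ (a + b)"]
    have "b\<pi> ^ N dvd E (a + b) (f * g) - E a f * E b g"
      by (simp add: E_def hom power_add mult_ac)
    then show "b\<pi> ^ N dvd \<theta> (f * g) - \<theta> f * \<theta> g"
      using 1 dvd_mult_diff[OF \<theta>[OF ab(1)] \<theta>[OF ab(2)]] by (metis dvd_diff_sym dvd_diff_trans)
  qed
  have "\<theta> 1 = 1" using fps[of 1] bl_of_fps_homo hom by (simp add: ring_homo_def)
  then show ?thesis using fps add mult unfolding ring_homo_def by blast
qed

end

section \<open>Laurent series in characteristic \<open>p\<close>\<close>

lemma fps_X_power_dvd_iff: "fps_X ^ n dvd f \<longleftrightarrow> (\<forall>i<n. f $ i = 0)" for f :: "'a::comm_ring_1 fps"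
proof
  assume "\<forall>i<n. f $ i = 0"
  then have "f = fps_X ^ n * fps_shift n f"
    by (intro fps_ext) (simp add: fps_X_power_mult_nth)
  then show "fps_X ^ n dvd f" by (metis dvdI)
qed (auto elim!: dvdE simp: fps_X_power_mult_nth)

text \<open>Puts k[[t]] under the same theory, so that the binomial series also extracts roots of
  power series over k.\<close>

lemma fps_cdvr: "cdvr_uniformizer (fps_X :: 'k::field fps)"
proof (rule cdvr_uniformizerI[of _ "\<lambda>f. f $ 0"])
  have "surj (\<lambda>f :: 'k fps. f $ 0)" by (rule surjI[of _ fps_const]) simp
  then show "reduction_map fps_X (\<lambda>f :: 'k fps. f $ 0)"
    using fps_X_power_dvd_iff[of 1] by (auto simp: reduction_map_def ring_homo_def fps_mult_nth)
next
  fix f :: "'k fps" assume "\<And>N. fps_X ^ N dvd f"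
  then show "f = 0" unfolding fps_X_power_dvd_iff by (intro fps_ext) auto
next
  fix s :: "nat \<Rightarrow> 'k fps" assume s: "\<And>n. fps_X ^ n dvd s (Suc n) - s n"
  \<comment> \<open>The k-th coefficient is constant from the index k + 1 on, which gives the limit
    coefficient by coefficient.\<close>
  have "s (i + Suc k) $ k = s (Suc k) $ k" for i k
  proof (induction i)
    case (Suc i)
    have "(s (Suc (i + Suc k)) - s (i + Suc k)) $ k = 0"
      using s[of "i + Suc k"] unfolding fps_X_power_dvd_iff by simp
    then show ?case using Suc by simp
  qed simp
  then have *: "s n $ k = s (Suc k) $ k" if "k < n" for n k
    using that less_imp_Suc_add by (metis add.commute add_Suc_right)
  have "(Abs_fps (\<lambda>k. s (Suc k) $ k) - s n) $ k = 0" if "k < n" for n k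
    by (subst fps_sub_nth, subst *[OF that]) simp
  then show "\<exists>l. \<forall>n. fps_X ^ n dvd l - s n"
    unfolding fps_X_power_dvd_iff by (intro exI[of _ "Abs_fps (\<lambda>k. s (Suc k) $ k)"]) blast
qed simp

lemma fps_to_fls_sum: "fps_to_fls (sum F S) = (\<Sum>i\<in>S. fps_to_fls (F i))"
  by (induction S rule: infinite_finite_induct) (auto intro!: fls_eqI)

lemma fls_eq_shift_fps: "f = fls_shift (- fls_subdegree f) (fps_to_fls (fls_base_factor_to_fps f))"
  by (rule fls_eqI) (auto simp: fls_eq0_below_subdegree)

lemma fls_subdegree_power: "fls_subdegree (f ^ n) = int n * fls_subdegree f" for f :: "'k::field fls"
proof (cases "f = 0")
  case False
  then show ?thesis by (induction n) (auto simp: algebra_simps)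
qed (cases n; simp)

text \<open>Factor f as t^(md) times a constant times a series 1 + x without constant term in x: the
  constant has a root because k is algebraically closed, 1 + x has the binomial one.\<close>

lemma fls_nth_root_exists:
  fixes f :: "'k::alg_closed_field fls"
  assumes p: "prime p" "CHAR('k) = p" and m: "coprime m p" "m > 0"
    and f: "f \<noteq> 0" "fls_subdegree f = int m * d"
  shows "\<exists>g. g ^ m = f \<and> fls_subdegree g = d"
proof -
  interpret X: cdvr_p "fps_X :: 'k fps" p
    by unfold_locales (use fps_cdvr p in \<open>auto simp flip: fps_of_nat\<close>)
  define F where "F = fls_base_factor_to_fps f"
  have "f $$ fls_subdegree f \<noteq> 0" using f(1) by simp
  then have F0: "F $ 0 \<noteq> 0" by (simp add: F_def)
  obtain a where a: "a ^ m = F $ 0" using nth_root_exists m(2) by blast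
  define x where "x = fps_const (inverse (F $ 0)) * F - 1"
  have "fps_X dvd x" using F0 fps_X_power_dvd_iff[of 1 x] by (simp add: x_def)
  then have "unit_powi (binom_root fps_X (int m) x) (int m) = 1 + x"
    by (rule X.unit_powi_binom_root) (use m(1) in simp)
  then have r: "binom_root fps_X (int m) x ^ m = 1 + x" by (simp add: X.unit_powi_nonneg)
  define G where "G = fps_const a * binom_root fps_X (int m) x"
  have "G ^ m = fps_const (F $ 0) * (1 + x)"
    unfolding G_def power_mult_distrib r by (simp add: a)
  also have "\<dots> = F"
    using F0 by (simp add: x_def flip: mult.assoc)
  finally have G: "G ^ m = F" .
  define g where "g = fls_shift (- d) (fps_to_fls G)"
  have "g ^ m = fls_shift (- (int m * d)) (fps_to_fls G ^ m)"
    unfolding g_def by (simp add: fls_shifted_pow)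
  also have "\<dots> = fls_shift (- fls_subdegree f) (fps_to_fls F)"
    using f G by (simp flip: fps_to_fls_power)
  also have "\<dots> = f" unfolding F_def by (rule fls_eq_shift_fps[symmetric])
  finally have g: "g ^ m = f" .
  then have "int m * fls_subdegree g = int m * d" using f fls_subdegree_power[of g m] by metis
  then have "fls_subdegree g = d" using m(2) by simp
  then show ?thesis using g by blast
qed

lemma fls_powi_root_exists:
  fixes f :: "'k::alg_closed_field fls"
  assumes p: "prime p" "CHAR('k) = p" and m: "coprime m (int p)"
    and f: "f \<noteq> 0" "fls_subdegree f = m"
  shows "\<exists>g. g powi m = f \<and> fls_subdegree g = 1"
proof -
  have m0: "m \<noteq> 0" using coprime_prime_nz p(1) m by blast
  have "coprime (nat \<bar>m\<bar>) p" using m by (simp add: coprime_int_iff[symmetric])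
  then obtain g where g: "g ^ nat \<bar>m\<bar> = f" "fls_subdegree g = sgn m"
    using fls_nth_root_exists[OF p, of "nat \<bar>m\<bar>" f "sgn m"] f m0 by (auto simp: abs_mult_sgn)
  show ?thesis
  proof (cases "m > 0")
    case True
    then show ?thesis using g by (intro exI[of _ g]) (auto simp: power_int_def)
  next
    case False
    have "g \<noteq> 0" using g(1) f(1) m0 by auto
    then have "fls_subdegree (inverse g) = 1" using g False m0 by (simp add: fls_inverse_subdegree sgn_if)
    then show ?thesis using g False m0
      by (intro exI[of _ "inverse g"]) (auto simp: power_int_def)
  qed
qed

text \<open>A Laurent series of order \<open>0\<close> has \<open>n\<close>-th roots for all \<open>n\<close> prime to \<open>p\<close>, so its image
  under any ring homomorphism again has order \<open>0\<close>: the order is preserved up to a factor.\<close>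

lemma fls_hom_subdegree:
  fixes \<chi> :: "'k::alg_closed_field fls \<Rightarrow> 'k fls"
  assumes p: "prime p" "CHAR('k) = p" and \<chi>: "ring_homo \<chi>" and f: "f \<noteq> 0"
  shows "fls_subdegree (\<chi> f) = fls_subdegree f * fls_subdegree (\<chi> fls_X)"
proof -
  note hom = ring_homoD[OF \<chi>]
  have nz: "\<chi> f \<noteq> 0" if "f \<noteq> 0" for f
    using hom(4)[of f "inverse f"] hom(1) that by auto
  have unit: "fls_subdegree (\<chi> u) = 0" if u: "u \<noteq> 0" "fls_subdegree u = 0" for u
  proof -
    \<comment> \<open>This n is prime to p and exceeds the absolute value of the order, while the
      order is a multiple of n; so the order is 0.\<close>
    define n where "n = p * nat \<bar>fls_subdegree (\<chi> u)\<bar> + 1"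
    have "coprime n p" unfolding n_def
      by (metis coprime_1_left coprime_commute coprime_iff_gcd_eq_1 gcd_add_mult mult.commute add.commute)
    then obtain g where "g ^ n = u"
      using fls_nth_root_exists[OF p, of n u 0] u by (auto simp: n_def)
    then have *: "fls_subdegree (\<chi> u) = int n * fls_subdegree (\<chi> g)"
      using hom fls_subdegree_power by metis
    have "1 * \<bar>fls_subdegree (\<chi> u)\<bar> \<le> int p * \<bar>fls_subdegree (\<chi> u)\<bar>"
      using prime_ge_1_nat[OF p(1)] by (intro mult_right_mono) auto
    then have "\<bar>fls_subdegree (\<chi> u)\<bar> < int n" by (simp add: n_def)
    moreover have "int n dvd fls_subdegree (\<chi> u)" using * by simp
    ultimately show ?thesis using dvd_imp_le_int[of "fls_subdegree (\<chi> u)" "int n"] by fastforce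
  qed
  define d where "d = fls_subdegree f"
  define u where "u = fls_shift d f"
  have u: "u \<noteq> 0" "fls_subdegree u = 0" using f by (auto simp: u_def d_def fls_shift_eq0_iff)
  have X: "fls_X ^ k = (fls_X_intpow (int k) :: 'k fls)" for k
    by (simp add: fls_X_power_conv_shift_1)
  show ?thesis
  proof (cases "d \<ge> 0")
    case True
    then have "f = fls_X ^ nat d * u" unfolding X by (simp add: u_def fls_shifted_times_simps)
    then have "\<chi> f = \<chi> fls_X ^ nat d * \<chi> u" using hom by metis
    then show ?thesis using nz[OF u(1)] nz[OF fls_X_nonzero] unit[OF u] True
      by (simp add: fls_subdegree_power d_def)
  next
    case False
    then have "fls_X ^ nat (- d) * f = u" unfolding X by (simp add: u_def fls_shifted_times_simps)
    then have "\<chi> fls_X ^ nat (- d) * \<chi> f = \<chi> u" using hom by metis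
    then have "fls_subdegree (\<chi> fls_X ^ nat (- d) * \<chi> f) = 0" using unit[OF u] by simp
    then show ?thesis using nz[OF f] nz[OF fls_X_nonzero] False
      by (simp add: fls_subdegree_power d_def algebra_simps)
  qed
qed

text \<open>1 + t has order 0, hence so has its image; a pole of the image of t would be a pole of
  that image.\<close>

lemma fls_hom_X_nonneg:
  fixes \<chi> :: "'k::alg_closed_field fls \<Rightarrow> 'k fls"
  assumes p: "prime p" "CHAR('k) = p" and \<chi>: "ring_homo \<chi>"
  shows "0 \<le> fls_subdegree (\<chi> fls_X)"
proof (rule ccontr)
  assume neg: "\<not> 0 \<le> fls_subdegree (\<chi> fls_X)"
  have 1: "fls_subdegree (1 + fls_X :: 'k fls) = 0" by (rule fls_subdegree_eqI) auto
  have "(1 + fls_X :: 'k fls) \<noteq> 0"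
  proof
    assume "1 + fls_X = (0 :: 'k fls)"
    then have "(1 + fls_X :: 'k fls) $$ 0 = 0 $$ 0" by (rule arg_cong)
    then show False by simp
  qed
  from fls_hom_subdegree[OF p \<chi> this] have "fls_subdegree (\<chi> (1 + fls_X)) = 0" unfolding 1 by simp
  then have 2: "fls_subdegree (1 + \<chi> fls_X) = 0" using ring_homoD[OF \<chi>] by simp
  have "\<chi> fls_X \<noteq> 0" using neg by auto
  then have "\<chi> fls_X $$ fls_subdegree (\<chi> fls_X) \<noteq> 0" by simp
  then have "(1 + \<chi> fls_X) $$ fls_subdegree (\<chi> fls_X) \<noteq> 0" using neg by simp
  then show False using fls_subdegree_leI 2 neg by fastforce
qed

text \<open>Continuity need not be assumed, because \<open>fls_hom_subdegree\<close> provides it.\<close>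

lemma fls_hom_rigid:
  fixes \<chi> :: "'k::alg_closed_field fls \<Rightarrow> 'k fls"
  assumes p: "prime p" "CHAR('k) = p" and \<chi>: "ring_homo \<chi>"
    and X: "\<chi> fls_X = fls_X" and c: "\<And>c. \<chi> (fls_const c) = fls_const c"
  shows "\<chi> f = f"
proof -
  note hom = ring_homoD[OF \<chi>]
  have deg: "fls_subdegree (\<chi> f) = fls_subdegree f" for f
    using fls_hom_subdegree[OF p \<chi>, of f] hom by (cases "f = 0") (auto simp: X)
  have fps: "\<chi> (fps_to_fls F) = fps_to_fls F" for F
  proof (rule fls_eqI)
    fix n
    \<comment> \<open>Splitting F after N > n terms, \<chi> fixes the polynomial part and the
      remainder contributes t^N times a series of nonnegative order, invisible in degree n.\<close>
    define N where "N = Suc (nat n)"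
    define G where "G = fps_to_fls (fps_shift N F)"
    have "F = (\<Sum>i<N. fps_const (F $ i) * fps_X ^ i) + fps_X ^ N * fps_shift N F"
    proof (rule fps_ext)
      fix k
      have "(\<Sum>i<N. (fps_const (F $ i) * fps_X ^ i) $ k) = (\<Sum>i<N. if i = k then F $ i else 0)"
        by (intro sum.cong) auto
      then show "F $ k = ((\<Sum>i<N. fps_const (F $ i) * fps_X ^ i) + fps_X ^ N * fps_shift N F) $ k"
        by (simp add: fps_sum_nth fps_X_power_mult_nth sum.delta' )
    qed
    then have "fps_to_fls F = fps_to_fls ((\<Sum>i<N. fps_const (F $ i) * fps_X ^ i) + fps_X ^ N * fps_shift N F)"
      by simp
    then have F: "fps_to_fls F = (\<Sum>i<N. fls_const (F $ i) * fls_X ^ i) + fls_X ^ N * G"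
      by (simp add: G_def fps_to_fls_sum fls_times_fps_to_fls fps_to_fls_power)
    have "\<chi> (fps_to_fls F) = (\<Sum>i<N. fls_const (F $ i) * fls_X ^ i) + fls_X ^ N * \<chi> G"
      unfolding F hom X c by (simp add: hom X c)
    then have eq: "\<chi> (fps_to_fls F) - fps_to_fls F = fls_X ^ N * (\<chi> G - G)"
      using F by (simp add: algebra_simps)
    have "0 \<le> fls_subdegree G" unfolding G_def by (rule fls_subdegree_fls_to_fps_gt0)
    moreover from this have "0 \<le> fls_subdegree (\<chi> G)" using deg by simp
    ultimately have "(\<chi> G - G) $$ (n - int N) = 0" unfolding N_def by auto
    then have "(fls_X ^ N * (\<chi> G - G)) $$ n = 0"
      by (simp add: fls_X_power_conv_shift_1 fls_shifted_times_simps)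
    then show "\<chi> (fps_to_fls F) $$ n = fps_to_fls F $$ n" unfolding eq[symmetric] by simp
  qed
  define m where "m = nat (- fls_subdegree f)"
  have "fls_X ^ m * f = fps_to_fls (fls_regpart (fls_X ^ m * f))"
    by (rule fls_eqI) (auto simp: m_def fls_X_power_conv_shift_1 fls_shifted_times_simps)
  then have "\<chi> (fls_X ^ m * f) = fls_X ^ m * f" using fps by metis
  then have "fls_X ^ m * \<chi> f = fls_X ^ m * f" by (simp add: hom X)
  then show ?thesis by simp
qed

text \<open>A series of order 1 has a compositional inverse, so substituting it for t is an
  automorphism.\<close>

lemma fls_substitution:
  fixes g :: "'k::field fls"
  assumes g: "fls_subdegree g = 1"
  shows "\<exists>\<chi>. ring_homo \<chi> \<and> bij \<chi> \<and> \<chi> fls_X = g \<and> (\<forall>c. \<chi> (fls_const c) = fls_const c)"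
proof -
  define G where "G = fls_regpart g"
  have gG: "fps_to_fls G = g" by (rule fls_eqI) (use g in \<open>auto simp: G_def\<close>)
  have "g \<noteq> 0" using g by auto
  then have "g $$ fls_subdegree g \<noteq> 0" by simp
  then have G: "G $ 0 = 0" "G $ 1 \<noteq> 0" using g by (auto simp: G_def)
  then have G': "G \<noteq> 0" by auto
  define H where "H = fps_inv G"
  have inv: "H oo G = fps_X" "G oo H = fps_X" unfolding H_def using fps_inv fps_inv_right G by blast+
  have H0: "H $ 0 = 0" by (simp add: H_def fps_inv_def)
  have H': "H \<noteq> 0"
  proof
    assume "H = 0"
    then have "fps_X = (0 :: 'k fps)" using inv(1) by simp
    then show False by simp
  qed
  have compX: "fls_compose_fps f fps_X = f" for f :: "'k fls"
    using fls_nth_fls_compose_fps_linear[of 1 f] by (intro fls_eqI) simp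
  have "ring_homo (\<lambda>f. fls_compose_fps f G)"
    using G G' by (simp add: ring_homo_def fls_compose_fps_mult fls_compose_fps_add)
  moreover have "bij (\<lambda>f. fls_compose_fps f G)"
    by (rule o_bij[of "\<lambda>f. fls_compose_fps f H"])
      (use G G' H0 H' inv compX in \<open>auto simp: fun_eq_iff fls_compose_fps_assoc\<close>)
  ultimately show ?thesis using gG by (intro exI[of _ "\<lambda>f. fls_compose_fps f G"]) auto
qed

subsection \<open>Powers of exponent \<open>p\<close>\<close>

lemma CHAR_power_add:
  fixes x y :: "'a::comm_ring_1"
  assumes "prime p" "CHAR('a) = p"
  shows "(x + y) ^ p = x ^ p + y ^ p"
  by (rule freshmans_dream) (use assms in simp_all)

lemma fps_power_CHAR_nth:
  fixes F :: "'k::field fps"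
  assumes p: "prime p" "CHAR('k) = p"
  shows "(F ^ p) $ n = (if p dvd n then (F $ (n div p)) ^ p else 0)"
proof -
  define N where "N = Suc n"
  have p0: "p > 0" using p prime_gt_0_nat by simp
  have F: "F = (\<Sum>i<N. fps_const (F $ i) * fps_X ^ i) + fps_X ^ N * fps_shift N F"
  proof (rule fps_ext)
    fix k
    have "(\<Sum>i<N. (fps_const (F $ i) * fps_X ^ i) $ k) = (\<Sum>i<N. if i = k then F $ i else 0)"
      by (intro sum.cong) auto
    then show "F $ k = ((\<Sum>i<N. fps_const (F $ i) * fps_X ^ i) + fps_X ^ N * fps_shift N F) $ k"
      by (simp add: fps_sum_nth fps_X_power_mult_nth sum.delta')
  qed
  have C: "CHAR('k fps) = p" using p by simp
  have "F ^ p = (\<Sum>i<N. fps_const (F $ i) * fps_X ^ i) ^ p + (fps_X ^ N * fps_shift N F) ^ p"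
    by (subst F) (rule CHAR_power_add[OF p(1) C])
  also have "(\<Sum>i<N. fps_const (F $ i) * fps_X ^ i) ^ p = (\<Sum>i<N. (fps_const (F $ i) * fps_X ^ i) ^ p)"
    by (rule freshmans_dream_sum) (use p C in simp_all)
  also have "\<dots> = (\<Sum>i<N. fps_const ((F $ i) ^ p) * fps_X ^ (i * p))"
    by (simp add: power_mult_distrib power_mult)
  finally have Fp: "F ^ p = (\<Sum>i<N. fps_const ((F $ i) ^ p) * fps_X ^ (i * p)) +
      fps_X ^ (N * p) * fps_shift N F ^ p"
    by (simp add: power_mult_distrib power_mult)
  have "N * 1 \<le> N * p" using p0 by (intro mult_le_mono2) simp
  then have "n < N * p" by (simp add: N_def)
  then have "(F ^ p) $ n = (\<Sum>i<N. if n = i * p then (F $ i) ^ p else 0)"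
    unfolding Fp by (simp add: fps_sum_nth fps_X_power_mult_nth) (intro sum.cong; auto)
  also have "\<dots> = (if p dvd n then (F $ (n div p)) ^ p else 0)"
  proof (cases "p dvd n")
    case True
    have "n div p < N" unfolding N_def less_Suc_eq_le by (rule div_le_dividend)
    moreover have "(\<Sum>i<N. if n = i * p then (F $ i) ^ p else 0) =
        (\<Sum>i<N. if i = n div p then (F $ i) ^ p else 0)"
      using p0 True by (intro sum.cong) auto
    ultimately show ?thesis using True by simp
  qed (auto intro!: sum.neutral)
  finally show ?thesis .
qed

lemma fls_power_CHAR_nth:
  fixes f :: "'k::field fls"
  assumes p: "prime p" "CHAR('k) = p"
  shows "(f ^ p) $$ n = (if int p dvd n then (f $$ (n div int p)) ^ p else 0)"
proof -
  have p0: "int p > 0" using p prime_gt_0_nat by simp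
  define F where "F = fls_base_factor_to_fps f"
  define d where "d = fls_subdegree f"
  have f: "f = fls_shift (- d) (fps_to_fls F)" unfolding F_def d_def by (rule fls_eq_shift_fps)
  have "f ^ p = fls_shift (- (int p * d)) (fps_to_fls (F ^ p))"
    unfolding f by (simp add: fls_shifted_pow fps_to_fls_power)
  then have 1: "(f ^ p) $$ n = (if n - int p * d < 0 then 0 else (F ^ p) $ nat (n - int p * d))" by simp
  show ?thesis
  proof (cases "int p dvd n")
    case True
    then obtain m where m: "n = int p * m" by (metis dvdE)
    have f: "f $$ m = (if m - d < 0 then 0 else F $ nat (m - d))" unfolding f by simp
    have "n - int p * d = int p * (m - d)" by (simp add: m algebra_simps)
    moreover have "(int p * (m - d) < 0) = (m - d < 0)" using p0 by (simp add: mult_less_0_iff)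
    moreover have "nat (int p * (m - d)) = p * nat (m - d)" by (simp add: nat_mult_distrib)
    ultimately show ?thesis unfolding 1 using True p0
      by (simp add: fps_power_CHAR_nth[OF p] m f)
  next
    case False
    have "\<not> p dvd nat (n - int p * d)" if "\<not> n - int p * d < 0"
    proof
      assume "p dvd nat (n - int p * d)"
      then have "int p dvd n - int p * d" using that by (metis int_dvd_int_iff int_nat_eq not_less)
      then have "int p dvd (n - int p * d) + int p * d" by (rule dvd_add) simp
      then show False using False by simp
    qed
    then show ?thesis unfolding 1 using False by (simp add: fps_power_CHAR_nth[OF p])
  qed
qed

lemma fls_power_CHAR_exists:
  fixes f :: "'k::alg_closed_field fls"
  assumes p: "prime p" "CHAR('k) = p"
  shows "\<exists>g. \<forall>n. (g $$ n) ^ p = f $$ (int p * n)"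
proof -
  have p0: "p > 0" using p prime_gt_0_nat by simp
  have "\<exists>y. y ^ p = f $$ (int p * n)" for n using nth_root_exists p0 by blast
  then obtain g where g: "\<And>n. g n ^ p = f $$ (int p * n)" by metis
  have "g n = 0" if "n < min (fls_subdegree f) 0" for n
  proof -
    have "int p * n \<le> 1 * n" using that p0 by (intro mult_right_mono_neg) auto
    then have "int p * n < fls_subdegree f" using that by linarith
    then have "f $$ (int p * n) = 0" by (rule fls_eq0_below_subdegree)
    then show ?thesis using g[of n] p0 by simp
  qed
  then have "Abs_fls g $$ n = g n" for n
    by (intro nth_Abs_fls_lower_bound[of "min (fls_subdegree f) 0"]) blast
  then show ?thesis using g by metis
qed

text \<open>As k is perfect, the terms with exponent divisible by p form a p-th power. This is how u
  is normalised to an order prime to p.\<close>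

lemma fls_remove_p_part:
  fixes f :: "'k::alg_closed_field fls"
  assumes p: "prime p" "CHAR('k) = p"
  shows "\<exists>g. \<forall>n. (f - g ^ p) $$ n = (if int p dvd n then 0 else f $$ n)"
proof -
  obtain g where g: "\<And>n. (g $$ n) ^ p = f $$ (int p * n)" using fls_power_CHAR_exists[OF p] by metis
  have "(f - g ^ p) $$ n = (if int p dvd n then 0 else f $$ n)" for n
    using g[of "n div int p"] by (simp add: fls_power_CHAR_nth[OF p])
  then show ?thesis by blast
qed

text \<open>Over the perfect field k the subfield k((t^p)) is the set of p-th powers, the form in
  which the condition on the reduction of u is used.\<close>

lemma fls_compose_power_range:
  fixes f :: "'k::alg_closed_field fls"
  assumes p: "prime p" "CHAR('k) = p"
  shows "f \<in> range (\<lambda>f. fls_compose_power f p) \<longleftrightarrow> f \<in> range (\<lambda>f. f ^ p)"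
proof
  have p0: "p > 0" using p prime_gt_0_nat by simp
  assume "f \<in> range (\<lambda>f. fls_compose_power f p)"
  then have f: "f $$ n = 0" if "\<not> int p dvd n" for n
    using that p0 by (auto simp: fls_nth_compose_power)
  obtain g where g: "\<And>n. (f - g ^ p) $$ n = (if int p dvd n then 0 else f $$ n)"
    using fls_remove_p_part[OF p] by metis
  then have "(f - g ^ p) $$ n = 0" for n unfolding g using f[of n] by simp
  then have "f - g ^ p = 0" by (intro fls_eqI) simp
  then show "f \<in> range (\<lambda>f. f ^ p)" by auto
next
  have p0: "p > 0" using p prime_gt_0_nat by simp
  assume "f \<in> range (\<lambda>f. f ^ p)"
  then obtain g where g: "f = g ^ p" by blast
  have "(g $$ n) ^ p = 0" if "n < fls_subdegree g" for n
    unfolding fls_eq0_below_subdegree[OF that] using p0 by simp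
  then have "Abs_fls (\<lambda>n. (g $$ n) ^ p) $$ n = (g $$ n) ^ p" for n
    by (intro nth_Abs_fls_lower_bound[of "fls_subdegree g"]) blast
  then have "f = fls_compose_power (Abs_fls (\<lambda>n. (g $$ n) ^ p)) p"
    unfolding g using p0 by (intro fls_eqI) (simp add: fls_power_CHAR_nth[OF p] fls_nth_compose_power)
  then show "f \<in> range (\<lambda>f. fls_compose_power f p)" by blast
qed

lemma of_int_eq_0_iff_CHAR:
  assumes "CHAR('k::field) = p" shows "(of_int n :: 'k) = 0 \<longleftrightarrow> int p dvd n"
  using assms by (simp add: of_int_eq_0_iff_char_dvd)

lemma fls_deriv_power_CHAR:
  fixes g :: "'k::field fls"
  assumes "CHAR('k) = p"
  shows "fls_deriv (g ^ p) = 0"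
proof -
  have "(of_nat p :: 'k fls) = 0" using assms by (metis of_nat_CHAR semiring_char_fls)
  then show ?thesis unfolding fls_deriv_power by simp
qed

lemma fls_deriv_eq_0_imp_power:
  fixes f :: "'k::alg_closed_field fls"
  assumes p: "prime p" "CHAR('k) = p" and f: "fls_deriv f = 0"
  shows "f \<in> range (\<lambda>f. f ^ p)"
proof -
  obtain g where g: "\<And>n. (f - g ^ p) $$ n = (if int p dvd n then 0 else f $$ n)"
    using fls_remove_p_part[OF p] by metis
  have "f $$ n = 0" if "\<not> int p dvd n" for n
  proof -
    have "fls_deriv f $$ (n - 1) = 0" using f by simp
    then show ?thesis using that of_int_eq_0_iff_CHAR[OF p(2)] by simp
  qed
  then have "(f - g ^ p) $$ n = 0" for n unfolding g using \<open>\<And>n. \<not> int p dvd n \<Longrightarrow> f $$ n = 0\<close>[of n] by simp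
  then have "f - g ^ p = 0" by (intro fls_eqI) simp
  then show ?thesis by auto
qed

lemma fls_subdegree_non_p_part:
  fixes f :: "'k::field fls"
  assumes p: "prime p" "CHAR('k) = p" and f: "\<And>n. int p dvd n \<Longrightarrow> f $$ n = 0" "f \<noteq> 0"
  shows "coprime (fls_subdegree f) (int p)" "fls_deriv f \<noteq> 0"
    "fls_subdegree (fls_deriv f) = fls_subdegree f - 1"
proof -
  have "f $$ fls_subdegree f \<noteq> 0" using f(2) by simp
  then have n: "\<not> int p dvd fls_subdegree f" using f(1) by blast
  then have "coprime (int p) (fls_subdegree f)" using p(1) by (intro prime_imp_coprime) auto
  then show "coprime (fls_subdegree f) (int p)" by (simp add: coprime_commute)
  have *: "of_int (fls_subdegree f) * f $$ fls_subdegree f \<noteq> 0"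
    using f(2) n of_int_eq_0_iff_CHAR[OF p(2)] by simp
  then show "fls_subdegree (fls_deriv f) = fls_subdegree f - 1" by (rule fls_deriv_subdegree')
  have "fls_deriv f $$ (fls_subdegree f - 1) \<noteq> 0" using * by simp
  then show "fls_deriv f \<noteq> 0" by (metis fls_zero_nth)
qed

text \<open>Write f = t^d u with u of order 0: the logarithmic derivative is d/t plus that of u,
  which has no pole. Hence the residue lies in the prime field.\<close>

lemma fls_residue_log_deriv:
  fixes f :: "'k::field fls"
  assumes f: "f \<noteq> 0"
  shows "fls_residue (fls_deriv f / f) = of_int (fls_subdegree f)"
proof -
  define d where "d = fls_subdegree f"
  define u where "u = fls_shift d f"
  have u: "u \<noteq> 0" "fls_subdegree u = 0" using f by (auto simp: u_def d_def fls_shift_eq0_iff)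
  have fu: "f = fls_X_intpow d * u" by (simp add: u_def fls_shifted_times_simps)
  have "fls_deriv f = fls_X_intpow d * fls_deriv u + of_int d * fls_X_intpow (d - 1) * u"
    unfolding fu fls_deriv_mult fls_deriv_X_intpow ..
  also have "fls_X_intpow (d - 1) = fls_X_intpow d * (fls_X_inv :: 'k fls)"
    by (simp add: fls_X_inv_conv_shift_1 fls_shifted_times_simps)
  finally have "fls_deriv f / f = fls_deriv u / u + of_int d * fls_X_inv"
    using u fu by (simp add: field_simps)
  moreover have "fls_residue (fls_deriv u / u) = 0"
  proof (cases "fls_deriv u = 0")
    case False
    have "0 \<le> fls_subdegree (fls_deriv u)" using u by (intro fls_deriv_subdegree0)
    then have "0 \<le> fls_subdegree (fls_deriv u / u)" using u False by (simp add: fls_divide_subdegree)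
    then show ?thesis by simp
  qed simp
  ultimately show ?thesis by (simp add: d_def fls_of_int)
qed

lemma fls_log_deriv_mult_power:
  fixes f v :: "'k::field fls"
  assumes "CHAR('k) = p" "f \<noteq> 0" "v \<noteq> 0"
  shows "fls_deriv (f * v ^ p) / (f * v ^ p) = fls_deriv f / f"
  using assms by (simp add: fls_deriv_power_CHAR)

section \<open>Parameters\<close>

subsection \<open>Taylor expansion\<close>

text \<open>The Hasse derivative, the k-th derivative divided by k! without any division; it serves
  Taylor expansions over every commutative ring.\<close>

definition hasse :: "nat \<Rightarrow> 'a::comm_semiring_1 fps \<Rightarrow> 'a fps" where
  "hasse k f = Abs_fps (\<lambda>n. of_nat ((n + k) choose k) * f $ (n + k))"

lemma hasse_add: "hasse k (f + g) = hasse k f + hasse k g"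
  by (rule fps_ext) (simp add: hasse_def algebra_simps)

text \<open>Leibniz' rule. With M = N + n and j the exponent taken from f, comparing the
  coefficients of f_j g_(M-j) is Vandermonde's identity for M choose n.\<close>

lemma hasse_mult: 
  fixes f g :: "'a::comm_semiring_1 fps"
  shows "hasse n (f * g) = (\<Sum>i\<le>n. hasse i f * hasse (n - i) g)"
proof (rule fps_ext)
  fix N
  define M where "M = N + n"
  define h :: "nat \<Rightarrow> nat \<Rightarrow> 'a" where
    "h = (\<lambda>i j. of_nat (j choose i) * of_nat ((M - j) choose (n - i)) * (f $ j * g $ (M - j)))"
  have "(\<Sum>i\<le>n. hasse i f * hasse (n - i) g) $ N = (\<Sum>i\<le>n. \<Sum>a\<le>N. h i (a + i))"
    unfolding fps_sum_nth fps_mult_nth atMost_atLeast0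
  proof (intro sum.cong refl)
    fix i a assume "i \<in> {0..n}" "a \<in> {0..N}"
    then have "M - (a + i) = N - a + (n - i)" unfolding M_def by auto
    then show "hasse i f $ a * hasse (n - i) g $ (N - a) = h i (a + i)"
      by (simp add: hasse_def h_def mult_ac)
  qed
  also have "\<dots> = (\<Sum>i\<le>n. \<Sum>j\<le>M. h i j)"
  proof (rule sum.cong[OF refl])
    fix i assume i: "i \<in> {..n}"
    have "(\<Sum>a\<le>N. h i (a + i)) = (\<Sum>j\<in>{i..N + i}. h i j)"
      by (rule sum.reindex_bij_witness[of _ "\<lambda>j. j - i" "\<lambda>a. a + i"]) auto
    also have "\<dots> = (\<Sum>j\<le>M. h i j)"
    proof (rule sum.mono_neutral_left)
      show "\<forall>j\<in>{..M} - {i..N + i}. h i j = 0"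
      proof
        fix j assume "j \<in> {..M} - {i..N + i}"
        then have "j < i \<or> M - j < n - i" unfolding M_def using i by auto
        then show "h i j = 0" unfolding h_def by (auto simp: binomial_eq_0)
      qed
    qed (use i in \<open>auto simp: M_def\<close>)
    finally show "(\<Sum>a\<le>N. h i (a + i)) = (\<Sum>j\<le>M. h i j)" .
  qed
  also have "\<dots> = (\<Sum>j\<le>M. \<Sum>i\<le>n. h i j)" by (rule sum.swap)
  also have "\<dots> = (\<Sum>j\<le>M. of_nat (M choose n) * (f $ j * g $ (M - j)))"
  proof (rule sum.cong[OF refl])
    fix j assume "j \<in> {..M}"
    then have "(M choose n) = (\<Sum>i\<le>n. (j choose i) * ((M - j) choose (n - i)))"
      using vandermonde[of j "M - j" n] by simp
    then show "(\<Sum>i\<le>n. h i j) = of_nat (M choose n) * (f $ j * g $ (M - j))"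
      by (simp add: h_def sum_distrib_right)
  qed
  also have "\<dots> = hasse n (f * g) $ N"
    by (simp add: hasse_def M_def fps_mult_nth atMost_atLeast0 sum_distrib_left)
  finally show "hasse n (f * g) $ N = (\<Sum>i\<le>n. hasse i f * hasse (n - i) g) $ N" ..
qed

lemma hasse_const: "hasse k (fps_const c) = (if k = 0 then fps_const c else 0)"
  by (rule fps_ext) (auto simp: hasse_def)

lemma hasse_X: "hasse k fps_X = (if k = 0 then fps_X else if k = 1 then 1 else 0)"
  by (rule fps_ext) (auto simp: hasse_def fps_X_def)

text \<open>The new homomorphism is f evaluated at \<beta>(X) + e by Taylor's formula. The series
  converges because \<pi> divides e, and Leibniz' rule makes it multiplicative.\<close>

lemma (in cdvr) taylor_hom:
  fixes \<beta> :: "'c::comm_ring_1 fps \<Rightarrow> 'a"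
  assumes \<beta>: "ring_homo \<beta>" and e: "\<pi> dvd e"
  shows "\<exists>\<tau>. ring_homo \<tau> \<and> \<tau> fps_X = \<beta> fps_X + e \<and> (\<forall>c. \<tau> (fps_const c) = \<beta> (fps_const c))"
proof -
  note hom = ring_homoD[OF \<beta>]
  define T where "T = (\<lambda>f k. \<beta> (hasse k f) * e ^ k)"
  define \<tau> where "\<tau> = (\<lambda>f. adic_sum \<pi> (T f))"
  have null: "null_seq (T f)" for f unfolding T_def by (rule null_seq_power[OF e])
  have add: "\<tau> (f + g) = \<tau> f + \<tau> g" for f g
  proof -
    have "T (f + g) = (\<lambda>i. T f i + T g i)" by (simp add: T_def hasse_add hom algebra_simps)
    then show ?thesis unfolding \<tau>_def using adic_sum_add[OF null null] by simp
  qed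
  have mult: "\<tau> (f * g) = \<tau> f * \<tau> g" for f g
  proof -
    have "T (f * g) = (\<lambda>n. \<Sum>i\<le>n. T f i * T g (n - i))"
    proof
      fix n
      show "T (f * g) n = (\<Sum>i\<le>n. T f i * T g (n - i))"
        unfolding T_def hasse_mult hom sum_distrib_right
      proof (rule sum.cong[OF refl])
        fix i assume "i \<in> {..n}"
        then have "e ^ n = e ^ i * e ^ (n - i)" by (simp flip: power_add)
        then show "\<beta> (hasse i f) * \<beta> (hasse (n - i) g) * e ^ n =
            \<beta> (hasse i f) * e ^ i * (\<beta> (hasse (n - i) g) * e ^ (n - i))" by (simp add: mult_ac)
      qed
    qed
    then show ?thesis unfolding \<tau>_def using adic_sum_mult[OF null null] by simp
  qed
  have const: "\<tau> (fps_const c) = \<beta> (fps_const c)" for c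
    unfolding \<tau>_def by (subst adic_sum_finite[of 1, OF _ null]) (auto simp: T_def hasse_const hom)
  have X: "\<tau> fps_X = \<beta> fps_X + e"
    unfolding \<tau>_def by (subst adic_sum_finite[of 2, OF _ null]) (auto simp: T_def hasse_X hom numeral_2_eq_2)
  have "\<tau> 1 = 1" using const[of 1] hom by simp
  then show ?thesis using add mult const X unfolding ring_homo_def by blast
qed

subsection \<open>Extracting a \<open>p\<close>-th root of the image of the variable\<close>

text \<open>Power series in X are free over those in X^p with basis 1, X, ..., X^(p-1).
  \<open>sec r\<close> extracts the r-th component, \<open>dil\<close> substitutes X^p for X, and
  the extension sends X to Z and a series in X^p to its image under \<tau>.\<close>

lemma fps_hom_root:
  fixes \<tau> :: "'c::comm_ring_1 fps \<Rightarrow> 'a::comm_ring_1"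
  assumes \<tau>: "ring_homo \<tau>" and p: "p > 0" and Z: "Z ^ p = \<tau> fps_X"
  shows "\<exists>\<Phi>. ring_homo \<Phi> \<and> \<Phi> fps_X = Z \<and> (\<forall>c. \<Phi> (fps_const c) = \<tau> (fps_const c))"
proof -
  note hom = ring_homoD[OF \<tau>]
  define sec :: "nat \<Rightarrow> 'c fps \<Rightarrow> 'c fps" where "sec = (\<lambda>r f. Abs_fps (\<lambda>n. f $ (p * n + r)))"
  define dil :: "'c fps \<Rightarrow> 'c fps" where
    "dil = (\<lambda>f. Abs_fps (\<lambda>n. if p dvd n then f $ (n div p) else 0))"
  define \<Phi> where "\<Phi> = (\<lambda>f. \<Sum>r<p. Z ^ r * \<tau> (sec r f))"
  have add: "\<Phi> (f + g) = \<Phi> f + \<Phi> g" for f g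
  proof -
    have "sec r (f + g) = sec r f + sec r g" for r by (rule fps_ext) (simp add: sec_def)
    then show ?thesis by (simp add: \<Phi>_def hom algebra_simps sum.distrib)
  qed
  have const: "\<Phi> (fps_const c) = \<tau> (fps_const c)" for c
  proof -
    have "sec r (fps_const c) = (if r = 0 then fps_const c else 0)" if "r < p" for r
      using p by (intro fps_ext) (auto simp: sec_def)
    then have "\<Phi> (fps_const c) = (\<Sum>r<p. if r = 0 then \<tau> (fps_const c) else 0)"
      unfolding \<Phi>_def by (intro sum.cong) (auto simp: hom)
    then show ?thesis using p by simp
  qed
  \<comment> \<open>Multiplication by X moves component r to r + 1; the last one wraps round to 0
    with a factor X, whose image under \<tau> is Z^p.\<close>
  have Xmult: "\<Phi> (fps_X * g) = Z * \<Phi> g" for g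
  proof -
    obtain q where q: "p = Suc q" using p by (cases p) auto
    have 0: "sec 0 (fps_X * g) = fps_X * sec q g"
    proof (rule fps_ext)
      fix n show "sec 0 (fps_X * g) $ n = (fps_X * sec q g) $ n"
        by (cases n) (auto simp: sec_def q algebra_simps)
    qed
    have r: "sec (Suc r) (fps_X * g) = sec r g" for r
      by (rule fps_ext) (simp add: sec_def)
    have "\<Phi> (fps_X * g) = \<tau> fps_X * \<tau> (sec q g) + (\<Sum>r<q. Z ^ Suc r * \<tau> (sec r g))"
      unfolding \<Phi>_def q sum.lessThan_Suc_shift by (simp add: 0 r hom)
    also have "\<dots> = Z * \<Phi> g"
      unfolding \<Phi>_def Z[symmetric] q by (simp add: sum_distrib_left algebra_simps)
    finally show ?thesis .
  qed
  have Xpow: "\<Phi> (fps_X ^ i * g) = Z ^ i * \<Phi> g" for i g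
    by (induction i) (simp_all add: Xmult mult.assoc)
  have dil: "\<Phi> (dil f * g) = \<tau> f * \<Phi> g" for f g
  proof -
    have "sec r (dil f * g) = f * sec r g" if r: "r < p" for r
    proof (rule fps_ext)
      fix n
      have "sec r (dil f * g) $ n = (\<Sum>i\<in>{0..p * n + r}. dil f $ i * g $ (p * n + r - i))"
        by (simp add: sec_def fps_mult_nth)
      also have "\<dots> = (\<Sum>i\<in>(*) p ` {0..n}. dil f $ i * g $ (p * n + r - i))"
      proof (rule sum.mono_neutral_right)
        show "(*) p ` {0..n} \<subseteq> {0..p * n + r}" by (auto intro!: trans_le_add1 mult_le_mono2)
        show "\<forall>i\<in>{0..p * n + r} - (*) p ` {0..n}. dil f $ i * g $ (p * n + r - i) = 0"
        proof
          fix i assume i: "i \<in> {0..p * n + r} - (*) p ` {0..n}"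
          have "\<not> p dvd i"
          proof
            assume "p dvd i"
            then obtain j where j: "i = p * j" by (metis dvdE)
            have "p * j < p * Suc n" using i r by (simp add: j)
            then have "j \<le> n" unfolding mult_less_cancel1 by simp
            then show False using i j by auto
          qed
          then show "dil f $ i * g $ (p * n + r - i) = 0" by (simp add: dil_def)
        qed
      qed simp
      also have "\<dots> = (\<Sum>j\<in>{0..n}. f $ j * g $ (p * (n - j) + r))"
      proof (subst sum.reindex)
        show "inj_on ((*) p) {0..n}" using p by (simp add: inj_on_def)
        show "sum ((\<lambda>i. dil f $ i * g $ (p * n + r - i)) \<circ> (*) p) {0..n} =
            (\<Sum>j\<in>{0..n}. f $ j * g $ (p * (n - j) + r))"
        proof (rule sum.cong[OF refl])
          fix j assume "j \<in> {0..n}"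
          then have "p * j \<le> p * n" by simp
          then have "p * n + r - p * j = p * (n - j) + r" by (simp add: diff_mult_distrib2)
          then show "((\<lambda>i. dil f $ i * g $ (p * n + r - i)) \<circ> (*) p) j = f $ j * g $ (p * (n - j) + r)"
            using p by (simp add: dil_def)
        qed
      qed
      finally show "sec r (dil f * g) $ n = (f * sec r g) $ n" by (simp add: sec_def fps_mult_nth)
    qed
    then show ?thesis by (simp add: \<Phi>_def hom sum_distrib_left mult_ac)
  qed
  have decomp: "f = (\<Sum>r<p. fps_X ^ r * dil (sec r f))" for f
  proof (rule fps_ext)
    fix n
    have "(fps_X ^ r * dil (sec r f)) $ n = (if r = n mod p then f $ n else 0)" if r: "r < p" for r
    proof (cases "r = n mod p")
      case True
      then have "n - r = p * (n div p)" by (metis minus_mod_eq_mult_div)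
      moreover have "n mod p \<le> n" by simp
      ultimately show ?thesis using True p
        by (simp add: fps_X_power_mult_nth dil_def sec_def not_less[THEN iffD2, OF mod_less_eq_dividend])
    next
      case False
      have "\<not> (r \<le> n \<and> p dvd n - r)"
      proof
        assume *: "r \<le> n \<and> p dvd n - r"
        then have "n mod p = r mod p" by (metis mod_eq_dvd_iff_nat)
        then show False using r False by simp
      qed
      then show ?thesis using False by (auto simp: fps_X_power_mult_nth dil_def)
    qed
    then have "(\<Sum>r<p. fps_X ^ r * dil (sec r f)) $ n = (\<Sum>r<p. if r = n mod p then f $ n else 0)"
      unfolding fps_sum_nth by (intro sum.cong) auto
    then show "f $ n = (\<Sum>r<p. fps_X ^ r * dil (sec r f)) $ n" using p by simp
  qed
  have sum: "\<Phi> (sum F S) = (\<Sum>i\<in>S. \<Phi> (F i))" for F :: "nat \<Rightarrow> 'c fps" and S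
  proof (induction S rule: infinite_finite_induct)
    case (insert i S) then show ?case by (simp add: add)
  qed (use const[of 0] hom in simp_all)
  have mult: "\<Phi> (f * g) = \<Phi> f * \<Phi> g" for f g
  proof -
    have "f * g = (\<Sum>r<p. fps_X ^ r * (dil (sec r f) * g))"
      by (subst decomp[of f]) (simp add: sum_distrib_right mult.assoc)
    then have "\<Phi> (f * g) = (\<Sum>r<p. Z ^ r * (\<tau> (sec r f) * \<Phi> g))"
      by (simp only: sum Xpow dil)
    then show ?thesis by (simp add: \<Phi>_def sum_distrib_right mult.assoc)
  qed
  have 1: "\<Phi> 1 = 1" using const[of 1] hom by simp
  then have "\<Phi> fps_X = Z" using Xmult[of 1] by simp
  then show ?thesis using 1 add mult const unfolding ring_homo_def by blast
qed

subsection \<open>The criterion\<close>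

text \<open>A nonzero element is a unit times a power of the uniformizer, so it cannot go to 0.
  Surjectivity modulo the uniformizer is lifted by successive approximation.\<close>

lemma bij_of_bij_mod:
  fixes \<theta> :: "'a::comm_ring_1 \<Rightarrow> 'b::comm_ring_1"
  assumes A: "cdvr_uniformizer a\<pi>" and B: "cdvr_uniformizer b\<pi>"
    and \<theta>: "ring_homo \<theta>" "\<theta> a\<pi> = b\<pi>" and onto: "\<And>b. \<exists>a. b\<pi> dvd b - \<theta> a"
  shows "bij \<theta>"
proof -
  interpret A: cdvr a\<pi> by standard (rule A)
  interpret B: cdvr b\<pi> by standard (rule B)
  note hom = ring_homoD[OF \<theta>(1)]
  have "x = 0" if x: "\<theta> x = 0" for x
  proof (rule ccontr)
    assume "x \<noteq> 0"
    then obtain u n where u: "u dvd 1" "x = u * a\<pi> ^ n" using A.unit_times_power by blast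
    have "\<theta> u dvd 1" using ring_homo_dvd[OF \<theta>(1) u(1)] hom by simp
    then show False using x u B.mult_eq_0 B.unit_nz B.pi_power_nz by (simp add: hom \<theta>(2))
  qed
  then have "inj \<theta>" unfolding inj_def using hom(6) by (metis eq_iff_diff_eq_0)
  moreover have "surj \<theta>"
    unfolding surj_def
  proof
    fix b
    have "\<exists>a c. b = \<theta> a + b\<pi> * c" for b
      using onto[of b] by (auto simp: dvd_def algebra_simps)
    then obtain g q where gq: "\<And>b. b = \<theta> (g b) + b\<pi> * q b" by metis
    \<comment> \<open>s n is the remainder after n rounds of approximation and
      \<open>g (s n)\<close> the n-th digit.\<close>
    define s where "s = (\<lambda>n. (q ^^ n) b)"
    define f where "f = (\<lambda>i. a\<pi> ^ i * g (s i))"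
    have s: "b = \<theta> (sum f {..<n}) + b\<pi> ^ n * s n" for n
    proof (induction n)
      case (Suc n)
      have "s n = \<theta> (g (s n)) + b\<pi> * s (Suc n)" using gq[of "s n"] by (simp add: s_def)
      then have "b = \<theta> (sum f {..<n}) + b\<pi> ^ n * (\<theta> (g (s n)) + b\<pi> * s (Suc n))" using Suc by simp
      then show ?case by (simp add: f_def hom \<theta>(2) algebra_simps)
    qed (simp add: s_def hom)
    have null: "A.null_seq f" by (simp add: A.null_seq_def f_def)
    have "b = \<theta> (adic_sum a\<pi> f)"
    proof (rule B.eqI)
      fix N
      have "\<theta> (a\<pi> ^ N) dvd \<theta> (adic_sum a\<pi> f - sum f {..<N})"
        by (rule ring_homo_dvd[OF \<theta>(1) A.adic_sum_cong[OF null]])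
      then have "b\<pi> ^ N dvd \<theta> (adic_sum a\<pi> f) - \<theta> (sum f {..<N})" by (simp add: hom \<theta>(2))
      moreover have "b\<pi> ^ N dvd b - \<theta> (sum f {..<N})" using s[of N] by (metis add_diff_cancel_left' dvd_triv_left)
      ultimately show "b\<pi> ^ N dvd b - \<theta> (adic_sum a\<pi> f)" using dvd_diff_trans dvd_diff_sym by metis
    qed
    then show "\<exists>a. b = \<theta> a" by blast
  qed
  ultimately show ?thesis by (simp add: bij_def)
qed

text \<open>Bilateral series in \<open>Z\<close> do not converge \<open>\<pi>\<close>-adically. As \<open>Z\<^sup>p\<close> is congruent to the image
  of some \<open>H \<in> T R[[T]]\<close>, they are summed by substituting \<open>H\<close>, correcting \<open>H\<close> to \<open>Z\<^sup>p\<close> by a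
  (\<open>\<pi>\<close>-adically convergent) Taylor expansion, and adjoining the \<open>p\<close>-th root \<open>Z\<close>.\<close>

theorem (in residue_dvr_alg) is_parameterI:
  fixes red' :: "'r \<Rightarrow> 'k' :: alg_closed_field"
    and \<iota> :: "'r bilaurent \<Rightarrow> 'b" and r :: "'b \<Rightarrow> 'k' fls"
  assumes p: "prime p" "CHAR('k') = p" and red': "reduction_map \<pi> red'"
    and \<iota>: "ring_homo \<iota>" and s: "s = \<iota> \<circ> bl_const" "s \<pi> = b\<pi>"
    and r: "reduction_map b\<pi> r" and rs: "\<And>c. r (s c) = fls_const (red' c)"
    and Z: "r Z = fls_X" and H: "H $ 0 = 0" "b\<pi> dvd Z ^ p - \<iota> (bl_of_fps H)"
  shows "is_parameter s Z"
proof -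
  interpret K: residue_dvr \<pi> red' by standard (rule unif_pi, rule red')
  note \<iota>h = ring_homoD[OF \<iota>]
  have r': "ring_homo r" "r x = 0 \<longleftrightarrow> b\<pi> dvd x" for x using r unfolding reduction_map_def by auto
  note rh = ring_homoD[OF r'(1)]
  have p0: "p > 0" using p prime_gt_0_nat by blast
  \<comment> \<open>Substitution of H, which is legitimate since H has no constant term; it sends X
    to the image of H, which is Z^p modulo \<pi>.\<close>
  define \<beta> where "\<beta> = (\<lambda>f. \<iota> (bl_of_fps (f oo H)))"
  have \<beta>: "ring_homo \<beta>"
    using bl_of_fps_homo H(1) unfolding \<beta>_def ring_homo_def
    by (simp add: \<iota>h fps_compose_mult_distrib fps_compose_add_distrib)
  obtain \<tau> where \<tau>: "ring_homo \<tau>" "\<tau> fps_X = \<beta> fps_X + (Z ^ p - \<iota> (bl_of_fps H))"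
    "\<And>c. \<tau> (fps_const c) = \<beta> (fps_const c)"
    using B.taylor_hom[OF \<beta> H(2)] by blast
  have "Z ^ p = \<tau> fps_X" using \<tau>(2) H(1) by (simp add: \<beta>_def)
  then obtain \<Phi> where \<Phi>: "ring_homo \<Phi>" "\<Phi> fps_X = Z" "\<And>c. \<Phi> (fps_const c) = \<tau> (fps_const c)"
    using fps_hom_root[OF \<tau>(1) p0] by blast
  have \<Phi>c: "\<Phi> (fps_const c) = s c" for c
    using \<Phi>(3) \<tau>(3) by (simp add: \<beta>_def bl_of_fps_const s)
  have "Z dvd 1" using B.unit_iff r'(2)[of Z] Z by simp
  then obtain \<theta> where \<theta>: "ring_homo \<theta>" "\<And>F. \<theta> (bl_of_fps F) = \<Phi> F"
    using extend_fps_hom[OF \<Phi>(1)] \<Phi>(2) \<Phi>c s(2) by metis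
  note \<theta>h = ring_homoD[OF \<theta>(1)]
  have \<theta>c: "\<theta> (bl_const c) = s c" for c using \<theta>(2) \<Phi>c bl_of_fps_const by metis
  have \<theta>T: "\<theta> bl_T = Z" using \<theta>(2) \<Phi>(2) bl_of_fps_X by metis
  have well: "r (\<theta> f) = r (\<theta> g)" if "bl_reduce red' f = bl_reduce red' g" for f g
  proof -
    have "bl_reduce red' (f - g) = 0" using that by (intro fls_eqI) (simp add: fls_eq_iff)
    then have "bl_const \<pi> dvd f - g" using K.bl_reduce_eq_0_iff by simp
    then have "b\<pi> dvd \<theta> (f - g)" using ring_homo_dvd[OF \<theta>(1)] \<theta>c s(2) by metis
    then have "r (\<theta> (f - g)) = 0" using r'(2) by simp
    then show ?thesis by (simp add: rh \<theta>h)
  qed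
  have "surj (bl_reduce red')" using K.bl_reduction_map unfolding reduction_map_def by simp
  then obtain l where l: "\<And>g. bl_reduce red' (l g) = g" by (metis surj_def)
  \<comment> \<open>The endomorphism of the field of Laurent series induced by \<theta>. It fixes
    the variable and the constants, so it is the identity by \<open>fls_hom_rigid\<close>.\<close>
  define \<chi> where "\<chi> = (\<lambda>g. r (\<theta> (l g)))"
  have \<chi>: "\<chi> (bl_reduce red' f) = r (\<theta> f)" for f unfolding \<chi>_def by (rule well) (rule l)
  have "ring_homo \<chi>"
    unfolding ring_homo_def
  proof (intro conjI allI)
    show "\<chi> 1 = 1" using \<chi>[of 1] by (simp add: K.bl_reduce_1 rh \<theta>h)
    fix x y
    show "\<chi> (x + y) = \<chi> x + \<chi> y"
      using \<chi>[of "l x + l y"] \<chi>[of "l x"] \<chi>[of "l y"] by (simp add: K.bl_reduce_add l rh \<theta>h)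
    show "\<chi> (x * y) = \<chi> x * \<chi> y"
      using \<chi>[of "l x * l y"] \<chi>[of "l x"] \<chi>[of "l y"] by (simp add: K.bl_reduce_mult l rh \<theta>h)
  qed
  moreover have "\<chi> fls_X = fls_X" using \<chi>[of bl_T] by (simp add: K.bl_reduce_T \<theta>T Z)
  moreover have "\<chi> (fls_const c) = fls_const c" for c
  proof -
    obtain c' where "red' c' = c" using K.red_surj by (metis surj_def)
    then show ?thesis using \<chi>[of "bl_const c'"] by (simp add: K.bl_reduce_const \<theta>c rs)
  qed
  ultimately have "\<chi> f = f" for f using fls_hom_rigid[OF p] by blast
  then have r\<theta>: "r (\<theta> f) = bl_reduce red' f" for f using \<chi> by metis
  have "bij \<theta>"
  proof (rule bij_of_bij_mod[OF bl_cdvr_uniformizer B.uniformizer \<theta>(1)])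
    show "\<theta> (bl_const \<pi>) = b\<pi>" using \<theta>c s(2) by simp
    fix b
    have "r (b - \<theta> (l (r b))) = 0" by (simp add: rh r\<theta> l)
    then show "\<exists>a. b\<pi> dvd b - \<theta> a" using r'(2) by blast
  qed
  then show ?thesis unfolding is_parameter_def using \<theta>(1) \<theta>c \<theta>T by blast
qed

section \<open>Purely inseparable residue extensions\<close>

lemma coeff_map_poly_homo: "ring_homo j \<Longrightarrow> coeff (map_poly j P) n = j (coeff P n)"
  by (simp add: coeff_map_poly ring_homoD(2))

lemma map_poly_homo: 
  assumes "ring_homo j" shows "ring_homo (map_poly j)"
  unfolding ring_homo_def
proof (intro conjI allI poly_eqI)
  note h = ring_homoD[OF assms]
  fix n show "coeff (map_poly j 1) n = coeff 1 n" by (simp add: coeff_map_poly_homo assms coeff_1 h)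
  fix P Q
  show "coeff (map_poly j (P + Q)) n = coeff (map_poly j P + map_poly j Q) n"
    by (simp add: coeff_map_poly_homo assms h)
  show "coeff (map_poly j (P * Q)) n = coeff (map_poly j P * map_poly j Q) n"
    by (simp add: coeff_map_poly_homo assms h coeff_mult)
qed

lemma map_poly_homo_simps:
  assumes "ring_homo j"
  shows "map_poly j [:c:] = [:j c:]" "map_poly j (pCons c P) = pCons (j c) (map_poly j P)"
    "map_poly j (smult c P) = smult (j c) (map_poly j P)" "map_poly j (monom c n) = monom (j c) n"
  by (auto intro!: poly_eqI simp: coeff_map_poly_homo[OF assms] ring_homoD[OF assms] coeff_pCons split: nat.split)

lemma poly_map_poly_sum:
  assumes j: "ring_homo j" and d: "degree P < n"
  shows "poly (map_poly j P) x = (\<Sum>i<n. j (coeff P i) * x ^ i)"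
proof -
  have "degree (map_poly j P) \<le> degree P"
    by (intro degree_le) (simp add: coeff_map_poly_homo[OF j] coeff_eq_0 ring_homoD[OF j])
  then have "degree (map_poly j P) < n" using d by simp
  then have "poly (map_poly j P) x = (\<Sum>i\<le>degree (map_poly j P). coeff (map_poly j P) i * x ^ i)"
    by (simp add: poly_altdef)
  also have "\<dots> = (\<Sum>i<n. coeff (map_poly j P) i * x ^ i)"
    using \<open>degree (map_poly j P) < n\<close> by (intro sum.mono_neutral_left) (auto simp: coeff_eq_0)
  finally show ?thesis by (simp add: coeff_map_poly_homo[OF j])
qed

lemma coeff_sum_monom: "coeff (\<Sum>i<n. monom (a i) i) k = (if k < n then a k else 0)"
proof -
  have "coeff (\<Sum>i<n. monom (a i) i) k = (\<Sum>i<n. if i = k then a i else 0)"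
    by (simp add: coeff_sum)
  then show ?thesis by simp
qed

lemma degree_sum_monom: "n > 0 \<Longrightarrow> degree (\<Sum>i<n. monom (a i) i) < n"
  using degree_le[of "n - 1" "\<Sum>i<n. monom (a i) i"] by (fastforce simp: coeff_sum_monom)

lemma dvd_power_linear_imp:
  fixes P :: "'l::field poly"
  assumes "P dvd [:- c, 1:] ^ n"
  shows "\<exists>u r. P = smult u ([:- c, 1:] ^ r)"
proof -
  obtain S where S: "[:- c, 1:] ^ n = P * S" using assms by (metis dvdE)
  have nz: "P * S \<noteq> 0" unfolding S[symmetric] by simp
  define r where "r = Polynomial.order c P"
  obtain R where R: "P = [:- c, 1:] ^ r * R" using order_decomp[of P c] nz r_def by auto
  have "R \<noteq> 0" using R nz by auto
  have "n = r + Polynomial.order c S" using order_mult[OF nz] order_power_n_n[of c n] S r_def by simp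
  moreover have "Polynomial.order c S \<le> degree S" using nz by (intro order_degree) auto
  moreover have "n = degree P + degree S"
    using degree_mult_eq[of P S] nz S degree_linear_power[of "- c" n] by simp
  moreover have "degree P = r + degree R"
    unfolding R using \<open>R \<noteq> 0\<close> by (simp add: degree_mult_eq degree_linear_power)
  ultimately have "degree R = 0" by simp
  then obtain u where "R = [:u:]" by (metis degree_eq_zeroE)
  then show ?thesis using R by (intro exI[of _ u] exI[of _ r]) (simp add: mult.commute)
qed

text \<open>The subleading coefficient serves to recover c from a power of x - c whose coefficients
  lie in a subfield.\<close>

lemma coeff_linear_power_pred:
  fixes a :: "'a::comm_ring_1"
  shows "coeff ([:a, 1:] ^ n) n = 1" "coeff ([:a, 1:] ^ Suc n) n = of_nat (Suc n) * a"
proof -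
  have deg: "degree ([:a, 1:] ^ n) \<le> n" for n
  proof (induction n)
    case (Suc n)
    have "degree ([:a, 1:] * [:a, 1:] ^ n) \<le> degree [:a, 1:] + degree ([:a, 1:] ^ n)" by (rule degree_mult_le)
    also have "\<dots> \<le> 1 + n" using Suc by (intro add_mono) auto
    finally show ?case by simp
  qed simp
  show 1: "coeff ([:a, 1:] ^ n) n = 1" for n
  proof (induction n)
    case (Suc n)
    have "coeff ([:a, 1:] ^ n) (Suc n) = 0" using deg[of n] by (intro coeff_eq_0) simp
    then show ?case using Suc by simp
  qed simp
  show "coeff ([:a, 1:] ^ Suc n) n = of_nat (Suc n) * a"
  proof (induction n)
    case (Suc n)
    have "coeff ([:a, 1:] ^ Suc (Suc n)) (Suc n) = a * coeff ([:a, 1:] ^ Suc n) (Suc n) + coeff ([:a, 1:] ^ Suc n) n"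
      by (subst power_Suc) (simp only: mult_pCons_left, simp)
    then show ?case unfolding Suc 1 by (simp add: algebra_simps)
  qed simp
qed

lemma field_homo_inj:
  fixes j :: "'f::field \<Rightarrow> 'l::field"
  assumes "ring_homo j"
  shows "j x = 0 \<longleftrightarrow> x = 0"
proof
  assume "j x = 0"
  show "x = 0"
  proof (rule ccontr)
    assume "x \<noteq> 0"
    then have "j x * j (inverse x) = 1" using ring_homoD(1,4)[OF assms] by (metis right_inverse)
    then show False using \<open>j x = 0\<close> by simp
  qed
qed (simp add: ring_homoD(2)[OF assms])

lemma CHAR_diff_power:
  fixes x y :: "'a::comm_ring_1"
  assumes "prime p" "CHAR('a) = p"
  shows "(x - y) ^ p = x ^ p - y ^ p"
  using CHAR_power_add[OF assms, of "x - y" y] by simp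

text \<open>The minimal polynomial of c divides x^p - c^p = (x - c)^p, so it is (x - c)^r, with 0 <
  r < p if some nonzero polynomial of degree below p kills c. Its subleading coefficient -rc lies in
  the base field, and r is invertible there, so c would too.\<close>

lemma insep_independent:
  fixes j :: "'f::field \<Rightarrow> 'l::field"
  assumes p: "prime p" "CHAR('l) = p" and j: "ring_homo j"
    and c: "c \<notin> range j" "c ^ p \<in> range j"
    and P: "degree P < p" "poly (map_poly j P) c = 0"
  shows "P = 0"
proof (rule ccontr)
  assume nz: "P \<noteq> 0"
  note J = ring_homoD[OF map_poly_homo[OF j]]
  define good where "good = (\<lambda>Q. Q \<noteq> 0 \<and> poly (map_poly j Q) c = 0)"
  have "good P" using nz P by (simp add: good_def)
  then obtain Q0 where Q0: "good Q0" "\<And>Q. good Q \<Longrightarrow> degree Q0 \<le> degree Q"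
    using ex_has_least_nat[of good P degree] by blast
  define Q where "Q = smult (inverse (lead_coeff Q0)) Q0"
  have Q: "Q \<noteq> 0" "poly (map_poly j Q) c = 0" "lead_coeff Q = 1" "degree Q = degree Q0"
    using Q0(1) by (auto simp: Q_def good_def map_poly_homo_simps[OF j])
  define r where "r = degree Q"
  have r: "r < p" using Q0(2)[OF \<open>good P\<close>] P(1) Q(4) r_def by simp
  obtain a where a: "c ^ p = j a" using c(2) by blast
  define S where "S = monom 1 p - [:a:]"
  have JS: "map_poly j S = [:- c, 1:] ^ p"
  proof -
    have "map_poly j S = monom 1 p - [:c:] ^ p"
      by (simp add: S_def J map_poly_homo_simps[OF j] ring_homoD[OF j] a[symmetric] poly_const_pow)
    also have "monom 1 p = (monom 1 1 :: 'l poly) ^ p" by (simp add: monom_power)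
    also have "(monom 1 1 :: 'l poly) ^ p - [:c:] ^ p = (monom 1 1 - [:c:]) ^ p"
      using p by (intro CHAR_diff_power[symmetric]) auto
    also have "monom 1 1 - [:c:] = [:- c, 1:]" by (simp add: monom_altdef)
    finally show ?thesis .
  qed
  have "S mod Q = 0"
  proof (rule ccontr)
    assume *: "S mod Q \<noteq> 0"
    have "S = S div Q * Q + S mod Q" by simp
    then have "map_poly j S = map_poly j (S div Q) * map_poly j Q + map_poly j (S mod Q)" using J(3,4) by metis
    then have "poly (map_poly j S) c = poly (map_poly j (S mod Q)) c" using Q(2) by simp
    then have "poly (map_poly j (S mod Q)) c = 0" unfolding JS using prime_gt_0_nat[OF p(1)] by (simp add: zero_power)
    then have "degree Q0 \<le> degree (S mod Q)" using * by (intro Q0(2)) (simp add: good_def)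
    then show False using degree_mod_less'[OF Q(1) *] Q(4) by simp
  qed
  then have "Q dvd S" by auto
  then have "map_poly j Q dvd [:- c, 1:] ^ p" using ring_homo_dvd[OF map_poly_homo[OF j]] JS by metis
  then obtain u k where uk: "map_poly j Q = smult u ([:- c, 1:] ^ k)" using dvd_power_linear_imp by blast
  have jd: "degree (map_poly j Q) = r"
    unfolding r_def by (intro degree_map_poly) (simp add: field_homo_inj[OF j])
  have "coeff (map_poly j Q) r = 1" using Q(3) by (simp add: coeff_map_poly_homo[OF j] r_def ring_homoD[OF j])
  then have "u \<noteq> 0" using uk by auto
  then have k: "k = r" using jd by (simp add: uk degree_linear_power)
  have "u = 1" using arg_cong[OF uk, of "\<lambda>P. coeff P r"] Q(3) coeff_linear_power_pred(1)[of "- c" r]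
    by (simp add: k coeff_map_poly_homo[OF j] r_def ring_homoD[OF j])
  obtain i where i: "r = Suc i"
  proof (cases r)
    case 0
    then have "poly (map_poly j Q) c = 1" using uk \<open>u = 1\<close> k by simp
    then show ?thesis using Q(2) by simp
  qed (use that in blast)
  have "j (coeff Q i) = of_nat r * (- c)"
    using arg_cong[OF uk, of "\<lambda>P. coeff P i"] coeff_linear_power_pred(2)[of "- c" i]
    unfolding k i \<open>u = 1\<close> coeff_map_poly_homo[OF j] by simp
  moreover have rn: "(of_nat r :: 'l) \<noteq> 0"
    unfolding of_nat_eq_0_iff_char_dvd p(2) using r i by (auto dest: dvd_imp_le)
  ultimately have "c = - j (coeff Q i) / of_nat r" by (simp add: field_simps)
  also have "\<dots> = j (- coeff Q i / of_nat r)"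
  proof -
    have "j (- coeff Q i / of_nat r) * j (of_nat r) = j (- coeff Q i)"
      using rn ring_homoD(4,8)[OF j] field_homo_inj[OF j, of "of_nat r"]
      by (metis nonzero_eq_divide_eq)
    then show ?thesis using rn by (simp add: ring_homoD[OF j] field_simps)
  qed
  finally show False using c(1) by blast
qed

lemma insep_independent_sum:
  fixes j :: "'f::field \<Rightarrow> 'l::field"
  assumes p: "prime p" "CHAR('l) = p" and j: "ring_homo j"
    and c: "c \<notin> range j" "c ^ p \<in> range j"
    and a: "(\<Sum>i<p. j (a i) * c ^ i) = 0" and i: "i < p"
  shows "a i = 0"
proof -
  define P where "P = (\<Sum>i<p. monom (a i) i)"
  have d: "degree P < p" unfolding P_def using p prime_gt_0_nat degree_sum_monom by blast
  have "poly (map_poly j P) c = (\<Sum>i<p. j (a i) * c ^ i)"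
    unfolding poly_map_poly_sum[OF j d] by (intro sum.cong) (auto simp: P_def coeff_sum_monom)
  then have "P = 0" using insep_independent[OF p j c d] a by simp
  then have "coeff P i = 0" by simp
  then show ?thesis using i by (simp add: P_def coeff_sum_monom)
qed

locale purely_insep =
  fixes p :: nat and j :: "'f::field \<Rightarrow> 'l::field"
  assumes p: "prime p" and charL: "CHAR('l) = p" and insep: "purely_insep_of_degree_p p j"
begin

lemma j: "ring_homo j" and j_dim: "vector_space.dim (alg_scale j) UNIV = p"
  and j_insep: "\<exists>n. x ^ (p ^ n) \<in> range j"
  using insep unfolding purely_insep_of_degree_p_def by auto

lemma p_gt_1: "p > 1" using p prime_gt_1_nat by blast

lemma vs: "vector_space (alg_scale j)"
  by unfold_locales (simp_all add: alg_scale_def ring_homoD[OF j] algebra_simps)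

lemma finite_basis: obtains T where "finite T" "card T = p" "module.span (alg_scale j) T = UNIV"
proof -
  interpret V: vector_space "alg_scale j" by (rule vs)
  obtain T where "V.independent T" "UNIV \<subseteq> V.span T" "card T = V.dim UNIV"
    using V.basis_exists[of UNIV] by blast
  moreover have "finite T" using calculation(3) j_dim p_gt_1 by (metis card.infinite not_one_less_zero)
  ultimately show ?thesis using that j_dim by auto
qed

lemma basis_of_power:
  assumes c: "c \<notin> range j" "c ^ p \<in> range j"
  shows "\<exists>a. x = (\<Sum>i<p. j (a i) * c ^ i)"
proof -
  interpret V: vector_space "alg_scale j" by (rule vs)
  obtain T where T: "finite T" "card T = p" "V.span T = UNIV" using finite_basis .
  note ind = insep_independent_sum[OF p charL j c]
  have inj: "inj_on (\<lambda>i. c ^ i) {..<p}"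
  proof (rule inj_onI, rule ccontr)
    fix m n assume mn: "m \<in> {..<p}" "n \<in> {..<p}" "c ^ m = c ^ n" "m \<noteq> n"
    define a :: "nat \<Rightarrow> 'f" where "a = (\<lambda>i. if i = m then 1 else if i = n then - 1 else 0)"
    have "(\<Sum>i<p. j (a i) * c ^ i) = (\<Sum>i<p. (if i = m then c ^ m else 0) - (if i = n then c ^ n else 0))"
      using mn(4) by (intro sum.cong) (auto simp: a_def ring_homoD[OF j])
    also have "\<dots> = 0" using mn by (simp add: sum_subtractf)
    finally have "a m = 0" using ind mn(1) by blast
    then show False by (simp add: a_def)
  qed
  define S where "S = (\<lambda>i. c ^ i) ` {..<p}"
  have cS: "card S = p" "finite S" using inj by (auto simp: S_def card_image)
  have indS: "V.independent S"
    unfolding V.dependent_finite[OF cS(2)]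
  proof safe
    fix u v assume u: "(\<Sum>v\<in>S. alg_scale j (u v) v) = 0" and v: "v \<in> S" and n: "u v \<noteq> 0"
    obtain i where i: "i < p" "v = c ^ i" using v by (auto simp: S_def)
    have "(\<Sum>i<p. j (u (c ^ i)) * c ^ i) = 0"
      using u unfolding S_def sum.reindex[OF inj] by (simp add: alg_scale_def)
    from ind[OF this i(1)] show False using n i by simp
  qed
  have "x \<in> V.span S"
  proof (rule ccontr)
    assume x: "x \<notin> V.span S"
    then have "V.independent (insert x S)" using indS by (simp add: V.independent_insertI)
    then have "card (insert x S) \<le> card T"
      using V.independent_span_bound[OF T(1)] T(3) by blast
    moreover have "x \<notin> S" using x V.span_base by blast
    ultimately show False using cS T by simp
  qed
  then obtain u where "x = (\<Sum>v\<in>S. alg_scale j (u v) v)"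
    unfolding V.span_finite[OF cS(2)] by blast
  then have "x = (\<Sum>i<p. j (u (c ^ i)) * c ^ i)"
    unfolding S_def sum.reindex[OF inj] by (simp add: alg_scale_def)
  then show ?thesis by (intro exI[of _ "\<lambda>i. u (c ^ i)"])
qed

text \<open>Take the last of the powers x, x^p, x^(p^2), ... that is still outside the base
  field.\<close>

lemma exists_generator: "\<exists>c. c \<notin> range j \<and> c ^ p \<in> range j"
proof -
  interpret V: vector_space "alg_scale j" by (rule vs)
  have "\<exists>x. x \<notin> range j"
  proof (rule ccontr)
    assume "\<nexists>x. x \<notin> range j"
    then have "x \<in> V.span {1}" for x
      unfolding V.span_singleton by (auto simp: alg_scale_def)
    then have "V.dim UNIV \<le> card {1 :: 'l}" by (intro V.dim_le_card) auto
    then show False using j_dim p_gt_1 by simp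
  qed
  then obtain x where x: "x \<notin> range j" by blast
  define n where "n = (LEAST n. x ^ (p ^ n) \<in> range j)"
  have n: "x ^ (p ^ n) \<in> range j" unfolding n_def using j_insep by (rule LeastI_ex)
  have "n \<noteq> 0" using n x by (cases n) auto
  then obtain m where m: "n = Suc m" by (cases n) auto
  have "x ^ (p ^ m) \<notin> range j" using not_less_Least[of m "\<lambda>n. x ^ (p ^ n) \<in> range j"] m n_def by simp
  moreover have "(x ^ (p ^ m)) ^ p \<in> range j" using n by (simp add: m mult.commute flip: power_mult)
  ultimately show ?thesis by blast
qed

text \<open>The definition only grants some exponent p^n. Expanding x in powers of a generator c
  shows that n = 1 always works, because c^p lies in the base field.\<close>

lemma power_p_in_range: "x ^ p \<in> range j"
proof -
  obtain c where c: "c \<notin> range j" "c ^ p \<in> range j" using exists_generator by blast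
  then obtain b where b: "c ^ p = j b" by blast
  obtain a where a: "x = (\<Sum>i<p. j (a i) * c ^ i)" using basis_of_power[OF c] by blast
  have "x ^ p = (\<Sum>i<p. (j (a i) * c ^ i) ^ p)"
    unfolding a by (rule freshmans_dream_sum) (use p charL in auto)
  also have "\<dots> = (\<Sum>i<p. j (a i ^ p * b ^ i))"
    by (intro sum.cong refl) (simp add: power_mult_distrib ring_homoD[OF j] b[symmetric] mult.commute flip: power_mult)
  also have "\<dots> = j (\<Sum>i<p. a i ^ p * b ^ i)" by (simp add: ring_homoD(10)[OF j])
  finally show ?thesis by blast
qed

lemma basis:
  assumes "c \<notin> range j" shows "\<exists>a. x = (\<Sum>i<p. j (a i) * c ^ i)"
  using basis_of_power[OF assms power_p_in_range] .

lemma basis_independent: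
  assumes "c \<notin> range j" "(\<Sum>i<p. j (a i) * c ^ i) = 0" "i < p" shows "a i = 0"
  using insep_independent_sum[OF p charL j assms(1) power_p_in_range assms(2,3)] .

lemma power_p_inj: "x ^ p = y ^ p \<Longrightarrow> x = (y::'l)"
  using CHAR_diff_power[OF p charL, of x y] by simp

end

subsection \<open>The residue field is a field of Laurent series\<close>

lemma fls_sum_nth: "sum f S $$ n = (\<Sum>i\<in>S. f i $$ n)"
  by (induction S rule: infinite_finite_induct) auto

text \<open>Frobenius on the coefficients with t fixed: f^p arises from it by substituting t^p for
  t.\<close>

definition fls_frob :: "nat \<Rightarrow> 'k::field fls \<Rightarrow> 'k fls" where
  "fls_frob p f = Abs_fls (\<lambda>n. (f $$ n) ^ p)"

lemma fls_frob_nth: "p > 0 \<Longrightarrow> fls_frob p f $$ n = (f $$ n) ^ p"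
  unfolding fls_frob_def by (rule nth_Abs_fls_lower_bound[of "fls_subdegree f"]) simp

locale laurent_insep = purely_insep p j for p :: nat and j :: "'k::alg_closed_field fls \<Rightarrow> 'l::field" +
  assumes char_k: "CHAR('k) = p"
begin

lemma p_pos: "p > 0" using p_gt_1 by simp

text \<open>Substitution of t^p for t is injective and turns this map into the p-th power, which is
  a homomorphism.\<close>

lemma fls_frob_homo: "ring_homo (fls_frob p :: 'k fls \<Rightarrow> _)"
proof -
  have comp: "fls_compose_power (fls_frob p f) p = f ^ p" for f :: "'k fls"
    using p_pos by (intro fls_eqI) (simp add: fls_nth_compose_power fls_frob_nth fls_power_CHAR_nth[OF p char_k])
  have inj: "f = g" if "fls_compose_power f p = fls_compose_power g p" for f g :: "'k fls"
  proof (rule fls_eqI)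
    fix n
    have "fls_compose_power f p $$ (int p * n) = fls_compose_power g p $$ (int p * n)" using that by simp
    then show "f $$ n = g $$ n" using p_pos by (simp add: fls_nth_compose_power)
  qed
  have C: "CHAR('k fls) = p" using char_k by simp
  show ?thesis
    unfolding ring_homo_def
    by (intro conjI allI; rule inj) (simp_all add: comp p_pos CHAR_power_add[OF p C] power_mult_distrib)
qed

lemma fls_frob_bij: "bij (fls_frob p :: 'k fls \<Rightarrow> _)"
proof -
  have "surj (fls_frob p :: 'k fls \<Rightarrow> _)"
    unfolding surj_def
  proof
    fix f :: "'k fls"
    have "\<exists>y. y ^ p = f $$ n" for n using nth_root_exists p_pos by blast
    then obtain g where g: "\<And>n. g n ^ p = f $$ n" by metis
    have "g n = 0" if "n < fls_subdegree f" for n using g[of n] that p_pos by simp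
    then have "Abs_fls g $$ n = g n" for n by (intro nth_Abs_fls_lower_bound) auto
    then show "\<exists>h. f = fls_frob p h"
      by (intro exI[of _ "Abs_fls g"] fls_eqI) (simp add: fls_frob_nth p_pos g)
  qed
  moreover have "inj (fls_frob p :: 'k fls \<Rightarrow> _)"
    using field_homo_inj[OF fls_frob_homo] ring_homoD(6)[OF fls_frob_homo]
    unfolding inj_def by (metis eq_iff_diff_eq_0)
  ultimately show ?thesis by (simp add: bij_def)
qed

text \<open>Subtracting a p-th power from c^p makes its order d prime to p; with u d + v p = 1, the
  u-th power of the new generator times t^v has a p-th power of order 1.\<close>

lemma root_of_uniformizer: "\<exists>z b. z ^ p = j b \<and> fls_subdegree b = 1"
proof -
  obtain c a where c: "c \<notin> range j" "c ^ p = j a" using exists_generator by blast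
  obtain g where g: "\<And>n. (a - g ^ p) $$ n = (if int p dvd n then 0 else a $$ n)"
    using fls_remove_p_part[OF p char_k] by metis
  define a' where "a' = a - g ^ p"
  have c': "(c - j g) ^ p = j a'"
    by (simp add: CHAR_diff_power[OF p charL] c a'_def ring_homoD[OF j])
  have "a' \<noteq> 0"
  proof
    assume "a' = 0"
    then have "(c - j g) ^ p = 0" using c' ring_homoD(2)[OF j] by simp
    then have "c = j g" by simp
    then show False using c(1) by blast
  qed
  then have cop: "coprime (fls_subdegree a') (int p)"
    using g by (intro fls_subdegree_non_p_part(1)[OF p char_k]) (auto simp: a'_def)
  then obtain x where "[fls_subdegree a' * x = 1] (mod int p)" using cong_solve_coprime_int by blast
  then have "[fls_subdegree a' * (x mod int p) = 1] (mod int p)" by (simp add: cong_def mod_mult_right_eq)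
  moreover define u where "u = nat (x mod int p)"
  ultimately have "int p dvd 1 - fls_subdegree a' * int u"
    using p_pos by (simp add: cong_iff_dvd_diff dvd_diff_commute)
  then obtain v where "1 - fls_subdegree a' * int u = int p * v" by (metis dvdE)
  then have uv: "int u * fls_subdegree a' + int p * v = 1" by (simp add: algebra_simps)
  have "((c - j g) ^ u * j (fls_X_intpow v)) ^ p = ((c - j g) ^ p) ^ u * j (fls_X_intpow v ^ p)"
    by (simp add: power_mult_distrib ring_homoD[OF j] mult.commute flip: power_mult)
  also have "\<dots> = j (a' ^ u * fls_X_intpow v ^ p)" unfolding c' by (simp add: ring_homoD[OF j])
  finally have "((c - j g) ^ u * j (fls_X_intpow v)) ^ p = j (a' ^ u * fls_X_intpow v ^ p)" .
  moreover have "fls_subdegree (a' ^ u * fls_X_intpow v ^ p) = 1"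
    using \<open>a' \<noteq> 0\<close> uv by (simp add: fls_subdegree_power)
  ultimately show ?thesis by blast
qed

text \<open>Converse to \<open>power_p_in_range\<close>. The base field has a uniformizer b = z^p,
  and every f is a sum of terms b^r g_r^p with r < p; each summand becomes a p-th power.\<close>

lemma j_power_p: "\<exists>x. x ^ p = j f"
proof -
  obtain z b where zb: "z ^ p = j b" "fls_subdegree b = 1" using root_of_uniformizer by blast
  obtain \<chi> :: "'k fls \<Rightarrow> 'k fls" where \<chi>: "ring_homo \<chi>" "bij \<chi>" "\<chi> fls_X = b" using fls_substitution[OF zb(2)] by blast
  obtain f' where f': "f = \<chi> f'" using \<chi>(2) by (metis bij_pointE)
  have "\<exists>g. \<forall>n. (g $$ n) ^ p = fls_shift (int r) f' $$ (int p * n)" for r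
    by (rule fls_power_CHAR_exists[OF p char_k])
  then obtain g where g: "\<And>r n. (g r $$ n) ^ p = f' $$ (int p * n + int r)" by (simp; metis)
  \<comment> \<open>The exponents are sorted by their class modulo p, and the coefficients have p-th
    roots in k.\<close>
  have "f' = (\<Sum>r<p. fls_X ^ r * g r ^ p)"
  proof (rule fls_eqI)
    fix n
    have "(fls_X ^ r * g r ^ p) $$ n = (if r = nat (n mod int p) then f' $$ n else 0)" if r: "r < p" for r
    proof -
      have "int p dvd n - int r \<longleftrightarrow> r = nat (n mod int p)"
        using r p_pos by (auto simp: mod_eq_dvd_iff[symmetric])
      moreover have "int p * ((n - int r) div int p) + int r = n" if "int p dvd n - int r" using that by simp
      ultimately show ?thesis
        using g[of r "(n - int r) div int p"]
        by (auto simp: fls_X_power_conv_shift_1 fls_shifted_times_simps fls_power_CHAR_nth[OF p char_k])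
    qed
    then have "(\<Sum>r<p. (fls_X ^ r * g r ^ p) $$ n) = (\<Sum>r<p. if r = nat (n mod int p) then f' $$ n else 0)"
      by (intro sum.cong) auto
    also have "\<dots> = f' $$ n" using p_pos by (simp add: nat_less_iff)
    finally show "f' $$ n = (\<Sum>r<p. fls_X ^ r * g r ^ p) $$ n" by (simp add: fls_sum_nth)
  qed
  then have "f = (\<Sum>r<p. b ^ r * \<chi> (g r) ^ p)"
    unfolding f' by (simp add: ring_homoD[OF \<chi>(1)] \<chi>(3))
  then have "j f = (\<Sum>r<p. (z ^ p) ^ r * j (\<chi> (g r)) ^ p)" by (simp add: ring_homoD[OF j] zb)
  also have "\<dots> = (\<Sum>r<p. (z ^ r * j (\<chi> (g r))) ^ p)"
    by (intro sum.cong refl) (simp add: power_mult_distrib mult.commute flip: power_mult)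
  also have "\<dots> = (\<Sum>r<p. z ^ r * j (\<chi> (g r))) ^ p"
    by (rule freshmans_dream_sum[symmetric]) (use p charL in auto)
  finally have "j f = (\<Sum>r<p. z ^ r * j (\<chi> (g r))) ^ p" .
  from this[symmetric] show ?thesis by blast
qed

text \<open>The extension consists of the p-th roots of the base field. Taking the p-th root of j
  (\<open>fls_frob p f\<close>) rather than of j f makes the isomorphism agree with j on
  constants.\<close>

theorem residue_field_iso:
  "\<exists>\<theta> :: 'k fls \<Rightarrow> 'l. ring_homo \<theta> \<and> bij \<theta> \<and> (\<forall>c. \<theta> (fls_const c) = j (fls_const c))"
proof -
  define J where "J = (\<lambda>f. j (fls_frob p f))"
  obtain z b where zb: "z ^ p = j b" "fls_subdegree b = 1" using root_of_uniformizer by blast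
  have "\<exists>x. x ^ p = j (fls_frob p f)" for f by (rule j_power_p)
  then obtain \<theta> where \<theta>: "\<And>f. \<theta> f ^ p = j (fls_frob p f)" by metis
  note fh = ring_homoD[OF fls_frob_homo]
  note jh = ring_homoD[OF j]
  have hom: "ring_homo \<theta>"
    unfolding ring_homo_def
    by (intro conjI allI; rule power_p_inj) (simp_all add: \<theta> CHAR_power_add[OF p charL] power_mult_distrib fh jh)
  moreover have "surj \<theta>"
    unfolding surj_def
  proof
    fix x
    obtain g where g: "x ^ p = j g" using power_p_in_range by blast
    obtain f where "g = fls_frob p f" using fls_frob_bij by (metis bij_pointE)
    then have "\<theta> f ^ p = x ^ p" using g \<theta> by simp
    then show "\<exists>f. x = \<theta> f" using power_p_inj by metis
  qed
  moreover have "inj \<theta>"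
    using field_homo_inj[OF hom] ring_homoD(6)[OF hom] unfolding inj_def by (metis eq_iff_diff_eq_0)
  moreover have "\<theta> (fls_const c) = j (fls_const c)" for c
  proof (rule power_p_inj)
    have "fls_frob p (fls_const c) = fls_const c ^ p"
      using p_pos by (intro fls_eqI) (auto simp: fls_frob_nth fls_power_CHAR_nth[OF p char_k] power_0_left elim!: dvdE)
    then show "\<theta> (fls_const c) ^ p = j (fls_const c) ^ p" by (simp add: \<theta> jh)
  qed
  ultimately show ?thesis by (auto simp: bij_def)
qed

end

section \<open>The structure of \<open>B\<close>\<close>

lemma monic_division:
  fixes F :: "'a::comm_ring_1 poly"
  assumes F: "lead_coeff F = 1" "degree F > 0"
  shows "\<exists>Q R. P = F * Q + R \<and> degree R < degree F"
proof (induction P rule: pCons_induct)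
  case 0
  then show ?case using F by (intro exI[of _ 0]) auto
next
  case (pCons a P)
  then obtain Q R where QR: "P = F * Q + R" "degree R < degree F" by blast
  define c where "c = coeff (pCons a R) (degree F)"
  define R' where "R' = pCons a R - smult c F"
  have "coeff R' i = 0" if i: "i > degree F - 1" for i
  proof (cases "i = degree F")
    case True then show ?thesis using F by (simp add: R'_def c_def)
  next
    case False
    then have "i > degree F" using i by simp
    then show ?thesis using QR(2) by (auto simp: R'_def coeff_pCons coeff_eq_0 split: nat.split)
  qed
  then have "degree R' \<le> degree F - 1" by (intro degree_le) blast
  then have "degree R' < degree F" using F(2) by simp
  moreover have "pCons a P = F * (pCons 0 Q + [:c:]) + R'"
    unfolding QR(1) R'_def by (simp add: algebra_simps)
  ultimately show ?case by blast
qed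

locale res_cover =
  fixes p :: nat
    and \<pi> :: "'r :: {complete_dvr, ring_char_0}"
    and red :: "'r \<Rightarrow> 'k :: alg_closed_field"
    and \<iota> :: "'r bilaurent \<Rightarrow> 'b :: comm_ring_1"
    and s :: "'r \<Rightarrow> 'b"
    and redB :: "'b \<Rightarrow> 'c :: field"
    and j :: "'k fls \<Rightarrow> 'c"
  assumes prime_p: "prime p"
    and unif_pi: "cdvr_uniformizer \<pi>"
    and red: "reduction_map \<pi> red" and char_k: "CHAR('k) = p"
    and iota: "ring_homo \<iota>" and fin: "finite_algebra \<iota>"
    and s_eq: "s = \<iota> \<circ> bl_const" and flat: "flat_algebra s"
    and redB: "reduction_map (s \<pi>) redB"
    and j_redB: "j (bl_reduce red a) = redB (\<iota> a)" and insep: "purely_insep_of_degree_p p j"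
begin

sublocale residue_dvr \<pi> red by standard (rule unif_pi, rule red)

lemma j_homo: "ring_homo j"
  using insep unfolding purely_insep_of_degree_p_def by simp

lemma char_c: "CHAR('c) = p"
proof -
  have "(of_nat p :: 'k fls) = 0" using char_k by (metis of_nat_CHAR semiring_char_fls)
  then have "(of_nat p :: 'c) = 0" using ring_homoD(2,8)[OF j_homo] by metis
  then have "CHAR('c) dvd p" by (simp add: of_nat_eq_0_iff_char_dvd)
  moreover have "CHAR('c) \<noteq> 1" by (metis of_nat_CHAR of_nat_1 zero_neq_one)
  ultimately show ?thesis using prime_p prime_nat_iff by metis
qed

sublocale C: laurent_insep p j
  by standard (rule prime_p, rule char_c, rule insep, rule char_k)

lemmas p_pos = C.p_pos and p_gt_1 = C.p_gt_1
lemmas iota_simps = ring_homoD[OF iota]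

lemma redB_homo: "ring_homo redB" and redB_surj: "surj redB" and redB_0: "redB x = 0 \<longleftrightarrow> s \<pi> dvd x"
  using redB unfolding reduction_map_def by auto

lemmas redB_simps = ring_homoD[OF redB_homo]

lemma s_homo: "ring_homo s"
  unfolding s_eq by (rule ring_homo_comp[OF iota bl_const_homo])

lemmas s_simps = ring_homoD[OF s_homo]

lemma s_apply: "s c = \<iota> (bl_const c)" by (simp add: s_eq)

lemma s_pi_power: "\<iota> (bl_const \<pi> ^ n) = s \<pi> ^ n"
  by (simp add: s_apply iota_simps)

text \<open>Flatness applied to the single relation \<pi> x = 0: the coefficients it provides are
  killed by \<pi> in the domain R.\<close>

lemma s_torsion_free:
  assumes "s \<pi> * x = 0" shows "x = 0"
proof -
  have "(\<Sum>i<1::nat. s ((\<lambda>_. \<pi>) i) * (\<lambda>_. x) i) = 0" using assms by simp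
  then obtain m :: nat and a c where ac: "\<forall>i<1::nat. x = (\<Sum>j<m. s (a i j) * c j)"
      "\<forall>j<m. (\<Sum>i<1::nat. \<pi> * a i j) = 0"
    using flat unfolding flat_algebra_def by meson
  have "a 0 j = 0" if "j < m" for j using ac(2) that R.mult_eq_0 R.pi_nz by simp
  then show ?thesis using ac(1) by (simp add: s_simps)
qed

lemma s_torsion_free_power: "s \<pi> ^ n * x = 0 \<Longrightarrow> x = 0"
  by (induction n) (auto dest: s_torsion_free simp: mult.assoc)

text \<open>Since the residue field extension has degree \<open>p\<close>, \<open>W\<close> generates \<open>B\<close> over \<open>A\<close>.\<close>

definition gen :: "'b \<Rightarrow> bool" where "gen W \<longleftrightarrow> redB W \<notin> range j"

definition lin :: "'b \<Rightarrow> (nat \<Rightarrow> 'r bilaurent) \<Rightarrow> 'b" where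
  "lin W a = (\<Sum>i<p. \<iota> (a i) * W ^ i)"

lemma lin_add: "lin W (\<lambda>i. a i + c i) = lin W a + lin W c"
  by (simp add: lin_def iota_simps algebra_simps sum.distrib)

lemma lin_diff: "lin W (\<lambda>i. a i - c i) = lin W a - lin W c"
  by (simp add: lin_def iota_simps algebra_simps sum_subtractf)

lemma lin_scale: "lin W (\<lambda>i. x * a i) = \<iota> x * lin W a"
  by (simp add: lin_def iota_simps sum_distrib_left mult.assoc)

lemma lin_single: "i < p \<Longrightarrow> lin W (\<lambda>l. if l = i then x else 0) = \<iota> x * W ^ i"
proof -
  assume i: "i < p"
  have "lin W (\<lambda>l. if l = i then x else 0) = (\<Sum>l<p. if l = i then \<iota> x * W ^ i else 0)"
    unfolding lin_def by (intro sum.cong) (auto simp: iota_simps)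
  then show ?thesis using i by simp
qed

text \<open>By induction \<pi>^n divides all coefficients: divide the relation by \<pi>^n, reduce
  it, and use independence over the residue field. A is separated.\<close>

lemma lin_indep:
  assumes W: "gen W" and 0: "lin W a = 0" and i: "i < p"
  shows "a i = 0"
proof -
  have "\<forall>i<p. bl_const \<pi> ^ n dvd a i" for n
  proof (induction n)
    case (Suc n)
    then have "\<forall>i. \<exists>c. i < p \<longrightarrow> a i = bl_const \<pi> ^ n * c" by (auto simp: dvd_def)
    then obtain c where c: "\<And>i. i < p \<Longrightarrow> a i = bl_const \<pi> ^ n * c i" by metis
    have "lin W a = lin W (\<lambda>i. bl_const \<pi> ^ n * c i)"
      unfolding lin_def using c by (intro sum.cong) auto
    then have "s \<pi> ^ n * lin W c = 0" using 0 by (simp add: lin_scale s_pi_power)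
    then have "redB (lin W c) = 0" using s_torsion_free_power redB_simps(2) by metis
    then have "(\<Sum>i<p. j (bl_reduce red (c i)) * redB W ^ i) = 0"
      by (simp add: lin_def redB_simps j_redB)
    then have "bl_reduce red (c i) = 0" if "i < p" for i
      using C.basis_independent[of "redB W" "\<lambda>i. bl_reduce red (c i)"] W that unfolding gen_def by blast
    then have "bl_const \<pi> dvd c i" if "i < p" for i using that bl_reduce_eq_0_iff by blast
    then show ?case using c by (auto simp: mult.commute[of "bl_const \<pi>"] intro!: mult_dvd_mono)
  qed simp
  then show ?thesis using A.separated i by blast
qed

text \<open>A finite generating set of B is added to N, and its elements are then discarded one at a
  time; only B has to be finitely generated.\<close>

lemma nakayama:
  assumes N: "module.subspace (alg_scale \<iota>) N" and cover: "\<And>b. \<exists>n\<in>N. s \<pi> dvd b - n"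
  shows "N = UNIV"
proof -
  interpret M: module "alg_scale \<iota>"
    by unfold_locales (simp_all add: alg_scale_def iota_simps algebra_simps)
  have step: "M.span (T \<union> N) = UNIV \<longrightarrow> N = UNIV" if "finite T" for T
    using that
  proof (induction T rule: finite_induct)
    case empty
    have "M.span N = N" using N by (simp only: M.span_eq_iff)
    then show ?case unfolding Un_empty_left by metis
  next
    case (insert g T)
    show ?case
    proof
      assume U: "M.span (insert g T \<union> N) = UNIV"
      obtain n b where n: "n \<in> N" "g - n = s \<pi> * b" using cover[of g] by (auto simp: dvd_def)
      have "b \<in> M.span (insert g (T \<union> N))" using U by simp
      then obtain k where k: "b - alg_scale \<iota> k g \<in> M.span (T \<union> N)"
        unfolding M.span_breakdown_eq by blast
      \<comment> \<open>Solving g = n + \<pi> b for g, where b is k g modulo the span without g,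
        leaves the factor 1 - \<pi> k, a unit as A is local.\<close>
      define u where "u = 1 - bl_const \<pi> * k"
      have "\<not> bl_const \<pi> dvd u"
        unfolding u_def using A.pi_nonunit by (metis diff_add_cancel dvd_add dvd_triv_left)
      then obtain u' where u': "u' * u = 1" using A.unit_iff by (metis dvdE mult.commute)
      have "\<iota> u * g = n + s \<pi> * (b - alg_scale \<iota> k g)"
        using n(2) by (simp add: u_def iota_simps alg_scale_def s_apply algebra_simps)
      also have "\<dots> = n + alg_scale \<iota> (bl_const \<pi>) (b - alg_scale \<iota> k g)"
        by (simp add: alg_scale_def s_apply)
      also have "\<dots> \<in> M.span (T \<union> N)"
        by (intro M.span_add M.span_scale k) (use n(1) M.span_base in blast)
      finally have "alg_scale \<iota> u' (\<iota> u * g) \<in> M.span (T \<union> N)" by (rule M.span_scale)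
      moreover have "alg_scale \<iota> u' (\<iota> u * g) = g"
        unfolding alg_scale_def mult.assoc[symmetric] iota_simps(4)[symmetric] u' by (simp add: iota_simps)
      ultimately have "g \<in> M.span (T \<union> N)" by simp
      then have "M.span (insert g T \<union> N) \<subseteq> M.span (T \<union> N)"
        by (intro M.span_minimal M.subspace_span) (auto intro: M.span_base)
      then show "N = UNIV" using insert.IH U by auto
    qed
  qed
  obtain S where "finite S" "M.span S = UNIV" using fin unfolding finite_algebra_def by blast
  then show ?thesis using step[of S] M.span_mono[of S "S \<union> N"] by auto
qed

lemma lin_surj:
  assumes W: "gen W" shows "\<exists>a. b = lin W a"
proof -
  interpret M: module "alg_scale \<iota>"
    by unfold_locales (simp_all add: alg_scale_def iota_simps algebra_simps)
  have "range (lin W) = UNIV"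
  proof (rule nakayama)
    show "M.subspace (range (lin W))"
      unfolding M.subspace_def
    proof safe
      show "0 \<in> range (lin W)" by (rule range_eqI[of _ _ "\<lambda>_. 0"]) (simp add: lin_def iota_simps)
      fix a c x
      show "lin W a + lin W c \<in> range (lin W)" unfolding lin_add[symmetric] by blast
      show "alg_scale \<iota> x (lin W a) \<in> range (lin W)"
        unfolding alg_scale_def lin_scale[symmetric] by blast
    qed
    fix b
    obtain c where c: "redB b = (\<Sum>i<p. j (c i) * redB W ^ i)"
      using C.basis[of "redB W"] W unfolding gen_def by metis
    have "\<exists>f. bl_reduce red f = g" for g using bl_reduction_map unfolding reduction_map_def surj_def by metis
    then have "\<forall>i. \<exists>f. bl_reduce red f = c i" by blast
    from choice[OF this] obtain a where a: "\<And>i. bl_reduce red (a i) = c i" by blast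
    have "redB (lin W a) = redB b" by (simp add: lin_def redB_simps j_redB[symmetric] a c)
    then have "redB (b - lin W a) = 0" by (simp add: redB_simps)
    then show "\<exists>n\<in>range (lin W). s \<pi> dvd b - n" using redB_0 by blast
  qed
  then show ?thesis by blast
qed

text \<open>Coordinates in the basis 1, W, ..., W^(p-1). Only the values at indices below p are
  determined, which is why the lemmas about them carry i < p.\<close>

definition co :: "'b \<Rightarrow> 'b \<Rightarrow> nat \<Rightarrow> 'r bilaurent" where
  "co W b = (SOME a. b = lin W a)"

lemma lin_co: "gen W \<Longrightarrow> lin W (co W b) = b"
  unfolding co_def using someI_ex[OF lin_surj] by metis

lemma co_eq: 
  assumes "gen W" "b = lin W a" "i < p" shows "co W b i = a i"
proof -
  have "lin W (\<lambda>i. co W b i - a i) = 0" by (simp add: lin_diff lin_co assms)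
  from lin_indep[OF assms(1) this assms(3)] show ?thesis by simp
qed

lemma gen_exists: "\<exists>W. gen W"
proof -
  obtain c where "c \<notin> range j" using C.exists_generator by blast
  moreover obtain W where "redB W = c" using redB_surj by (metis surj_def)
  ultimately show ?thesis unfolding gen_def by blast
qed

lemma dvd_co:
  assumes W: "gen W" shows "s \<pi> ^ n dvd b \<longleftrightarrow> (\<forall>i<p. bl_const \<pi> ^ n dvd co W b i)"
proof
  assume "s \<pi> ^ n dvd b"
  then obtain c where "b = s \<pi> ^ n * c" by (metis dvdE)
  then have "b = lin W (\<lambda>i. bl_const \<pi> ^ n * co W c i)"
    by (simp add: lin_scale lin_co[OF W] s_pi_power)
  then show "\<forall>i<p. bl_const \<pi> ^ n dvd co W b i" using co_eq[OF W] by simp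
next
  assume "\<forall>i<p. bl_const \<pi> ^ n dvd co W b i"
  then have "\<forall>i. \<exists>c. i < p \<longrightarrow> co W b i = bl_const \<pi> ^ n * c" by (auto simp: dvd_def)
  then obtain c where c: "\<And>i. i < p \<Longrightarrow> co W b i = bl_const \<pi> ^ n * c i" by metis
  have "b = lin W (co W b)" by (simp add: lin_co[OF W])
  also have "\<dots> = lin W (\<lambda>i. bl_const \<pi> ^ n * c i)" unfolding lin_def using c by (intro sum.cong) auto
  also have "\<dots> = s \<pi> ^ n * lin W c" by (simp add: lin_scale s_pi_power)
  finally show "s \<pi> ^ n dvd b" by simp
qed

lemma co_diff: "gen W \<Longrightarrow> i < p \<Longrightarrow> co W (b - c) i = co W b i - co W c i"
  by (rule co_eq) (simp_all add: lin_diff lin_co)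

text \<open>Separatedness and limits are read off coordinatewise from A. This is also the point
  where B becomes a domain.\<close>

lemma cdvr_B: "cdvr_uniformizer (s \<pi>)"
proof (rule cdvr_uniformizerI[OF redB])
  obtain W where W: "gen W" using gen_exists by blast
  show "x = 0" if "s \<pi> * x = 0" for x using s_torsion_free that .
  show "x = 0" if x: "\<And>N. s \<pi> ^ N dvd x" for x
  proof -
    have "co W x i = 0" if "i < p" for i
      using x that unfolding dvd_co[OF W] by (intro A.separated) blast
    then have "lin W (co W x) = 0" by (simp add: lin_def iota_simps)
    then show ?thesis using lin_co[OF W] by simp
  qed
  fix t assume t: "\<And>n. s \<pi> ^ n dvd t (Suc n) - t n"
  have "\<exists>l. i < p \<longrightarrow> (\<forall>n. bl_const \<pi> ^ n dvd l - co W (t n) i)" for i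
  proof (cases "i < p")
    case True
    have "bl_const \<pi> ^ n dvd co W (t (Suc n)) i - co W (t n) i" for n
      using t[of n] True unfolding dvd_co[OF W] by (simp add: co_diff[OF W])
    then show ?thesis using A.limit[of "\<lambda>n. co W (t n) i"] by blast
  qed simp
  then obtain l where l: "\<And>i n. i < p \<Longrightarrow> bl_const \<pi> ^ n dvd l i - co W (t n) i" by metis
  have "s \<pi> ^ n dvd lin W l - t n" for n
    unfolding dvd_co[OF W] using l by (simp add: co_diff[OF W] co_eq[OF W refl])
  then show "\<exists>l. \<forall>n. s \<pi> ^ n dvd l - t n" by blast
qed

sublocale residue_dvr_alg \<pi> red "s \<pi>"
  by unfold_locales (rule cdvr_B)

sublocale B: cdvr_p "s \<pi>" p
proof
  have "redB (of_nat p) = 0" using char_c by (simp add: redB_simps) (metis of_nat_CHAR)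
  then show "s \<pi> dvd of_nat p" using redB_0 by blast
qed (rule prime_p)

sublocale R: cdvr_p \<pi> p
proof
  have "red (of_nat p) = of_nat p" by (rule ring_homoD(8)) (use red in \<open>simp add: reduction_map_def\<close>)
  then have "red (of_nat p) = 0" using char_k by (metis of_nat_CHAR)
  then show "\<pi> dvd of_nat p" using red_eq_0_iff by blast
qed (rule prime_p)

lemma s_dvd_iff: "s \<pi> ^ n dvd s x \<longleftrightarrow> \<pi> ^ n dvd x"
proof (cases "x = 0")
  case False
  then obtain u k where u: "u dvd 1" "x = u * \<pi> ^ k" using R.unit_times_power by blast
  have "s u dvd 1" using ring_homo_dvd[OF s_homo u(1)] by (simp add: s_simps)
  then show ?thesis using B.dvd_unit_power R.dvd_unit_power u by (simp add: s_simps)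
qed (simp add: s_simps)

lemma iota_inj: "\<iota> x = 0 \<longleftrightarrow> x = 0"
proof
  assume "\<iota> x = 0"
  obtain W where W: "gen W" using gen_exists by blast
  have "lin W (\<lambda>l. if l = 0 then x else 0) = 0" using lin_single[of 0 W x] p_pos \<open>\<iota> x = 0\<close> by simp
  from lin_indep[OF W this p_pos] show "x = 0" by simp
qed (simp add: iota_simps)

lemma s_inj: "s x = 0 \<longleftrightarrow> x = 0"
proof
  assume "s x = 0"
  then have "bl_const x = 0" by (simp add: s_apply iota_inj)
  then have "bl_nth (bl_const x) 0 = bl_nth 0 0" by simp
  then show "x = 0" by simp
qed (simp add: s_simps)

lemma iota_unit: "\<iota> a dvd 1 \<longleftrightarrow> a dvd 1"
proof
  assume "\<iota> a dvd 1"
  then have "\<not> s \<pi> dvd \<iota> a" using B.unit_iff by blast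
  then have "\<not> bl_const \<pi> dvd a" using ring_homo_dvd[OF iota] s_apply by metis
  then show "a dvd 1" using A.unit_iff by blast
qed (use ring_homo_dvd[OF iota, of a 1] iota_simps in simp)

subsection \<open>Presentations\<close>

text \<open>A polynomial killing W leaves on division by the monic F a remainder of degree below p,
  and the powers of W below p are independent.\<close>

lemma presentsI:
  assumes W: "gen W" and F: "lead_coeff F = 1" "degree F = p" "poly (map_poly \<iota> F) W = 0"
  shows "presents \<iota> F W"
  unfolding presents_def
proof safe
  fix b
  define P where "P = (\<Sum>i<p. monom (co W b i) i)"
  have d: "degree P < p" unfolding P_def using p_pos degree_sum_monom by blast
  have "poly (map_poly \<iota> P) W = lin W (co W b)"
    unfolding poly_map_poly_sum[OF iota d] lin_def by (intro sum.cong) (auto simp: P_def coeff_sum_monom)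
  then show "\<exists>P. b = poly (map_poly \<iota> P) W" using lin_co[OF W] by metis
next
  note h = ring_homoD[OF map_poly_homo[OF iota]]
  fix P
  {
    assume P: "poly (map_poly \<iota> P) W = 0"
    obtain Q R where QR: "P = F * Q + R" "degree R < p" using monic_division[of F P] F p_pos by auto
    then have "poly (map_poly \<iota> R) W = 0" using P F(3) by (simp add: h)
    then have "lin W (coeff R) = 0" using poly_map_poly_sum[OF iota QR(2)] by (simp add: lin_def)
    then have "coeff R i = 0" for i
      using lin_indep[OF W] QR(2) by (cases "i < p") (auto simp: coeff_eq_0)
    then have "R = 0" by (intro poly_eqI) simp
    then show "F dvd P" using QR by simp
  }
  assume "F dvd P"
  then show "poly (map_poly \<iota> P) W = 0" using F(3) by (auto elim!: dvdE simp: h)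
qed

lemma presents_imp_gen:
  assumes "presents \<iota> F W" shows "gen W"
proof (rule ccontr)
  assume "\<not> gen W"
  then obtain g where g: "redB W = j g" unfolding gen_def by blast
  have "redB b \<in> range j" for b
  proof -
    obtain P where "b = poly (map_poly \<iota> P) W" using assms unfolding presents_def by blast
    then have "b = (\<Sum>i<Suc (degree P). \<iota> (coeff P i) * W ^ i)"
      using poly_map_poly_sum[OF iota, of P "Suc (degree P)"] by simp
    then have "redB b = j (\<Sum>i<Suc (degree P). bl_reduce red (coeff P i) * g ^ i)"
      by (simp only: redB_simps j_redB[symmetric] g ring_homoD[OF j_homo])
    then show ?thesis by blast
  qed
  moreover obtain c where "c \<notin> range j" using C.exists_generator by blast
  ultimately show False using redB_surj by (metis surj_def)
qed

lemma gen_iff_power: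
  assumes "redB y ^ p = j u"
  shows "gen y \<longleftrightarrow> u \<notin> range (\<lambda>f. f ^ p)"
proof -
  have "redB y = j f \<longleftrightarrow> u = f ^ p" for f
  proof -
    have "redB y = j f \<longleftrightarrow> redB y ^ p = j f ^ p" using C.power_p_inj by metis
    also have "\<dots> \<longleftrightarrow> j (u - f ^ p) = 0" unfolding assms by (simp add: ring_homoD[OF j_homo])
    finally show ?thesis by (simp add: field_homo_inj[OF j_homo])
  qed
  then show ?thesis unfolding gen_def by auto
qed

subsection \<open>The residue field and parameters\<close>

text \<open>\<open>is_parameterI\<close> wants Z^p congruent to a power series in T without constant
  term. The p-th power of the residue of Z is j h; under the identification of residue fields j h
  becomes t^p, and as homomorphisms multiply orders by a nonnegative factor, h has positive
  order.\<close>

lemma is_parameter_of_iso: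
  assumes \<theta>: "ring_homo \<theta>" "bij \<theta>" "\<And>c. \<theta> (fls_const c) = j (fls_const c)"
    and Z: "redB Z = \<theta> fls_X"
  shows "is_parameter s Z"
proof -
  define r where "r = Hilbert_Choice.inv \<theta> \<circ> redB"
  have inj: "inj \<theta>" using \<theta>(2) by (simp add: bij_def)
  have ih: "ring_homo (Hilbert_Choice.inv \<theta>)" by (rule ring_homo_inv[OF \<theta>(1,2)])
  have i0: "Hilbert_Choice.inv \<theta> x = 0 \<longleftrightarrow> x = 0" for x by (rule field_homo_inj[OF ih])
  have r: "reduction_map (s \<pi>) r"
    unfolding reduction_map_def
  proof (intro conjI allI)
    show "ring_homo r" unfolding r_def by (rule ring_homo_comp[OF ih redB_homo])
    show "surj r" unfolding r_def using redB_surj \<theta>(2) by (intro comp_surj) (auto simp: bij_imp_bij_inv bij_is_surj)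
    show "r x = 0 \<longleftrightarrow> s \<pi> dvd x" for x by (simp add: r_def i0 redB_0)
  qed
  have rs: "r (s c) = fls_const (red c)" for c
    by (simp add: r_def s_apply j_redB[symmetric] bl_reduce_const \<theta>(3)[symmetric] inv_f_f[OF inj])
  have rZ: "r Z = fls_X" by (simp add: r_def Z inv_f_f[OF inj])
  obtain h where h: "redB Z ^ p = j h" using C.power_p_in_range by blast
  define J where "J = Hilbert_Choice.inv \<theta> \<circ> j"
  have J: "ring_homo J" unfolding J_def by (rule ring_homo_comp[OF ih j_homo])
  have Jh: "J h = fls_X ^ p"
    unfolding J_def using h[symmetric] by (simp add: Z ring_homoD[OF ih] inv_f_f[OF inj])
  have "h \<noteq> 0"
  proof
    assume "h = 0"
    then have "(fls_X ^ p :: 'k fls) = 0" using Jh by (simp add: ring_homoD[OF J])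
    then show False by simp
  qed
  then have "fls_subdegree (J h) = fls_subdegree h * fls_subdegree (J fls_X)"
    by (rule fls_hom_subdegree[OF prime_p char_k J])
  then have "fls_subdegree h * fls_subdegree (J fls_X) = int p"
    unfolding Jh by (simp add: fls_subdegree_power)
  then have "0 < fls_subdegree h * fls_subdegree (J fls_X)" using p_pos by simp
  then have "0 < fls_subdegree h"
    using fls_hom_X_nonneg[OF prime_p char_k J] by (simp add: zero_less_mult_iff)
  then obtain f where f: "bl_reduce red f = h" "\<And>i. i < 1 \<Longrightarrow> bl_nth f i = 0"
    using bl_lift_exists[of 1 h] by auto
  define H where "H = Abs_fps (\<lambda>n. bl_nth f (int n))"
  have Hf: "bl_of_fps H = f" by (rule bl_eqI) (simp add: bl_of_fps.rep_eq H_def f(2))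
  show ?thesis
  proof (rule is_parameterI[OF prime_p char_k red iota s_eq _ r rs rZ])
    show "H $ 0 = 0" by (simp add: H_def f(2))
    have "redB (Z ^ p - \<iota> (bl_of_fps H)) = 0" by (simp add: redB_simps h Hf j_redB[symmetric] f(1))
    then show "s \<pi> dvd Z ^ p - \<iota> (bl_of_fps H)" using redB_0 by blast
  qed simp
qed

definition theta :: "'k fls \<Rightarrow> 'c" where
  "theta = (SOME \<theta>. ring_homo \<theta> \<and> bij \<theta> \<and> (\<forall>c. \<theta> (fls_const c) = j (fls_const c)))"

lemma theta: "ring_homo theta" "bij theta" "theta (fls_const c) = j (fls_const c)"
  using someI_ex[OF C.residue_field_iso] unfolding theta_def by blast+

definition r :: "'b \<Rightarrow> 'k fls" where "r = Hilbert_Choice.inv theta \<circ> redB"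

lemma theta_r: "theta (r x) = redB x"
  using theta(2) by (simp add: r_def bij_is_surj surj_f_inv_f)

lemma theta_inj: "theta x = theta y \<longleftrightarrow> x = y"
  using theta(2) by (meson bij_is_inj injD)

lemma r_homo: "ring_homo r"
  unfolding r_def by (rule ring_homo_comp[OF ring_homo_inv[OF theta(1,2)] redB_homo])

lemmas r_simps = ring_homoD[OF r_homo]

lemma r_0: "r x = 0 \<longleftrightarrow> s \<pi> dvd x"
proof -
  have "r x = 0 \<longleftrightarrow> theta (r x) = theta 0" using theta_inj by metis
  then show ?thesis unfolding theta_r by (simp add: ring_homoD[OF theta(1)] redB_0)
qed

lemma r_eq_iff: "r x = r y \<longleftrightarrow> s \<pi> dvd x - y"
  using r_0[of "x - y"] by (simp add: r_simps)

lemma r_surj: "\<exists>x. r x = f"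
proof -
  obtain x where "redB x = theta f" using redB_surj by (metis surj_def)
  then show ?thesis using theta_inj theta_r by metis
qed

lemma r_unit: "x dvd 1 \<longleftrightarrow> r x \<noteq> 0"
  using B.unit_iff r_0 by simp

lemma is_parameter_of_subdegree:
  assumes "fls_subdegree (r Z) = 1"
  shows "is_parameter s Z"
proof -
  obtain \<chi> :: "'k fls \<Rightarrow> 'k fls" where \<chi>: "ring_homo \<chi>" "bij \<chi>" "\<chi> fls_X = r Z"
    "\<And>c. \<chi> (fls_const c) = fls_const c"
    using fls_substitution[OF assms] by blast
  show ?thesis
    by (rule is_parameter_of_iso[of "theta \<circ> \<chi>"])
      (use \<chi> theta in \<open>simp_all add: ring_homo_comp bij_comp theta_r\<close>)
qed

lemma r_power_p: "\<exists>a. r x ^ p = r (\<iota> a)"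
proof -
  obtain f where f: "redB x ^ p = j f" using C.power_p_in_range by blast
  obtain a where a: "bl_reduce red a = f" using bl_reduction_map unfolding reduction_map_def surj_def by metis
  have "theta (r x ^ p) = theta (r (\<iota> a))"
    by (simp only: ring_homoD[OF theta(1)] theta_r f a j_redB[symmetric])
  then show ?thesis using theta_inj by blast
qed

text \<open>Let e be the order of the image of t. Some h has image t^p, so e divides p; and j t is a
  p-th power, so p divides e. Hence e = p.\<close>

lemma r_iota_subdegree:
  assumes "bl_reduce red a \<noteq> 0"
  shows "fls_subdegree (r (\<iota> a)) = int p * fls_subdegree (bl_reduce red a)"
proof -
  define J where "J = Hilbert_Choice.inv theta \<circ> j"
  have J: "ring_homo J" unfolding J_def by (rule ring_homo_comp[OF ring_homo_inv[OF theta(1,2)] j_homo])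
  have Jr: "J (bl_reduce red a) = r (\<iota> a)" for a by (simp add: J_def r_def j_redB)
  have tJ: "theta (J f) = j f" for f
    using theta(2) by (simp add: J_def bij_is_surj surj_f_inv_f)
  note sub = fls_hom_subdegree[OF prime_p char_k J]
  have nz: "J f \<noteq> 0" if "f \<noteq> 0" for f using field_homo_inj[OF J] that by blast
  obtain x where x: "r x = fls_X" using r_surj by blast
  obtain h where h: "r x ^ p = r (\<iota> h)" using r_power_p by blast
  have Jh: "J (bl_reduce red h) = fls_X ^ p" using h x Jr by simp
  have "bl_reduce red h \<noteq> 0" using Jh ring_homoD(2)[OF J] by (metis fls_X_nonzero power_not_zero)
  from sub[OF this] have 1: "fls_subdegree (bl_reduce red h) * fls_subdegree (J fls_X) = int p"
    unfolding Jh by (simp add: fls_subdegree_power)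
  obtain y where y: "y ^ p = j fls_X" using C.j_power_p by blast
  obtain g where g: "theta g = y" using theta(2) by (metis bij_pointE)
  have "theta (g ^ p) = theta (J fls_X)" by (simp add: ring_homoD[OF theta(1)] g y tJ)
  then have "J fls_X = g ^ p" using theta_inj by simp
  then have "int p dvd fls_subdegree (J fls_X)" by (simp add: fls_subdegree_power)
  then have "fls_subdegree (J fls_X) = int p"
    using 1 fls_hom_X_nonneg[OF prime_p char_k J] p_pos by (metis dvd_triv_right zdvd_antisym_nonneg of_nat_0_le_iff)
  then show ?thesis using sub[OF assms] by (simp add: Jr)
qed

end

section \<open>Roots of unity\<close>

text \<open>Two monic polynomials of degree p agree at p distinct points. The argument y may itself
  be a polynomial, which turns the identity into the factorisations needed for both group
  schemes.\<close>

lemma root_of_unity_prod: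
  fixes \<omega> y :: "'a::idom"
  assumes p: "p > 0" and w: "\<omega> ^ p = 1" "\<And>i. 0 < i \<Longrightarrow> i < p \<Longrightarrow> \<omega> ^ i \<noteq> 1"
  shows "y ^ p - 1 = (\<Prod>i<p. y - \<omega> ^ i)"
proof -
  have w0: "\<omega> \<noteq> 0" using w(1) p by (auto simp: zero_power)
  have inj: "inj_on (\<lambda>i. \<omega> ^ i) {..<p}"
  proof (rule linorder_inj_onI')
    fix m n assume mn: "m \<in> {..<p}" "n \<in> {..<p}" "m < n"
    show "\<omega> ^ m \<noteq> \<omega> ^ n"
    proof
      assume "\<omega> ^ m = \<omega> ^ n"
      moreover have "\<omega> ^ m * \<omega> ^ (n - m) = \<omega> ^ n" using mn(3) by (simp flip: power_add)
      ultimately have "\<omega> ^ m * \<omega> ^ (n - m) = \<omega> ^ m * 1" by simp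
      then have "\<omega> ^ (n - m) = 1" using w0 by simp
      moreover have "0 < n - m" "n - m < p" using mn by auto
      ultimately show False using w(2) by blast
    qed
  qed
  define F where "F = (monom 1 p - 1 :: 'a poly)"
  define P where "P = (\<Prod>i<p. [:- (\<omega> ^ i), 1:])"
  have deg: "degree P = p" unfolding P_def by (subst degree_prod_eq_sum_degree) auto
  have lead: "lead_coeff P = 1" unfolding P_def by (simp add: lead_coeff_prod)
  have F1: "coeff F i = (if i = p then 1 else if i = 0 then - 1 else 0)" for i
    using p by (auto simp: F_def)
  have "degree (F - P) \<le> p - 1"
  proof (rule degree_le, safe)
    fix i assume i: "p - 1 < i"
    show "coeff (F - P) i = 0"
      using i deg lead p by (cases "i = p") (auto simp: F1 coeff_eq_0)
  qed
  then have d: "degree (F - P) < p" using p by simp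
  have "F - P = 0"
  proof (rule ccontr)
    assume nz: "F - P \<noteq> 0"
    have "(\<lambda>i. \<omega> ^ i) ` {..<p} \<subseteq> {x. poly (F - P) x = 0}"
    proof safe
      fix i assume i: "i < p"
      have "poly F (\<omega> ^ i) = 0" by (simp add: F_def poly_monom power_commutes w(1) flip: power_mult) (simp add: mult.commute[of i] power_mult w(1))
      moreover have "poly P (\<omega> ^ i) = 0" unfolding P_def poly_prod using i by (intro prod_zero) auto
      ultimately show "poly (F - P) (\<omega> ^ i) = 0" by simp
    qed
    then have "card ((\<lambda>i. \<omega> ^ i) ` {..<p}) \<le> card {x. poly (F - P) x = 0}"
      using nz by (intro card_mono poly_roots_finite)
    also have "\<dots> \<le> degree (F - P)" by (rule card_poly_roots_bound[OF nz])
    finally show False using d by (simp add: card_image[OF inj])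
  qed
  then have "poly F y = poly P y" by simp
  then show ?thesis by (simp add: F_def P_def poly_monom poly_prod)
qed

text \<open>Divide x^p - 1 by x - 1 and evaluate at 1. This factorisation of p is the source of the
  formula for the different.\<close>

lemma root_of_unity_prod_pred:
  fixes \<omega> :: "'a::{idom, ring_char_0}"
  assumes p: "p > 0" and w: "\<omega> ^ p = 1" "\<And>i. 0 < i \<Longrightarrow> i < p \<Longrightarrow> \<omega> ^ i \<noteq> 1"
  shows "(\<Prod>i\<in>{0<..<p}. 1 - \<omega> ^ i) = of_nat p"
proof -
  define X where "X = (monom 1 1 :: 'a poly)"
  have "X ^ p - 1 = (\<Prod>i<p. X - [:\<omega>:] ^ i)"
    by (rule root_of_unity_prod[OF p]) (use w in \<open>auto simp: poly_const_pow one_pCons\<close>)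
  also have "{..<p} = insert 0 {0<..<p}" using p by auto
  also have "(\<Prod>i\<in>insert 0 {0<..<p}. X - [:\<omega>:] ^ i) = (X - 1) * (\<Prod>i\<in>{0<..<p}. X - [:\<omega>:] ^ i)"
    by simp
  also have "X ^ p - 1 = (X - 1) * (\<Sum>i<p. X ^ i)" by (rule power_diff_1_eq)
  finally have "(\<Sum>i<p. X ^ i) = (\<Prod>i\<in>{0<..<p}. X - [:\<omega>:] ^ i)"
  proof -
    assume *: "(X - 1) * (\<Sum>i<p. X ^ i) = (X - 1) * (\<Prod>i\<in>{0<..<p}. X - [:\<omega>:] ^ i)"
    have "coeff (X - 1) 1 = 1" by (simp add: X_def)
    then have "X - 1 \<noteq> 0" by auto
    then show ?thesis using * by simp
  qed
  then have "poly (\<Sum>i<p. X ^ i) 1 = poly (\<Prod>i\<in>{0<..<p}. X - [:\<omega>:] ^ i) 1" by simp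
  then show ?thesis by (simp add: X_def poly_sum poly_prod poly_monom poly_const_pow)
qed

section \<open>The Galois action\<close>

lemma comp_group_pow: "x [^]\<^bsub>comp_group G\<^esub> (n::nat) = x ^^ n"
  by (induction n) (auto simp: comp_group_def nat_pow_def funpow_swap1 fun_eq_iff)

locale cover = res_cover p \<pi> red \<iota> s redB j
  for p :: nat
    and \<pi> :: "'r :: {complete_dvr, ring_char_0}"
    and red :: "'r \<Rightarrow> 'k :: alg_closed_field"
    and \<iota> :: "'r bilaurent \<Rightarrow> 'b :: comm_ring_1"
    and s :: "'r \<Rightarrow> 'b"
    and redB :: "'b \<Rightarrow> 'c :: field"
    and j :: "'k fls \<Rightarrow> 'c" +
  fixes \<zeta> :: 'r and G :: "('b \<Rightarrow> 'b) set"
  assumes zeta_p: "\<zeta> ^ p = 1" and zeta_prim: "\<forall>i\<in>{0<..<p}. \<zeta> ^ i \<noteq> 1"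
    and G_auto: "\<forall>\<sigma>\<in>G. ring_auto \<sigma>" and G_group: "group (comp_group G)"
    and G_cyclic: "cyclic_group (comp_group G)" and card_G: "card G = p"
    and fixed: "range \<iota> = {b. \<forall>\<sigma>\<in>G. \<sigma> b = b}"
begin

abbreviation z :: 'b where "z \<equiv> s \<zeta>"

lemma z_p: "z ^ p = 1" by (simp add: zeta_p s_simps flip: s_simps(7))

lemma z_power_eq_1: "z ^ i = 1 \<longleftrightarrow> p dvd i"
proof -
  have "z ^ i = (z ^ p) ^ (i div p) * z ^ (i mod p)"
    by (simp flip: power_mult power_add)
  then have "z ^ i = z ^ (i mod p)" by (simp add: z_p)
  moreover have "z ^ (i mod p) = 1 \<longleftrightarrow> i mod p = 0"
  proof
    assume "z ^ (i mod p) = 1"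
    then have "s (\<zeta> ^ (i mod p) - 1) = 0" by (simp add: s_simps)
    then have "\<zeta> ^ (i mod p) = 1" using s_inj by simp
    then show "i mod p = 0" using zeta_prim p_pos by (metis gr0I greaterThanLessThan_iff mod_less_divisor)
  qed simp
  ultimately show ?thesis by (simp add: dvd_eq_mod_eq_0)
qed

lemma z_unit: "z ^ i dvd 1"
proof (rule B.unit_power)
  have "z * z ^ (p - 1) = 1" using z_p p_pos by (metis power_eq_if less_numeral_extra(3))
  then show "z dvd 1" by (metis dvdI)
qed

lemma zeta_cong: "\<pi> dvd \<zeta> ^ i - 1"
proof -
  have C: "CHAR('k) = p" by (rule char_k)
  have "(red \<zeta> - 1) ^ p = red (\<zeta> ^ p) - 1" by (simp add: CHAR_diff_power[OF prime_p C])
  then have "red \<zeta> = 1" by (simp add: zeta_p)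
  then have "red (\<zeta> ^ i) = red 1" by simp
  then show ?thesis using red_eq_iff by blast
qed

lemma redB_z: "redB z = 1"
proof -
  have "s \<pi> dvd s (\<zeta> ^ 1 - 1)" using zeta_cong ring_homo_dvd[OF s_homo] by blast
  then have "redB (z - 1) = 0" using redB_0 by (simp add: s_simps)
  then show ?thesis by (simp add: redB_simps)
qed

lemma G_homo: "\<sigma> \<in> G \<Longrightarrow> ring_homo \<sigma>" and G_bij: "\<sigma> \<in> G \<Longrightarrow> bij \<sigma>"
  using G_auto unfolding ring_auto_def by auto

lemma G_iota: "\<sigma> \<in> G \<Longrightarrow> \<sigma> (\<iota> a) = \<iota> a"
  using fixed by blast

lemma G_s: "\<sigma> \<in> G \<Longrightarrow> \<sigma> (s c) = s c"
  by (simp add: s_apply G_iota)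

lemma G_comp: "\<sigma> \<in> G \<Longrightarrow> \<tau> \<in> G \<Longrightarrow> \<sigma> \<circ> \<tau> \<in> G" and id_G: "id \<in> G"
  using group.is_monoid[OF G_group] unfolding monoid_def comp_group_def by auto

lemma G_funpow: "\<sigma> \<in> G \<Longrightarrow> \<sigma> ^^ n \<in> G"
  by (induction n) (auto intro: G_comp id_G)

section \<open>G as a set of iterates, and its action on the residue field\<close>

lemma funpow_finite_order:
  assumes \<sigma>: "\<sigma> \<in> G" shows "\<exists>m. 0 < m \<and> m \<le> p \<and> \<sigma> ^^ m = id"
proof -
  have "\<not> inj_on (\<lambda>k. \<sigma> ^^ k) {..p}"
  proof
    assume "inj_on (\<lambda>k. \<sigma> ^^ k) {..p}"
    moreover have "(\<lambda>k. \<sigma> ^^ k) ` {..p} \<subseteq> G" using G_funpow[OF \<sigma>] by blast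
    moreover have "finite G" using card_G p_pos by (simp add: card_ge_0_finite)
    ultimately have "card {..p} \<le> card G" by (rule card_inj_on_le)
    then show False using card_G by simp
  qed
  then obtain a b where ab: "a < b" "b \<le> p" "\<sigma> ^^ a = \<sigma> ^^ b"
    unfolding inj_on_def by (metis atMost_iff linorder_neqE_nat)
  have "(\<sigma> ^^ a) ((\<sigma> ^^ (b - a)) x) = (\<sigma> ^^ a) x" for x
  proof -
    have "(\<sigma> ^^ a) ((\<sigma> ^^ (b - a)) x) = (\<sigma> ^^ (a + (b - a))) x" by (simp add: funpow_add)
    then show ?thesis using ab by simp
  qed
  moreover have "inj (\<sigma> ^^ a)" using G_bij[OF G_funpow[OF \<sigma>]] by (rule bij_is_inj)
  ultimately have "(\<sigma> ^^ (b - a)) x = x" for x by (meson injD)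
  then have "\<sigma> ^^ (b - a) = id" by auto
  then show ?thesis using ab by (intro exI[of _ "b - a"]) auto
qed

lemma funpow_period: "\<sigma> ^^ m = id \<Longrightarrow> \<sigma> ^^ (k mod m) = \<sigma> ^^ k"
proof -
  assume m: "\<sigma> ^^ m = id"
  have *: "\<sigma> ^^ (m * l) = id" for l by (induction l) (simp_all add: funpow_add m)
  have "\<sigma> ^^ k = \<sigma> ^^ (m * (k div m) + k mod m)" by simp
  also have "\<dots> = \<sigma> ^^ (k mod m)" unfolding funpow_add * by simp
  finally show ?thesis ..
qed

text \<open>Cyclic groups are described by integer powers; finite order turns the negative ones into
  iterates of functions.\<close>

lemma cyclic_powers: "\<exists>x\<in>G. \<forall>\<sigma>\<in>G. \<exists>k::nat. \<sigma> = x ^^ k"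
proof -
  interpret GG: group "comp_group G" by (rule G_group)
  obtain x where x: "x \<in> G" "G = range (\<lambda>n::int. x [^]\<^bsub>comp_group G\<^esub> n)"
    using G_cyclic unfolding GG.cyclic_group by (auto simp: comp_group_def)
  have "\<exists>k::nat. \<sigma> = x ^^ k" if \<sigma>: "\<sigma> \<in> G" for \<sigma>
  proof -
    obtain n :: int where n: "\<sigma> = x [^]\<^bsub>comp_group G\<^esub> n" using \<sigma> x(2) by blast
    show ?thesis
    proof (cases "n \<ge> 0")
      case True
      have "\<sigma> = x [^]\<^bsub>comp_group G\<^esub> (nat n)" by (subst n, subst int_pow_def2) (use True in simp)
      then show ?thesis unfolding comp_group_pow by blast
    next
      case False
      define k where "k = nat (- n)"
      have \<tau>: "x ^^ k \<in> G" by (rule G_funpow[OF x(1)])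
      obtain m where m: "0 < m" "(x ^^ k) ^^ m = id" using funpow_finite_order[OF \<tau>] by blast
      then have "(x ^^ k) ^^ (m - 1) \<circ> x ^^ k = id"
        by (metis Suc_diff_1 funpow_Suc_right)
      then have "inv\<^bsub>comp_group G\<^esub> (x ^^ k) = (x ^^ k) ^^ (m - 1)"
        using \<tau> G_funpow[OF \<tau>] by (intro GG.inv_equality) (simp_all add: comp_group_def)
      moreover have "\<sigma> = inv\<^bsub>comp_group G\<^esub> (x ^^ k)"
        unfolding comp_group_pow[symmetric, where x = x and G = G] k_def
        by (subst n, subst int_pow_def2) (use False in simp)
      ultimately show ?thesis by (metis funpow_mult)
    qed
  qed
  then show ?thesis using x(1) by blast
qed

text \<open>A cyclic generator has some order m \<le> p, and its m iterates exhaust the p elements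
  of G.\<close>

lemma funpow_order: assumes "\<sigma> \<in> G" shows "\<sigma> ^^ p = id"
proof -
  obtain x where x: "x \<in> G" "\<And>\<sigma>. \<sigma> \<in> G \<Longrightarrow> \<exists>k::nat. \<sigma> = x ^^ k" using cyclic_powers by blast
  obtain m where m: "0 < m" "m \<le> p" "x ^^ m = id" using funpow_finite_order[OF x(1)] by blast
  have "G \<subseteq> (\<lambda>k. x ^^ k) ` {..<m}"
  proof
    fix \<sigma> assume "\<sigma> \<in> G"
    then obtain k where "\<sigma> = x ^^ k" using x(2) by blast
    then have "\<sigma> = x ^^ (k mod m)" using funpow_period[OF m(3)] by simp
    then show "\<sigma> \<in> (\<lambda>k. x ^^ k) ` {..<m}" using m(1) by auto
  qed
  then have "card G \<le> card ((\<lambda>k. x ^^ k) ` {..<m})" by (intro card_mono) auto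
  also have "\<dots> \<le> m" using card_image_le[of "{..<m}"] by simp
  finally have "x ^^ p = id" using m card_G by simp
  moreover obtain k where "\<sigma> = x ^^ k" using x(2) assms by blast
  moreover have "id ^^ k = (id :: 'b \<Rightarrow> 'b)" by (induction k) auto
  ultimately show ?thesis by (metis funpow_mult mult.commute)
qed

lemma funpow_mod: "\<sigma> \<in> G \<Longrightarrow> \<sigma> ^^ (k mod p) = \<sigma> ^^ k"
  by (rule funpow_period) (rule funpow_order)

text \<open>b^p is congruent to an element of A, which \<sigma> fixes; so the residues of b and
  \<sigma> b have the same p-th power, and Frobenius is injective.\<close>

lemma G_res: assumes "\<sigma> \<in> G" shows "redB (\<sigma> b) = redB b"
proof -
  note h = ring_homoD[OF G_homo[OF assms]]
  obtain f where f: "redB b ^ p = j f" using C.power_p_in_range by blast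
  obtain a where a: "bl_reduce red a = f" using bl_reduction_map unfolding reduction_map_def surj_def by metis
  have "redB (b ^ p - \<iota> a) = 0" by (simp add: redB_simps f j_redB[symmetric] a)
  then have "s \<pi> dvd b ^ p - \<iota> a" using redB_0 by blast
  then have "\<sigma> (s \<pi>) dvd \<sigma> (b ^ p - \<iota> a)" by (rule ring_homo_dvd[OF G_homo[OF assms]])
  then have "redB (\<sigma> b ^ p - \<iota> a) = 0" using redB_0 by (simp add: h G_s[OF assms] G_iota[OF assms])
  then have "redB (\<sigma> b) ^ p = redB b ^ p" by (simp add: redB_simps f j_redB[symmetric] a)
  then show ?thesis by (rule C.power_p_inj)
qed

lemma generator_exists: "\<exists>\<sigma>\<in>G. \<forall>b. \<sigma> b = b \<longrightarrow> b \<in> range \<iota>"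
proof -
  obtain x where x: "x \<in> G" "\<And>\<sigma>. \<sigma> \<in> G \<Longrightarrow> \<exists>k::nat. \<sigma> = x ^^ k" using cyclic_powers by blast
  have "b \<in> range \<iota>" if b: "x b = b" for b
  proof -
    have "(x ^^ k) b = b" for k by (induction k) (simp_all add: b)
    then have "\<sigma> b = b" if "\<sigma> \<in> G" for \<sigma> using x(2)[OF that] by auto
    then show ?thesis using fixed by blast
  qed
  then show ?thesis using x(1) by blast
qed

subsection \<open>Eigenvectors\<close>

definition eig :: "('b \<Rightarrow> 'b) \<Rightarrow> 'b \<Rightarrow> bool" where
  "eig \<sigma> y \<longleftrightarrow> y dvd 1 \<and> \<sigma> y = z * y"

text \<open>The eigenvector clause demands the eigenvalue \<zeta> itself, since a resolvent gives
  \<zeta>^i for some i only; \<open>is_gen_exists\<close> passes to a suitable power of the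
  automorphism.\<close>

definition is_gen :: "('b \<Rightarrow> 'b) \<Rightarrow> bool" where
  "is_gen \<sigma> \<longleftrightarrow> \<sigma> \<in> G \<and> (\<forall>b. \<sigma> b = b \<longrightarrow> b \<in> range \<iota>) \<and> (\<exists>y. eig \<sigma> y)"

lemma funpow_eigen:
  assumes "\<sigma> \<in> G" "\<sigma> y = z ^ i * y"
  shows "(\<sigma> ^^ k) y = z ^ (i * k) * y"
proof (induction k)
  case (Suc k)
  then show ?case
    using ring_homoD[OF G_homo[OF assms(1)]] assms by (simp add: G_s power_add mult_ac)
qed simp

text \<open>The resolvents y i, i < p, have eigenvalues \<zeta>^i and add up to p W. If all with i >
  0 vanished, p W = y 0 would be fixed, hence W, which is not in A.\<close>

lemma exists_resolvent:
  assumes \<sigma>: "\<sigma> \<in> G" and fix\<sigma>: "\<And>b. \<sigma> b = b \<Longrightarrow> b \<in> range \<iota>"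
  shows "\<exists>i y. 0 < i \<and> i < p \<and> y \<noteq> 0 \<and> \<sigma> y = z ^ i * y"
proof (rule ccontr)
  assume no: "\<not> ?thesis"
  note h = ring_homoD[OF G_homo[OF \<sigma>]]
  obtain W where "gen W" using gen_exists by blast
  then have "W \<notin> range \<iota>" unfolding gen_def j_redB[symmetric] by (metis j_redB rangeE rangeI)
  then have neq: "\<sigma> W \<noteq> W" using fix\<sigma> by blast
  \<comment> \<open>The exponent (p - l) i stands for -l i, so that only natural powers of \<zeta>
    occur.\<close>
  define g where "g = (\<lambda>i l. z ^ ((p - l) * i) * (\<sigma> ^^ l) W)"
  define y where "y = (\<lambda>i. \<Sum>l<p. g i l)"
  have y: "\<sigma> (y i) = z ^ i * y i" for i
  proof -
    have "\<sigma> (g i l) = z ^ i * g i (Suc l)" if "l < p" for l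
    proof -
      have "(p - l) * i = i + (p - Suc l) * i" using that by (metis Suc_diff_Suc mult_Suc)
      then show ?thesis by (simp add: g_def h G_s[OF \<sigma>] power_add mult_ac)
    qed
    then have "\<sigma> (y i) = z ^ i * (\<Sum>l<p. g i (Suc l))"
      unfolding y_def h(10) sum_distrib_left by (intro sum.cong) auto
    also have "(\<Sum>l<p. g i (Suc l)) = y i"
    proof -
      have "g i p = g i 0" using funpow_order[OF \<sigma>] by (simp add: g_def power_mult z_p)
      then show ?thesis
        unfolding y_def using sum.lessThan_Suc_shift[of "g i" p] by (simp add: algebra_simps)
    qed
    finally show ?thesis .
  qed
  have "y i = 0" if "0 < i" "i < p" for i using no that y by blast
  then have "(\<Sum>i<p. y i) = y 0"
    using p_pos by (subst sum.remove[of _ 0]) (auto intro!: sum.neutral)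
  moreover have "(\<Sum>i<p. y i) = of_nat p * W"
  proof -
    have "(\<Sum>i<p. y i) = (\<Sum>l<p. \<Sum>i<p. g i l)" unfolding y_def by (rule sum.swap)
    also have "\<dots> = (\<Sum>l<p. if l = 0 then of_nat p * W else 0)"
    proof (rule sum.cong[OF refl])
      fix l assume l: "l \<in> {..<p}"
      have eq: "(\<Sum>i<p. g i l) = (\<Sum>i<p. (z ^ (p - l)) ^ i) * (\<sigma> ^^ l) W"
        by (simp add: g_def sum_distrib_right power_mult)
      show "(\<Sum>i<p. g i l) = (if l = 0 then of_nat p * W else 0)"
      proof (cases "l = 0")
        case True then show ?thesis unfolding eq by (simp add: z_p)
      next
        case False
        have "\<not> p dvd p - l" using False l by (auto dest: dvd_imp_le)
        then have "z ^ (p - l) - 1 \<noteq> 0" using z_power_eq_1 by simp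
        moreover have "(z ^ (p - l)) ^ p - 1 = (z ^ (p - l) - 1) * (\<Sum>i<p. (z ^ (p - l)) ^ i)"
          by (rule power_diff_1_eq)
        moreover have "(z ^ (p - l)) ^ p = 1" by (simp add: z_p mult.commute flip: power_mult) (simp add: power_mult z_p mult.commute)
        ultimately have "(\<Sum>i<p. (z ^ (p - l)) ^ i) = 0" using B.mult_eq_0 by (metis diff_self)
        then show ?thesis using False eq by simp
      qed
    qed
    also have "\<dots> = of_nat p * W" using p_pos by simp
    finally show ?thesis .
  qed
  moreover have "\<sigma> (y 0) = y 0" using y[of 0] by simp
  ultimately have "\<sigma> (of_nat p * W) = of_nat p * W" by simp
  then have "of_nat p * (\<sigma> W - W) = 0" by (simp add: h algebra_simps)
  moreover have "(of_nat p :: 'b) \<noteq> 0"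
    using s_inj[of "of_nat p"] p_pos by (simp add: s_simps)
  ultimately show False using neq B.mult_eq_0 by simp
qed

text \<open>If \<sigma> has the eigenvalue \<zeta>^i, its k-th iterate with i k congruent to 1
  modulo p has the eigenvalue \<zeta>.\<close>

lemma is_gen_exists: "\<exists>\<sigma>. is_gen \<sigma>"
proof -
  obtain \<sigma> where \<sigma>: "\<sigma> \<in> G" "\<And>b. \<sigma> b = b \<Longrightarrow> b \<in> range \<iota>" using generator_exists by blast
  obtain i y where iy: "0 < i" "i < p" "y \<noteq> 0" "\<sigma> y = z ^ i * y" using exists_resolvent[OF \<sigma>] by blast
  have "coprime i p" using iy prime_p by (metis coprime_commute dvd_imp_le not_le prime_imp_coprime)
  then obtain k where k: "[i * k = 1] (mod p)" using cong_solve_coprime_nat by auto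
  define \<tau> where "\<tau> = \<sigma> ^^ k"
  have ik: "(i * k) mod p = 1" using k p_gt_1 by (simp add: cong_def)
  have \<tau>y: "\<tau> y = z * y"
  proof -
    have "z ^ (i * k) = (z ^ p) ^ (i * k div p) * z ^ (i * k mod p)" by (simp flip: power_mult power_add)
    then show ?thesis unfolding \<tau>_def funpow_eigen[OF \<sigma>(1) iy(4)] by (simp add: z_p ik)
  qed
  have \<tau>G: "\<tau> \<in> G" unfolding \<tau>_def by (rule G_funpow[OF \<sigma>(1)])
  have "\<tau> ^^ i = \<sigma>"
  proof -
    have "\<tau> ^^ i = \<sigma> ^^ (i * k)" unfolding \<tau>_def by (simp add: funpow_mult mult.commute)
    also have "\<dots> = \<sigma> ^^ (i * k mod p)" using funpow_mod[OF \<sigma>(1)] by simp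
    finally show ?thesis by (simp add: ik)
  qed
  moreover have "(\<tau> ^^ n) b = b" if "\<tau> b = b" for b n by (induction n) (simp_all add: that)
  ultimately have fix\<tau>: "b \<in> range \<iota>" if "\<tau> b = b" for b using \<sigma>(2) that by metis
  \<comment> \<open>Powers of \<pi> are fixed, so they can be split off to make the eigenvector a
    unit.\<close>
  obtain u n where u: "u dvd 1" "y = u * s \<pi> ^ n" using B.unit_times_power iy(3) by blast
  have "\<tau> u * s \<pi> ^ n = (z * u) * s \<pi> ^ n"
    using \<tau>y unfolding u(2) by (simp add: ring_homoD[OF G_homo[OF \<tau>G]] G_s[OF \<tau>G] mult.assoc)
  then have "\<tau> u = z * u" using B.mult_cancel_right[OF B.pi_power_nz] by blast
  then show ?thesis unfolding is_gen_def eig_def using \<tau>G fix\<tau> u(1) by blast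
qed

lemma eig_funpow: "\<sigma> \<in> G \<Longrightarrow> eig \<sigma> y \<Longrightarrow> (\<sigma> ^^ k) y = z ^ k * y"
  using funpow_eigen[of \<sigma> y 1 k] by (simp add: eig_def)

lemma z_power_inj: "i < p \<Longrightarrow> k < p \<Longrightarrow> z ^ i = z ^ k \<Longrightarrow> i = k"
proof (induction i k rule: linorder_wlog)
  case (le i k)
  have "z ^ i * z ^ (k - i) = z ^ k" using le(1) by (simp flip: power_add)
  then have "z ^ i * z ^ (k - i) = z ^ i * 1" using le by simp
  then have "z ^ (k - i) = 1" using B.mult_cancel[OF B.unit_nz[OF z_unit]] by blast
  then have "p dvd k - i" using z_power_eq_1 by simp
  then show ?case using le by (auto dest: dvd_imp_le)
qed simp

text \<open>The eigenvalues \<zeta>^k on a common eigenvector distinguish the p iterates.\<close>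

lemma G_eq_powers: 
  assumes "is_gen \<sigma>" shows "G = (\<lambda>k. \<sigma> ^^ k) ` {..<p}" "inj_on (\<lambda>k. \<sigma> ^^ k) {..<p}"
proof -
  obtain y where \<sigma>: "\<sigma> \<in> G" and y: "eig \<sigma> y" using assms unfolding is_gen_def by blast
  have y0: "y \<noteq> 0" using y B.unit_nz unfolding eig_def by blast
  show inj: "inj_on (\<lambda>k. \<sigma> ^^ k) {..<p}"
  proof (rule inj_onI)
    fix m n assume mn: "m \<in> {..<p}" "n \<in> {..<p}" "\<sigma> ^^ m = \<sigma> ^^ n"
    then have "z ^ m * y = z ^ n * y" using eig_funpow[OF \<sigma> y] by metis
    then have "z ^ m = z ^ n" using B.mult_cancel_right[OF y0] by blast
    then show "m = n" using z_power_inj mn by blast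
  qed
  show "G = (\<lambda>k. \<sigma> ^^ k) ` {..<p}"
    by (rule card_subset_eq[symmetric])
      (use card_G p_pos card_image[OF inj] G_funpow[OF \<sigma>] card_ge_0_finite[of G] in auto)
qed

text \<open>If c k is congruent to 1 modulo p, then y^k is an eigenvector of the c-th iterate with
  eigenvalue \<zeta>^(ck) = \<zeta>.\<close>

lemma is_gen_funpow:
  assumes \<sigma>: "is_gen \<sigma>" and c: "coprime c p"
  shows "is_gen (\<sigma> ^^ c)"
proof -
  have \<sigma>G: "\<sigma> \<in> G" and fix\<sigma>: "\<And>b. \<sigma> b = b \<Longrightarrow> b \<in> range \<iota>" using \<sigma> unfolding is_gen_def by auto
  obtain y where y: "eig \<sigma> y" using \<sigma> unfolding is_gen_def by blast
  obtain k where k: "[c * k = 1] (mod p)" using cong_solve_coprime_nat[OF c] by auto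
  then have ck: "(c * k) mod p = 1" using p_gt_1 by (simp add: cong_def)
  have \<tau>G: "\<sigma> ^^ c \<in> G" by (rule G_funpow[OF \<sigma>G])
  have "(\<sigma> ^^ c) ^^ k = \<sigma> ^^ (k * c)" by (simp add: funpow_mult mult.commute)
  also have "\<dots> = \<sigma> ^^ (k * c mod p)" using funpow_mod[OF \<sigma>G] by simp
  finally have 1: "(\<sigma> ^^ c) ^^ k = \<sigma>" using ck by (simp add: mult.commute)
  have 2: "((\<sigma> ^^ c) ^^ n) b = b" if "(\<sigma> ^^ c) b = b" for b n by (induction n) (simp_all add: that)
  have 3: "b \<in> range \<iota>" if "(\<sigma> ^^ c) b = b" for b using fix\<sigma> 2[OF that, of k] 1 by simp
  have "(\<sigma> ^^ c) (y ^ k) = (z ^ c * y) ^ k"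
    by (simp add: ring_homoD[OF G_homo[OF \<tau>G]] eig_funpow[OF \<sigma>G y])
  also have "\<dots> = z ^ (c * k) * y ^ k" by (simp add: power_mult_distrib power_mult)
  also have "z ^ (c * k) = (z ^ p) ^ (c * k div p) * z ^ (c * k mod p)" by (simp flip: power_mult power_add)
  also have "\<dots> = z" by (simp add: z_p ck)
  finally have "eig (\<sigma> ^^ c) (y ^ k)" using y B.unit_power unfolding eig_def by blast
  then show ?thesis unfolding is_gen_def using \<tau>G 3 by blast
qed

lemma eig_iota_mult: "\<sigma> \<in> G \<Longrightarrow> eig \<sigma> y \<Longrightarrow> a dvd 1 \<Longrightarrow> eig \<sigma> (y * \<iota> a)"
  unfolding eig_def using B.unit_mult iota_unit by (simp add: ring_homoD(4)[OF G_homo] G_iota mult.assoc)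

lemma eig_power_p:
  assumes "is_gen \<sigma>" "eig \<sigma> y" shows "\<exists>u. u dvd 1 \<and> y ^ p = \<iota> u"
proof -
  have \<sigma>: "\<sigma> \<in> G" using assms(1) unfolding is_gen_def by blast
  have "\<sigma> (y ^ p) = y ^ p"
    using assms(2) unfolding eig_def by (simp add: ring_homoD[OF G_homo[OF \<sigma>]] power_mult_distrib z_p)
  then obtain u where u: "y ^ p = \<iota> u" using assms(1) unfolding is_gen_def by blast
  moreover have "y ^ p dvd 1" using assms(2) B.unit_power unfolding eig_def by blast
  ultimately show ?thesis using iota_unit by metis
qed

lemma eig_ratio:
  assumes "is_gen \<sigma>" "eig \<sigma> y" "eig \<sigma> y'"
  shows "\<exists>v. v dvd 1 \<and> y' = y * \<iota> v"
proof -
  have \<sigma>: "\<sigma> \<in> G" using assms(1) unfolding is_gen_def by blast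
  note h = ring_homoD[OF G_homo[OF \<sigma>]]
  have y: "y dvd 1" "\<sigma> y = z * y" and y': "y' dvd 1" "\<sigma> y' = z * y'" using assms unfolding eig_def by auto
  define q where "q = B.recip y * y'"
  have yq: "y * q = y'" unfolding q_def using B.recip[OF y(1)] by (metis mult.assoc mult_1)
  have "\<sigma> y * \<sigma> q = z * y'" using arg_cong[OF yq, of \<sigma>] y'(2) h(4) by metis
  then have "z * y * \<sigma> q = z * y * q" unfolding y(2) yq[symmetric] by (simp add: mult.assoc)
  moreover have "z * y \<noteq> 0" using B.unit_nz B.unit_mult z_unit[of 1] y(1) by simp
  ultimately have "\<sigma> q = q" using B.mult_cancel by blast
  then obtain v where "q = \<iota> v" using assms(1) unfolding is_gen_def by blast
  moreover have "q dvd 1" unfolding q_def by (intro B.unit_mult B.recip_unit y y')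
  ultimately show ?thesis using yq iota_unit by metis
qed

subsection \<open>The normalised Kummer generator\<close>

lemma gen_shift: "gen (1 + W) \<longleftrightarrow> gen W"
proof -
  have "redB (1 + W) = j f \<longleftrightarrow> redB W = j (f - 1)" for f
    by (simp add: redB_simps ring_homoD[OF j_homo] algebra_simps)
  moreover have "f - 1 = g \<longleftrightarrow> f = g + 1" for f g :: "'k fls" by (auto simp: algebra_simps)
  ultimately show ?thesis unfolding gen_def by (metis rangeE rangeI)
qed

lemma reduce_surj: "\<exists>a. bl_reduce red a = f"
  using bl_reduction_map unfolding reduction_map_def surj_def by metis

lemma zeta_1_nz: "\<zeta> - 1 \<noteq> 0" using zeta_prim p_gt_1 by (metis eq_iff_diff_eq_0 greaterThanLessThan_iff less_one power_one_right)

lemma kummer_normal_form: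
  assumes gen\<sigma>: "is_gen \<sigma>"
  shows "\<exists>n W. n < val \<pi> (\<zeta> - 1) \<and> gen W \<and> eig \<sigma> (1 + s \<pi> ^ n * W)"
proof (cases "\<exists>y. eig \<sigma> y \<and> gen y")
  case True
  then obtain y where y: "eig \<sigma> y" "gen y" by blast
  \<comment> \<open>This is the case n = 0 with W = y - 1; the strict bound needs \<zeta> congruent
    to 1.\<close>
  have "1 \<le> val \<pi> (\<zeta> - 1)"
    using zeta_cong[of 1] R.dvd_power_iff_le_val[OF zeta_1_nz, of 1] by simp
  moreover have "gen (y - 1)" using gen_shift[of "y - 1"] y by simp
  ultimately show ?thesis using y by (intro exI[of _ 0] exI[of _ "y - 1"]) auto
next
  case False
  have \<sigma>: "\<sigma> \<in> G" using gen\<sigma> unfolding is_gen_def by blast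
  note h = ring_homoD[OF G_homo[OF \<sigma>]]
  define P where "P = (\<lambda>n. \<exists>y. eig \<sigma> y \<and> s \<pi> ^ n dvd y - 1)"
  \<comment> \<open>Here the class of every eigenvector lies in k((t)); dividing by a lift of it
    makes the eigenvector congruent to 1.\<close>
  have P1: "P 1"
  proof -
    obtain y where y: "eig \<sigma> y" using gen\<sigma> unfolding is_gen_def by blast
    then obtain f where f: "redB y = j f" using False unfolding gen_def by blast
    have "redB y \<noteq> 0" using y B.unit_iff redB_0 unfolding eig_def by blast
    then have f0: "f \<noteq> 0" using f ring_homoD(2)[OF j_homo] by metis
    obtain a where a: "bl_reduce red a = inverse f" using reduce_surj by blast
    then have "a dvd 1" using A.unit_iff bl_reduce_eq_0_iff f0 by (metis inverse_nonzero_iff_nonzero)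
    then have "eig \<sigma> (y * \<iota> a)" using eig_iota_mult \<sigma> y by blast
    moreover have "redB (y * \<iota> a - 1) = j (f * inverse f) - 1"
      by (simp only: redB_simps j_redB[symmetric] a f ring_homoD[OF j_homo])
    then have "s \<pi> dvd y * \<iota> a - 1" using f0 redB_0 by (simp add: ring_homoD[OF j_homo])
    ultimately show ?thesis unfolding P_def by auto
  qed
  \<comment> \<open>Applying \<sigma> to the congruence for y and subtracting shows that \<pi>^n
    divides y (\<zeta> - 1).\<close>
  have bound: "n \<le> val \<pi> (\<zeta> - 1)" if Pn: "P n" for n
  proof -
    obtain y where y: "eig \<sigma> y" "s \<pi> ^ n dvd y - 1" using Pn unfolding P_def by blast
    have "\<sigma> (s \<pi> ^ n) dvd \<sigma> (y - 1)" using y(2) by (rule ring_homo_dvd[OF G_homo[OF \<sigma>]])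
    then have "s \<pi> ^ n dvd z * y - 1" using y(1) unfolding eig_def by (simp add: h G_s[OF \<sigma>])
    from dvd_diff[OF this y(2)] have "s \<pi> ^ n dvd y * s (\<zeta> - 1)" by (simp add: s_simps algebra_simps)
    then have "s \<pi> ^ n dvd s (\<zeta> - 1)" using B.unit_cancel y(1) unfolding eig_def by blast
    then show ?thesis using s_dvd_iff R.dvd_power_iff_le_val[OF zeta_1_nz] by blast
  qed
  define n where "n = (GREATEST n. P n)"
  have Pn: "P n" unfolding n_def using P1 bound by (rule GreatestI_nat)
  have max: "m \<le> n" if "P m" for m unfolding n_def using that bound by (rule Greatest_le_nat)
  have n1: "n \<ge> 1" using max[OF P1] .
  obtain y W where y: "eig \<sigma> y" "y - 1 = s \<pi> ^ n * W" using Pn unfolding P_def dvd_def by blast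
  have yW: "y = 1 + s \<pi> ^ n * W" using y(2) by (simp add: algebra_simps)
  have genW: "gen W"
  proof (rule ccontr)
    assume "\<not> gen W"
    then obtain f where f: "redB W = j f" unfolding gen_def by blast
    obtain a where a: "bl_reduce red a = f" using reduce_surj by blast
    have "redB (W - \<iota> a) = 0" by (simp add: redB_simps f j_redB[symmetric] a)
    then obtain c where c: "W - \<iota> a = s \<pi> * c" using redB_0 by (metis dvdE)
    \<comment> \<open>The unit of A to divide by: y - u is \<pi>^n (W - a), divisible by
      \<pi>^(n+1), against maximality of n.\<close>
    define u where "u = 1 + bl_const \<pi> ^ n * a"
    have "bl_const \<pi> dvd u - 1" using n1 by (simp add: u_def dvd_mult2)
    then have "\<not> bl_const \<pi> dvd u" using A.pi_nonunit dvd_diff[of "bl_const \<pi>" u "u - 1"] by auto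
    then have u: "u dvd 1" using A.unit_iff by blast
    obtain u' where u': "u * u' = 1" using u by (metis dvdE)
    then have "eig \<sigma> (y * \<iota> u')" using eig_iota_mult[OF \<sigma> y(1)] by (metis dvdI mult.commute)
    moreover have "y * \<iota> u' - 1 = (y - \<iota> u) * \<iota> u'"
      using u' by (simp add: algebra_simps flip: iota_simps(4)) (simp add: iota_simps)
    moreover have "y - \<iota> u = s \<pi> ^ Suc n * c"
    proof -
      have "y - \<iota> u = s \<pi> ^ n * (W - \<iota> a)"
        unfolding yW u_def by (simp add: iota_simps s_apply algebra_simps)
      then show ?thesis unfolding c by (simp add: mult_ac)
    qed
    ultimately have "P (Suc n)" unfolding P_def by (metis dvd_mult2 dvd_triv_left)
    then show False using max by fastforce
  qed
  have "n \<noteq> val \<pi> (\<zeta> - 1)"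
  proof
    assume n: "n = val \<pi> (\<zeta> - 1)"
    obtain u where u: "u dvd 1" "\<zeta> - 1 = u * \<pi> ^ n" using R.val_decomp[OF zeta_1_nz] n by blast
    have "\<sigma> y = z * y" using y(1) unfolding eig_def by blast
    then have "1 + s \<pi> ^ n * \<sigma> W = z * y" unfolding yW by (simp add: h G_s[OF \<sigma>])
    then have "s \<pi> ^ n * (\<sigma> W - W) = s (\<zeta> - 1) * y" using yW by (simp add: s_simps algebra_simps)
    also have "\<dots> = s \<pi> ^ n * (s u * y)" unfolding u(2) by (simp add: s_simps mult_ac)
    finally have "\<sigma> W - W = s u * y" using B.mult_cancel[OF B.pi_power_nz] by blast
    moreover have "redB (\<sigma> W - W) = 0" by (simp add: redB_simps G_res[OF \<sigma>])
    ultimately have "s \<pi> dvd s u * y" using redB_0 by metis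
    moreover have "s u dvd 1" using ring_homo_dvd[OF s_homo u(1)] by (simp add: s_simps)
    ultimately show False using B.unit_mult B.unit_iff y(1) unfolding eig_def by blast
  qed
  then have "n < val \<pi> (\<zeta> - 1)" using bound[OF Pn] by simp
  then show ?thesis using genW y(1) yW by blast
qed

subsection \<open>Trace and different\<close>

lemma co_add: "gen W \<Longrightarrow> i < p \<Longrightarrow> co W (b + c) i = co W b i + co W c i"
  by (rule co_eq) (simp_all add: lin_add lin_co)

lemma co_scale: "gen W \<Longrightarrow> i < p \<Longrightarrow> co W (\<iota> a * b) i = a * co W b i"
  by (rule co_eq) (simp_all add: lin_scale lin_co)

lemma co_0: "gen W \<Longrightarrow> i < p \<Longrightarrow> co W 0 i = 0"
  using co_diff[of W i 0 0] by simp

lemma co_sum: "gen W \<Longrightarrow> i < p \<Longrightarrow> co W (sum f S) i = (\<Sum>x\<in>S. co W (f x) i)"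
  by (induction S rule: infinite_finite_induct) (simp_all add: co_add co_0)

lemma co_power: "gen W \<Longrightarrow> i < p \<Longrightarrow> k < p \<Longrightarrow> co W (W ^ k) i = (if i = k then 1 else 0)"
  by (rule co_eq) (simp_all add: lin_single iota_simps)

definition tr :: "'b \<Rightarrow> 'b \<Rightarrow> 'r bilaurent" where
  "tr W b = (\<Sum>k<p. co W (b * W ^ k) k)"

text \<open>The trace is a definite description over all finite bases, so every basis must give the
  same value. Expanding b e in powers of W and the powers of W in the basis S gives the same double
  sum in two orders.\<close>

lemma alg_trace_eq:
  assumes W: "gen W" shows "alg_trace \<iota> b = tr W b"
proof -
  interpret M: module "alg_scale \<iota>"
    by unfold_locales (simp_all add: alg_scale_def iota_simps algebra_simps)
  have main: "(\<Sum>e\<in>S. M.representation S (b * e) e) = tr W b"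
    if S: "finite S" "M.independent S" "M.span S = UNIV" for S
  proof -
    define rep where "rep = M.representation S"
    have rep: "(\<Sum>e\<in>S. \<iota> (rep v e) * e) = v" for v
      using M.sum_representation_eq[OF S(2), of v S] S by (simp add: rep_def alg_scale_def)
    have rep_sum: "rep (\<Sum>k<p. \<iota> (c k) * v k) e = (\<Sum>k<p. c k * rep (v k) e)" if e: "e \<in> S" for c v e
    proof -
      have "rep (\<Sum>k<p. \<iota> (c k) * v k) = (\<lambda>e. if e \<in> S then \<Sum>k<p. c k * rep (v k) e else 0)"
        unfolding rep_def
      proof (rule M.representation_eqI[OF S(2)])
        show "finite {e. (if e \<in> S then \<Sum>k<p. c k * M.representation S (v k) e else 0) \<noteq> 0}"
          by (rule finite_subset[OF _ S(1)]) auto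
        let ?f = "\<lambda>e. if e \<in> S then \<Sum>k<p. c k * rep (v k) e else 0"
        have "(\<Sum>e | ?f e \<noteq> 0. alg_scale \<iota> (?f e) e) = (\<Sum>e\<in>S. alg_scale \<iota> (?f e) e)"
          using S(1) by (intro sum.mono_neutral_left) (auto simp: alg_scale_def iota_simps(2))
        also have "\<dots> = (\<Sum>e\<in>S. \<Sum>k<p. \<iota> (c k) * (\<iota> (rep (v k) e) * e))"
          by (intro sum.cong) (auto simp: alg_scale_def iota_simps sum_distrib_right mult.assoc)
        also have "\<dots> = (\<Sum>k<p. \<iota> (c k) * v k)"
          by (subst sum.swap) (simp add: rep flip: sum_distrib_left)
        finally show "(\<Sum>e | (if e \<in> S then \<Sum>k<p. c k * M.representation S (v k) e else 0) \<noteq> 0.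
            alg_scale \<iota> (if e \<in> S then \<Sum>k<p. c k * M.representation S (v k) e else 0) e) = (\<Sum>k<p. \<iota> (c k) * v k)"
          unfolding rep_def .
      qed (use S in \<open>auto split: if_splits\<close>)
      then show ?thesis using e by simp
    qed
    have "(\<Sum>e\<in>S. rep (b * e) e) = (\<Sum>e\<in>S. \<Sum>k<p. co W (b * e) k * rep (W ^ k) e)"
    proof (rule sum.cong[OF refl])
      fix e assume e: "e \<in> S"
      have "rep (b * e) e = rep (\<Sum>k<p. \<iota> (co W (b * e) k) * W ^ k) e"
        using lin_co[OF W, of "b * e"] by (simp add: lin_def)
      then show "rep (b * e) e = (\<Sum>k<p. co W (b * e) k * rep (W ^ k) e)" using rep_sum[OF e] by simp
    qed
    also have "\<dots> = (\<Sum>k<p. \<Sum>e\<in>S. co W (b * e) k * rep (W ^ k) e)" by (rule sum.swap)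
    also have "\<dots> = tr W b"
      unfolding tr_def
    proof (rule sum.cong[OF refl])
      fix k assume k: "k \<in> {..<p}"
      have "b * W ^ k = (\<Sum>e\<in>S. \<iota> (rep (W ^ k) e) * (b * e))"
        by (subst rep[of "W ^ k", symmetric]) (simp add: sum_distrib_left mult_ac)
      then have "co W (b * W ^ k) k = (\<Sum>e\<in>S. rep (W ^ k) e * co W (b * e) k)"
        using k by (simp add: co_sum[OF W] co_scale[OF W])
      then show "(\<Sum>e\<in>S. co W (b * e) k * rep (W ^ k) e) = co W (b * W ^ k) k" by (simp add: mult.commute)
    qed
    finally show ?thesis by (simp add: rep_def)
  qed
  have inj: "inj_on (\<lambda>i. W ^ i) {..<p}"
  proof (rule inj_onI)
    fix m n assume mn: "m \<in> {..<p}" "n \<in> {..<p}" "W ^ m = W ^ n"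
    then have "co W (W ^ m) m = co W (W ^ n) m" by simp
    then show "m = n" using mn co_power[OF W] by (metis lessThan_iff zero_neq_one)
  qed
  define S where "S = (\<lambda>i. W ^ i) ` {..<p}"
  have finS: "finite S" by (simp add: S_def)
  have indS: "M.independent S"
    unfolding M.dependent_finite[OF finS]
  proof safe
    fix u v assume u: "(\<Sum>v\<in>S. alg_scale \<iota> (u v) v) = 0" and v: "v \<in> S" and n: "u v \<noteq> 0"
    obtain i where i: "i < p" "v = W ^ i" using v by (auto simp: S_def)
    have "lin W (\<lambda>i. u (W ^ i)) = 0"
      using u unfolding S_def sum.reindex[OF inj] lin_def by (simp add: alg_scale_def)
    from lin_indep[OF W this i(1)] show False using n i by simp
  qed
  have spS: "M.span S = UNIV"
  proof -
    have "x \<in> M.span S" for x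
    proof -
      have "x = (\<Sum>i<p. alg_scale \<iota> (co W x i) (W ^ i))" using lin_co[OF W, of x] by (simp add: lin_def alg_scale_def)
      also have "\<dots> \<in> M.span S" by (intro M.span_sum M.span_scale M.span_base) (auto simp: S_def)
      finally show ?thesis .
    qed
    then show ?thesis by blast
  qed
  show ?thesis
    unfolding alg_trace_def
  proof (rule the_equality)
    show "\<exists>S. finite S \<and> M.independent S \<and> M.span S = UNIV \<and>
        tr W b = (\<Sum>e\<in>S. M.representation S (b * e) e)"
      using finS indS spS main[OF finS indS spS] by (intro exI[of _ S] conjI) auto
    fix t
    assume "\<exists>S. finite S \<and> M.independent S \<and> M.span S = UNIV \<and>
        t = (\<Sum>e\<in>S. M.representation S (b * e) e)"
    then obtain S' where S': "finite S'" "M.independent S'" "M.span S' = UNIV"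
        "t = (\<Sum>e\<in>S'. M.representation S' (b * e) e)" by (elim exE conjE)
    show "t = tr W b" unfolding S'(4) by (rule main[OF S'(1-3)])
  qed
qed

lemma alg_trace_add: "alg_trace \<iota> (b + c) = alg_trace \<iota> b + alg_trace \<iota> c"
  and alg_trace_scale: "alg_trace \<iota> (\<iota> a * b) = a * alg_trace \<iota> b"
  and alg_trace_1: "alg_trace \<iota> 1 = of_nat p"
proof -
  obtain W where W: "gen W" using gen_exists by blast
  show "alg_trace \<iota> (b + c) = alg_trace \<iota> b + alg_trace \<iota> c"
    by (simp add: alg_trace_eq[OF W] tr_def co_add[OF W] distrib_right sum.distrib)
  show "alg_trace \<iota> (\<iota> a * b) = a * alg_trace \<iota> b"
    by (simp add: alg_trace_eq[OF W] tr_def co_scale[OF W] mult.assoc sum_distrib_left)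
  show "alg_trace \<iota> 1 = of_nat p"
    by (simp add: alg_trace_eq[OF W] tr_def co_power[OF W])
qed

lemma alg_trace_0: "alg_trace \<iota> 0 = 0"
  using alg_trace_scale[of 0 0] by (simp add: iota_simps)

lemma alg_trace_sum: "alg_trace \<iota> (sum f S) = (\<Sum>x\<in>S. alg_trace \<iota> (f x))"
  by (induction S rule: infinite_finite_induct) (simp_all add: alg_trace_add alg_trace_0)

text \<open>\<sigma> carries the basis of powers of W to that of \<sigma> W, again a generator since
  the residue is unchanged; coordinates, and so the traces, correspond.\<close>

lemma alg_trace_G:
  assumes \<sigma>: "\<sigma> \<in> G" shows "alg_trace \<iota> (\<sigma> b) = alg_trace \<iota> b"
proof -
  note h = ring_homoD[OF G_homo[OF \<sigma>]]
  obtain W where W: "gen W" using gen_exists by blast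
  have W': "gen (\<sigma> W)" using W unfolding gen_def by (simp add: G_res[OF \<sigma>])
  have co': "co (\<sigma> W) (\<sigma> b) k = co W b k" if "k < p" for b k
  proof (rule co_eq[OF W' _ that])
    have "\<sigma> b = \<sigma> (lin W (co W b))" by (simp add: lin_co[OF W])
    also have "\<dots> = lin (\<sigma> W) (co W b)" by (simp add: lin_def h G_iota[OF \<sigma>])
    finally show "\<sigma> b = lin (\<sigma> W) (co W b)" .
  qed
  have "tr (\<sigma> W) (\<sigma> b) = (\<Sum>k<p. co (\<sigma> W) (\<sigma> (b * W ^ k)) k)" by (simp add: tr_def h)
  also have "\<dots> = tr W b" unfolding tr_def using co' by (intro sum.cong) auto
  finally show ?thesis using alg_trace_eq[OF W] alg_trace_eq[OF W'] by simp
qed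

text \<open>Invariance of the trace gives Tr(y^k) = \<zeta>^k Tr(y^k).\<close>

lemma alg_trace_eig_power:
  assumes "is_gen \<sigma>" "eig \<sigma> y" "\<not> p dvd k"
  shows "alg_trace \<iota> (y ^ k) = 0"
proof -
  have \<sigma>: "\<sigma> \<in> G" using assms(1) unfolding is_gen_def by blast
  have "\<sigma> (y ^ k) = \<iota> (bl_const (\<zeta> ^ k)) * y ^ k"
    using assms(2) unfolding eig_def
    by (simp add: ring_homoD[OF G_homo[OF \<sigma>]] power_mult_distrib s_simps flip: s_apply)
  then have "alg_trace \<iota> (y ^ k) = bl_const (\<zeta> ^ k) * alg_trace \<iota> (y ^ k)"
    using alg_trace_G[OF \<sigma>, of "y ^ k"] by (simp add: alg_trace_scale)
  then have "(bl_const (\<zeta> ^ k) - 1) * alg_trace \<iota> (y ^ k) = 0" by (simp add: algebra_simps)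
  moreover have "bl_const (\<zeta> ^ k) - 1 \<noteq> 0"
  proof
    assume "bl_const (\<zeta> ^ k) - 1 = 0"
    then have "\<iota> (bl_const (\<zeta> ^ k) - 1) = 0" by (simp add: iota_simps)
    then have "z ^ k = 1" by (simp add: iota_simps s_simps flip: s_apply)
    then show False using z_power_eq_1 assms(3) by simp
  qed
  ultimately show ?thesis using A.mult_eq_0 by blast
qed

text \<open>Pair c and b through the coordinate of c b at W^(p-1). On powers of W the matrix is
  antitriangular with entries 1 on the antidiagonal; testing c against W^(m+1) yields the coordinate
  i = p - 2 - m once all higher ones are known to be divisible by a.\<close>

lemma perfect_pairing:
  assumes W: "gen W" and c: "\<And>b. a dvd co W (c * b) (p - 1)"
  shows "\<iota> a dvd c"
proof -
  have "\<forall>i<p. p - 1 - m \<le> i \<longrightarrow> a dvd co W c i" for m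
  proof (induction m)
    case 0
    show ?case
    proof (intro allI impI)
      fix i assume "i < p" "p - 1 - 0 \<le> i"
      then have "i = p - 1" by linarith
      then show "a dvd co W c i" using c[of 1] by simp
    qed
  next
    case (Suc m)
    show ?case
    proof (intro allI impI)
      fix i assume i: "i < p" "p - 1 - Suc m \<le> i"
      show "a dvd co W c i"
      proof (cases "p - 1 - m \<le> i")
        case True then show ?thesis using Suc i by blast
      next
        case False
        then have im: "i + Suc m = p - 1" using i by linarith
        have "c * W ^ Suc m = (\<Sum>l<p. \<iota> (co W c l) * W ^ (l + Suc m))"
          using arg_cong[OF lin_co[OF W, of c], of "\<lambda>x. x * W ^ Suc m"]
          by (simp only: lin_def sum_distrib_right power_add mult.assoc)
        then have "co W (c * W ^ Suc m) (p - 1) = (\<Sum>l<p. co W c l * co W (W ^ (l + Suc m)) (p - 1))"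
          using p_pos by (simp only: co_sum[OF W] co_scale[OF W] diff_less zero_less_one)
        also have "\<dots> = co W c i * co W (W ^ (i + Suc m)) (p - 1) +
            (\<Sum>l\<in>{..<p} - {i}. co W c l * co W (W ^ (l + Suc m)) (p - 1))"
          using i by (intro sum.remove) auto
        also have "co W (W ^ (i + Suc m)) (p - 1) = 1" unfolding im using p_pos by (simp add: co_power[OF W])
        finally have eq: "co W (c * W ^ Suc m) (p - 1) = co W c i +
            (\<Sum>l\<in>{..<p} - {i}. co W c l * co W (W ^ (l + Suc m)) (p - 1))" by simp
        have "a dvd (\<Sum>l\<in>{..<p} - {i}. co W c l * co W (W ^ (l + Suc m)) (p - 1))"
        proof (rule dvd_sum)
          fix l assume l: "l \<in> {..<p} - {i}"
          show "a dvd co W c l * co W (W ^ (l + Suc m)) (p - 1)"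
          proof (cases "l < i")
            case True
            then have "l + Suc m < p" "l + Suc m \<noteq> p - 1" using im by auto
            then have "co W (W ^ (l + Suc m)) (p - 1) = 0"
              using co_power[OF W, of "p - 1" "l + Suc m"] p_pos by simp
            then show ?thesis by (simp only: mult_zero_right dvd_0_right)
          next
            case False
            then have "p - 1 - m \<le> l" using l im by auto
            then show ?thesis using Suc l by simp
          qed
        qed
        moreover have "a dvd co W (c * W ^ Suc m) (p - 1)" by (rule c)
        ultimately show ?thesis unfolding eq using dvd_add_left_iff by blast
      qed
    qed
  qed
  from this[of p] have "\<forall>i. \<exists>q. i < p \<longrightarrow> co W c i = a * q" by (auto simp: dvd_def)
  then obtain q where q: "\<And>i. i < p \<Longrightarrow> co W c i = a * q i" by metis
  have "c = lin W (co W c)" by (simp only: lin_co[OF W])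
  also have "\<dots> = lin W (\<lambda>i. a * q i)" unfolding lin_def using q by (intro sum.cong) auto
  finally show ?thesis unfolding lin_scale by (metis dvd_triv_left)
qed

text \<open>These x are the coordinates on \<open>\<G>\<^sup>(\<^sup>n\<^sup>)\<close> of the p-th
  roots of unity, that is, the sections of \<open>\<H>\<^sub>n\<close>.\<close>

lemma zeta_points:
  assumes "n \<le> val \<pi> (\<zeta> - 1)"
  shows "\<exists>x. \<zeta> ^ i = 1 + \<pi> ^ n * x"
proof -
  have "\<pi> ^ n dvd \<zeta> - 1" using R.dvd_power_iff_le_val[OF zeta_1_nz] assms by simp
  then have "\<pi> ^ n dvd \<zeta> ^ i - 1" using dvd_power_diff[of "\<pi> ^ n" \<zeta> 1 i] by simp
  then obtain x where "\<zeta> ^ i - 1 = \<pi> ^ n * x" by (metis dvdE)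
  then show ?thesis by (intro exI[of _ x]) (simp add: algebra_simps)
qed

text \<open>The strict inequality makes all sections reduce to 0, so that \<open>psi\<close> reduces
  to the p-th power.\<close>

lemma zeta_points_dvd:
  assumes "n < val \<pi> (\<zeta> - 1)" "\<zeta> ^ i = 1 + \<pi> ^ n * x"
  shows "\<pi> dvd x"
proof -
  have "\<pi> ^ Suc n dvd \<zeta> - 1" unfolding R.dvd_power_iff_le_val[OF zeta_1_nz] using assms(1) by simp
  then have "\<pi> ^ Suc n dvd \<zeta> ^ i - 1" using dvd_power_diff[of "\<pi> ^ Suc n" \<zeta> 1 i] by simp
  then have "\<pi> ^ n * \<pi> dvd \<pi> ^ n * x" using assms(2) by (simp add: mult.commute)
  then show ?thesis using R.dvd_cancel[OF R.pi_power_nz] by blast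
qed

text \<open>With Y = 1 + \<pi>^n W and Y^p = u, the unit g = Y/u satisfies Tr(g W^i) = 0 for i < p -
  1 and Tr(g W^(p-1)) = a, where p = \<pi>^(n(p-1)) a. So Tr(g b) is a times the top coordinate of
  b, and \<open>perfect_pairing\<close> identifies the different with the ideal (a).\<close>

theorem different_val:
  assumes gen\<sigma>: "is_gen \<sigma>" and n: "n < val \<pi> (\<zeta> - 1)" and W: "gen W"
    and y: "eig \<sigma> (1 + s \<pi> ^ n * W)"
  shows "val \<pi> (of_nat p) = ideal_val (s \<pi>) (different \<iota>) + n * (p - 1)"
    "0 < ideal_val (s \<pi>) (different \<iota>)"
proof -
  define Y where "Y = 1 + s \<pi> ^ n * W"
  have eY: "eig \<sigma> Y" using y by (simp add: Y_def)
  obtain x where x: "\<And>i. \<zeta> ^ i = 1 + \<pi> ^ n * x i" using zeta_points[of n] n by (metis less_imp_le)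
  \<comment> \<open>Each of the p - 1 factors 1 - \<zeta>^i of p is \<pi>^n times -x i; D is what
    remains of p.\<close>
  define D where "D = (\<Prod>i\<in>{0<..<p}. - x i)"
  have "of_nat p = (\<Prod>i\<in>{0<..<p}. 1 - \<zeta> ^ i)"
    using root_of_unity_prod_pred[OF p_pos zeta_p] zeta_prim by simp
  also have "\<dots> = (\<Prod>i\<in>{0<..<p}. \<pi> ^ n * - x i)" by (intro prod.cong) (simp_all add: x)
  also have "\<dots> = (\<pi> ^ n) ^ (p - 1) * D" unfolding D_def prod.distrib by simp
  finally have pD: "of_nat p = \<pi> ^ (n * (p - 1)) * D" by (simp add: power_mult)
  have p0: "(of_nat p :: 'r) \<noteq> 0" using p_pos by simp
  then have D0: "D \<noteq> 0" using pD by auto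
  define a where "a = bl_const D"
  have ia: "\<iota> a = s D" by (simp add: a_def s_apply)
  have pa: "of_nat p = bl_const \<pi> ^ (n * (p - 1)) * a"
    using arg_cong[OF pD, of bl_const] by (simp add: ring_homoD[OF bl_const_homo] a_def)
  obtain u where u: "u dvd 1" "Y ^ p = \<iota> u" using eig_power_p[OF gen\<sigma> eY] by blast
  obtain u' where u': "u * u' = 1" using u(1) by (metis dvdE)
  have u'x: "u' * (u * x) = x" for x using u' by (metis mult.assoc mult.commute mult_1)
  have u'y: "u' * (x * u) = x" for x using u'x[of x] by (simp add: mult.commute)
  \<comment> \<open>The factor Y raises the powers of Y in the expansion of \<pi>^(ni) W^i from l
    \<le> i < p to l + 1; among those only Y^p = u has a nonzero trace, and dividing by u turns it
    into p.\<close>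
  define g where "g = \<iota> u' * Y"
  have Yu: "Y dvd 1" using eY unfolding eig_def by blast
  have gu: "g dvd 1"
    unfolding g_def using u' Yu by (intro B.unit_mult) (auto simp: iota_unit intro: dvdI[of _ _ u] simp: mult.commute)
  have trY: "alg_trace \<iota> (Y ^ k) = (if k = p then of_nat p * u else 0)" if "0 < k" "k \<le> p" for k
  proof (cases "k = p")
    case True
    have "alg_trace \<iota> (\<iota> u * 1) = u * of_nat p" unfolding alg_trace_scale alg_trace_1 ..
    then show ?thesis using True u(2) by (simp add: mult.commute)
  next
    case False
    then have "\<not> p dvd k" using that by (auto dest: dvd_imp_le)
    then show ?thesis using alg_trace_eig_power[OF gen\<sigma> eY] False by simp
  qed
  have trW: "alg_trace \<iota> (g * W ^ i) = (if i = p - 1 then a else 0)" if i: "i < p" for i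
  proof -
    have "\<iota> (bl_const \<pi> ^ (n * i)) = (s \<pi> ^ n) ^ i"
      unfolding s_pi_power by (rule power_mult)
    then have "\<iota> (bl_const \<pi> ^ (n * i)) * (g * W ^ i) = g * (Y + (- 1)) ^ i"
      by (simp add: Y_def power_mult_distrib mult_ac)
    also have "\<dots> = (\<Sum>l\<le>i. \<iota> (u' * of_nat (i choose l) * (- 1) ^ (i - l)) * Y ^ Suc l)"
      unfolding binomial_ring sum_distrib_left g_def
      by (intro sum.cong refl) (simp add: iota_simps mult_ac)
    finally have "alg_trace \<iota> (\<iota> (bl_const \<pi> ^ (n * i)) * (g * W ^ i)) =
        alg_trace \<iota> (\<Sum>l\<le>i. \<iota> (u' * of_nat (i choose l) * (- 1) ^ (i - l)) * Y ^ Suc l)" by simp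
    then have "bl_const \<pi> ^ (n * i) * alg_trace \<iota> (g * W ^ i) =
        (\<Sum>l\<le>i. u' * of_nat (i choose l) * (- 1) ^ (i - l) * alg_trace \<iota> (Y ^ Suc l))"
      unfolding alg_trace_scale alg_trace_sum .
    also have "\<dots> = (\<Sum>l\<le>i. if l = i then (if i = p - 1 then of_nat p else 0) else 0)"
    proof (rule sum.cong[OF refl])
      fix l assume l: "l \<in> {..i}"
      have "alg_trace \<iota> (Y ^ Suc l) = (if Suc l = p then of_nat p * u else 0)"
        using l i by (intro trY) auto
      then show "u' * of_nat (i choose l) * (- 1) ^ (i - l) * alg_trace \<iota> (Y ^ Suc l) =
          (if l = i then (if i = p - 1 then of_nat p else 0) else 0)"
        using l i by (auto simp: u'x u'y)
    qed
    also have "\<dots> = (if i = p - 1 then of_nat p else 0)" by simp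
    finally have eq: "bl_const \<pi> ^ (n * i) * alg_trace \<iota> (g * W ^ i) = (if i = p - 1 then of_nat p else 0)" .
    show ?thesis
    proof (cases "i = p - 1")
      case True
      then have "bl_const \<pi> ^ (n * i) * alg_trace \<iota> (g * W ^ i) = bl_const \<pi> ^ (n * i) * a"
        using eq pa by simp
      then show ?thesis using A.mult_cancel[OF A.pi_power_nz] True by simp
    next
      case False
      then show ?thesis using eq A.mult_eq_0 A.pi_power_nz by metis
    qed
  qed
  have tr: "alg_trace \<iota> (g * b) = a * co W b (p - 1)" for b
  proof -
    have "g * b = (\<Sum>i<p. \<iota> (co W b i) * (g * W ^ i))"
      by (subst lin_co[OF W, symmetric]) (simp add: lin_def sum_distrib_left mult_ac)
    then have "alg_trace \<iota> (g * b) = (\<Sum>i<p. co W b i * alg_trace \<iota> (g * W ^ i))"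
      by (simp only: alg_trace_sum alg_trace_scale)
    also have "\<dots> = (\<Sum>i<p. if i = p - 1 then co W b (p - 1) * a else 0)"
      by (intro sum.cong) (auto simp: trW)
    also have "\<dots> = a * co W b (p - 1)" using p_pos by (simp add: mult.commute)
    finally show ?thesis .
  qed
  have a0: "a \<noteq> 0" using D0 iota_inj s_inj ia by metis
  have diff: "b \<in> different \<iota> \<longleftrightarrow> s D dvd b" for b
  proof
    assume b: "b \<in> different \<iota>"
    have "\<forall>b'. a dvd alg_trace \<iota> (g * b')" by (simp add: tr)
    moreover have "\<forall>c a. a \<noteq> 0 \<longrightarrow> (\<forall>b'. a dvd alg_trace \<iota> (c * b')) \<longrightarrow> \<iota> a dvd b * c"
      using b unfolding different_def by simp
    ultimately have "\<iota> a dvd b * g" using a0 by blast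
    then have "\<iota> a dvd g * b" by (simp only: mult.commute)
    then show "s D dvd b" using B.unit_cancel[OF gu] ia by simp
  next
    assume "s D dvd b"
    then obtain b1 where b1: "b = \<iota> a * b1" using ia by (metis dvdE)
    show "b \<in> different \<iota>"
      unfolding different_def
    proof safe
      fix c a' assume "a' \<noteq> 0" and c: "\<forall>b'. a' dvd alg_trace \<iota> (c * b')"
      define c' where "c' = B.recip g * c"
      have gc: "c = g * c'" unfolding c'_def using B.recip[OF gu] by (metis mult.assoc mult_1)
      have "\<iota> a' dvd \<iota> a * c'"
      proof (rule perfect_pairing[OF W])
        fix b'
        have "co W (\<iota> a * c' * b') (p - 1) = alg_trace \<iota> (c * b')"
          unfolding gc mult.assoc tr using p_pos by (simp add: co_scale[OF W])
        then show "a' dvd co W (\<iota> a * c' * b') (p - 1)" using c by simp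
      qed
      then have "\<iota> a' dvd (\<iota> a * c') * (b1 * g)" by simp
      then show "\<iota> a' dvd b * c" unfolding b1 gc by (simp add: mult_ac)
    qed
  qed
  obtain w m where w: "w dvd 1" "D = w * \<pi> ^ m" and m: "m = val \<pi> D" using R.val_decomp[OF D0] by blast
  have sw: "s w dvd 1" using ring_homo_dvd[OF s_homo w(1)] by (simp add: s_simps)
  have sD: "s D = s w * s \<pi> ^ m" unfolding w(2) by (simp add: s_simps)
  have dvd: "s D dvd b \<longleftrightarrow> s \<pi> ^ val \<pi> D dvd b" for b
  proof -
    obtain w' where w': "s w * w' = 1" using sw by (metis dvdE)
    have "s \<pi> ^ m = s D * w'" unfolding sD using w' by (metis mult.assoc mult.commute mult_1)
    then have "s D dvd s \<pi> ^ m" by simp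
    moreover have "s \<pi> ^ m dvd s D" using sD by simp
    ultimately show ?thesis unfolding m[symmetric] by (meson dvd_trans)
  qed
  have "ideal_val (s \<pi>) (different \<iota>) = val \<pi> D"
    unfolding ideal_val_def
  proof (rule the_equality)
    show eq: "different \<iota> = {x. s \<pi> ^ val \<pi> D dvd x}" using diff dvd by blast
    fix k assume k: "different \<iota> = {x. s \<pi> ^ k dvd x}"
    have "s \<pi> ^ k dvd s \<pi> ^ val \<pi> D" "s \<pi> ^ val \<pi> D dvd s \<pi> ^ k"
      using eq k by (metis dvd_refl mem_Collect_eq)+
    then show "k = val \<pi> D" using B.power_dvd_power by simp
  qed
  moreover have "val \<pi> (of_nat p) = n * (p - 1) + val \<pi> D"
    unfolding pD using R.val_mult[OF R.pi_power_nz D0] by (simp add: R.val_power)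
  moreover have "val \<pi> D > 0"
  proof -
    have "\<pi> dvd - x 1" using zeta_points_dvd[OF n x] by simp
    moreover have "- x 1 dvd D" unfolding D_def using p_gt_1 by (intro dvd_prodI) auto
    ultimately have "\<pi> ^ 1 dvd D" by (simp add: dvd_trans)
    then show ?thesis unfolding R.dvd_power_iff_le_val[OF D0] by simp
  qed
  ultimately show "val \<pi> (of_nat p) = ideal_val (s \<pi>) (different \<iota>) + n * (p - 1)"
    "0 < ideal_val (s \<pi>) (different \<iota>)" by auto
qed

end

section \<open>Polynomials vanishing on a finite set of points\<close>

lemma monic_linear_mult:
  fixes P :: "'a::comm_ring_1 poly"
  assumes "lead_coeff P = 1"
  shows "lead_coeff ([:a, 1:] * P) = 1 \<and> degree ([:a, 1:] * P) = Suc (degree P)"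
proof -
  have P: "P \<noteq> 0" using assms by auto
  have "degree ([:a, 1:] * P) = Suc (degree P)"
  proof (rule antisym)
    show "degree ([:a, 1:] * P) \<le> Suc (degree P)"
      using degree_mult_le[of "[:a, 1:]" P] by (auto intro: order_trans)
    have "coeff ([:a, 1:] * P) (Suc (degree P)) = 1" using assms by (simp add: coeff_eq_0)
    then show "Suc (degree P) \<le> degree ([:a, 1:] * P)" by (intro le_degree) simp
  qed
  moreover have "coeff ([:a, 1:] * P) (Suc (degree P)) = 1" using assms by (simp add: coeff_eq_0)
  ultimately show ?thesis by simp
qed

lemma monic_prod_linear:
  fixes c :: "nat \<Rightarrow> 'a::comm_ring_1"
  shows "lead_coeff (\<Prod>i<n. [:- c i, 1:]) = 1 \<and> degree (\<Prod>i<n. [:- c i, 1:]) = n"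
proof (induction n)
  case (Suc n)
  have "(\<Prod>i<Suc n. [:- c i, 1:]) = [:- c n, 1:] * (\<Prod>i<n. [:- c i, 1:])"
    by (simp only: prod.lessThan_Suc mult.commute)
  then show ?case using Suc monic_linear_mult[of "\<Prod>i<n. [:- c i, 1:]" "- c n"] by metis
qed simp

lemma monic_dvd_small:
  fixes F :: "'a::comm_ring_1 poly"
  assumes "lead_coeff F = 1" "F dvd P" "degree P < degree F"
  shows "P = 0"
proof (rule ccontr)
  assume "P \<noteq> 0"
  obtain Q where Q: "P = F * Q" using assms(2) by (metis dvdE)
  then have "Q \<noteq> 0" using \<open>P \<noteq> 0\<close> by auto
  then have "coeff P (degree F + degree Q) \<noteq> 0"
    unfolding Q coeff_mult_degree_sum using assms(1) by simp
  then have "degree F + degree Q \<le> degree P" by (rule le_degree)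
  then show False using assms(3) by simp
qed

lemma ring_homo_poly: "ring_homo h \<Longrightarrow> h (poly P y) = poly (map_poly h P) (h y)"
  by (induction P) (simp_all add: ring_homoD map_poly_homo_simps)

lemma ring_homo_poly_eval: "ring_homo (\<lambda>P. poly P c)"
  by (simp add: ring_homo_def)

lemma (in cdvr) prod_nz: 
  assumes "\<And>i. i < n \<Longrightarrow> f i \<noteq> (0::'a)" shows "(\<Prod>i<(n::nat). f i) \<noteq> 0"
  using assms
proof (induction n)
  case 0
  show ?case using pi_nonunit by (metis dvd_0_right dvd_refl lessThan_0 prod.empty)
qed (simp add: mult_eq_0)

text \<open>The factor theorem for several distinct roots, with cancellation taken from the locale
  so that it applies over B.\<close>

lemma (in cdvr) prod_linear_dvd:
  fixes c :: "nat \<Rightarrow> 'a"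
  assumes "inj_on c {..<n}" "\<And>i. i < n \<Longrightarrow> poly P (c i) = 0"
  shows "(\<Prod>i<n. [:- c i, 1:]) dvd P"
  using assms
proof (induction n)
  case (Suc n)
  have "(\<Prod>i<n. [:- c i, 1:]) dvd P"
    using Suc by (intro Suc.IH) (auto simp: inj_on_def)
  then obtain Q where Q: "P = (\<Prod>i<n. [:- c i, 1:]) * Q" by (metis dvdE)
  have "(\<Prod>i<n. c n - c i) * poly Q (c n) = 0"
    using Suc.prems(2)[of n] unfolding Q by (simp add: poly_prod)
  moreover have "(\<Prod>i<n. c n - c i) \<noteq> 0"
  proof (intro prod_nz notI)
    fix i assume "i < n" "c n - c i = 0"
    then show False using inj_onD[OF Suc.prems(1), of n i] by auto
  qed
  ultimately have "poly Q (c n) = 0" using mult_eq_0 by blast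
  then obtain Q' where "Q = [:- c n, 1:] * Q'" unfolding poly_eq_0_iff_dvd by (metis dvdE)
  then have "P = (\<Prod>i<Suc n. [:- c i, 1:]) * Q'" unfolding Q prod.lessThan_Suc by (simp only: mult_ac)
  then show ?case by (metis dvdI)
qed simp

section \<open>Additive maps on \<open>\<int>[B \<times> B]\<close>\<close>

definition zsum :: "('x \<Rightarrow> 'a::comm_ring_1) \<Rightarrow> ('x \<Rightarrow>\<^sub>0 int) \<Rightarrow> 'a" where
  "zsum g t = (\<Sum>k\<in>Poly_Mapping.keys t. of_int (Poly_Mapping.lookup t k) * g k)"

lemma zsum_superset:
  assumes "finite U" "Poly_Mapping.keys t \<subseteq> U"
  shows "zsum g t = (\<Sum>k\<in>U. of_int (Poly_Mapping.lookup t k) * g k)"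
  unfolding zsum_def using assms by (intro sum.mono_neutral_left) (auto simp: in_keys_iff)

lemma zsum_diff: "zsum g (t - t') = zsum g t - zsum g t'"
proof -
  let ?U = "Poly_Mapping.keys t \<union> Poly_Mapping.keys t'"
  have "Poly_Mapping.keys (t - t') \<subseteq> ?U"
    by (auto simp: in_keys_iff lookup_minus)
  then show ?thesis
    using zsum_superset[of ?U "t - t'" g] zsum_superset[of ?U t g] zsum_superset[of ?U t' g]
    by (simp add: lookup_minus algebra_simps sum_subtractf)
qed

lemma zsum_0 [simp]: "zsum g 0 = 0" by (simp add: zsum_def)

lemma zsum_add: "zsum g (t + t') = zsum g t + zsum g t'"
  using zsum_diff[of g "t + t'" t'] by simp

lemma zsum_single [simp]: "zsum g (Poly_Mapping.single k m) = of_int m * g k"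
  by (cases "m = 0") (simp_all add: zsum_def)

lemma zsum_sum: "zsum g (sum f S) = (\<Sum>x\<in>S. zsum g (f x))"
  by (induction S rule: infinite_finite_induct) (simp_all add: zsum_add)

lemma zsum_homo: "ring_homo h \<Longrightarrow> h (zsum g t) = zsum (\<lambda>k. h (g k)) t"
  by (simp add: zsum_def ring_homoD)

lemma torsor_map_zsum: "torsor_map \<rho> t = zsum (\<lambda>(b, b'). smult b (\<rho> b')) t"
  unfolding torsor_map_def zsum_def by (intro sum.cong) (auto split: prod.splits)

text \<open>Basis elements and differences suffice, matching the closure rules of
  \<open>tensor_relations\<close>.\<close>

lemma int_poly_mapping_induct:
  fixes t :: "'x \<Rightarrow>\<^sub>0 int"
  assumes 0: "P 0" and s: "\<And>k. P (Poly_Mapping.single k 1)"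
    and d: "\<And>t t'. P t \<Longrightarrow> P t' \<Longrightarrow> P (t - t')"
  shows "P t"
proof -
  have add: "P (t + t')" if "P t" "P t'" for t t'
    using d[OF that(1) d[OF 0 that(2)]] by simp
  have nat: "P (Poly_Mapping.single k (int n))" for k n
  proof (induction n)
    case (Suc n)
    have "Poly_Mapping.single k (int (Suc n)) = Poly_Mapping.single k (int n) + Poly_Mapping.single k 1"
      unfolding single_add[symmetric] by (simp add: add.commute)
    then show ?case using add[OF Suc s, of k] by simp
  qed (simp add: 0)
  have "P (Poly_Mapping.single k m)" for k m
  proof (cases "m \<ge> 0")
    case True then show ?thesis using nat[of k "nat m"] by simp
  next
    case False
    then show ?thesis using d[OF 0 nat[of k "nat (- m)"]] by (simp add: single_uminus)
  qed
  then have "P (\<Sum>k\<in>S. Poly_Mapping.single k (m k))" for S m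
    by (induction S rule: infinite_finite_induct) (auto intro: add 0)
  moreover have "t = (\<Sum>k\<in>Poly_Mapping.keys t. Poly_Mapping.single k (Poly_Mapping.lookup t k))"
    by (rule poly_mapping_eqI) (simp add: lookup_sum lookup_single when_def in_keys_iff)
  ultimately show ?thesis by metis
qed

section \<open>Torsors and the Galois action\<close>

text \<open>Both group schemes are \<open>Spec R[x]/(f)\<close> with \<open>e + d x\<close> as their group-like function, where
  \<open>(e, d) = (0, 1)\<close> for \<open>\<mu>\<^sub>p\<close> and \<open>(e, d) = (1, \<pi>\<^sup>n)\<close> for \<open>\<H>\<^sub>n\<close>. All \<open>p\<close> zeros \<open>x\<^sub>i\<close> of \<open>f\<close> lie in
  \<open>R\<close>, and as \<open>B\<close> is a domain a polynomial modulo \<open>f\<close> is determined by its values at them.\<close>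

locale cover_scheme = cover p \<pi> red \<iota> s redB j \<zeta> G
  for p :: nat
    and \<pi> :: "'r :: {complete_dvr, ring_char_0}"
    and red :: "'r \<Rightarrow> 'k :: alg_closed_field"
    and \<iota> :: "'r bilaurent \<Rightarrow> 'b :: comm_ring_1"
    and s :: "'r \<Rightarrow> 'b"
    and redB :: "'b \<Rightarrow> 'c :: field"
    and j :: "'k fls \<Rightarrow> 'c"
    and \<zeta> :: 'r and G :: "('b \<Rightarrow> 'b) set" +
  fixes e d :: 'r and x :: "nat \<Rightarrow> 'r" and H :: "'r line_group"
  assumes d_nz: "d \<noteq> 0" and e_idem: "e * e = e" and x: "\<zeta> ^ i = e + d * x i"
    and eqn: "equation H = (\<Prod>i<p. [:- x i, 1:])"
    and law: "law H = [:[:0, e:], [:e, d:]:]" and neutral: "neutral H = x 0"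
begin

definition X :: "nat \<Rightarrow> 'b" where "X i = s (x i)"

abbreviation f :: "'b poly" where "f \<equiv> map_poly s (equation H)"

lemma z_X: "z ^ i = s e + s d * X i"
  using arg_cong[OF x[of i], of s] by (simp add: X_def s_simps)

lemma f_eq: "f = (\<Prod>i<p. [:- X i, 1:])"
  unfolding eqn ring_homoD(11)[OF map_poly_homo[OF s_homo]]
  by (simp add: X_def map_poly_homo_simps[OF s_homo] s_simps)

lemma sd_nz: "s d \<noteq> 0" using d_nz s_inj by simp

lemma X_inj: "inj_on X {..<p}"
proof (rule inj_onI)
  fix m n assume mn: "m \<in> {..<p}" "n \<in> {..<p}" "X m = X n"
  then have "z ^ m = z ^ n" by (simp add: z_X)
  then show "m = n" using z_power_inj mn by blast
qed

lemma f_dvd_iff: "f dvd P \<longleftrightarrow> (\<forall>i<p. poly P (X i) = 0)"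
proof
  assume "f dvd P"
  then obtain Q where Q: "P = f * Q" by (metis dvdE)
  show "\<forall>i<p. poly P (X i) = 0"
  proof (intro allI impI)
    fix i assume "i < p"
    then have "poly f (X i) = 0" unfolding f_eq poly_prod by (intro prod_zero) auto
    then show "poly P (X i) = 0" by (simp add: Q)
  qed
next
  assume "\<forall>i<p. poly P (X i) = 0"
  then show "f dvd P" unfolding f_eq by (intro B.prod_linear_dvd X_inj) auto
qed

lemma se_idem: "s e * s e = s e"
  by (metis e_idem s_simps(4))

text \<open>The group law adds indices: expand \<zeta>^i \<zeta>^k through e + d x and cancel d.
  Idempotence of e is all that both schemes need in common.\<close>

lemma X_add: "s e * X i + X k * (s e + s d * X i) = X ((i + k) mod p)"
proof -
  have "z ^ ((i + k) mod p) = z ^ i * z ^ k"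
  proof -
    have "z ^ (i + k) = (z ^ p) ^ ((i + k) div p) * z ^ ((i + k) mod p)"
      by (simp only: power_mult[symmetric] power_add[symmetric] mult_div_mod_eq)
    then show ?thesis by (simp add: z_p power_add)
  qed
  then have "s e + s d * X ((i + k) mod p) = (s e + s d * X i) * (s e + s d * X k)" by (simp only: z_X)
  also have "\<dots> = s e * s e + s d * (s e * X i + X k * (s e + s d * X i))" by (simp add: algebra_simps)
  also have "s e * s e = s e" by (rule se_idem)
  finally have "s d * X ((i + k) mod p) = s d * (s e * X i + X k * (s e + s d * X i))" by simp
  then show ?thesis using B.mult_cancel[OF sd_nz] by simp
qed

lemma X_0: "X 0 = s (neutral H)" by (simp add: X_def neutral)

lemma G_X: "\<sigma> \<in> G \<Longrightarrow> \<sigma> (X i) = X i" by (simp add: X_def G_s)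

lemma eval_law: "poly (poly (map_poly (map_poly s) (law H)) [:X k:]) (X i) = X ((i + k) mod p)"
  unfolding law by (simp add: map_poly_homo_simps[OF map_poly_homo[OF s_homo]]
      map_poly_homo_simps[OF s_homo] s_simps X_add[symmetric] algebra_simps)

lemma ring_homo_eval2: "ring_homo (\<lambda>E. poly (poly E [:X k:]) (X i))"
  by (simp add: ring_homo_def)

lemma eval_rhs:
  "poly (poly (poly (map_poly (\<lambda>c. [:[:c:]:]) Q) (map_poly (map_poly s) (law H))) [:X k:]) (X i) =
    poly Q (X ((i + k) mod p))"
proof -
  have "map_poly (\<lambda>E. poly (poly E [:X k:]) (X i)) (map_poly (\<lambda>c. [:[:c:]:]) Q) = Q"
    by (intro poly_eqI) (simp add: coeff_map_poly)
  then show ?thesis by (simp add: ring_homo_poly[OF ring_homo_eval2] eval_law)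
qed

text \<open>\<rho> chooses polynomials representing classes modulo f and may send 0 to a nonzero
  multiple of f. Hence coefficients beyond the degree are treated separately, and 0 goes to 0 only
  after evaluation at a section.\<close>

lemma eval_lhs:
  assumes A: "ring_homo (\<lambda>b. poly (\<rho> b) (X i))" and AX: "poly (\<rho> (X k)) (X i) = X k"
  shows "poly (poly (map_poly \<rho> Q) [:X k:]) (X i) = poly (\<rho> (poly Q (X k))) (X i)"
proof -
  have "map_poly (\<lambda>P. poly P (X i)) (map_poly \<rho> Q) = map_poly (\<lambda>b. poly (\<rho> b) (X i)) Q"
  proof (rule poly_eqI)
    fix l
    have Ql: "coeff Q l = (if l < length (coeffs Q) then coeffs Q ! l else 0)"
      unfolding nth_default_coeffs_eq[symmetric] by (simp add: nth_default_def)
    then have "coeff (map_poly \<rho> Q) l = (if l < length (coeffs Q) then \<rho> (coeff Q l) else 0)"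
      by (simp add: map_poly_def nth_default_def)
    moreover have "coeff Q l = 0" if "\<not> l < length (coeffs Q)" using that Ql by simp
    ultimately show "coeff (map_poly (\<lambda>P. poly P (X i)) (map_poly \<rho> Q)) l =
        coeff (map_poly (\<lambda>b. poly (\<rho> b) (X i)) Q) l"
      using ring_homoD(2)[OF A] by (auto simp: coeff_map_poly)
  qed
  then show ?thesis
    using ring_homo_poly[OF ring_homo_poly_eval[of "X i"], of "map_poly \<rho> Q" "[:X k:]"]
      ring_homo_poly[OF A, of Q "X k"] AX by simp
qed

text \<open>Divide by the monic f in the outer variable. At each section X i of the inner variable
  the remainder has degree below p and p roots, hence vanishes; so f divides all its
  coefficients.\<close>

lemma ideal2I:
  assumes E: "\<And>i k. i < p \<Longrightarrow> k < p \<Longrightarrow> poly (poly E [:X k:]) (X i) = 0"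
  shows "\<exists>U V. E = [:f:] * U + map_poly (\<lambda>c. [:c:]) f * V"
proof -
  have C: "ring_homo (\<lambda>c::'b. [:c:])" by (simp add: ring_homo_def one_pCons)
  define F where "F = map_poly (\<lambda>c. [:c:]) f"
  have Fp: "F = (\<Prod>i<p. [:- [:X i:], 1:])"
    unfolding F_def f_eq ring_homoD(11)[OF map_poly_homo[OF C]]
    by (simp add: map_poly_homo_simps[OF C] one_pCons)
  have F: "lead_coeff F = 1" "degree F = p"
    unfolding Fp using monic_prod_linear[of "\<lambda>i. [:X i:]" p] by blast+
  obtain Q R where QR: "E = F * Q + R" "degree R < p" using monic_division[of F E] F p_pos by auto
  have F0: "poly F [:X k:] = [:poly f (X k):]" for k
    using ring_homo_poly[OF C, of f "X k"] by (simp add: F_def)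
  have R0: "poly (poly R [:X k:]) (X i) = 0" if "i < p" "k < p" for i k
  proof -
    have "poly f (X k) = 0" using f_dvd_iff[of f] that by simp
    then show ?thesis using E[OF that] unfolding QR by (simp add: F0)
  qed
  have "f dvd coeff R l" for l
    unfolding f_dvd_iff
  proof (intro allI impI)
    fix i assume i: "i < p"
    define S where "S = map_poly (\<lambda>P. poly P (X i)) R"
    have "f dvd S"
      unfolding f_dvd_iff
      using R0[OF i] ring_homo_poly[OF ring_homo_poly_eval[of "X i"], of R "[:X _:]"] by (simp add: S_def)
    moreover have "degree S \<le> degree R"
      unfolding S_def by (intro degree_le) (simp add: coeff_map_poly coeff_eq_0)
    ultimately have "S = 0" using monic_prod_linear[of X p] QR(2) unfolding f_eq
      by (intro monic_dvd_small) auto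
    then have "coeff S l = 0" by simp
    then show "poly (coeff R l) (X i) = 0" by (simp add: S_def coeff_map_poly)
  qed
  then have "\<forall>l. \<exists>q. coeff R l = f * q" by (simp add: dvd_def)
  then obtain q where q: "\<And>l. coeff R l = f * q l" by metis
  have "R = [:f:] * (\<Sum>l<p. monom (q l) l)"
  proof (rule poly_eqI)
    fix l
    show "coeff R l = coeff ([:f:] * (\<Sum>l<p. monom (q l) l)) l"
      using QR(2) q[of l] by (auto simp: coeff_sum_monom coeff_eq_0)
  qed
  then show ?thesis using QR(1) unfolding F_def by (metis add.commute)
qed

text \<open>Evaluation at a section turns the coaction into a map on B; this says that the resulting
  action of the cyclic group of sections is through the powers of \<sigma>.\<close>

definition acts :: "('b \<Rightarrow> 'b poly) \<Rightarrow> ('b \<Rightarrow> 'b) \<Rightarrow> bool" where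
  "acts \<rho> \<sigma> \<longleftrightarrow> (\<forall>b. \<forall>i<p. poly (\<rho> b) (X i) = (\<sigma> ^^ i) b)"

lemma coaction_of_acts:
  assumes \<sigma>: "\<sigma> \<in> G" and \<rho>: "acts \<rho> \<sigma>"
  shows "coaction \<iota> s H \<rho>"
proof -
  have ev: "poly (\<rho> b) (X i) = (\<sigma> ^^ i) b" if "i < p" for b i using \<rho> that unfolding acts_def by blast
  note h = ring_homoD[OF G_homo[OF G_funpow[OF \<sigma>]]]
  have "\<exists>U V. map_poly \<rho> (\<rho> b) - poly (map_poly (\<lambda>c. [:[:c:]:]) (\<rho> b)) (map_poly (map_poly s) (law H))
      = [:f:] * U + map_poly (\<lambda>c. [:c:]) f * V" for b
  proof (rule ideal2I)
    fix i k assume ik: "i < p" "k < p"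
    have A: "ring_homo (\<lambda>b. poly (\<rho> b) (X i))"
      using ev[OF ik(1)] G_homo[OF G_funpow[OF \<sigma>, of i]] by (simp add: ring_homo_def)
    have "poly (\<rho> (X k)) (X i) = X k" using ev[OF ik(1)] G_X[OF G_funpow[OF \<sigma>]] by simp
    note l = eval_lhs[OF A this, of "\<rho> b"]
    have "(i + k) mod p < p" using p_pos by simp
    then have "poly (\<rho> b) (X ((i + k) mod p)) = (\<sigma> ^^ (i + k)) b"
      using ev funpow_mod[OF \<sigma>] by simp
    then show "poly (poly (map_poly \<rho> (\<rho> b) - poly (map_poly (\<lambda>c. [:[:c:]:]) (\<rho> b))
        (map_poly (map_poly s) (law H))) [:X k:]) (X i) = 0"
      by (simp add: l eval_rhs ev ik funpow_add)
  qed
  then have I2: "map_poly \<rho> (\<rho> b) - poly (map_poly (\<lambda>c. [:[:c:]:]) (\<rho> b)) (map_poly (map_poly s) (law H))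
      \<in> {[:f:] * U + map_poly (\<lambda>c. [:c:]) f * V | U V. True}" for b by blast
  have "f dvd \<rho> (b + b') - (\<rho> b + \<rho> b')" "f dvd \<rho> (b * b') - \<rho> b * \<rho> b'" for b b'
    unfolding f_dvd_iff by (simp_all add: ev h)
  moreover have "f dvd \<rho> (\<iota> a) - [:\<iota> a:]" for a
    unfolding f_dvd_iff by (simp add: ev G_iota[OF G_funpow[OF \<sigma>]])
  moreover have "poly (\<rho> b) (s (neutral H)) = b" for b
    unfolding X_0[symmetric] using ev[OF p_pos] by simp
  ultimately show ?thesis unfolding coaction_def Let_def using I2 by blast
qed

lemma eval_torsor_map:
  assumes "acts \<rho> \<sigma>" "i < p"
  shows "poly (torsor_map \<rho> t) (X i) = zsum (\<lambda>(b, c). b * (\<sigma> ^^ i) c) t"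
proof -
  have "poly (torsor_map \<rho> t) (X i) = zsum (\<lambda>k. poly (case k of (b, c) \<Rightarrow> smult b (\<rho> c)) (X i)) t"
    unfolding torsor_map_zsum by (rule zsum_homo[OF ring_homo_poly_eval])
  also have "(\<lambda>k. poly (case k of (b, c) \<Rightarrow> smult b (\<rho> c)) (X i)) = (\<lambda>(b, c). b * (\<sigma> ^^ i) c)"
    using assms unfolding acts_def by (auto simp: fun_eq_iff)
  finally show ?thesis .
qed

end

section \<open>Faithful flatness of B over A, and normal forms in the tensor square\<close>

context cover
begin

text \<open>B is free, so a relation holds coordinate by coordinate and the coordinates are the
  required coefficients.\<close>

lemma flat_iota: "flat_algebra \<iota>"
  unfolding flat_algebra_def
proof (intro allI impI)
  fix n :: nat and r :: "nat \<Rightarrow> 'r bilaurent" and b :: "nat \<Rightarrow> 'b"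
  assume 0: "(\<Sum>i<n. \<iota> (r i) * b i) = 0"
  obtain W where W: "gen W" using gen_exists by blast
  have "b i = (\<Sum>l<p. \<iota> (co W (b i) l) * W ^ l)" for i
    using lin_co[OF W, of "b i"] by (simp add: lin_def)
  moreover have "(\<Sum>i<n. r i * co W (b i) l) = 0" if l: "l < p" for l
  proof -
    have "(\<Sum>i<n. r i * co W (b i) l) = co W (\<Sum>i<n. \<iota> (r i) * b i) l"
      using l by (simp add: co_sum[OF W] co_scale[OF W])
    then show ?thesis unfolding 0 by (simp add: co_0[OF W l])
  qed
  ultimately show "\<exists>(m::nat) a c. (\<forall>i<n. b i = (\<Sum>j<m. \<iota> (a i j) * c j)) \<and> (\<forall>j<m. (\<Sum>i<n. r i * a i j) = 0)"
    by (intro exI[of _ p] exI[of _ "\<lambda>i l. co W (b i) l"] exI[of _ "\<lambda>l. W ^ l"]) auto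
qed

text \<open>A is local with maximal ideal (\<pi>): if no a i were a unit, \<pi> would divide 1 in
  B.\<close>

lemma faithfully_flat_iota: "faithfully_flat \<iota>"
  unfolding faithfully_flat_def
proof (intro conjI allI impI flat_iota)
  fix n :: nat and a :: "nat \<Rightarrow> 'r bilaurent" and b :: "nat \<Rightarrow> 'b"
  assume 1: "(\<Sum>i<n. \<iota> (a i) * b i) = 1"
  have "\<exists>i<n. a i dvd 1"
  proof (rule ccontr)
    assume "\<not> (\<exists>i<n. a i dvd 1)"
    then have "\<forall>i<n. bl_const \<pi> dvd a i" using A.unit_iff by blast
    then have "\<forall>i<n. s \<pi> dvd \<iota> (a i)" using ring_homo_dvd[OF iota] s_apply by metis
    then have "s \<pi> dvd (\<Sum>i<n. \<iota> (a i) * b i)" by (intro dvd_sum) auto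
    then show False using 1 B.pi_nonunit by simp
  qed
  then obtain i where i: "i < n" "a i dvd 1" by blast
  then obtain c where c: "a i * c = 1" by (metis dvdE)
  have "(\<Sum>l<n. (if l = i then c else 0) * a l) = (\<Sum>l<n. if l = i then c * a i else 0)"
    by (intro sum.cong) auto
  also have "\<dots> = 1" using i c by (simp add: mult.commute)
  finally show "\<exists>c. (\<Sum>i<n. c i * a i) = 1" by (intro exI[of _ "\<lambda>l. if l = i then c else 0"])
qed

lemma finitely_presented_iota: "finitely_presented \<iota>"
proof -
  obtain W where W: "gen W" using gen_exists by blast
  have 1: "\<forall>b. \<exists>c. b = (\<Sum>i<p. \<iota> (c i) * W ^ i)"
    using lin_surj[OF W] unfolding lin_def by blast
  have 2: "\<forall>c. (\<Sum>i<p. \<iota> (c i) * W ^ i) = 0 \<longrightarrow> (\<forall>i<p. c i = (\<Sum>j<0::nat. d j * r j i))" for d r :: "nat \<Rightarrow> _"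
    using lin_indep[OF W] unfolding lin_def by simp
  show ?thesis
    unfolding finitely_presented_def
    by (rule exI[of _ p], rule exI[of _ "\<lambda>i. W ^ i"], rule conjI[OF 1], rule exI[of _ "0::nat"])
      (use 2 in auto)
qed

text \<open>The factorisation is proved over R[x] and transported to B by mapping coefficients and
  evaluating at q.\<close>

lemma B_root_prod: "q ^ p - 1 = (\<Prod>l<p. q - z ^ l)"
proof -
  have "[:0, 1:] ^ p - 1 = (\<Prod>l<p. [:0, 1:] - [:\<zeta>:] ^ l)"
    by (rule root_of_unity_prod[OF p_pos]) (use zeta_p zeta_prim in \<open>auto simp: poly_const_pow one_pCons\<close>)
  then have "poly (map_poly s ([:0, 1:] ^ p - 1)) q = poly (map_poly s (\<Prod>l<p. [:0, 1:] - [:\<zeta>:] ^ l)) q" by simp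
  then show ?thesis
    by (simp add: ring_homoD[OF map_poly_homo[OF s_homo]] map_poly_homo_simps[OF s_homo] s_simps poly_prod)
qed

lemma tensor_relations_add:
  assumes "t \<in> tensor_relations \<iota>" "t' \<in> tensor_relations \<iota>" shows "t + t' \<in> tensor_relations \<iota>"
  using tensor_relations.intros(5)[OF assms(1) tensor_relations.intros(5)[OF tensor_relations.intros(4) assms(2)]]
  by simp

lemma tensor_relations_sum:
  assumes "\<And>i. i \<in> S \<Longrightarrow> t i \<in> tensor_relations \<iota>" shows "sum t S \<in> tensor_relations \<iota>"
  using assms by (induction S rule: infinite_finite_induct) (auto intro: tensor_relations_add tensor_relations.intros(4))

lemma tensor_relations_zero: "Poly_Mapping.single (b, 0) 1 \<in> tensor_relations \<iota>"
  "Poly_Mapping.single (0, c) 1 \<in> tensor_relations \<iota>"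
  using tensor_relations.intros(5)[OF tensor_relations.intros(4) tensor_relations.intros(2)[of b 0 0 \<iota>]]
    tensor_relations.intros(5)[OF tensor_relations.intros(4) tensor_relations.intros(1)[of 0 0 c \<iota>]] by simp_all

text \<open>The tensor square of B is spanned over its left factor by the classes of W^k, k < p;
  coefficients in A move to the left.\<close>

lemma tensor_normal_form:
  assumes W: "gen W"
  shows "\<exists>c. t - (\<Sum>k<p. Poly_Mapping.single (c k, W ^ k) 1) \<in> tensor_relations \<iota>"
proof (induction t rule: int_poly_mapping_induct)
  case 1
  have "0 - (\<Sum>k<p. Poly_Mapping.single (0, W ^ k) 1) \<in> tensor_relations \<iota>"
    by (intro tensor_relations.intros(5) tensor_relations.intros(4) tensor_relations_sum tensor_relations_zero)
  then show ?case by (intro exI[of _ "\<lambda>_. 0"])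
next
  case (2 k)
  obtain b b' where k: "k = (b, b')" by fastforce
  define v where "v = (\<lambda>l. \<iota> (co W b' l) * W ^ l)"
  have split: "Poly_Mapping.single (b, \<Sum>l<n. v l) 1 - (\<Sum>l<n. Poly_Mapping.single (b, v l) 1) \<in> tensor_relations \<iota>" for n :: nat
  proof (induction n)
    case (Suc n)
    from tensor_relations_add[OF tensor_relations.intros(2)[of b "\<Sum>l<n. v l" "v n" \<iota>] Suc]
    show ?case by (simp add: algebra_simps)
  qed (simp add: tensor_relations_zero)
  have "(\<Sum>l<p. Poly_Mapping.single (b, v l) 1 - Poly_Mapping.single (\<iota> (co W b' l) * b, W ^ l) 1)
      \<in> tensor_relations \<iota>"
  proof (rule tensor_relations_sum)
    fix l
    show "Poly_Mapping.single (b, v l) 1 - Poly_Mapping.single (\<iota> (co W b' l) * b, W ^ l) 1 \<in> tensor_relations \<iota>"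
      using tensor_relations.intros(5)[OF tensor_relations.intros(4) tensor_relations.intros(3)[of \<iota> "co W b' l" b "W ^ l"]]
      by (simp add: v_def)
  qed
  from tensor_relations_add[OF split[of p] this]
  have "Poly_Mapping.single (b, \<Sum>l<p. v l) 1 - (\<Sum>l<p. Poly_Mapping.single (\<iota> (co W b' l) * b, W ^ l) 1)
      \<in> tensor_relations \<iota>" by (simp add: sum_subtractf)
  moreover have "(\<Sum>l<p. v l) = b'" using lin_co[OF W, of b'] by (simp add: lin_def v_def)
  ultimately show ?case unfolding k by auto
next
  case (3 t t')
  then obtain c c' where c: "t - (\<Sum>k<p. Poly_Mapping.single (c k, W ^ k) 1) \<in> tensor_relations \<iota>"
    "t' - (\<Sum>k<p. Poly_Mapping.single (c' k, W ^ k) 1) \<in> tensor_relations \<iota>" by blast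
  have "(\<Sum>k<p. Poly_Mapping.single (c k, W ^ k) 1 - Poly_Mapping.single (c k - c' k, W ^ k) 1
      - Poly_Mapping.single (c' k, W ^ k) 1) \<in> tensor_relations \<iota>"
  proof (rule tensor_relations_sum)
    fix k
    show "Poly_Mapping.single (c k, W ^ k) 1 - Poly_Mapping.single (c k - c' k, W ^ k) 1
      - Poly_Mapping.single (c' k, W ^ k) 1 \<in> tensor_relations \<iota>"
      using tensor_relations.intros(1)[of "c k - c' k" "c' k" "W ^ k" \<iota>] by simp
  qed
  from tensor_relations_add[OF tensor_relations.intros(5)[OF c] this]
  show ?case by (intro exI[of _ "\<lambda>k. c k - c' k"]) (simp add: sum_subtractf sum.distrib algebra_simps)
qed

end

section \<open>Torsor structures correspond to generators of G\<close>

context cover_scheme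
begin

lemma tensor_relations_eval:
  assumes \<sigma>: "\<sigma> \<in> G" and t: "t \<in> tensor_relations \<iota>"
  shows "zsum (\<lambda>(b, c). b * (\<sigma> ^^ i) c) t = 0"
  using t
  by (induction rule: tensor_relations.induct)
    (simp_all add: zsum_diff zsum_add ring_homoD[OF G_homo[OF G_funpow[OF \<sigma>]]] G_iota[OF G_funpow[OF \<sigma>]] algebra_simps)

lemma generator_powers:
  assumes \<sigma>: "\<sigma> \<in> G" and Y: "eig \<sigma> (s e + s d * W)"
  shows "(\<sigma> ^^ i) W = s e * W + (s e + s d * W) * X i" "inj_on (\<lambda>i. (\<sigma> ^^ i) W) {..<p}"
proof -
  define Y where "Y = s e + s d * W"
  have Y0: "Y \<noteq> 0" using Y B.unit_nz unfolding eig_def Y_def by blast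
  have pow: "s e + s d * (\<sigma> ^^ i) W = z ^ i * Y" for i
    using eig_funpow[OF \<sigma> Y, of i]
    by (simp add: Y_def ring_homoD[OF G_homo[OF G_funpow[OF \<sigma>]]] G_s[OF G_funpow[OF \<sigma>]])

  have "s d * (\<sigma> ^^ i) W = z ^ i * Y - s e" using pow[of i] by (simp add: algebra_simps)
  also have "\<dots> = s e * Y + s d * X i * Y - s e" by (simp add: z_X algebra_simps)
  also have "s e * Y = s e + s e * s d * W" unfolding Y_def by (simp add: distrib_left se_idem mult.assoc)
  finally have "s d * (\<sigma> ^^ i) W = s d * (s e * W + Y * X i)" by (simp add: algebra_simps)
  then show "(\<sigma> ^^ i) W = s e * W + (s e + s d * W) * X i"
    using B.mult_cancel[OF sd_nz] by (simp add: Y_def)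
  show "inj_on (\<lambda>i. (\<sigma> ^^ i) W) {..<p}"
  proof (rule inj_onI)
    fix m n assume mn: "m \<in> {..<p}" "n \<in> {..<p}" "(\<sigma> ^^ m) W = (\<sigma> ^^ n) W"
    then have "z ^ m * Y = z ^ n * Y" using pow by metis
    then have "z ^ m = z ^ n" using B.mult_cancel_right[OF Y0] by blast
    then show "m = n" using z_power_inj mn by blast
  qed
qed

text \<open>The coaction sends W to L = e W + (e + d W) x and extends through coordinates; its value
  at the i-th section is the i-th iterate of \<sigma>.\<close>

theorem torsor_exists:
  assumes \<sigma>: "is_gen \<sigma>" and W: "gen W" and Y: "eig \<sigma> (s e + s d * W)"
  shows "\<exists>\<rho>. fppf_torsor \<iota> s H \<rho>"
proof -
  have \<sigma>G: "\<sigma> \<in> G" using \<sigma> unfolding is_gen_def by blast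
  note h = ring_homoD[OF G_homo[OF G_funpow[OF \<sigma>G]]]
  define y where "y = s e + s d * W"
  define L where "L = [:s e * W, y:]"
  have L: "poly L (X i) = (\<sigma> ^^ i) W" for i
    using generator_powers(1)[OF \<sigma>G Y, of i] by (simp add: L_def y_def mult.commute)
  define \<rho> where "\<rho> = (\<lambda>b. \<Sum>k<p. smult (\<iota> (co W b k)) (L ^ k))"
  have acts: "acts \<rho> \<sigma>"
    unfolding acts_def
  proof (intro allI impI)
    fix b i
    have "poly (\<rho> b) (X i) = (\<Sum>k<p. \<iota> (co W b k) * (\<sigma> ^^ i) W ^ k)" by (simp add: \<rho>_def poly_sum L)
    also have "\<dots> = (\<sigma> ^^ i) (lin W (co W b))" by (simp add: lin_def h G_iota[OF G_funpow[OF \<sigma>G]])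
    finally show "poly (\<rho> b) (X i) = (\<sigma> ^^ i) b" by (simp add: lin_co[OF W])
  qed
  note ev = eval_torsor_map[OF acts]
  have yu: "y dvd 1" using Y unfolding eig_def y_def by blast
  have surj: "\<exists>t. f dvd P - torsor_map \<rho> t" for P
  proof -
    \<comment> \<open>The compositional inverse of L, available because its leading coefficient is a
      unit. It expresses x through the image of W, so any polynomial in x comes from the tensor
      product.\<close>
    define L' where "L' = [:- (B.recip y * (s e * W)), B.recip y:]"
    have L'L: "poly L' (poly L v) = v" for v
    proof -
      have "poly L' (poly L v) = (B.recip y * y) * v" by (simp add: L_def L'_def algebra_simps)
      then show ?thesis using B.recip'[OF yu] by simp
    qed
    define Q where "Q = pcompose P L'"
    define t where "t = (\<Sum>k\<le>degree Q. Poly_Mapping.single (coeff Q k, W ^ k) (1::int))"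
    have "f dvd P - torsor_map \<rho> t"
      unfolding f_dvd_iff
    proof (intro allI impI)
      fix i assume i: "i < p"
      have "poly P (X i) = poly Q (poly L (X i))" by (simp add: Q_def poly_pcompose L'L)
      also have "\<dots> = poly Q ((\<sigma> ^^ i) W)" by (simp add: L)
      also have "\<dots> = (\<Sum>k\<le>degree Q. coeff Q k * (\<sigma> ^^ i) W ^ k)" by (rule poly_altdef)
      also have "\<dots> = poly (torsor_map \<rho> t) (X i)" by (simp add: ev[OF i] t_def zsum_sum h)
      finally show "poly (P - torsor_map \<rho> t) (X i) = 0" by simp
    qed
    then show ?thesis by blast
  qed
  have ker: "f dvd torsor_map \<rho> t \<longleftrightarrow> t \<in> tensor_relations \<iota>" for t
  proof
    assume "t \<in> tensor_relations \<iota>"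
    then show "f dvd torsor_map \<rho> t" unfolding f_dvd_iff using ev tensor_relations_eval[OF \<sigma>G] by simp
  next
    assume 0: "f dvd torsor_map \<rho> t"
    obtain c where c: "t - (\<Sum>k<p. Poly_Mapping.single (c k, W ^ k) 1) \<in> tensor_relations \<iota>"
      using tensor_normal_form[OF W] by blast
    \<comment> \<open>A normal form in the kernel becomes a polynomial of degree below p with p
      roots, the distinct conjugates of W; so it vanishes.\<close>
    define P where "P = (\<Sum>k<p. monom (c k) k)"
    have dP: "degree P < p" unfolding P_def using p_pos degree_sum_monom by blast
    have "poly P ((\<sigma> ^^ i) W) = 0" if i: "i < p" for i
    proof -
      have "zsum (\<lambda>(b, c). b * (\<sigma> ^^ i) c) t = 0" using 0 i unfolding f_dvd_iff ev[OF i, symmetric] by blast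
      then have "zsum (\<lambda>(b, c). b * (\<sigma> ^^ i) c) (\<Sum>k<p. Poly_Mapping.single (c k, W ^ k) 1) = 0"
        using tensor_relations_eval[OF \<sigma>G c, of i] by (simp add: zsum_diff)
      then show ?thesis by (simp add: P_def zsum_sum poly_sum poly_monom h)
    qed
    then have "(\<Prod>i<p. [:- ((\<sigma> ^^ i) W), 1:]) dvd P"
      by (intro B.prod_linear_dvd generator_powers(2)[OF \<sigma>G Y]) auto
    then have "P = 0" using dP monic_prod_linear[of "\<lambda>i. (\<sigma> ^^ i) W" p] by (intro monic_dvd_small) auto
    then have "c k = 0" if "k < p" for k
      using coeff_sum_monom[of c p k] that unfolding P_def by simp
    then have "(\<Sum>k<p. Poly_Mapping.single (c k, W ^ k) (1::int)) \<in> tensor_relations \<iota>"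
      by (intro tensor_relations_sum) (simp add: tensor_relations_zero)
    from tensor_relations_add[OF c this] show "t \<in> tensor_relations \<iota>" by simp
  qed
  show ?thesis
    unfolding fppf_torsor_def
    using faithfully_flat_iota finitely_presented_iota coaction_of_acts[OF \<sigma>G acts] surj ker by blast
qed

text \<open>Evaluation at the sections gives ring endomorphisms A i of B over A that compose by
  adding indices modulo p. Each turns out to be an iterate of a fixed generator, so A 1 determines
  the action; surjectivity of the torsor map makes A 1 itself a generator.\<close>

theorem torsor_acts:
  assumes T: "fppf_torsor \<iota> s H \<rho>"
  shows "\<exists>\<sigma>. is_gen \<sigma> \<and> acts \<rho> \<sigma>"
proof -
  have co: "coaction \<iota> s H \<rho>" and surj: "\<And>P. \<exists>t. f dvd P - torsor_map \<rho> t"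
    using T unfolding fppf_torsor_def by blast+
  have c1: "f dvd \<rho> (b + b') - (\<rho> b + \<rho> b')" and c2: "f dvd \<rho> (b * b') - \<rho> b * \<rho> b'"
    and c3: "f dvd \<rho> (\<iota> a) - [:\<iota> a:]" and c4: "poly (\<rho> b) (X 0) = b"
    and c5: "map_poly \<rho> (\<rho> b) - poly (map_poly (\<lambda>c. [:[:c:]:]) (\<rho> b)) (map_poly (map_poly s) (law H))
        \<in> {[:f:] * U + map_poly (\<lambda>c. [:c:]) f * V | U V. True}" for b b' a
    using co unfolding coaction_def Let_def X_0 by blast+
  define A where "A = (\<lambda>i b. poly (\<rho> b) (X i))"
  have Aiota: "A i (\<iota> a) = \<iota> a" if "i < p" for i a
    using c3[of a] that unfolding f_dvd_iff A_def by simp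
  have Ahomo: "ring_homo (A i)" if i: "i < p" for i
    unfolding ring_homo_def
  proof (intro conjI allI)
    show "A i 1 = 1" using Aiota[OF i, of 1] by (simp add: iota_simps)
    show "A i (b + b') = A i b + A i b'" for b b' using c1[of b b'] i unfolding f_dvd_iff A_def by simp
    show "A i (b * b') = A i b * A i b'" for b b' using c2[of b b'] i unfolding f_dvd_iff A_def by simp
  qed
  have Acomp: "A i (A k b) = A ((i + k) mod p) b" if ik: "i < p" "k < p" for i k b
  proof -
    have hA: "ring_homo (\<lambda>b. poly (\<rho> b) (X i))" using Ahomo[OF ik(1)] by (simp add: A_def)
    have "poly (\<rho> (X k)) (X i) = X k" using Aiota[OF ik(1), of "bl_const (x k)"] by (simp add: A_def X_def s_apply)
    note l = eval_lhs[OF hA this, of "\<rho> b"]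
    obtain U V where UV: "map_poly \<rho> (\<rho> b) - poly (map_poly (\<lambda>c. [:[:c:]:]) (\<rho> b)) (map_poly (map_poly s) (law H))
        = [:f:] * U + map_poly (\<lambda>c. [:c:]) f * V" using c5[of b] by blast
    have C: "ring_homo (\<lambda>c::'b. [:c:])" by (simp add: ring_homo_def one_pCons)
    have f0: "poly f (X i) = 0" "poly f (X k) = 0" using f_dvd_iff[of f] ik by simp_all
    have "poly (map_poly (\<lambda>c. [:c:]) f) [:X k:] = 0"
      using ring_homo_poly[OF C, of f "X k"] f0 by simp
    then have "poly (poly ([:f:] * U + map_poly (\<lambda>c. [:c:]) f * V) [:X k:]) (X i) = 0" by (simp add: f0)
    then have "poly (\<rho> (poly (\<rho> b) (X k))) (X i) - poly (\<rho> b) (X ((i + k) mod p)) = 0"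
      unfolding UV[symmetric] by (simp add: l eval_rhs)
    then show ?thesis by (simp add: A_def)
  qed
  obtain \<sigma>0 where \<sigma>0: "is_gen \<sigma>0" using is_gen_exists by blast
  then have \<sigma>0G: "\<sigma>0 \<in> G" unfolding is_gen_def by blast
  obtain n W where W: "gen W" "eig \<sigma>0 (1 + s \<pi> ^ n * W)" using kummer_normal_form[OF \<sigma>0] by blast
  define y where "y = 1 + s \<pi> ^ n * W"
  obtain u where u: "y ^ p = \<iota> u" using eig_power_p[OF \<sigma>0] W(2) unfolding y_def by blast
  have yu: "y dvd 1" using W(2) unfolding eig_def y_def by blast
  have Apow: "\<exists>l<p. A i = \<sigma>0 ^^ l" if i: "i < p" for i
  proof -
    note hA = ring_homoD[OF Ahomo[OF i]]
    \<comment> \<open>y^p lies in A, so q is a p-th root of 1 in the domain B, that is a power of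
      \<zeta>. Then A i agrees with an iterate on y, hence on W after cancelling \<pi>^n, hence on
      B.\<close>
    define q where "q = A i y * B.recip y"
    have qy: "A i y = q * y" unfolding q_def using B.recip'[OF yu] by (simp add: mult.assoc)
    have "q ^ p * y ^ p = y ^ p"
      using arg_cong[OF u, of "A i"] unfolding hA qy by (simp add: Aiota[OF i] u power_mult_distrib)
    then have "q ^ p = 1" using B.mult_cancel_right[OF B.unit_nz[OF B.unit_power[OF yu]], of "q ^ p" p 1] by simp
    then have "(\<Prod>l<p. q - z ^ l) = 0" using B_root_prod[of q] by simp
    then have "\<exists>l<p. q - z ^ l = 0" using B.prod_nz[of p "\<lambda>l. q - z ^ l"] by metis
    then obtain l where l: "l < p" "q - z ^ l = 0" by blast
    have h: "ring_homo (\<sigma>0 ^^ l)" by (rule G_homo[OF G_funpow[OF \<sigma>0G]])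
    have Ay: "A i y = (\<sigma>0 ^^ l) y"
      using l(2) eig_funpow[OF \<sigma>0G W(2)[folded y_def], of l] qy by simp
    have As: "A i (s c) = s c" for c by (simp add: s_apply Aiota[OF i])
    have "s \<pi> ^ n * A i W = s \<pi> ^ n * (\<sigma>0 ^^ l) W"
      using Ay unfolding y_def by (simp add: hA As ring_homoD[OF h] G_s[OF G_funpow[OF \<sigma>0G]])
    then have AW: "A i W = (\<sigma>0 ^^ l) W" using B.mult_cancel[OF B.pi_power_nz] by blast
    have "A i b = (\<sigma>0 ^^ l) b" for b
    proof -
      have "A i (lin W (co W b)) = (\<sigma>0 ^^ l) (lin W (co W b))"
        by (simp add: lin_def hA Aiota[OF i] AW ring_homoD[OF h] G_iota[OF G_funpow[OF \<sigma>0G]])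
      then show ?thesis by (simp add: lin_co[OF W(1)])
    qed
    then show ?thesis using l(1) by blast
  qed
  define \<sigma> where "\<sigma> = A 1"
  have pw: "A i = \<sigma> ^^ i" if "i < p" for i
    using that
  proof (induction i)
    case 0
    then show ?case using c4 by (auto simp: A_def)
  next
    case (Suc i)
    have "A (Suc i) b = A 1 (A i b)" for b using Acomp[of 1 i b] Suc.prems p_gt_1 by simp
    then show ?case using Suc by (auto simp: \<sigma>_def)
  qed
  obtain l where l: "l < p" "\<sigma> = \<sigma>0 ^^ l" using Apow[of 1] p_gt_1 unfolding \<sigma>_def by blast
  have act: "acts \<rho> \<sigma>"
    unfolding acts_def using pw by (simp add: A_def[symmetric] fun_eq_iff) (simp add: A_def)
  \<comment> \<open>For a trivial action the torsor map has equal values at all sections and misses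
    x, which separates them.\<close>
  have "l \<noteq> 0"
  proof
    assume "l = 0"
    then have "\<sigma> ^^ i = id" for i using l by (induction i) auto
    moreover obtain t where t: "f dvd [:0, 1:] - torsor_map \<rho> t" using surj by blast
    ultimately have "X i = zsum (\<lambda>(b, c). b * c) t" if "i < p" for i
      using that eval_torsor_map[OF act that, of t] unfolding f_dvd_iff by simp
    then have "X 0 = X 1" using p_gt_1 by simp
    then show False using X_inj p_gt_1 unfolding inj_on_def by force
  qed
  then have "coprime l p" using l prime_p by (metis coprime_commute dvd_imp_le gr0I not_le prime_imp_coprime)
  then have "is_gen \<sigma>" unfolding l(2) by (rule is_gen_funpow[OF \<sigma>0])
  then show ?thesis using act by blast
qed

end

section \<open>The explicit formulas\<close>

context cover
begin

lemma root_pow_int: "root_pow z p (int k) = z ^ k"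
proof -
  have "z ^ k = (z ^ p) ^ (k div p) * z ^ (k mod p)"
    by (simp only: power_mult[symmetric] power_add[symmetric] mult_div_mod_eq)
  then show ?thesis by (simp add: root_pow_def z_p nat_mod_as_int[symmetric] flip: zmod_int)
qed

lemma root_pow_cong: "a mod int p = b mod int p \<Longrightarrow> root_pow c p a = root_pow c p b"
  by (simp add: root_pow_def)

lemma root_pow_add: "root_pow z p (a + b) = root_pow z p a * root_pow z p b"
proof -
  define k l where "k = nat (a mod int p)" and "l = nat (b mod int p)"
  have kl: "int k = a mod int p" "int l = b mod int p" using p_pos by (simp_all add: k_def l_def)
  have "root_pow z p (a + b) = root_pow z p (int (k + l))"
    by (rule root_pow_cong) (simp add: kl mod_add_eq)
  also have "\<dots> = root_pow z p (int k) * root_pow z p (int l)"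
    unfolding root_pow_int by (rule power_add)
  also have "root_pow z p (int k) = root_pow z p a" by (rule root_pow_cong) (simp add: kl)
  also have "root_pow z p (int l) = root_pow z p b" by (rule root_pow_cong) (simp add: kl)
  finally show ?thesis .
qed

lemma root_pow_0: "root_pow z p 0 = 1" by (simp add: root_pow_def)

lemma root_pow_unit: "root_pow z p a dvd 1"
  unfolding root_pow_def by (rule z_unit)

lemma root_pow_uminus: "root_pow z p (- a) = B.recip (root_pow z p a)"
  using root_pow_add[of a "- a"] by (intro B.recip_unique[symmetric]) (simp add: root_pow_0)

lemma root_pow_nat: "root_pow z p (int n * a) = root_pow z p a ^ n"
proof (induction n)
  case (Suc n)
  have "int (Suc n) * a = a + int n * a" by (simp add: algebra_simps)
  then show ?case unfolding root_pow_add using Suc by (simp add: root_pow_add)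
qed (simp add: root_pow_0)

lemma unit_powi_root_pow: "unit_powi (root_pow z p a) m = root_pow z p (m * a)"
proof (cases "0 \<le> m")
  case True
  then show ?thesis using root_pow_nat[of "nat m" a] by (simp add: B.unit_powi_nonneg)
next
  case False
  then have "unit_powi (root_pow z p a) m = root_pow z p (- a) ^ nat (- m)"
    by (simp add: B.unit_powi_neg root_pow_uminus)
  also have "\<dots> = root_pow z p (m * a)" using root_pow_nat[of "nat (- m)" "- a"] False by simp
  finally show ?thesis .
qed

lemma redB_root_pow: "redB (root_pow z p a) = 1"
  by (simp add: root_pow_def redB_simps redB_z)

lemma homo_unit_powi:
  fixes h :: "'b \<Rightarrow> 'b"
  assumes h: "ring_homo h" and c: "c dvd 1" shows "h (unit_powi c m) = unit_powi (h c) m"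
proof -
  note hs = ring_homoD[OF h]
  have "h c * h (B.recip c) = 1" using B.recip[OF c] by (metis hs(1,4))
  then have "B.recip (h c) = h (B.recip c)" by (rule B.recip_unique)
  then show ?thesis by (cases "0 \<le> m") (simp_all add: B.unit_powi_nonneg B.unit_powi_neg hs)
qed

lemma r_unit_powi: 
  assumes c: "c dvd 1" shows "r (unit_powi c m) = r c powi m"
proof -
  have "r c * r (B.recip c) = 1" using B.recip[OF c] by (metis r_simps(1,4))
  then have "r (B.recip c) = inverse (r c)" by (metis inverse_unique)
  then show ?thesis
    by (cases "0 \<le> m") (simp_all add: B.unit_powi_nonneg B.unit_powi_neg r_simps power_int_def)
qed

text \<open>Both sides have the same m-th power, as the inverse of m modulo p cancels in the
  exponent of \<zeta>, and the same residue, as powers of \<zeta> and b reduce to 1. So they agree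
  by uniqueness of m-th roots.\<close>

lemma root_action:
  assumes \<tau>: "\<tau> \<in> G" and Z: "Z dvd 1" and m: "coprime m (int p)"
    and b: "b dvd 1" "redB b = 1"
    and eq: "\<tau> (unit_powi Z m) = root_pow z p k * unit_powi Z m * unit_powi b m"
  shows "\<tau> Z = root_pow z p (modular_inverse (int p) m * k) * Z * b"
proof -
  define \<epsilon> where "\<epsilon> = root_pow z p (modular_inverse (int p) m * k)"
  have \<tau>Z: "\<tau> Z dvd 1" using ring_homo_dvd[OF G_homo[OF \<tau>] Z] ring_homoD(1)[OF G_homo[OF \<tau>]] by simp
  have \<epsilon>: "\<epsilon> dvd 1" unfolding \<epsilon>_def by (rule root_pow_unit)
  have "[m * modular_inverse (int p) m = 1] (mod int p)"
    using m by (intro cong_modular_inverse1) (simp add: coprime_commute)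
  then have "[m * modular_inverse (int p) m * k = 1 * k] (mod int p)" by (rule cong_mult) simp
  then have "unit_powi \<epsilon> m = root_pow z p k"
    unfolding \<epsilon>_def unit_powi_root_pow by (intro root_pow_cong) (simp add: cong_def mult.assoc)
  then have "unit_powi (\<tau> Z) m = unit_powi (\<epsilon> * Z * b) m"
    using homo_unit_powi[OF G_homo[OF \<tau>] Z, of m] eq
    by (simp add: B.unit_powi_mult B.unit_mult \<epsilon> Z b)
  moreover have "redB (\<tau> Z - \<epsilon> * Z * b) = 0"
    by (simp add: redB_simps G_res[OF \<tau>] b \<epsilon>_def redB_root_pow)
  then have "s \<pi> dvd \<tau> Z - \<epsilon> * Z * b" using redB_0 by blast
  ultimately show ?thesis
    unfolding \<epsilon>_def[symmetric] by (rule B.unit_powi_inject) (intro \<tau>Z B.unit_mult \<epsilon> Z b m)+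
qed

lemma root_action_binom:
  assumes \<tau>: "\<tau> \<in> G" and Z: "Z dvd 1" and m: "coprime m (int p)" and c: "redB c = 0"
    and eq: "\<tau> (unit_powi Z m) = root_pow z p k * unit_powi Z m * (1 + c)"
  shows "\<tau> Z = root_pow z p (modular_inverse (int p) m * k) * Z * binom_root (s \<pi>) m c"
proof (rule root_action[OF \<tau> Z m])
  have c': "s \<pi> dvd c" using c redB_0 by blast
  have b: "s \<pi> dvd binom_root (s \<pi>) m c - 1" by (rule B.binom_root_cong[OF c'])
  then show "binom_root (s \<pi>) m c dvd 1" by (rule B.unit_of_cong_1)
  have "redB (binom_root (s \<pi>) m c - 1) = 0" using b redB_0 by blast
  then show "redB (binom_root (s \<pi>) m c) = 1" by (simp add: redB_simps)
  show "\<tau> (unit_powi Z m) = root_pow z p k * unit_powi Z m * unit_powi (binom_root (s \<pi>) m c) m"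
    unfolding eq B.unit_powi_binom_root[OF c' m] ..
qed

text \<open>The m-th root g of the reduction has order 1, so any lift of g is a parameter; the lift
  is then adjusted modulo \<pi> to an exact root of v.\<close>

lemma parameter_root:
  assumes v: "v dvd 1" and m: "fls_subdegree (r v) = m" "coprime m (int p)"
  shows "\<exists>Z. Z dvd 1 \<and> is_parameter s Z \<and> unit_powi Z m = v"
proof -
  have rv: "r v \<noteq> 0" using v r_unit by blast
  obtain g where g: "g powi m = r v" "fls_subdegree g = 1"
    using fls_powi_root_exists[OF prime_p char_k m(2) rv m(1)] by blast
  obtain Z0 where Z0: "r Z0 = g" using r_surj by blast
  have "g \<noteq> 0" using g(2) by auto
  then have Z0u: "Z0 dvd 1" using r_unit Z0 by blast
  have "r v = r (unit_powi Z0 m)" by (simp add: r_unit_powi[OF Z0u] Z0 g)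
  then have "s \<pi> dvd v - unit_powi Z0 m" using r_eq_iff by blast
  then obtain Z where Z: "Z dvd 1" "unit_powi Z m = v" "s \<pi> dvd Z - Z0"
    using B.unit_powi_root_exists[OF v Z0u m(2)] by blast
  have "r Z = g" using Z(3) r_eq_iff Z0 by metis
  then show ?thesis using Z is_parameter_of_subdegree g(2) by blast
qed

lemma r_of_redB: "redB b ^ p = j (bl_reduce red u) \<Longrightarrow> r b ^ p = r (\<iota> u)"
proof -
  assume "redB b ^ p = j (bl_reduce red u)"
  then have "theta (r b ^ p) = theta (r (\<iota> u))"
    by (simp add: ring_homoD[OF theta(1)] theta_r j_redB)
  then show ?thesis using theta_inj by blast
qed

text \<open>Taking p-th powers and passing from k((t)) to the residue field of B both multiply
  orders by p, so the order of b equals that of the reduction of u.\<close>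

lemma r_root_subdegree:
  assumes "redB b ^ p = j (bl_reduce red u)" "bl_reduce red u \<noteq> 0"
  shows "b dvd 1" "fls_subdegree (r b) = fls_subdegree (bl_reduce red u)"
proof -
  have rb: "r b ^ p = r (\<iota> u)" by (rule r_of_redB[OF assms(1)])
  have "j (bl_reduce red u) \<noteq> 0" using assms(2) field_homo_inj[OF j_homo] by blast
  then have "redB b \<noteq> 0" using assms(1) p_pos by (metis zero_power)
  then show "b dvd 1" using redB_0 B.unit_iff by blast
  have "int p * fls_subdegree (r b) = int p * fls_subdegree (bl_reduce red u)"
    using r_iota_subdegree[OF assms(2)] rb fls_subdegree_power by metis
  then show "fls_subdegree (r b) = fls_subdegree (bl_reduce red u)" using p_pos by simp
qed

lemma gen_mult: "gen y \<Longrightarrow> a dvd 1 \<Longrightarrow> gen (y * \<iota> a)"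
proof -
  assume y: "gen y" and a: "a dvd 1"
  have a0: "bl_reduce red a \<noteq> 0" using a A.unit_iff bl_reduce_eq_0_iff by blast
  show ?thesis
    unfolding gen_def
  proof
    assume "redB (y * \<iota> a) \<in> range j"
    then obtain g where "redB y * j (bl_reduce red a) = j g" by (auto simp: redB_simps j_redB)
    then have "redB y * j (bl_reduce red a) * j (inverse (bl_reduce red a)) = j (g * inverse (bl_reduce red a))"
      by (simp add: ring_homoD[OF j_homo])
    then have "redB y = j (g * inverse (bl_reduce red a))"
      using a0 by (simp add: mult.assoc ring_homoD(1)[OF j_homo] flip: ring_homoD(4)[OF j_homo])
    then show False using y unfolding gen_def by blast
  qed
qed

lemma reduce_unit: "a dvd 1 \<longleftrightarrow> bl_reduce red a \<noteq> 0"
  using A.unit_iff bl_reduce_eq_0_iff by blast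

lemma reduce_homo: "ring_homo (bl_reduce red)"
  using bl_reduction_map unfolding reduction_map_def by blast

lemmas reduce_simps = ring_homoD[OF reduce_homo]

lemma iota_eq_iff: "\<iota> a = \<iota> b \<longleftrightarrow> a = b"
  using iota_inj[of "a - b"] by (simp add: iota_simps)

lemma j_eq_iff: "j a = j b \<longleftrightarrow> a = b"
  using field_homo_inj[OF j_homo, of "a - b"] by (simp add: ring_homoD[OF j_homo])

subsection \<open>The Kummer character\<close>

text \<open>Restriction to G fixes the values elsewhere, so that uniqueness of the character is
  plain equality of functions.\<close>

definition kummer_char :: "('b \<Rightarrow> 'b) \<Rightarrow> ('b \<Rightarrow> 'b) \<Rightarrow> int" where
  "kummer_char \<sigma> = restrict (\<lambda>\<tau>. int (the_inv_into {..<p} (\<lambda>k. \<sigma> ^^ k) \<tau>)) G"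

lemma kummer_char_funpow:
  assumes "is_gen \<sigma>" "k < p" shows "kummer_char \<sigma> (\<sigma> ^^ k) = int k"
proof -
  have "\<sigma> ^^ k \<in> G" using G_eq_powers(1)[OF assms(1)] assms(2) by auto
  then show ?thesis
    using the_inv_into_f_f[OF G_eq_powers(2)[OF assms(1)]] assms(2) by (simp add: kummer_char_def)
qed

text \<open>The right-hand side does not involve y: one character serves all eigenvectors, hence all
  presentations of the torsor.\<close>

lemma kummer_iso_iff:
  assumes \<sigma>: "is_gen \<sigma>" and y: "eig \<sigma> y"
  shows "is_kummer_iso p z G y \<phi> \<longleftrightarrow> \<phi> = kummer_char \<sigma>"
proof -
  have \<sigma>G: "\<sigma> \<in> G" using \<sigma> unfolding is_gen_def by blast
  have y0: "y \<noteq> 0" using y B.unit_nz unfolding eig_def by blast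
  have pow: "\<exists>k<p. \<tau> = \<sigma> ^^ k" if "\<tau> \<in> G" for \<tau> using G_eq_powers(1)[OF \<sigma>] that by auto
  have act: "(\<sigma> ^^ k) y = root_pow z p (int k) * y" for k
    by (simp add: root_pow_int eig_funpow[OF \<sigma>G y])
  have car: "carrier (integer_mod_group p) = {0..<int p}" using p_pos by (simp add: carrier_integer_mod_group)
  have "is_kummer_iso p z G y (kummer_char \<sigma>)"
    unfolding is_kummer_iso_def
  proof (intro conjI ballI)
    show "kummer_char \<sigma> \<in> extensional G" by (simp add: kummer_char_def)
    show "\<tau> y = root_pow z p (kummer_char \<sigma> \<tau>) * y" if "\<tau> \<in> G" for \<tau>
      using pow[OF that] act kummer_char_funpow[OF \<sigma>] by auto
    have "kummer_char \<sigma> (\<tau> \<circ> \<tau>') = (kummer_char \<sigma> \<tau> + kummer_char \<sigma> \<tau>') mod int p" if \<tau>: "\<tau> \<in> G" "\<tau>' \<in> G" for \<tau> \<tau>'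
    proof -
      obtain k l where kl: "k < p" "\<tau> = \<sigma> ^^ k" "l < p" "\<tau>' = \<sigma> ^^ l" using pow \<tau> by meson
      have "\<tau> \<circ> \<tau>' = \<sigma> ^^ ((k + l) mod p)" using kl funpow_mod[OF \<sigma>G] by (simp add: funpow_add)
      then show ?thesis using kummer_char_funpow[OF \<sigma>] kl p_pos by (simp add: zmod_int)
    qed
    moreover have "kummer_char \<sigma> \<tau> \<in> {0..<int p}" if "\<tau> \<in> G" for \<tau>
      using pow[OF that] kummer_char_funpow[OF \<sigma>] by auto
    moreover have "bij_betw (kummer_char \<sigma>) G {0..<int p}"
      unfolding bij_betw_def
    proof
      show "inj_on (kummer_char \<sigma>) G"
      proof (rule inj_onI)
        fix \<tau> \<tau>' assume \<tau>: "\<tau> \<in> G" "\<tau>' \<in> G" "kummer_char \<sigma> \<tau> = kummer_char \<sigma> \<tau>'"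
        obtain k l where kl: "k < p" "\<tau> = \<sigma> ^^ k" "l < p" "\<tau>' = \<sigma> ^^ l" using pow \<tau> by meson
        then show "\<tau> = \<tau>'" using \<tau>(3) kummer_char_funpow[OF \<sigma>] by simp
      qed
      show "kummer_char \<sigma> ` G = {0..<int p}"
      proof (intro equalityI subsetI)
        fix i assume "i \<in> kummer_char \<sigma> ` G"
        then show "i \<in> {0..<int p}" using calculation(2) by blast
      next
        fix i assume "i \<in> {0..<int p}"
        then have "kummer_char \<sigma> (\<sigma> ^^ nat i) = i"
          using kummer_char_funpow[OF \<sigma>, of "nat i"] by (simp add: nat_less_iff)
        then show "i \<in> kummer_char \<sigma> ` G" using G_funpow[OF \<sigma>G] by (metis imageI)
      qed
    qed
    ultimately show "kummer_char \<sigma> \<in> iso (comp_group G) (integer_mod_group p)"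
      unfolding iso_def hom_def by (auto simp: car comp_group_def)
  qed
  moreover have "\<phi> = kummer_char \<sigma>" if \<phi>: "is_kummer_iso p z G y \<phi>"
  proof (rule extensionalityI[of _ G])
    show "\<phi> \<in> extensional G" using \<phi> unfolding is_kummer_iso_def by blast
    show "kummer_char \<sigma> \<in> extensional G" by (simp add: kummer_char_def)
    fix \<tau> assume \<tau>: "\<tau> \<in> G"
    obtain k where k: "k < p" "\<tau> = \<sigma> ^^ k" using pow[OF \<tau>] by blast
    have "\<phi> \<in> hom (comp_group G) (integer_mod_group p)"
      using \<phi> unfolding is_kummer_iso_def iso_def by blast
    moreover have "\<tau> \<in> carrier (comp_group G)" using \<tau> by (simp add: comp_group_def)
    ultimately have "\<phi> \<tau> \<in> {0..<int p}" unfolding car[symmetric] by (rule hom_in_carrier)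
    then obtain l where l: "\<phi> \<tau> = int l" "l < p" by (metis atLeastLessThan_iff nat_0_le nat_less_iff of_nat_less_iff)
    have "\<tau> y = root_pow z p (\<phi> \<tau>) * y" using \<phi> \<tau> unfolding is_kummer_iso_def by blast
    also have "root_pow z p (\<phi> \<tau>) = z ^ l" unfolding l(1) by (rule root_pow_int)
    finally have "z ^ k * y = z ^ l * y" using act[of k] unfolding k(2) root_pow_int by simp
    then have "z ^ k = z ^ l" using B.mult_cancel_right[OF y0] by blast
    then have "k = l" using z_power_inj k l by blast
    then show "\<phi> \<tau> = kummer_char \<sigma> \<tau>" using kummer_char_funpow[OF \<sigma>] k l by simp
  qed
  ultimately show ?thesis by blast
qed

lemma kummer_char_action:
  assumes \<sigma>: "is_gen \<sigma>" and y: "eig \<sigma> y" and \<tau>: "\<tau> \<in> G"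
  shows "\<tau> y = root_pow z p (kummer_char \<sigma> \<tau>) * y"
  using kummer_iso_iff[OF \<sigma> y, of "kummer_char \<sigma>"] \<tau> unfolding is_kummer_iso_def by blast

subsection \<open>The case of \<open>\<mu>\<^sub>p\<close>\<close>

lemma mu_equation: "monom 1 p - 1 = (\<Prod>i<p. [:- (\<zeta> ^ i), 1:])"
proof -
  have "[:0, 1:] ^ p - 1 = (\<Prod>i<p. [:0, 1:] - [:\<zeta>:] ^ i)"
    by (rule root_of_unity_prod[OF p_pos]) (use zeta_p zeta_prim in \<open>auto simp: poly_const_pow one_pCons\<close>)
  then show ?thesis by (simp add: monom_altdef poly_const_pow)
qed

lemma presents_root: "presents \<iota> F y \<Longrightarrow> poly (map_poly \<iota> F) y = 0"
  by (simp add: presents_def)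

lemma mu_cover_scheme: "cover_scheme p \<pi> red \<iota> s redB j \<zeta> G 0 1 (\<lambda>i. \<zeta> ^ i) (mu_scheme p)"
  by unfold_locales (simp_all add: mu_scheme_def mu_equation)

text \<open>Translates torsor data into eigenvectors. The congruence for \<rho> y at the section
  \<zeta> is the eigenvalue equation; conversely the iterates of \<sigma> give it at all
  sections.\<close>

lemma mu_presentation_iff:
  assumes \<sigma>: "is_gen \<sigma>" and \<rho>: "cover_scheme.acts p s (\<lambda>i. \<zeta> ^ i) \<rho> \<sigma>"
  shows "mu_presentation p \<iota> \<rho> u y \<longleftrightarrow> eig \<sigma> y \<and> gen y \<and> y ^ p = \<iota> u"
proof -
  interpret M: cover_scheme p \<pi> red \<iota> s redB j \<zeta> G 0 1 "\<lambda>i. \<zeta> ^ i" "mu_scheme p"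
    by (rule mu_cover_scheme)
  have \<sigma>G: "\<sigma> \<in> G" using \<sigma> unfolding is_gen_def by blast
  have X: "M.X i = z ^ i" for i by (simp add: M.X_def s_simps)
  have ev: "poly (\<rho> b) (M.X i) = (\<sigma> ^^ i) b" if "i < p" for b i using \<rho> that unfolding M.acts_def by blast
  have f: "M.f = monom 1 p - 1"
    by (simp add: mu_scheme_def ring_homoD[OF map_poly_homo[OF s_homo]] map_poly_homo_simps[OF s_homo] s_simps)
  have F: "poly (map_poly \<iota> (monom 1 p - [:u:])) y = y ^ p - \<iota> u"
    by (simp add: ring_homoD[OF map_poly_homo[OF iota]] map_poly_homo_simps[OF iota] iota_simps poly_monom)
  show ?thesis
  proof
    assume L: "mu_presentation p \<iota> \<rho> u y"
    then have u: "u dvd 1" and pr: "presents \<iota> (monom 1 p - [:u:]) y" and d: "M.f dvd \<rho> y - [:0, y:]"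
      unfolding mu_presentation_def f by auto
    have yu: "y ^ p = \<iota> u" using presents_root[OF pr] unfolding F by simp
    have "\<iota> u dvd 1" using u iota_unit by blast
    moreover have "y dvd \<iota> u" unfolding yu[symmetric] using p_pos by simp
    ultimately have "y dvd 1" by (rule dvd_trans[rotated])
    moreover have "poly (\<rho> y - [:0, y:]) (M.X 1) = 0" using d p_gt_1 unfolding M.f_dvd_iff by blast
    then have "\<sigma> y = z * y" using ev[of 1 y] p_gt_1 by (simp add: X)
    ultimately show "eig \<sigma> y \<and> gen y \<and> y ^ p = \<iota> u"
      using presents_imp_gen[OF pr] yu unfolding eig_def by blast
  next
    assume R: "eig \<sigma> y \<and> gen y \<and> y ^ p = \<iota> u"
    then have "\<iota> u dvd 1" using B.unit_power[of y p] unfolding eig_def by simp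
    then have "u dvd 1" using iota_unit by blast
    moreover have "presents \<iota> (monom 1 p - [:u:]) y"
    proof (rule presentsI)
      have cf: "coeff (monom 1 p - [:u:]) i = (if i = p then 1 else if i = 0 then - u else 0)" for i
        using p_pos by (auto simp: coeff_pCons split: nat.split)
      show deg: "degree (monom 1 p - [:u:]) = p"
      proof (rule antisym)
        show "degree (monom 1 p - [:u:]) \<le> p" using cf p_pos by (intro degree_le) (simp del: coeff_diff)
        show "p \<le> degree (monom 1 p - [:u:])" using cf p_pos by (intro le_degree) (simp del: coeff_diff)
      qed
      show "lead_coeff (monom 1 p - [:u:]) = 1" unfolding deg cf by simp
      show "poly (map_poly \<iota> (monom 1 p - [:u:])) y = 0" unfolding F using R by simp
    qed (use R in blast)
    moreover have "M.f dvd \<rho> y - [:0, y:]"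
      unfolding M.f_dvd_iff using ev R by (auto simp: eig_funpow[OF \<sigma>G] X)
    ultimately show "mu_presentation p \<iota> \<rho> u y" unfolding mu_presentation_def f by blast
  qed
qed

text \<open>By \<open>different_val\<close> every normal form has the same n, since p - 1 >
  0.\<close>

lemma normal_form_index:
  assumes "is_gen \<sigma>" "val \<pi> (of_nat p) = ideal_val (s \<pi>) (different \<iota>) + n * (p - 1)"
  shows "n < val \<pi> (\<zeta> - 1) \<and> (\<exists>W. gen W \<and> eig \<sigma> (1 + s \<pi> ^ n * W))"
proof -
  obtain n' W where nW: "n' < val \<pi> (\<zeta> - 1)" "gen W" "eig \<sigma> (1 + s \<pi> ^ n' * W)"
    using kummer_normal_form[OF assms(1)] by blast
  have "n' * (p - 1) = n * (p - 1)" using different_val(1)[OF assms(1) nW] assms(2) by linarith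
  then have "n' = n" using p_gt_1 by auto
  then show ?thesis using nW by blast
qed

lemma mu_root_subdegree:
  assumes "eig \<sigma> y" "y ^ p = \<iota> u"
  shows "bl_reduce red u \<noteq> 0" "fls_subdegree (r y) = fls_subdegree (bl_reduce red u)"
proof -
  have "\<iota> u dvd 1" using assms B.unit_power[of y p] unfolding eig_def by simp
  then show u: "bl_reduce red u \<noteq> 0" using iota_unit reduce_unit by blast
  have "redB y ^ p = j (bl_reduce red u)" using arg_cong[OF assms(2), of redB] by (simp add: redB_simps j_redB)
  then show "fls_subdegree (r y) = fls_subdegree (bl_reduce red u)" using r_root_subdegree(2) u by blast
qed

lemma mu_case_a:
  assumes \<sigma>: "is_gen \<sigma>" and y: "eig \<sigma> y" "y ^ p = \<iota> u"
    and h: "fls_subdegree (bl_reduce red u) = h" "coprime h (int p)"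
  shows "\<exists>Z. is_parameter s Z \<and> y = unit_powi Z h \<and>
    (\<forall>\<tau>\<in>G. \<tau> Z = root_pow z p (modular_inverse (int p) h * kummer_char \<sigma> \<tau>) * Z)"
proof -
  have yu: "y dvd 1" using y(1) unfolding eig_def by blast
  obtain Z where Z: "Z dvd 1" "is_parameter s Z" "unit_powi Z h = y"
    using parameter_root[OF yu] mu_root_subdegree(2)[OF y] h by blast
  have "\<tau> Z = root_pow z p (modular_inverse (int p) h * kummer_char \<sigma> \<tau>) * Z" if \<tau>: "\<tau> \<in> G" for \<tau>
  proof -
    have 1: "unit_powi (1::'b) h = 1"
    proof -
      have "B.recip 1 = 1" by (rule B.recip_unique) simp
      then show ?thesis by (cases "0 \<le> h") (simp_all add: B.unit_powi_nonneg B.unit_powi_neg)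
    qed
    have "\<tau> Z = root_pow z p (modular_inverse (int p) h * kummer_char \<sigma> \<tau>) * Z * 1"
      by (rule root_action[OF \<tau> Z(1) h(2)])
        (simp_all add: redB_simps 1 Z(3) kummer_char_action[OF \<sigma> y(1) \<tau>])
    then show ?thesis by simp
  qed
  then show ?thesis using Z by metis
qed

text \<open>Residue 0 means that p divides the order of U. So the lowest term of U belongs to its
  p-th power part g^p, and the remaining part N has larger order, prime to p. Dividing u by a lift
  of g^p makes its reduction 1 + M with M of positive order m prime to p; \<omega> is unchanged and
  equals dM/(1 + M).\<close>

lemma mu_case_b:
  assumes \<sigma>: "is_gen \<sigma>" and y0: "eig \<sigma> y0" "gen y0" "y0 ^ p = \<iota> u0"
    and \<omega>: "\<omega> = fls_deriv (bl_reduce red u0) / bl_reduce red u0" and res: "fls_residue \<omega> = 0"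
  shows "\<omega> \<noteq> 0" and "\<exists>m. m = 1 + fls_subdegree \<omega> \<and> 0 < m \<and> coprime m (int p) \<and>
    (\<exists>u y Z. eig \<sigma> y \<and> gen y \<and> y ^ p = \<iota> u \<and> is_parameter s Z \<and> y = 1 + unit_powi Z m \<and>
      (\<forall>\<tau>\<in>G. \<tau> Z = root_pow z p (modular_inverse (int p) m * kummer_char \<sigma> \<tau>) * Z *
         binom_root (s \<pi>) m (root_pow z p (- kummer_char \<sigma> \<tau>) *
           (root_pow z p (kummer_char \<sigma> \<tau>) - 1) * unit_powi Z (- m))))"
proof -
  have \<sigma>G: "\<sigma> \<in> G" using \<sigma> unfolding is_gen_def by blast
  define U where "U = bl_reduce red u0"
  have U0: "U \<noteq> 0" unfolding U_def by (rule mu_root_subdegree(1)[OF y0(1,3)])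
  have "redB y0 ^ p = j U" using arg_cong[OF y0(3), of redB] by (simp add: redB_simps j_redB U_def)
  then have Unp: "U \<notin> range (\<lambda>f. f ^ p)" using gen_iff_power y0(2) by blast
  then have dU: "fls_deriv U \<noteq> 0" using fls_deriv_eq_0_imp_power[OF prime_p char_k] by blast
  then show "\<omega> \<noteq> 0" using U0 unfolding \<omega> U_def[symmetric] by simp
  have "(of_int (fls_subdegree U) :: 'k) = 0"
    using fls_residue_log_deriv[OF U0] res unfolding \<omega> U_def[symmetric] by simp
  then have pU: "int p dvd fls_subdegree U" using of_int_eq_0_iff_CHAR[OF char_k] by blast
  obtain g where g: "\<And>n. (U - g ^ p) $$ n = (if int p dvd n then 0 else U $$ n)"
    using fls_remove_p_part[OF prime_p char_k] by metis
  define N where "N = U - g ^ p"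
  have N0: "N \<noteq> 0" using Unp unfolding N_def by (metis eq_iff_diff_eq_0 rangeI)
  have Nv: "N $$ n = 0" if "n \<le> fls_subdegree U" for n
    using g[of n] pU that unfolding N_def by (cases "n = fls_subdegree U") auto
  have sN: "fls_subdegree U < fls_subdegree N"
    using fls_subdegree_geI[OF N0, of "fls_subdegree U + 1"] Nv by simp
  have gU: "g ^ p = U - N" by (simp add: N_def)
  have "(g ^ p) $$ fls_subdegree U \<noteq> 0" unfolding gU using Nv[of "fls_subdegree U"] U0 by simp
  then have gp: "fls_subdegree (g ^ p) = fls_subdegree U" "g ^ p \<noteq> 0"
    using Nv by (auto simp: gU intro!: fls_subdegree_eqI)
  then have g0: "g \<noteq> 0" using p_pos by (auto simp: zero_power)
  define M where "M = N * inverse g ^ p"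
  define m where "m = fls_subdegree M"
  have M0: "M \<noteq> 0" using N0 g0 by (simp add: M_def)
  have mN: "m = fls_subdegree N - fls_subdegree U"
    using N0 g0 gp fls_subdegree_power[of "inverse g" p] fls_subdegree_power[of g p]
    by (simp add: m_def M_def fls_inverse_subdegree)
  have copN: "coprime (fls_subdegree N) (int p)"
    using g N0 by (intro fls_subdegree_non_p_part(1)[OF prime_p char_k]) (auto simp: N_def)
  have m0: "0 < m" using mN sN by simp
  have cop: "coprime m (int p)"
  proof -
    obtain q where "fls_subdegree U = int p * q" using pU by (metis dvdE)
    then have "fls_subdegree N = m + q * int p" using mN by simp
    then have "gcd (int p) (q * int p + m) = 1"
      using copN by (simp add: coprime_iff_gcd_eq_1 gcd.commute add.commute)
    then show ?thesis unfolding gcd_add_mult by (simp add: coprime_iff_gcd_eq_1 gcd.commute)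
  qed
  obtain v where v: "bl_reduce red v = inverse g" using reduce_surj by blast
  have vu: "v dvd 1" using v g0 reduce_unit by simp
  define u where "u = u0 * v ^ p"
  define y where "y = y0 * \<iota> v"
  have ey: "eig \<sigma> y" unfolding y_def by (rule eig_iota_mult[OF \<sigma>G y0(1) vu])
  have gy: "gen y" unfolding y_def by (rule gen_mult[OF y0(2) vu])
  have yp: "y ^ p = \<iota> u" by (simp add: y_def u_def power_mult_distrib y0(3) iota_simps)
  have uM: "bl_reduce red u = 1 + M"
  proof -
    have "bl_reduce red u = U * inverse g ^ p" by (simp add: u_def reduce_simps v U_def)
    also have "U = N + g ^ p" by (simp add: N_def)
    finally show ?thesis using g0 by (simp add: M_def distrib_right flip: power_mult_distrib)
  qed
  have \<omega>M: "\<omega> = fls_deriv M / (1 + M)"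
  proof -
    have "\<omega> = fls_deriv (U * inverse g ^ p) / (U * inverse g ^ p)"
      unfolding \<omega> U_def[symmetric]
      by (rule fls_log_deriv_mult_power[symmetric]) (use char_k U0 g0 in auto)
    also have "U * inverse g ^ p = 1 + M" using uM by (simp add: u_def reduce_simps v U_def)
    finally show ?thesis by simp
  qed
  have "of_int (fls_subdegree M) * M $$ fls_subdegree M \<noteq> 0"
  proof -
    have "\<not> int p dvd m" using cop prime_p by (metis coprime_absorb_right not_prime_unit prime_nat_int_transfer)
    then show ?thesis using M0 of_int_eq_0_iff_CHAR[OF char_k, of m] by (simp add: m_def)
  qed
  then have "fls_deriv M $$ (m - 1) \<noteq> 0" by (simp add: fls_deriv_nth m_def)
  moreover have "fls_deriv M $$ k = 0" if "k < m - 1" for k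
    using that by (simp add: fls_deriv_nth m_def)
  ultimately have dM: "fls_subdegree (fls_deriv M) = m - 1" "fls_deriv M \<noteq> 0"
    by (blast intro: fls_subdegree_eqI, metis fls_zero_nth)
  have 1: "fls_subdegree (1 + M) = 0" "1 + M \<noteq> 0"
  proof -
    have M00: "M $$ 0 = 0" "\<And>k. k < 0 \<Longrightarrow> M $$ k = 0" using m0 by (auto simp: m_def)
    then have *: "(1 + M) $$ 0 \<noteq> 0" by simp
    then show "fls_subdegree (1 + M) = 0" using M00 by (intro fls_subdegree_eqI) auto
    show "1 + M \<noteq> 0" using * by (metis fls_zero_nth)
  qed
  have m\<omega>: "m = 1 + fls_subdegree \<omega>"
    unfolding \<omega>M using dM 1 by (simp add: fls_divide_subdegree)
  have r1: "redB (y - 1) ^ p = j (bl_reduce red (u - 1))"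
  proof -
    have "redB (y - 1) ^ p = redB y ^ p - 1" by (simp add: redB_simps CHAR_diff_power[OF prime_p char_c])
    also have "redB y ^ p = j (bl_reduce red u)" using arg_cong[OF yp, of redB] by (simp add: redB_simps j_redB)
    finally show ?thesis by (simp add: reduce_simps ring_homoD[OF j_homo])
  qed
  have uM1: "bl_reduce red (u - 1) = M" using uM by (simp add: reduce_simps)
  have y1: "y - 1 dvd 1" "fls_subdegree (r (y - 1)) = m"
    using r_root_subdegree[OF r1] M0 unfolding uM1 m_def by auto
  obtain Z where Z: "Z dvd 1" "is_parameter s Z" "unit_powi Z m = y - 1"
    using parameter_root[OF y1 cop] by blast
  have "\<tau> Z = root_pow z p (modular_inverse (int p) m * kummer_char \<sigma> \<tau>) * Z *
         binom_root (s \<pi>) m (root_pow z p (- kummer_char \<sigma> \<tau>) *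
           (root_pow z p (kummer_char \<sigma> \<tau>) - 1) * unit_powi Z (- m))" if \<tau>: "\<tau> \<in> G" for \<tau>
  proof (rule root_action_binom[OF \<tau> Z(1) cop])
    define k where "k = kummer_char \<sigma> \<tau>"
    define E where "E = root_pow z p k"
    have EE: "E * root_pow z p (- k) = 1"
      unfolding E_def root_pow_uminus by (rule B.recip[OF root_pow_unit])
    have ZZ: "unit_powi Z m * unit_powi Z (- m) = 1"
      unfolding B.unit_powi_minus[OF Z(1)] by (rule B.recip[OF B.unit_powi_unit[OF Z(1)]])
    show "redB (root_pow z p (- kummer_char \<sigma> \<tau>) * (root_pow z p (kummer_char \<sigma> \<tau>) - 1) * unit_powi Z (- m)) = 0"
      by (simp add: redB_simps redB_root_pow)
    have "\<tau> (unit_powi Z m) = E * y - 1"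
      unfolding Z(3) using kummer_char_action[OF \<sigma> ey \<tau>] by (simp add: ring_homoD[OF G_homo[OF \<tau>]] E_def k_def)
    also have "\<dots> = E * (1 + unit_powi Z m) - 1" using Z(3) by simp
    also have "\<dots> = E * unit_powi Z m + (E - 1)" by (simp add: algebra_simps)
    \<comment> \<open>Mutually inverse units are inserted so that E Z^m factors out of the whole
      sum.\<close>
    also have "E - 1 = (E * root_pow z p (- k)) * (unit_powi Z m * unit_powi Z (- m)) * (E - 1)"
      by (simp add: EE ZZ)
    also have "E * unit_powi Z m + \<dots> = E * unit_powi Z m * (1 + root_pow z p (- k) * (E - 1) * unit_powi Z (- m))"
      by (simp add: algebra_simps)
    finally show "\<tau> (unit_powi Z m) = root_pow z p (kummer_char \<sigma> \<tau>) * unit_powi Z m *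
        (1 + root_pow z p (- kummer_char \<sigma> \<tau>) * (root_pow z p (kummer_char \<sigma> \<tau>) - 1) * unit_powi Z (- m))"
      unfolding E_def k_def .
  qed
  moreover have "y = 1 + unit_powi Z m" using Z(3) by simp
  ultimately show "\<exists>m. m = 1 + fls_subdegree \<omega> \<and> 0 < m \<and> coprime m (int p) \<and>
    (\<exists>u y Z. eig \<sigma> y \<and> gen y \<and> y ^ p = \<iota> u \<and> is_parameter s Z \<and> y = 1 + unit_powi Z m \<and>
      (\<forall>\<tau>\<in>G. \<tau> Z = root_pow z p (modular_inverse (int p) m * kummer_char \<sigma> \<tau>) * Z *
         binom_root (s \<pi>) m (root_pow z p (- kummer_char \<sigma> \<tau>) *
           (root_pow z p (kummer_char \<sigma> \<tau>) - 1) * unit_powi Z (- m))))"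
    using m\<omega> m0 cop ey gy yp Z(2) by blast
qed

subsection \<open>The case of \<open>\<H>\<^sub>n\<close>\<close>

text \<open>The p-th roots of unity factor the numerator into terms 1 + \<pi>^n x - \<zeta>^i, each
  a multiple of \<pi>^n. So the exact quotient exists and is monic with the sections as
  roots.\<close>

lemma psi_equation:
  assumes x: "\<And>i. \<zeta> ^ i = 1 + \<pi> ^ n * x i"
  shows "psi \<pi> p n = (\<Prod>i<p. [:- x i, 1:])"
    and "[:\<pi> ^ (p * n):] * psi \<pi> p n = [:1, \<pi> ^ n:] ^ p - 1"
proof -
  have "[:1, \<pi> ^ n:] ^ p - 1 = (\<Prod>i<p. [:1, \<pi> ^ n:] - [:\<zeta>:] ^ i)"
    by (rule root_of_unity_prod[OF p_pos]) (use zeta_p zeta_prim in \<open>auto simp: poly_const_pow one_pCons\<close>)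
  also have "\<dots> = (\<Prod>i<p. [:\<pi> ^ n:] * [:- x i, 1:])"
    by (intro prod.cong) (simp_all add: poly_const_pow x)
  also have "\<dots> = [:\<pi> ^ (p * n):] * (\<Prod>i<p. [:- x i, 1:])"
    unfolding prod.distrib by (simp add: poly_const_pow mult.commute flip: power_mult)
  finally have eq: "[:\<pi> ^ (p * n):] * (\<Prod>i<p. [:- x i, 1:]) = [:1, \<pi> ^ n:] ^ p - 1" ..
  show psi: "psi \<pi> p n = (\<Prod>i<p. [:- x i, 1:])"
    unfolding psi_def exact_div_def
  proof (rule the_equality)
    fix c assume "[:\<pi> ^ (p * n):] * c = [:1, \<pi> ^ n:] ^ p - 1"
    then have "[:\<pi> ^ (p * n):] * c = [:\<pi> ^ (p * n):] * (\<Prod>i<p. [:- x i, 1:])" using eq by simp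
    moreover have "[:\<pi> ^ (p * n):] \<noteq> 0" using R.pi_power_nz by simp
    ultimately show "c = (\<Prod>i<p. [:- x i, 1:])" by (metis mult_left_cancel)
  qed (rule eq)
  show "[:\<pi> ^ (p * n):] * psi \<pi> p n = [:1, \<pi> ^ n:] ^ p - 1" unfolding psi by (rule eq)
qed

lemma H_cover_scheme:
  assumes x: "\<And>i. \<zeta> ^ i = 1 + \<pi> ^ n * x i"
  shows "cover_scheme p \<pi> red \<iota> s redB j \<zeta> G 1 (\<pi> ^ n) x (H_scheme \<pi> p n)"
proof -
  have "x 0 = 0" using x[of 0] R.pi_nz by simp
  then show ?thesis
    by unfold_locales (use R.pi_nz x psi_equation(1)[OF x] in \<open>simp_all add: H_scheme_def\<close>)
qed

lemma iota_dvd_iff: "s \<pi> ^ n dvd \<iota> a \<longleftrightarrow> bl_const \<pi> ^ n dvd a"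
proof (cases "a = 0")
  case False
  then obtain u k where u: "u dvd 1" "a = u * bl_const \<pi> ^ k" using A.unit_times_power by blast
  then have "\<iota> u dvd 1" using iota_unit by blast
  moreover have "\<iota> a = \<iota> u * s \<pi> ^ k" by (simp add: u(2) iota_simps s_apply)
  ultimately show ?thesis using B.dvd_unit_power A.dvd_unit_power u by simp
qed (simp add: iota_simps)

section \<open>Presentations attached to a torsor under \<open>\<H>\<^sub>n\<close>\<close>

context
  fixes n :: nat and \<sigma> and x :: "nat \<Rightarrow> 'r"
  assumes n: "0 < n" "n < val \<pi> (\<zeta> - 1)" and \<sigma>: "is_gen \<sigma>"
    and x: "\<And>i. \<zeta> ^ i = 1 + \<pi> ^ n * x i"
begin

definition psiB :: "'b \<Rightarrow> 'b" where "psiB w = poly (map_poly s (psi \<pi> p n)) w"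

lemma psiB_mult: "s \<pi> ^ (p * n) * psiB w = (1 + s \<pi> ^ n * w) ^ p - 1"
proof -
  have "poly (map_poly s ([:\<pi> ^ (p * n):] * psi \<pi> p n)) w = poly (map_poly s ([:1, \<pi> ^ n:] ^ p - 1)) w"
    by (simp only: psi_equation(2)[OF x])
  then show ?thesis
    unfolding psiB_def
    by (simp add: ring_homoD[OF map_poly_homo[OF s_homo]] map_poly_homo_simps[OF s_homo] s_simps mult.commute)
qed

text \<open>All roots of \<open>psi\<close> reduce to 0, so the isogeny becomes Frobenius on
  residues.\<close>

lemma redB_psiB: "redB (psiB w) = redB w ^ p"
proof -
  have "map_poly s (psi \<pi> p n) = (\<Prod>i<p. [:- s (x i), 1:])"
    unfolding psi_equation(1)[OF x] by (simp add: ring_homoD[OF map_poly_homo[OF s_homo]] map_poly_homo_simps[OF s_homo] s_simps)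
  then have "psiB w = (\<Prod>i<p. w - s (x i))" by (simp add: psiB_def poly_prod)
  moreover have "redB (s (x i)) = 0" for i
    using zeta_points_dvd[OF n(2) x] ring_homo_dvd[OF s_homo] redB_0 by blast
  ultimately show ?thesis by (simp add: redB_simps)
qed

lemma psiB_iota:
  assumes "eig \<sigma> (1 + s \<pi> ^ n * w)" shows "\<exists>u. psiB w = \<iota> u"
proof -
  have \<sigma>G: "\<sigma> \<in> G" using \<sigma> unfolding is_gen_def by blast
  note h = ring_homoD[OF G_homo[OF \<sigma>G]]
  obtain u where u: "(1 + s \<pi> ^ n * w) ^ p = \<iota> u" using eig_power_p[OF \<sigma> assms] by blast
  have "\<sigma> (s \<pi> ^ (p * n) * psiB w) = s \<pi> ^ (p * n) * psiB w"
    unfolding psiB_mult u by (simp add: h G_iota[OF \<sigma>G])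
  then have "s \<pi> ^ (p * n) * \<sigma> (psiB w) = s \<pi> ^ (p * n) * psiB w" by (simp add: h G_s[OF \<sigma>G])
  then have "\<sigma> (psiB w) = psiB w" using B.mult_cancel[OF B.pi_power_nz] by blast
  then show ?thesis using \<sigma> unfolding is_gen_def by blast
qed

lemma H_presentation_iff:
  assumes \<rho>: "cover_scheme.acts p s x \<rho> \<sigma>"
  shows "H_presentation \<pi> p n bl_const \<iota> \<rho> u w \<longleftrightarrow> eig \<sigma> (1 + s \<pi> ^ n * w) \<and> gen w \<and> psiB w = \<iota> u"
proof -
  interpret M: cover_scheme p \<pi> red \<iota> s redB j \<zeta> G 1 "\<pi> ^ n" x "H_scheme \<pi> p n"
    by (rule H_cover_scheme[OF x])
  have \<sigma>G: "\<sigma> \<in> G" using \<sigma> unfolding is_gen_def by blast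
  have ev: "poly (\<rho> b) (M.X i) = (\<sigma> ^^ i) b" if "i < p" for b i using \<rho> that unfolding M.acts_def by blast
  have f: "map_poly (\<iota> \<circ> bl_const) (psi \<pi> p n) = M.f"
    unfolding s_eq[symmetric] by (simp add: H_scheme_def)
  define F where "F = map_poly bl_const (psi \<pi> p n) - [:u:]"
  have F: "poly (map_poly \<iota> F) w = psiB w - \<iota> u"
  proof -
    have "map_poly \<iota> (map_poly bl_const (psi \<pi> p n)) = map_poly s (psi \<pi> p n)"
      by (rule poly_eqI) (simp add: coeff_map_poly_homo[OF iota] coeff_map_poly_homo[OF bl_const_homo]
        coeff_map_poly_homo[OF s_homo] s_apply)
    then show ?thesis
      by (simp add: F_def psiB_def ring_homoD[OF map_poly_homo[OF iota]] map_poly_homo_simps[OF iota])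
  qed
  have y: "1 + \<iota> (bl_const (\<pi> ^ n)) * w = 1 + s \<pi> ^ n * w" by (simp add: s_simps flip: s_apply)
  \<comment> \<open>Multiplying by \<pi>^n turns the condition on w into one on 1 + \<pi>^n w, where
    the group law is multiplication by \<zeta>^i.\<close>
  have ev1: "poly (\<rho> w - [:w, 1 + s \<pi> ^ n * w:]) (M.X i) = 0 \<longleftrightarrow>
      s \<pi> ^ n * (\<sigma> ^^ i) w = s \<pi> ^ n * w + (z ^ i - 1) * (1 + s \<pi> ^ n * w)" if "i < p" for i
  proof -
    have "poly (\<rho> w - [:w, 1 + s \<pi> ^ n * w:]) (M.X i) = (\<sigma> ^^ i) w - (w + M.X i * (1 + s \<pi> ^ n * w))"
      by (simp add: ev[OF that])
    also have "\<dots> = 0 \<longleftrightarrow> (\<sigma> ^^ i) w = w + M.X i * (1 + s \<pi> ^ n * w)" by simp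
    also have "\<dots> \<longleftrightarrow> s \<pi> ^ n * (\<sigma> ^^ i) w = s \<pi> ^ n * (w + M.X i * (1 + s \<pi> ^ n * w))"
      by (rule B.mult_cancel[OF B.pi_power_nz, symmetric])
    also have "s \<pi> ^ n * (w + M.X i * (1 + s \<pi> ^ n * w)) = s \<pi> ^ n * w + (s \<pi> ^ n * M.X i) * (1 + s \<pi> ^ n * w)"
      by (simp add: algebra_simps)
    also have "s \<pi> ^ n * M.X i = z ^ i - 1" using M.z_X[of i] by (simp add: s_simps)
    finally show ?thesis .
  qed
  show ?thesis
  proof
    assume L: "H_presentation \<pi> p n bl_const \<iota> \<rho> u w"
    then have pr: "presents \<iota> F w" and d: "M.f dvd \<rho> w - [:w, 1 + s \<pi> ^ n * w:]"
      unfolding H_presentation_def f F_def y by auto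
    have pw: "psiB w = \<iota> u" using presents_root[OF pr] unfolding F by simp
    have "poly (\<rho> w - [:w, 1 + s \<pi> ^ n * w:]) (M.X 1) = 0" using d p_gt_1 unfolding M.f_dvd_iff by blast
    then have "s \<pi> ^ n * \<sigma> w = s \<pi> ^ n * w + (z - 1) * (1 + s \<pi> ^ n * w)" using ev1[of 1] p_gt_1 by simp
    then have "\<sigma> (1 + s \<pi> ^ n * w) = z * (1 + s \<pi> ^ n * w)"
      by (simp add: ring_homoD[OF G_homo[OF \<sigma>G]] G_s[OF \<sigma>G] algebra_simps)
    \<comment> \<open>As n > 0, this element is congruent to 1, which supplies the unit condition in
      \<open>eig\<close>.\<close>
    moreover have "s \<pi> dvd (1 + s \<pi> ^ n * w) - 1" using n(1) by simp
    then have "(1 + s \<pi> ^ n * w) dvd 1" by (rule B.unit_of_cong_1)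
    ultimately show "eig \<sigma> (1 + s \<pi> ^ n * w) \<and> gen w \<and> psiB w = \<iota> u"
      using presents_imp_gen[OF pr] pw unfolding eig_def by blast
  next
    assume R: "eig \<sigma> (1 + s \<pi> ^ n * w) \<and> gen w \<and> psiB w = \<iota> u"
    have "presents \<iota> F w"
    proof (rule presentsI)
      have mp: "map_poly bl_const (psi \<pi> p n) = (\<Prod>i<p. [:- bl_const (x i), 1:])"
        unfolding psi_equation(1)[OF x]
        by (simp add: ring_homoD[OF map_poly_homo[OF bl_const_homo]] map_poly_homo_simps[OF bl_const_homo] bl_const_hom)
      have mon: "coeff (map_poly bl_const (psi \<pi> p n)) p = 1" "degree (map_poly bl_const (psi \<pi> p n)) = p"
        unfolding mp using monic_prod_linear[of "\<lambda>i. bl_const (x i)" p] by auto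
      have cF: "coeff F p = 1" using mon p_pos by (simp add: F_def coeff_pCons split: nat.split)
      have "degree F \<le> p" unfolding F_def using mon by (intro degree_diff_le) auto
      moreover have "p \<le> degree F" using cF by (intro le_degree) simp
      ultimately show deg: "degree F = p" by simp
      show "lead_coeff F = 1" unfolding deg by (rule cF)
      show "poly (map_poly \<iota> F) w = 0" unfolding F using R by simp
    qed (use R in blast)
    moreover have "M.f dvd \<rho> w - [:w, 1 + s \<pi> ^ n * w:]"
      unfolding M.f_dvd_iff
    proof (intro allI impI)
      fix i assume i: "i < p"
      have "(\<sigma> ^^ i) (1 + s \<pi> ^ n * w) = z ^ i * (1 + s \<pi> ^ n * w)" using eig_funpow[OF \<sigma>G] R by blast
      then have "1 + s \<pi> ^ n * (\<sigma> ^^ i) w = z ^ i * (1 + s \<pi> ^ n * w)"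
        by (simp add: ring_homoD[OF G_homo[OF G_funpow[OF \<sigma>G]]] G_s[OF G_funpow[OF \<sigma>G]])
      then show "poly (\<rho> w - [:w, 1 + s \<pi> ^ n * w:]) (M.X i) = 0"
        unfolding ev1[OF i] by (simp add: algebra_simps)
    qed
    ultimately show "H_presentation \<pi> p n bl_const \<iota> \<rho> u w" unfolding H_presentation_def f F_def y by blast
  qed
qed

lemma H_reduce:
  assumes "psiB w = \<iota> u" shows "redB w ^ p = j (bl_reduce red u)"
  using redB_psiB[of w] unfolding assms j_redB by simp

text \<open>Two eigenvectors congruent to 1 modulo \<pi>^n differ by a unit 1 + \<pi>^n a of A. Then
  w' = w + a (1 + \<pi>^n w) is congruent to w + a, and Frobenius turns this into addition of the
  p-th power of the reduction of a.\<close>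

lemma H_reduction_classes:
  assumes w: "eig \<sigma> (1 + s \<pi> ^ n * w)" "gen w" "psiB w = \<iota> u"
  shows "(\<exists>u' w'. eig \<sigma> (1 + s \<pi> ^ n * w') \<and> gen w' \<and> psiB w' = \<iota> u' \<and> g = bl_reduce red u') \<longleftrightarrow>
    (\<exists>f. g = bl_reduce red u + f ^ p)"
proof -
  have \<sigma>G: "\<sigma> \<in> G" using \<sigma> unfolding is_gen_def by blast
  have mult: "(1 + s \<pi> ^ n * w) * \<iota> (1 + bl_const \<pi> ^ n * a) = 1 + s \<pi> ^ n * (w + \<iota> a * (1 + s \<pi> ^ n * w))" for a
    by (simp add: iota_simps s_apply algebra_simps)
  have red1: "redB (w + \<iota> a * (1 + s \<pi> ^ n * w)) = redB w + j (bl_reduce red a)" for a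
  proof -
    have "redB (s \<pi>) = 0" using redB_0 by simp
    then show ?thesis using n(1) by (simp add: redB_simps j_redB)
  qed
  have redp: "(redB w + j (bl_reduce red a)) ^ p = j (bl_reduce red u + bl_reduce red a ^ p)" for a
    by (simp add: CHAR_power_add[OF prime_p char_c] H_reduce[OF w(3)] ring_homoD[OF j_homo])
  show ?thesis
  proof safe
    fix u' w' assume w': "eig \<sigma> (1 + s \<pi> ^ n * w')" "gen w'" "psiB w' = \<iota> u'"
    obtain v where v: "1 + s \<pi> ^ n * w' = (1 + s \<pi> ^ n * w) * \<iota> v" using eig_ratio[OF \<sigma> w(1) w'(1)] by blast
    have "(1 + s \<pi> ^ n * w) * \<iota> (v - 1) = s \<pi> ^ n * (w' - w)"
      using v by (simp add: iota_simps algebra_simps)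
    then have "s \<pi> ^ n dvd (1 + s \<pi> ^ n * w) * \<iota> (v - 1)" by simp
    then have "s \<pi> ^ n dvd \<iota> (v - 1)" using B.unit_cancel w(1) unfolding eig_def by blast
    then obtain a where "v - 1 = bl_const \<pi> ^ n * a" unfolding iota_dvd_iff by (metis dvdE)
    then have "v = 1 + bl_const \<pi> ^ n * a" by (simp add: algebra_simps)
    then have "1 + s \<pi> ^ n * w' = 1 + s \<pi> ^ n * (w + \<iota> a * (1 + s \<pi> ^ n * w))" using v mult by simp
    then have "s \<pi> ^ n * w' = s \<pi> ^ n * (w + \<iota> a * (1 + s \<pi> ^ n * w))" by simp
    then have "w' = w + \<iota> a * (1 + s \<pi> ^ n * w)" using B.mult_cancel[OF B.pi_power_nz] by blast
    then have "j (bl_reduce red u') = j (bl_reduce red u + bl_reduce red a ^ p)"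
      using H_reduce[OF w'(3)] red1 redp by simp
    then show "\<exists>f. bl_reduce red u' = bl_reduce red u + f ^ p" using j_eq_iff by blast
  next
    fix f
    obtain a where a: "bl_reduce red a = f" using reduce_surj by blast
    define v where "v = 1 + bl_const \<pi> ^ n * a"
    have "bl_const \<pi> dvd v - 1" using n(1) by (simp add: v_def)
    then have "\<not> bl_const \<pi> dvd v" using A.pi_nonunit dvd_diff[of "bl_const \<pi>" v "v - 1"] by auto
    then have vu: "v dvd 1" using A.unit_iff by blast
    define w' where "w' = w + \<iota> a * (1 + s \<pi> ^ n * w)"
    have e: "eig \<sigma> (1 + s \<pi> ^ n * w')"
      using eig_iota_mult[OF \<sigma>G w(1) vu] unfolding v_def mult w'_def .
    have rw: "redB w' = redB w + j f" unfolding w'_def red1 a ..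
    have g: "gen w'"
      unfolding gen_def
    proof
      assume "redB w' \<in> range j"
      then obtain h where "redB w + j f = j h" using rw by auto
      then have "redB w = j (h - f)" by (simp add: ring_homoD[OF j_homo] algebra_simps)
      then show False using w(2) unfolding gen_def by blast
    qed
    obtain u' where u': "psiB w' = \<iota> u'" using psiB_iota[OF e] by blast
    have "j (bl_reduce red u') = j (bl_reduce red u + f ^ p)"
      using H_reduce[OF u'] redp[of a] unfolding rw a by simp
    then have "bl_reduce red u + f ^ p = bl_reduce red u'" using j_eq_iff by simp
    then show "\<exists>u' w'. eig \<sigma> (1 + s \<pi> ^ n * w') \<and> gen w' \<and> psiB w' = \<iota> u' \<and>
        bl_reduce red u + f ^ p = bl_reduce red u'" using e g u' by blast
  qed
qed

text \<open>Dividing the eigenvalue equation by \<pi>^n gives \<tau> w = E w + (E - 1)/\<pi>^n. The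
  quotient is a section of the group scheme, lies in R and reduces to 0, so the binomial root
  converges.\<close>

lemma H_parameter:
  assumes w: "eig \<sigma> (1 + s \<pi> ^ n * w)" "psiB w = \<iota> u" "bl_reduce red u \<noteq> 0"
    and m: "fls_subdegree (bl_reduce red u) = m" "coprime m (int p)"
  shows "\<exists>Z. is_parameter s Z \<and> w = unit_powi Z m \<and>
    (\<forall>\<tau>\<in>G. \<tau> Z = root_pow z p (modular_inverse (int p) m * kummer_char \<sigma> \<tau>) * Z *
       binom_root (s \<pi>) m (s (exact_div (root_pow \<zeta> p (kummer_char \<sigma> \<tau>) - 1) (\<pi> ^ n)) *
         root_pow z p (- kummer_char \<sigma> \<tau>) * unit_powi Z (- m)))"
proof -
  obtain Z where Z: "Z dvd 1" "is_parameter s Z" "unit_powi Z m = w"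
    using parameter_root r_root_subdegree[OF H_reduce[OF w(2)] w(3)] m by metis
  have "\<tau> Z = root_pow z p (modular_inverse (int p) m * kummer_char \<sigma> \<tau>) * Z *
       binom_root (s \<pi>) m (s (exact_div (root_pow \<zeta> p (kummer_char \<sigma> \<tau>) - 1) (\<pi> ^ n)) *
         root_pow z p (- kummer_char \<sigma> \<tau>) * unit_powi Z (- m))" if \<tau>: "\<tau> \<in> G" for \<tau>
  proof (rule root_action_binom[OF \<tau> Z(1) m(2)])
    define k where "k = kummer_char \<sigma> \<tau>"
    define l where "l = nat (k mod int p)"
    define E where "E = root_pow z p k"
    have rl: "root_pow \<zeta> p k = \<zeta> ^ l" by (simp add: root_pow_def l_def)
    have q: "exact_div (root_pow \<zeta> p k - 1) (\<pi> ^ n) = x l"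
      by (rule R.exact_div) (use R.pi_nz in \<open>simp_all add: rl x\<close>)
    have Ex: "s \<pi> ^ n * s (x l) = E - 1"
      using arg_cong[OF x[of l], of s] by (simp add: E_def root_pow_def l_def s_simps)
    have EE: "E * root_pow z p (- k) = 1"
      unfolding E_def root_pow_uminus by (rule B.recip[OF root_pow_unit])
    have ZZ: "unit_powi Z m * unit_powi Z (- m) = 1"
      unfolding B.unit_powi_minus[OF Z(1)] by (rule B.recip[OF B.unit_powi_unit[OF Z(1)]])
    have "redB (s (x l)) = 0"
      using zeta_points_dvd[OF n(2) x] ring_homo_dvd[OF s_homo] redB_0 by blast
    then show "redB (s (exact_div (root_pow \<zeta> p (kummer_char \<sigma> \<tau>) - 1) (\<pi> ^ n)) *
         root_pow z p (- kummer_char \<sigma> \<tau>) * unit_powi Z (- m)) = 0"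
      unfolding k_def[symmetric] q by (simp add: redB_simps)
    have "\<tau> (1 + s \<pi> ^ n * w) = E * (1 + s \<pi> ^ n * w)"
      unfolding E_def k_def by (rule kummer_char_action[OF \<sigma> w(1) \<tau>])
    then have "s \<pi> ^ n * \<tau> w = s \<pi> ^ n * (E * w) + (E - 1)"
      by (simp add: ring_homoD[OF G_homo[OF \<tau>]] G_s[OF \<tau>] algebra_simps)
    also have "\<dots> = s \<pi> ^ n * (E * w + s (x l))" unfolding Ex[symmetric] by (simp add: algebra_simps)
    finally have "\<tau> w = E * w + s (x l)" using B.mult_cancel[OF B.pi_power_nz] by blast
    also have "s (x l) = (E * root_pow z p (- k)) * (unit_powi Z m * unit_powi Z (- m)) * s (x l)"
      by (simp add: EE ZZ)
    also have "E * w + \<dots> = E * unit_powi Z m * (1 + s (x l) * root_pow z p (- k) * unit_powi Z (- m))"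
      unfolding Z(3) by (simp add: algebra_simps)
    finally show "\<tau> (unit_powi Z m) = root_pow z p (kummer_char \<sigma> \<tau>) * unit_powi Z m *
        (1 + s (exact_div (root_pow \<zeta> p (kummer_char \<sigma> \<tau>) - 1) (\<pi> ^ n)) *
         root_pow z p (- kummer_char \<sigma> \<tau>) * unit_powi Z (- m))"
      unfolding k_def[symmetric] q E_def Z(3) .
  qed
  then show ?thesis using Z(2,3) by blast
qed

end

text \<open>Here \<delta> = v(p) forces n = 0, and the eigenvector 1 + W itself generates the
  residue extension.\<close>

lemma mu_exists:
  assumes \<sigma>: "is_gen \<sigma>" and \<delta>: "ideal_val (s \<pi>) (different \<iota>) = val \<pi> (of_nat p)"
  shows "\<exists>u y. eig \<sigma> y \<and> gen y \<and> y ^ p = \<iota> u"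
proof -
  have "val \<pi> (of_nat p) = ideal_val (s \<pi>) (different \<iota>) + 0 * (p - 1)" using \<delta> by simp
  then obtain W where W: "gen W" "eig \<sigma> (1 + s \<pi> ^ 0 * W)" using normal_form_index[OF \<sigma>] by blast
  then have "eig \<sigma> (1 + W)" by simp
  then show ?thesis using gen_shift W(1) eig_power_p[OF \<sigma>] by blast
qed

lemma mu_classes:
  assumes \<sigma>: "is_gen \<sigma>" and y: "eig \<sigma> y" "gen y" "y ^ p = \<iota> u"
  shows "(\<exists>y'. eig \<sigma> y' \<and> gen y' \<and> y' ^ p = \<iota> u') \<longleftrightarrow> (\<exists>v. v dvd 1 \<and> u' = u * v ^ p)"
proof safe
  have \<sigma>G: "\<sigma> \<in> G" using \<sigma> unfolding is_gen_def by blast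
  {
    fix y' assume y': "eig \<sigma> y'" "y' ^ p = \<iota> u'"
    obtain v where v: "v dvd 1" "y' = y * \<iota> v" using eig_ratio[OF \<sigma> y(1) y'(1)] by blast
    have "\<iota> u' = \<iota> (u * v ^ p)" using y'(2) by (simp add: v(2) power_mult_distrib y(3) iota_simps)
    then show "\<exists>v. v dvd 1 \<and> u' = u * v ^ p" using v(1) iota_eq_iff by blast
  next
    fix v :: "'r bilaurent" assume v: "v dvd 1"
    have "(y * \<iota> v) ^ p = \<iota> (u * v ^ p)" by (simp add: power_mult_distrib y(3) iota_simps)
    then show "\<exists>y'. eig \<sigma> y' \<and> gen y' \<and> y' ^ p = \<iota> (u * v ^ p)"
      using eig_iota_mult[OF \<sigma>G y(1) v] gen_mult[OF y(2) v] by blast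
  }
qed

lemma mu_log_deriv:
  assumes \<sigma>: "is_gen \<sigma>" and y: "eig \<sigma> y" "gen y" "y ^ p = \<iota> u"
    and y': "eig \<sigma> y'" "gen y'" "y' ^ p = \<iota> u'"
  shows "fls_deriv (bl_reduce red u') / bl_reduce red u' = fls_deriv (bl_reduce red u) / bl_reduce red u"
proof -
  obtain v where v: "v dvd 1" "u' = u * v ^ p" using mu_classes[OF \<sigma> y] y' by blast
  have "bl_reduce red u \<noteq> 0" by (rule mu_root_subdegree(1)[OF y(1,3)])
  moreover have "bl_reduce red v \<noteq> 0" using v(1) reduce_unit by blast
  ultimately show ?thesis unfolding v(2) reduce_simps by (rule fls_log_deriv_mult_power[OF char_k])
qed

lemma coprime_iff_of_int_nz: "coprime h (int p) \<longleftrightarrow> (of_int h :: 'k) \<noteq> 0"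
proof -
  have "prime (int p)" using prime_p by simp
  then have "coprime (int p) h \<longleftrightarrow> \<not> int p dvd h"
    by (metis coprime_absorb_left not_prime_unit prime_imp_coprime)
  then show ?thesis using of_int_eq_0_iff_CHAR[OF char_k] by (simp add: coprime_commute)
qed

theorem mu_case:
  assumes \<delta>: "ideal_val (s \<pi>) (different \<iota>) = val \<pi> (of_nat p)"
  shows "\<exists>\<rho>. fppf_torsor \<iota> s (mu_scheme p) \<rho>"
    and "fppf_torsor \<iota> s (mu_scheme p) \<rho> \<Longrightarrow>
         (\<exists>u y. mu_presentation p \<iota> \<rho> u y) \<and>
         (\<forall>u y. mu_presentation p \<iota> \<rho> u y \<longrightarrow>
            (\<forall>u'. (\<exists>y'. mu_presentation p \<iota> \<rho> u' y') \<longleftrightarrow> (\<exists>v. v dvd 1 \<and> u' = u * v ^ p))) \<and>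
         (\<exists>\<omega> \<phi>.
            (\<forall>u y. mu_presentation p \<iota> \<rho> u y \<longrightarrow>
               fls_deriv (bl_reduce red u) / bl_reduce red u = \<omega> \<and>
               (\<forall>\<phi>'. is_kummer_iso p (s \<zeta>) G y \<phi>' \<longleftrightarrow> \<phi>' = \<phi>)) \<and>
            (\<exists>h::int. fls_residue \<omega> = of_int h) \<and>
            (fls_residue \<omega> \<noteq> 0 \<longrightarrow>
              (\<forall>u y. mu_presentation p \<iota> \<rho> u y \<longrightarrow>
                (\<exists>h Z. fls_residue \<omega> = of_int h \<and> is_parameter s Z \<and> y = unit_powi Z h \<and>
                  (\<forall>\<sigma>\<in>G. \<sigma> Z = root_pow (s \<zeta>) p (modular_inverse (int p) h * \<phi> \<sigma>) * Z))) \<and>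
              (\<forall>h. fls_residue \<omega> = of_int h \<longrightarrow>
                (\<exists>u y Z. mu_presentation p \<iota> \<rho> u y \<and> is_parameter s Z \<and> y = unit_powi Z h \<and>
                  (\<forall>\<sigma>\<in>G. \<sigma> Z = root_pow (s \<zeta>) p (modular_inverse (int p) h * \<phi> \<sigma>) * Z)))) \<and>
            (fls_residue \<omega> = 0 \<longrightarrow> \<omega> \<noteq> 0 \<and>
              (\<exists>m. m = 1 + fls_subdegree \<omega> \<and> 0 < m \<and> coprime m (int p) \<and>
                (\<exists>u y Z. mu_presentation p \<iota> \<rho> u y \<and> is_parameter s Z \<and> y = 1 + unit_powi Z m \<and>
                  (\<forall>\<sigma>\<in>G. \<sigma> Z =
                     root_pow (s \<zeta>) p (modular_inverse (int p) m * \<phi> \<sigma>) * Z *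
                     binom_root (s \<pi>) m
                       (root_pow (s \<zeta>) p (- \<phi> \<sigma>) * (root_pow (s \<zeta>) p (\<phi> \<sigma>) - 1) *
                        unit_powi Z (- m)))))))"
      (is "_ \<Longrightarrow> ?Q")
proof -
  obtain \<sigma> where \<sigma>: "is_gen \<sigma>" using is_gen_exists by blast
  obtain u y where y: "eig \<sigma> y" "gen y" using mu_exists[OF \<sigma> \<delta>] by blast
  then have "eig \<sigma> (s 0 + s 1 * y)" by (simp add: s_simps)
  then show "\<exists>\<rho>. fppf_torsor \<iota> s (mu_scheme p) \<rho>"
    using cover_scheme.torsor_exists[OF mu_cover_scheme \<sigma> y(2)] by blast
next
  assume "fppf_torsor \<iota> s (mu_scheme p) \<rho>"
  then obtain \<sigma> where \<sigma>: "is_gen \<sigma>" and acts: "cover_scheme.acts p s (\<lambda>i. \<zeta> ^ i) \<rho> \<sigma>"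
    using cover_scheme.torsor_acts[OF mu_cover_scheme] by blast
  have \<sigma>G: "\<sigma> \<in> G" using \<sigma> unfolding is_gen_def by blast
  note pres = mu_presentation_iff[OF \<sigma> acts]
  obtain u0 y0 where y0: "eig \<sigma> y0" "gen y0" "y0 ^ p = \<iota> u0" using mu_exists[OF \<sigma> \<delta>] by blast
  define \<omega> where "\<omega> = fls_deriv (bl_reduce red u0) / bl_reduce red u0"
  have res: "fls_residue \<omega> = of_int (fls_subdegree (bl_reduce red u))"
    if "eig \<sigma> y" "gen y" "y ^ p = \<iota> u" for u y
    using mu_log_deriv[OF \<sigma> that y0] fls_residue_log_deriv[OF mu_root_subdegree(1)[OF that(1,3)]]
    unfolding \<omega>_def by simp
  have a1: "\<exists>h Z. fls_residue \<omega> = of_int h \<and> is_parameter s Z \<and> y = unit_powi Z h \<and>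
      (\<forall>\<tau>\<in>G. \<tau> Z = root_pow z p (modular_inverse (int p) h * kummer_char \<sigma> \<tau>) * Z)"
    if nz: "fls_residue \<omega> \<noteq> 0" and y: "eig \<sigma> y" "gen y" "y ^ p = \<iota> u" for u y
    using mu_case_a[OF \<sigma> y(1,3) refl] res[OF y] nz coprime_iff_of_int_nz by metis
  \<comment> \<open>Only the class of h modulo p is determined by the residue. Multiplying y by a
    unit that reduces to t^q shifts the order of the reduction of u by p q, so every integer h in
    the class is attained.\<close>
  have a2: "\<exists>u y Z. (eig \<sigma> y \<and> gen y \<and> y ^ p = \<iota> u) \<and> is_parameter s Z \<and> y = unit_powi Z h \<and>
      (\<forall>\<tau>\<in>G. \<tau> Z = root_pow z p (modular_inverse (int p) h * kummer_char \<sigma> \<tau>) * Z)"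
    if nz: "fls_residue \<omega> \<noteq> 0" and h: "fls_residue \<omega> = of_int h" for h
  proof -
    define h0 where "h0 = fls_subdegree (bl_reduce red u0)"
    have "of_int (h - h0) = (0::'k)" using res[OF y0] h by (simp add: h0_def)
    then obtain q where q: "h - h0 = int p * q" using of_int_eq_0_iff_CHAR[OF char_k] by blast
    obtain v where v: "bl_reduce red v = fls_X_intpow q" using reduce_surj by blast
    have vu: "v dvd 1" unfolding reduce_unit v by simp
    define u y where "u = u0 * v ^ p" and "y = y0 * \<iota> v"
    have y: "eig \<sigma> y" "gen y" "y ^ p = \<iota> u"
      unfolding y_def u_def using eig_iota_mult[OF \<sigma>G y0(1) vu] gen_mult[OF y0(2) vu]
      by (simp_all add: power_mult_distrib y0(3) iota_simps)
    have "fls_subdegree (bl_reduce red u) = h0 + int p * q"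
      unfolding u_def reduce_simps v h0_def
      using mu_root_subdegree(1)[OF y0(1,3)] by (simp add: fls_subdegree_power)
    then have "fls_subdegree (bl_reduce red u) = h" using q by simp
    moreover have "coprime h (int p)" using nz h coprime_iff_of_int_nz by simp
    ultimately show ?thesis using mu_case_a[OF \<sigma> y(1,3)] y by blast
  qed
  note b = mu_case_b[OF \<sigma> y0 \<omega>_def]
  show ?Q
    unfolding pres
  proof (intro conjI exI[of _ \<omega>] exI[of _ "kummer_char \<sigma>"] allI impI; (elim conjE)?)
    show "\<exists>u y. eig \<sigma> y \<and> gen y \<and> y ^ p = \<iota> u" using y0 by blast
    show "(\<exists>y'. eig \<sigma> y' \<and> gen y' \<and> y' ^ p = \<iota> u') \<longleftrightarrow> (\<exists>v. v dvd 1 \<and> u' = u * v ^ p)"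
      if "eig \<sigma> y" "gen y" "y ^ p = \<iota> u" for u y u'
      by (rule mu_classes[OF \<sigma> that])
    show "fls_deriv (bl_reduce red u) / bl_reduce red u = \<omega>"
      if "eig \<sigma> y" "gen y" "y ^ p = \<iota> u" for u y
      unfolding \<omega>_def by (rule mu_log_deriv[OF \<sigma> y0 that])
    show "is_kummer_iso p z G y \<phi>' \<longleftrightarrow> \<phi>' = kummer_char \<sigma>" if "eig \<sigma> y" for y \<phi>'
      by (rule kummer_iso_iff[OF \<sigma> that])
    show "\<exists>h::int. fls_residue \<omega> = of_int h" using res[OF y0] by blast
  qed (use a1 a2 b in blast)+
qed

theorem H_case:
  assumes n: "0 < n" "n < val \<pi> (\<zeta> - 1)"
    and \<delta>: "val \<pi> (of_nat p) = ideal_val (s \<pi>) (different \<iota>) + n * (p - 1)"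
  shows "\<exists>\<rho>. fppf_torsor \<iota> s (H_scheme \<pi> p n) \<rho>"
    and "fppf_torsor \<iota> s (H_scheme \<pi> p n) \<rho> \<Longrightarrow>
           (\<exists>u w. H_presentation \<pi> p n bl_const \<iota> \<rho> u w) \<and>
           (\<forall>u w. H_presentation \<pi> p n bl_const \<iota> \<rho> u w \<longrightarrow>
              bl_reduce red u \<notin> range (\<lambda>f. fls_compose_power f p) \<and>
              (\<forall>g. (\<exists>u' w'. H_presentation \<pi> p n bl_const \<iota> \<rho> u' w' \<and> g = bl_reduce red u')
                   \<longleftrightarrow> (\<exists>f. g = bl_reduce red u + f ^ p))) \<and>
           (\<exists>\<omega> \<phi>.
              (\<forall>u w. H_presentation \<pi> p n bl_const \<iota> \<rho> u w \<longrightarrow>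
                 fls_deriv (bl_reduce red u) = \<omega> \<and>
                 (\<forall>\<phi>'. is_kummer_iso p (s \<zeta>) G (s \<pi> ^ n * w + 1) \<phi>' \<longleftrightarrow> \<phi>' = \<phi>)) \<and>
              \<omega> \<noteq> 0 \<and>
              (\<exists>m. m = 1 + fls_subdegree \<omega> \<and> coprime m (int p) \<and>
                (\<exists>u w Z. H_presentation \<pi> p n bl_const \<iota> \<rho> u w \<and>
                  is_parameter s Z \<and> w = unit_powi Z m \<and>
                  (\<forall>\<sigma>\<in>G. \<sigma> Z =
                     root_pow (s \<zeta>) p (modular_inverse (int p) m * \<phi> \<sigma>) * Z *
                     binom_root (s \<pi>) m
                       (s (exact_div (root_pow \<zeta> p (\<phi> \<sigma>) - 1) (\<pi> ^ n)) *
                        root_pow (s \<zeta>) p (- \<phi> \<sigma>) * unit_powi Z (- m))))))"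
      (is "_ \<Longrightarrow> ?Q")
proof -
  obtain x where x: "\<And>i. \<zeta> ^ i = 1 + \<pi> ^ n * x i"
    using zeta_points[of n] n(2) by (metis less_imp_le)
  obtain \<sigma> where \<sigma>: "is_gen \<sigma>" using is_gen_exists by blast
  obtain W where W: "gen W" "eig \<sigma> (1 + s \<pi> ^ n * W)" using normal_form_index[OF \<sigma> \<delta>] by blast
  have "eig \<sigma> (s 1 + s (\<pi> ^ n) * W)" using W(2) by (simp add: s_simps)
  then show "\<exists>\<rho>. fppf_torsor \<iota> s (H_scheme \<pi> p n) \<rho>"
    using cover_scheme.torsor_exists[OF H_cover_scheme[OF x] \<sigma> W(1)] by blast
next
  obtain x where x: "\<And>i. \<zeta> ^ i = 1 + \<pi> ^ n * x i"
    using zeta_points[of n] n(2) by (metis less_imp_le)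
  assume "fppf_torsor \<iota> s (H_scheme \<pi> p n) \<rho>"
  then obtain \<sigma> where \<sigma>: "is_gen \<sigma>" and acts: "cover_scheme.acts p s x \<rho> \<sigma>"
    using cover_scheme.torsor_acts[OF H_cover_scheme[OF x]] by blast
  note pres = H_presentation_iff[OF n \<sigma> x acts]
  note redu = H_reduce[OF n \<sigma> x] and classes = H_reduction_classes[OF n \<sigma> x]
  obtain W where W: "gen W" "eig \<sigma> (1 + s \<pi> ^ n * W)" using normal_form_index[OF \<sigma> \<delta>] by blast
  obtain u0 where u0: "psiB n W = \<iota> u0" using psiB_iota[OF n \<sigma> x W(2)] by blast
  define \<omega> where "\<omega> = fls_deriv (bl_reduce red u0)"
  have np: "bl_reduce red u \<notin> range (\<lambda>f. f ^ p)" if "gen w" "psiB n w = \<iota> u" for u w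
    using gen_iff_power[OF redu[OF that(2)]] that(1) by blast
  have d: "fls_deriv (bl_reduce red u) = \<omega>"
    if w: "eig \<sigma> (1 + s \<pi> ^ n * w)" "gen w" "psiB n w = \<iota> u" for u w
  proof -
    obtain f where "bl_reduce red u = bl_reduce red u0 + f ^ p"
      using classes[OF W(2,1) u0, of "bl_reduce red u"] w by blast
    then show ?thesis by (simp add: \<omega>_def fls_deriv_power_CHAR[OF char_k])
  qed
  have \<omega>0: "\<omega> \<noteq> 0"
    unfolding \<omega>_def using fls_deriv_eq_0_imp_power[OF prime_p char_k] np[OF W(1) u0] by blast
  obtain g where g: "\<And>n. (bl_reduce red u0 - g ^ p) $$ n = (if int p dvd n then 0 else bl_reduce red u0 $$ n)"
    using fls_remove_p_part[OF prime_p char_k] by metis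
  define N where "N = bl_reduce red u0 - g ^ p"
  have N0: "N \<noteq> 0" using np[OF W(1) u0] unfolding N_def by (metis eq_iff_diff_eq_0 rangeI)
  have Np: "N $$ k = 0" if "int p dvd k" for k unfolding N_def g using that by simp
  note Nd = fls_subdegree_non_p_part[OF prime_p char_k Np N0]
  \<comment> \<open>Applied to 0 and g, \<open>CHAR_diff_power\<close> rewrites the subtracted p-th
    power as an added one, for p = 2 too; so N is the reduction of another admissible u.\<close>
  have "N = bl_reduce red u0 + (- g) ^ p"
    using CHAR_diff_power[of p 0 g] prime_p char_k p_pos by (simp add: N_def zero_power)
  then obtain u w where w: "eig \<sigma> (1 + s \<pi> ^ n * w)" "gen w" "psiB n w = \<iota> u" "N = bl_reduce red u"
    using classes[OF W(2,1) u0, of N] by blast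
  define m where "m = fls_subdegree N"
  have m: "m = 1 + fls_subdegree \<omega>" using Nd(3) d[OF w(1-3)] by (simp add: m_def w(4))
  have cop: "coprime m (int p)" unfolding m_def by (rule Nd(1))
  have Z: "\<exists>Z. is_parameter s Z \<and> w = unit_powi Z m \<and>
    (\<forall>\<tau>\<in>G. \<tau> Z = root_pow z p (modular_inverse (int p) m * kummer_char \<sigma> \<tau>) * Z *
       binom_root (s \<pi>) m (s (exact_div (root_pow \<zeta> p (kummer_char \<sigma> \<tau>) - 1) (\<pi> ^ n)) *
         root_pow z p (- kummer_char \<sigma> \<tau>) * unit_powi Z (- m)))"
    by (rule H_parameter[OF n \<sigma> x w(1,3)]) (use N0 w(4) cop m_def in auto)
  show ?Q
    unfolding pres
  proof (intro conjI exI[of _ \<omega>] exI[of _ "kummer_char \<sigma>"] allI impI; (elim conjE)?)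
    show "\<exists>u w. eig \<sigma> (1 + s \<pi> ^ n * w) \<and> gen w \<and> psiB n w = \<iota> u" using W u0 by blast
    show "bl_reduce red u \<notin> range (\<lambda>f. fls_compose_power f p)" if "gen w" "psiB n w = \<iota> u" for u w
      unfolding fls_compose_power_range[OF prime_p char_k] by (rule np[OF that])
    show "(\<exists>u' w'. (eig \<sigma> (1 + s \<pi> ^ n * w') \<and> gen w' \<and> psiB n w' = \<iota> u') \<and> g = bl_reduce red u')
        \<longleftrightarrow> (\<exists>f. g = bl_reduce red u + f ^ p)"
      if "eig \<sigma> (1 + s \<pi> ^ n * w)" "gen w" "psiB n w = \<iota> u" for u w g
      using classes[OF that, of g] by simp
    show "fls_deriv (bl_reduce red u) = \<omega>"
      if "eig \<sigma> (1 + s \<pi> ^ n * w)" "gen w" "psiB n w = \<iota> u" for u w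
      by (rule d[OF that])
    show "is_kummer_iso p z G (s \<pi> ^ n * w + 1) \<phi>' \<longleftrightarrow> \<phi>' = kummer_char \<sigma>"
      if "eig \<sigma> (1 + s \<pi> ^ n * w)" for w \<phi>'
      using kummer_iso_iff[OF \<sigma> that] by (simp add: add.commute)
    show "\<omega> \<noteq> 0" by (rule \<omega>0)
    show "\<exists>m. m = 1 + fls_subdegree \<omega> \<and> coprime m (int p) \<and>
        (\<exists>u w Z. (eig \<sigma> (1 + s \<pi> ^ n * w) \<and> gen w \<and> psiB n w = \<iota> u) \<and>
          is_parameter s Z \<and> w = unit_powi Z m \<and>
          (\<forall>\<tau>\<in>G. \<tau> Z = root_pow z p (modular_inverse (int p) m * kummer_char \<sigma> \<tau>) * Z *
             binom_root (s \<pi>) m (s (exact_div (root_pow \<zeta> p (kummer_char \<sigma> \<tau>) - 1) (\<pi> ^ n)) *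
               root_pow z p (- kummer_char \<sigma> \<tau>) * unit_powi Z (- m))))"
      using m cop w(1-3) Z by blast
  qed
qed

text \<open>In the normal form, n = 0 would give \<delta> = v(p), so n is positive.\<close>

lemma H_index:
  assumes "ideal_val (s \<pi>) (different \<iota>) < val \<pi> (of_nat p)"
  shows "\<exists>n. val \<pi> (of_nat p) = ideal_val (s \<pi>) (different \<iota>) + n * (p - 1) \<and>
    0 < n \<and> n < val \<pi> (\<zeta> - 1)"
proof -
  obtain \<sigma> where \<sigma>: "is_gen \<sigma>" using is_gen_exists by blast
  obtain n W where nW: "n < val \<pi> (\<zeta> - 1)" "gen W" "eig \<sigma> (1 + s \<pi> ^ n * W)"
    using kummer_normal_form[OF \<sigma>] by blast
  have "val \<pi> (of_nat p) = ideal_val (s \<pi>) (different \<iota>) + n * (p - 1)"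
    by (rule different_val(1)[OF \<sigma> nW])
  then show ?thesis using assms nW(1) by (cases "n = 0") auto
qed

end

theorem mainTheorem6:
  fixes p :: nat
    and \<pi> \<zeta> :: "'r :: {complete_dvr, ring_char_0}"
    and red :: "'r \<Rightarrow> 'k :: alg_closed_field"
    and \<iota> :: "'r bilaurent \<Rightarrow> 'b :: comm_ring_1"
    and s :: "'r \<Rightarrow> 'b"
    and redB :: "'b \<Rightarrow> 'c :: field"
    and j :: "'k fls \<Rightarrow> 'c"
    and G :: "('b \<Rightarrow> 'b) set"
    and \<delta> :: nat
  assumes "prime p"
    and "cdvr_uniformizer \<pi>"
    and "reduction_map \<pi> red" and "CHAR('k) = p"
    and "\<zeta> ^ p = 1" and "\<forall>i\<in>{0<..<p}. \<zeta> ^ i \<noteq> 1"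
    and "ring_homo \<iota>" and "finite_algebra \<iota>" and "algebra_degree \<iota> p"
    and "s = \<iota> \<circ> bl_const" and "flat_algebra s"
    and "\<forall>\<sigma>\<in>G. ring_auto \<sigma>"
    and "group (comp_group G)" and "cyclic_group (comp_group G)" and "card G = p"
    and "inj \<iota>" and "range \<iota> = {b. \<forall>\<sigma>\<in>G. \<sigma> b = b}"
    and "reduction_map (s \<pi>) redB"
    and "\<forall>a. j (bl_reduce red a) = redB (\<iota> a)" and "purely_insep_of_degree_p p j"
    and "\<delta> = ideal_val (s \<pi>) (different \<iota>)"
  shows
    "cdvr_uniformizer (s \<pi>) \<and>
     (\<exists>\<theta> :: 'k fls \<Rightarrow> 'c. ring_homo \<theta> \<and> bij \<theta> \<and> (\<forall>c. \<theta> (fls_const c) = j (fls_const c))) \<and>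
     (\<forall>(\<theta> :: 'k fls \<Rightarrow> 'c) Z.
        ring_homo \<theta> \<and> bij \<theta> \<and> (\<forall>c. \<theta> (fls_const c) = j (fls_const c)) \<and> redB Z = \<theta> fls_X
        \<longrightarrow> is_parameter s Z) \<and>

     \<comment> \<open>(A)\<close>
     (\<delta> = val \<pi> (of_nat p) \<longrightarrow>
       (\<exists>\<rho>. fppf_torsor \<iota> s (mu_scheme p) \<rho>) \<and>
       (\<forall>\<rho>. fppf_torsor \<iota> s (mu_scheme p) \<rho> \<longrightarrow>
         (\<exists>u y. mu_presentation p \<iota> \<rho> u y) \<and>
         (\<forall>u y. mu_presentation p \<iota> \<rho> u y \<longrightarrow>
            (\<forall>u'. (\<exists>y'. mu_presentation p \<iota> \<rho> u' y') \<longleftrightarrow> (\<exists>v. v dvd 1 \<and> u' = u * v ^ p))) \<and>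
         (\<exists>\<omega> \<phi>.
            (\<forall>u y. mu_presentation p \<iota> \<rho> u y \<longrightarrow>
               fls_deriv (bl_reduce red u) / bl_reduce red u = \<omega> \<and>
               (\<forall>\<phi>'. is_kummer_iso p (s \<zeta>) G y \<phi>' \<longleftrightarrow> \<phi>' = \<phi>)) \<and>
            (\<exists>h::int. fls_residue \<omega> = of_int h) \<and>

            \<comment> \<open>(A.a)\<close>
            (fls_residue \<omega> \<noteq> 0 \<longrightarrow>
              (\<forall>u y. mu_presentation p \<iota> \<rho> u y \<longrightarrow>
                (\<exists>h Z. fls_residue \<omega> = of_int h \<and> is_parameter s Z \<and> y = unit_powi Z h \<and>
                  (\<forall>\<sigma>\<in>G. \<sigma> Z = root_pow (s \<zeta>) p (modular_inverse (int p) h * \<phi> \<sigma>) * Z))) \<and>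
              (\<forall>h. fls_residue \<omega> = of_int h \<longrightarrow>
                (\<exists>u y Z. mu_presentation p \<iota> \<rho> u y \<and> is_parameter s Z \<and> y = unit_powi Z h \<and>
                  (\<forall>\<sigma>\<in>G. \<sigma> Z = root_pow (s \<zeta>) p (modular_inverse (int p) h * \<phi> \<sigma>) * Z)))) \<and>

            \<comment> \<open>(A.b)\<close>
            (fls_residue \<omega> = 0 \<longrightarrow> \<omega> \<noteq> 0 \<and>
              (\<exists>m. m = 1 + fls_subdegree \<omega> \<and> 0 < m \<and> coprime m (int p) \<and>
                (\<exists>u y Z. mu_presentation p \<iota> \<rho> u y \<and> is_parameter s Z \<and> y = 1 + unit_powi Z m \<and>
                  (\<forall>\<sigma>\<in>G. \<sigma> Z =
                     root_pow (s \<zeta>) p (modular_inverse (int p) m * \<phi> \<sigma>) * Z *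
                     binom_root (s \<pi>) m
                       (root_pow (s \<zeta>) p (- \<phi> \<sigma>) * (root_pow (s \<zeta>) p (\<phi> \<sigma>) - 1) *
                        unit_powi Z (- m))))))))) \<and>

     \<comment> \<open>(B)\<close>
     (0 < \<delta> \<and> \<delta> < val \<pi> (of_nat p) \<longrightarrow>
       (\<exists>n. val \<pi> (of_nat p) = \<delta> + n * (p - 1) \<and> 0 < n \<and> n \<le> val \<pi> (\<zeta> - 1) \<and>
         (\<exists>\<rho>. fppf_torsor \<iota> s (H_scheme \<pi> p n) \<rho>) \<and>
         (\<forall>\<rho>. fppf_torsor \<iota> s (H_scheme \<pi> p n) \<rho> \<longrightarrow>
           (\<exists>u w. H_presentation \<pi> p n bl_const \<iota> \<rho> u w) \<and>
           (\<forall>u w. H_presentation \<pi> p n bl_const \<iota> \<rho> u w \<longrightarrow>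
              bl_reduce red u \<notin> range (\<lambda>f. fls_compose_power f p) \<and>
              (\<forall>g. (\<exists>u' w'. H_presentation \<pi> p n bl_const \<iota> \<rho> u' w' \<and> g = bl_reduce red u')
                   \<longleftrightarrow> (\<exists>f. g = bl_reduce red u + f ^ p))) \<and>
           (\<exists>\<omega> \<phi>.
              (\<forall>u w. H_presentation \<pi> p n bl_const \<iota> \<rho> u w \<longrightarrow>
                 fls_deriv (bl_reduce red u) = \<omega> \<and>
                 (\<forall>\<phi>'. is_kummer_iso p (s \<zeta>) G (s \<pi> ^ n * w + 1) \<phi>' \<longleftrightarrow> \<phi>' = \<phi>)) \<and>
              \<omega> \<noteq> 0 \<and>
              (\<exists>m. m = 1 + fls_subdegree \<omega> \<and> coprime m (int p) \<and>
                (\<exists>u w Z. H_presentation \<pi> p n bl_const \<iota> \<rho> u w \<and>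
                  is_parameter s Z \<and> w = unit_powi Z m \<and>
                  (\<forall>\<sigma>\<in>G. \<sigma> Z =
                     root_pow (s \<zeta>) p (modular_inverse (int p) m * \<phi> \<sigma>) * Z *
                     binom_root (s \<pi>) m
                       (s (exact_div (root_pow \<zeta> p (\<phi> \<sigma>) - 1) (\<pi> ^ n)) *
                        root_pow (s \<zeta>) p (- \<phi> \<sigma>) * unit_powi Z (- m)))))))))"
proof -
  interpret cover p \<pi> red \<iota> s redB j \<zeta> G
    by (intro cover.intro res_cover.intro cover_axioms.intro) (use assms in blast)+
  have \<delta>: "\<delta> = ideal_val (s \<pi>) (different \<iota>)" by fact
  show ?thesis
  proof (intro conjI cdvr_B C.residue_field_iso, goal_cases)
    case 1
    show ?case by (blast intro: is_parameter_of_iso)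
  next
    case 2
    show ?case
      by (intro impI conjI, rule mu_case(1), simp add: \<delta>, rule allI, rule impI, rule mu_case(2)) (simp_all add: \<delta>)
  next
    case 3
    show ?case
    proof (rule impI, goal_cases)
      case 1
      \<comment> \<open>The bound is strict: n = v(\<zeta> - 1) would mean \<delta> = 0.\<close>
      then obtain n where n: "val \<pi> (of_nat p) = \<delta> + n * (p - 1)" "0 < n" "n < val \<pi> (\<zeta> - 1)"
        using H_index[folded \<delta>] by blast
      note H = H_case[OF n(2,3) n(1)[unfolded \<delta>]]
      show ?case
        by (rule exI[of _ n], intro conjI n H(1), use n in simp, rule allI, rule impI, rule H(2))
    qed
  qed
qed

end
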